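(* Assume, in addition to the standing assumptions described in the context, the following. (i) $\dfrac{d v_i^{(i)}}{d x_i}(x_i)\ge0$ for all $i\in\{1,2,3\}$ and all $x_i\in(0,\ell_i)$. (ii) $\kappa_0^{(i)}-d_i\ell_i>0$ for all $i\in\{1,2,3\}$, where $d_1=\sup_{\Omega_\varepsilon^{(1)}}|(v_2^{(1)},v_3^{(1)})|$, $d_2=\sup_{\Omega_\varepsilon^{(2)}}|(v_1^{(2)},v_3^{(2)})|$, $d_3=\sup_{\Omega_\varepsilon^{(3)}}|(v_1^{(3)},v_2^{(3)})|$. (iii) $\sum_{i=1}^3h_i^2\,\mathrm v_i=0$. (iv) The velocity field is conservative in the node: $\overrightarrow{V_\varepsilon}^{(0)}(x)=\nabla_\xi p(\xi)|_{\xi=x/\varepsilon}$ for $x\in\Omega_\varepsilon^{(0)}$, where the potential $p$ is the solution with $\int_{\Xi^{(0)}}p\,d\xi=0$ of the Neumann problem $\Delta_\xi p=0$ in $\Xi^{(0)}$, $\partial p/\partial\xi_i=\mathrm v_i$ on $\Upsilon^{(i)}(\ell_0)=\overline{\Xi^{(0)}}\cap\{\xi_i=\ell_0\}$ for $i\in\{1,2,3\}$, $\partial p/\partial\boldsymbol\nu=0$ on $\partial\Xi^{(0)}\setminus\bigcup_{i=1}^3\Upsilon^{(i)}(\ell_0)$. Let $F_i\in L^2(\Omega_\varepsilon^{(i)})$ and $\Phi_i\in L^2(\Gamma_\varepsilon^{(i)})$, $i\in\{1,2,3\}$. Then for a weak solution $\psi_\varepsilon$ to the problem $$\left\{\begin{array}{rcll}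 -\varepsilon\,\mathrm{div}\big(\mathbb D_\varepsilon^{(i)}\nabla\psi_\varepsilon\big)+\mathrm{div}\big(\overrightarrow{V_\varepsilon}^{(i)}\psi_\varepsilon\big)&=&F_i&\text{in }\Omega_\varepsilon^{(i)},\ i\in\{1,2,3\},\\ -\varepsilon\,\sigma_\varepsilon(\psi_\varepsilon)+\psi_\varepsilon\,\overrightarrow{V_\varepsilon}^{(i)}\cdot\boldsymbol\nu&=&\varepsilon\,\Phi_i&\text{on }\Gamma_\varepsilon^{(i)},\ i\in\{1,2,3\},\\ -\varepsilon\,\mathrm{div}\big(\mathbb D_\varepsilon^{(0)}\nabla\psi_\varepsilon\big)+\mathrm{div}\big(\overrightarrow{V_\varepsilon}^{(0)}\psi_\varepsilon\big)&=&0&\text{in }\Omega_\varepsilon^{(0)},\\ -\varepsilon\,\sigma_\varepsilon(\psi_\varepsilon)+\psi_\varepsilon\,\overrightarrow{V_\varepsilon}^{(0)}\cdot\boldsymbol\nu&=&0&\text{on }\Gamma_\varepsilon^{(0)},\\ \psi_\varepsilon&=&0&\text{on }\Upsilon_\varepsilon^{(i)}(\ell_i),\ i\in\{1,2,3\},\\ \psi_\varepsilon|_{x_i=\varepsilon\ell_0-0}&=&\psi_\varepsilon|_{x_i=\varepsilon\ell_0+0},&i\in\{1,2,3\},\\ a_{ii}^{(i)}\,\partial_{x_i}\psi_\varepsilon|_{x_i=\varepsilon\ell_0+0}&=&\sum_{j=1}^3\big(a_{ij}^{(0)}(\tfrac x\varepsilon)\,\partial_{x_j}\psi_\varepsilon\big)|_{x_i=\varepsilon\ell_0-0},&i\in\{1,2,3\},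 \end{array}\right.$$ one has the estimate $$\|\psi_\varepsilon\|_{H^1(\Omega_\varepsilon)}\le C\,\varepsilon^{-1}\sum_{i=1}^3\Big(\|F_i\|_{L^2(\Omega_\varepsilon^{(i)})}+\sqrt\varepsilon\,\|\Phi_i\|_{L^2(\Gamma_\varepsilon^{(i)})}\Big),$$ where the constant $C$ does not depend on $\varepsilon$, $\psi_\varepsilon$, $\{F_i\}$, $\{\Phi_i\}$.
   Context: Notation. For $x=(x_1,x_2,x_3)$, $\overline x_i\in\mathbb R^2$ is the pair of coordinates other than $x_i$ (in increasing order of index). $\varepsilon\in(0,\varepsilon_0)$ is a small parameter; $\ell_0\in(0,\frac13)$, $\ell_i\ge1$, $h_i>0$ ($i=1,2,3$) are fixed. Domain. For $i=1,2,3$: $\Omega_\varepsilon^{(i)}=\{x\in\mathbb R^3:\varepsilon\ell_0<x_i<\ell_i,\ |\overline x_i|<\varepsilon h_i\}$ is a thin cylinder, $\Gamma_\varepsilon^{(i)}=\partial\Omega_\varepsilon^{(i)}\cap\{\varepsilon\ell_0<x_i<\ell_i\}$ its lateral surface, $\Upsilon_\varepsilon^{(i)}(y)$ its cross-section $\{x_i=y,\ |\overline x_i|<\varepsilon h_i\}$ for $y\in[\varepsilon\ell_0,\ell_i]$. The node is $\Omega_\varepsilon^{(0)}=\varepsilon\,\Xi^{(0)}$, with $\Xi^{(0)}\subset\mathbb R^3$ a fixed bounded domain; its boundary contains the discs $\Upsilon_\varepsilon^{(i)}(\varepsilon\ell_0)$, $i=1,2,3$, and $\Gamma_\varepsilon^{(0)}=\partial\Omega_\varepsilon^{(0)}\setminus\bigcup_{i=1}^3\overline{\Upsilon_\varepsilon^{(i)}(\varepsilon\ell_0)}$.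 $\Omega_\varepsilon$ is the interior of $\bigcup_{i=0}^3\overline{\Omega_\varepsilon^{(i)}}$, and $\partial\Omega_\varepsilon\setminus\bigcup_{i=1}^3\overline{\Upsilon_\varepsilon^{(i)}(\ell_i)}$ is smooth. $\boldsymbol\nu$ is the outward unit normal. Velocity field (standing assumptions). On $\Omega_\varepsilon^{(0)}$: $\overrightarrow{V_\varepsilon}=\overrightarrow{V_\varepsilon}^{(0)}(x)=(v_1^{(0)},v_2^{(0)},v_3^{(0)})(x/\varepsilon)$. On $\Omega_\varepsilon^{(i)}$, $i=1,2,3$: $\overrightarrow{V_\varepsilon}=\overrightarrow{V_\varepsilon}^{(i)}$, whose $i$-th component is $v_i^{(i)}(x_i)$ and whose $j$-th component for $j\neq i$ is $\varepsilon\,v_j^{(i)}(x_i,\overline x_i/\varepsilon)$. Here $v_1^{(1)}<0$, $v_2^{(2)}>0$, $v_3^{(3)}>0$. All components are smooth and bounded; $v_i^{(i)}$ equals a constant $\mathrm v_i$ in a neighbourhood of $x_i=0$; the functions $v_j^{(i)}$ with $j\ne i$ ($i=1,2,3$) have compact support with respect to $x_i$ in $(0,\ell_i)$; and on $\Upsilon_\varepsilon^{(i)}(\varepsilon\ell_0)$ the one-sided values of $\overrightarrow{V_\varepsilon}^{(0)}$ and $\overrightarrow{V_\varepsilon}^{(i)}$ coincide and equal the vector with $i$-th component $\mathrm v_i$ and other components $0$. In (ii) the functions $v_j^{(i)}$ are evaluated at $(x_i,\overline x_i/\varepsilon)$. Diffusion matrix (standing assumptions). $\mathbb D_\varepsilon=\mathbb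 D_\varepsilon^{(0)}=(a_{mn}^{(0)}(x/\varepsilon))_{m,n=1}^3$ on $\Omega_\varepsilon^{(0)}$; on $\Omega_\varepsilon^{(i)}$, $i=1,2,3$, $\mathbb D_\varepsilon=\mathbb D_\varepsilon^{(i)}=(a_{mn}^{(i)})$ with $a_{ii}^{(i)}$ a constant, $a_{im}^{(i)}=a_{mi}^{(i)}=0$ for $m\ne i$, and the other entries functions of $\overline x_i/\varepsilon$. All matrices are symmetric with smooth bounded entries, and there are positive constants $\kappa_0^{(i)},\kappa_1^{(i)}$ ($i=0,1,2,3$) with $\kappa_0^{(i)}|y|^2\le\sum_{m,n}a^{(i)}_{mn}y_my_n\le\kappa_1^{(i)}|y|^2$ for all $y\in\mathbb R^3$, uniformly in $x$ and $\varepsilon\in(0,\varepsilon_0)$. $\sigma_\varepsilon(u)=(\mathbb D_\varepsilon\nabla u)\cdot\boldsymbol\nu$. Weak solution. $\psi_\varepsilon\in H^1(\Omega_\varepsilon)$ with $\psi_\varepsilon=0$ on $\Upsilon_\varepsilon:=\bigcup_{i=1}^3\Upsilon_\varepsilon^{(i)}(\ell_i)$ such that for all $\eta\in H^1(\Omega_\varepsilon)$ vanishing on $\Upsilon_\varepsilon$, $$\varepsilon\int_{\Omega_\varepsilon}\nabla\eta\cdot(\mathbb D_\varepsilon\nabla\psi_\varepsilon)\,dx-\int_{\Omega_\varepsilon}\psi_\varepsilon\,\overrightarrow{V_\varepsilon}\cdot\nabla\eta\,dx=\sum_{i=1}^3\int_{\Omega_\varepsilon^{(i)}}F_i\,\eta\,dx-\varepsilon\sum_{i=1}^3\int_{\Gamma_\varepsilon^{(i)}}\Phi_i\,\eta\,dS_x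 .$$
   Formalization: On the interface discs only the normal component of the node velocity is required to equal v_i (the tangential components are left free); requiring the full vector, as in the standing assumptions, contradicts (iv) by unique continuation for the harmonic potential p. *)

theory Defs
  imports "HOL-Analysis.Analysis"
begin

section \<open>Smooth functions and smooth boundaries\<close>

text \<open>\<open>C_on k S f\<close> is used for open \<open>S\<close> only.\<close>

fun C_on :: "nat \<Rightarrow> 'a::euclidean_space set \<Rightarrow> ('a \<Rightarrow> real) \<Rightarrow> bool" where
  "C_on 0 S f \<longleftrightarrow> continuous_on S f"
| "C_on (Suc k) S f \<longleftrightarrow>
     (\<forall>x\<in>S. f differentiable (at x)) \<and>
     (\<forall>b\<in>Basis. C_on k S (\<lambda>x. frechet_derivative f (at x) b))"

definition smooth_on :: "'a::euclidean_space set \<Rightarrow> ('a \<Rightarrow> real) \<Rightarrow> bool" where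
  "smooth_on S f \<longleftrightarrow> (\<forall>k. C_on k S f)"

definition smooth_bounded_on :: "'a::euclidean_space set \<Rightarrow> ('a \<Rightarrow> real) \<Rightarrow> bool" where
  "smooth_bounded_on S f \<longleftrightarrow> smooth_on S f \<and> bounded (f ` S)"

definition partial :: "3 \<Rightarrow> (real^3 \<Rightarrow> real) \<Rightarrow> real^3 \<Rightarrow> real" where
  "partial i f x = frechet_derivative f (at x) (axis i 1)"

definition grad :: "(real^3 \<Rightarrow> real) \<Rightarrow> real^3 \<Rightarrow> real^3" where
  "grad f x = (\<chi> i. partial i f x)"

definition laplacian :: "(real^3 \<Rightarrow> real) \<Rightarrow> real^3 \<Rightarrow> real" where
  "laplacian f x = (\<Sum>i\<in>UNIV. partial i (partial i f) x)"

definition local_defining_function ::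
  "(real^3) set \<Rightarrow> real^3 \<Rightarrow> (real^3) set \<Rightarrow> (real^3 \<Rightarrow> real) \<Rightarrow> bool" where
  "local_defining_function \<Omega> x U \<rho> \<longleftrightarrow>
     open U \<and> x \<in> U \<and> smooth_on U \<rho> \<and> (\<forall>y\<in>U. grad \<rho> y \<noteq> 0) \<and>
     \<Omega> \<inter> U = {y\<in>U. \<rho> y < 0}"

definition smooth_boundary_at :: "(real^3) set \<Rightarrow> real^3 \<Rightarrow> bool" where
  "smooth_boundary_at \<Omega> x \<longleftrightarrow> x \<in> frontier \<Omega> \<and> (\<exists>U \<rho>. local_defining_function \<Omega> x U \<rho>)"

definition outward_unit_normal :: "(real^3) set \<Rightarrow> real^3 \<Rightarrow> real^3 \<Rightarrow> bool" where
  "outward_unit_normal \<Omega> x n \<longleftrightarrow> x \<in> frontier \<Omega> \<and>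
     (\<exists>U \<rho>. local_defining_function \<Omega> x U \<rho> \<and> n = (1 / norm (grad \<rho> x)) *\<^sub>R grad \<rho> x)"


section \<open>The thin junction\<close>

text \<open>The coordinates other than \<open>x\<^sub>i\<close> in increasing order of index, and the inverse operation.
  In the type \<open>3\<close> the numeral \<open>3\<close> is the same element as \<open>0\<close>.\<close>

definition bar :: "3 \<Rightarrow> real^3 \<Rightarrow> real^2" where
  "bar i x = (if i = 1 then vector [x$2, x$3]
              else if i = 2 then vector [x$1, x$3]
              else vector [x$1, x$2])"

definition insert_coord :: "3 \<Rightarrow> real \<Rightarrow> real^2 \<Rightarrow> real^3" where
  "insert_coord i t z = (if i = 1 then vector [t, z$1, z$2]
                         else if i = 2 then vector [z$1, t, z$2]
                         else vector [z$1, z$2, t])"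

definition cyl :: "real \<Rightarrow> (3 \<Rightarrow> real) \<Rightarrow> (3 \<Rightarrow> real) \<Rightarrow> real \<Rightarrow> 3 \<Rightarrow> (real^3) set" where
  "cyl l0 l h \<epsilon> i = {x. \<epsilon> * l0 < x$i \<and> x$i < l i \<and> norm (bar i x) < \<epsilon> * h i}"

definition lateral :: "real \<Rightarrow> (3 \<Rightarrow> real) \<Rightarrow> (3 \<Rightarrow> real) \<Rightarrow> real \<Rightarrow> 3 \<Rightarrow> (real^3) set" where
  "lateral l0 l h \<epsilon> i = frontier (cyl l0 l h \<epsilon> i) \<inter> {x. \<epsilon> * l0 < x$i \<and> x$i < l i}"

definition disc :: "(3 \<Rightarrow> real) \<Rightarrow> real \<Rightarrow> 3 \<Rightarrow> real \<Rightarrow> (real^3) set" where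
  "disc h \<epsilon> i y = {x. x$i = y \<and> norm (bar i x) < \<epsilon> * h i}"

definition node :: "(real^3) set \<Rightarrow> real \<Rightarrow> (real^3) set" where
  "node \<Xi> \<epsilon> = (\<lambda>\<xi>. \<epsilon> *\<^sub>R \<xi>) ` \<Xi>"

definition node_lateral ::
  "real \<Rightarrow> (3 \<Rightarrow> real) \<Rightarrow> (real^3) set \<Rightarrow> real \<Rightarrow> (real^3) set" where
  "node_lateral l0 h \<Xi> \<epsilon> = frontier (node \<Xi> \<epsilon>) - (\<Union>i. closure (disc h \<epsilon> i (\<epsilon> * l0)))"

definition junction ::
  "real \<Rightarrow> (3 \<Rightarrow> real) \<Rightarrow> (3 \<Rightarrow> real) \<Rightarrow> (real^3) set \<Rightarrow> real \<Rightarrow> (real^3) set" where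
  "junction l0 l h \<Xi> \<epsilon> =
     interior (closure (node \<Xi> \<epsilon>) \<union> (\<Union>i. closure (cyl l0 l h \<epsilon> i)))"

text \<open>The interface \<open>closure \<Xi> \<inter> {\<xi>\<^sub>i = l0}\<close> of the unscaled node with the \<open>i\<close>-th cylinder.\<close>

definition node_face :: "real \<Rightarrow> (real^3) set \<Rightarrow> 3 \<Rightarrow> (real^3) set" where
  "node_face l0 \<Xi> i = closure \<Xi> \<inter> {\<xi>. \<xi>$i = l0}"

text \<open>The inclusion \<open>\<Xi> \<subseteq> {\<xi>\<^sub>i < l0}\<close> says that the node lies on the side
  \<open>x\<^sub>i = \<epsilon> l0 - 0\<close> of each interface (in particular it does not overlap the cylinders);
  the inclusion of the lateral boundary of the node in the boundary of the junction excludes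
  slits inside the node.\<close>

definition junction_geometry ::
  "real \<Rightarrow> real \<Rightarrow> (3 \<Rightarrow> real) \<Rightarrow> (3 \<Rightarrow> real) \<Rightarrow> (real^3) set \<Rightarrow> bool" where
  "junction_geometry \<epsilon>0 l0 l h \<Xi> \<longleftrightarrow>
     0 < \<epsilon>0 \<and> 0 < l0 \<and> l0 < 1/3 \<and>
     (\<forall>i. 1 \<le> l i \<and> 0 < h i \<and> \<epsilon>0 * l0 \<le> l i) \<and>
     open \<Xi> \<and> connected \<Xi> \<and> bounded \<Xi> \<and> \<Xi> \<noteq> {} \<and>
     (\<forall>i. \<Xi> \<subseteq> {\<xi>. \<xi>$i < l0} \<and> node_face l0 \<Xi> i = closure (disc h 1 i l0)) \<and>
     (\<forall>\<epsilon>\<in>{0<..<\<epsilon>0}.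
        (\<forall>i. disc h \<epsilon> i (\<epsilon> * l0) \<subseteq> frontier (node \<Xi> \<epsilon>)) \<and>
        node_lateral l0 h \<Xi> \<epsilon> \<subseteq> frontier (junction l0 l h \<Xi> \<epsilon>) \<and>
        (\<forall>x \<in> frontier (junction l0 l h \<Xi> \<epsilon>) - (\<Union>i. closure (disc h \<epsilon> i (l i))).
           smooth_boundary_at (junction l0 l h \<Xi> \<epsilon>) x))"

text \<open>Surface measures: \<open>dS\<close> on the lateral surface in cylindrical coordinates
  (radius \<open>\<epsilon> h\<^sub>i\<close>, hence the density \<open>\<epsilon> h\<^sub>i\<close>), and on a cross-section.\<close>

definition lateral_measure ::
  "real \<Rightarrow> (3 \<Rightarrow> real) \<Rightarrow> (3 \<Rightarrow> real) \<Rightarrow> real \<Rightarrow> 3 \<Rightarrow> (real^3) measure" where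
  "lateral_measure l0 l h \<epsilon> i =
     scale_measure (ennreal (\<epsilon> * h i))
       (distr (restrict_space lborel ({\<epsilon> * l0<..<l i} \<times> {0..<2 * pi}))
              (restrict_space borel (lateral l0 l h \<epsilon> i))
              (\<lambda>(y, \<theta>). insert_coord i y ((\<epsilon> * h i) *\<^sub>R vector [cos \<theta>, sin \<theta>])))"

definition disc_measure :: "(3 \<Rightarrow> real) \<Rightarrow> real \<Rightarrow> 3 \<Rightarrow> real \<Rightarrow> (real^3) measure" where
  "disc_measure h \<epsilon> i y =
     distr (restrict_space lborel (ball 0 (\<epsilon> * h i)))
           (restrict_space borel (disc h \<epsilon> i y))
           (insert_coord i y)"


section \<open>Sobolev functions and traces\<close>

definition L2 :: "'a measure \<Rightarrow> ('a \<Rightarrow> 'b::euclidean_space) \<Rightarrow> bool" where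
  "L2 M f \<longleftrightarrow> f \<in> borel_measurable M \<and> integrable M (\<lambda>x. (norm (f x))\<^sup>2)"

definition L2_norm_on :: "'a measure \<Rightarrow> ('a \<Rightarrow> 'b::euclidean_space) \<Rightarrow> real" where
  "L2_norm_on M f = sqrt (\<integral>x. (norm (f x))\<^sup>2 \<partial>M)"

definition test_function :: "(real^3) set \<Rightarrow> (real^3 \<Rightarrow> real) \<Rightarrow> bool" where
  "test_function \<Omega> \<phi> \<longleftrightarrow> smooth_on UNIV \<phi> \<and>
     compact (closure {x. \<phi> x \<noteq> 0}) \<and> closure {x. \<phi> x \<noteq> 0} \<subseteq> \<Omega>"

definition weak_gradient :: "(real^3) set \<Rightarrow> (real^3 \<Rightarrow> real) \<Rightarrow> (real^3 \<Rightarrow> real^3) \<Rightarrow> bool" where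
  "weak_gradient \<Omega> u Du \<longleftrightarrow>
     (\<forall>\<phi> i. test_function \<Omega> \<phi> \<longrightarrow>
        (\<integral>x. u x * partial i \<phi> x \<partial>lebesgue_on \<Omega>) = - (\<integral>x. Du x $ i * \<phi> x \<partial>lebesgue_on \<Omega>))"

text \<open>Since weak gradients are unique almost everywhere, an element \<open>u\<close> of the Sobolev space
  \<open>H\<^sup>1\<close> is handled together with (a representative of) its weak gradient \<open>Du\<close>.\<close>

definition H1 :: "(real^3) set \<Rightarrow> (real^3 \<Rightarrow> real) \<Rightarrow> (real^3 \<Rightarrow> real^3) \<Rightarrow> bool" where
  "H1 \<Omega> u Du \<longleftrightarrow> L2 (lebesgue_on \<Omega>) u \<and> L2 (lebesgue_on \<Omega>) Du \<and> weak_gradient \<Omega> u Du"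

definition H1_norm :: "(real^3) set \<Rightarrow> (real^3 \<Rightarrow> real) \<Rightarrow> (real^3 \<Rightarrow> real^3) \<Rightarrow> real" where
  "H1_norm \<Omega> u Du =
     sqrt ((L2_norm_on (lebesgue_on \<Omega>) u)\<^sup>2 + (L2_norm_on (lebesgue_on \<Omega>) Du)\<^sup>2)"

text \<open>\<open>t\<close> is the trace of \<open>u\<close> on a piece of the boundary of the bounded domain \<open>\<Omega>\<close> carrying the
  surface measure \<open>M\<close>: the trace operator is the continuous extension of the restriction of
  functions smooth up to the boundary, which are dense in \<open>H\<^sup>1\<close> of a Lipschitz domain.\<close>

definition has_trace ::
  "(real^3) set \<Rightarrow> (real^3) measure \<Rightarrow> (real^3 \<Rightarrow> real) \<Rightarrow> (real^3 \<Rightarrow> real^3) \<Rightarrow>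
   (real^3 \<Rightarrow> real) \<Rightarrow> bool" where
  "has_trace \<Omega> M u Du t \<longleftrightarrow> L2 M t \<and>
     (\<exists>U :: nat \<Rightarrow> real^3 \<Rightarrow> real.
        (\<forall>n. smooth_on UNIV (U n)) \<and>
        (\<lambda>n. H1_norm \<Omega> (\<lambda>x. U n x - u x) (\<lambda>x. grad (U n) x - Du x)) \<longlonglongrightarrow> 0 \<and>
        (\<lambda>n. L2_norm_on M (\<lambda>x. U n x - t x)) \<longlonglongrightarrow> 0)"


section \<open>The velocity field\<close>

text \<open>\<open>v0\<close> is the node field in the variable \<open>\<xi>\<close>. In the \<open>i\<close>-th cylinder, \<open>w i\<close> is the axial
  component \<open>v\<^sub>i\<^sup>(\<^sup>i\<^sup>)\<close> and \<open>vt i j\<close> for \<open>j \<noteq> i\<close> is the transversal profile \<open>v\<^sub>j\<^sup>(\<^sup>i\<^sup>)\<close>, a function of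
  \<open>(x\<^sub>i, \<xi>)\<close> with \<open>\<xi>\<close> in the cross-section of radius \<open>h\<^sub>i\<close>; the values \<open>vt i i\<close> are never used.\<close>

definition V_node :: "(real^3 \<Rightarrow> real^3) \<Rightarrow> real \<Rightarrow> real^3 \<Rightarrow> real^3" where
  "V_node v0 \<epsilon> x = v0 ((1/\<epsilon>) *\<^sub>R x)"

definition V_cyl ::
  "(3 \<Rightarrow> real \<Rightarrow> real) \<Rightarrow> (3 \<Rightarrow> 3 \<Rightarrow> real \<times> (real^2) \<Rightarrow> real) \<Rightarrow> real \<Rightarrow> 3 \<Rightarrow> real^3 \<Rightarrow> real^3" where
  "V_cyl w vt \<epsilon> i x =
     (\<chi> j. if j = i then w i (x$i) else \<epsilon> * vt i j (x$i, (1/\<epsilon>) *\<^sub>R bar i x))"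

text \<open>A field on the junction given by its restrictions to the node and to the cylinders. The
  remaining points of the junction lie on the interfaces and form a null set.\<close>

definition piecewise ::
  "real \<Rightarrow> (3 \<Rightarrow> real) \<Rightarrow> (3 \<Rightarrow> real) \<Rightarrow> (real^3) set \<Rightarrow> real \<Rightarrow>
   (real^3 \<Rightarrow> 'b::zero) \<Rightarrow> (3 \<Rightarrow> real^3 \<Rightarrow> 'b) \<Rightarrow> real^3 \<Rightarrow> 'b" where
  "piecewise l0 l h \<Xi> \<epsilon> f0 f x =
     (if x \<in> node \<Xi> \<epsilon> then f0 x
      else if x \<in> cyl l0 l h \<epsilon> 1 then f 1 x
      else if x \<in> cyl l0 l h \<epsilon> 2 then f 2 x
      else if x \<in> cyl l0 l h \<epsilon> 3 then f 3 x
      else 0)"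

text \<open>In the matching condition on the interfaces, the one-sided value of the cylinder field is the
  vector \<open>\<v>\<^sub>i e\<^sub>i\<close>; of the node field, only the normal component is prescribed. Prescribing its
  tangential components as well would be incompatible with the node field being the gradient of a
  harmonic potential \<open>p\<close>: then \<open>p\<close> and \<open>\<v>\<^sub>i \<xi>\<^sub>i\<close> would have, up to a constant, the same Cauchy
  data on the \<open>i\<close>-th interface, so that \<open>\<nabla>p = \<v>\<^sub>i e\<^sub>i\<close> in the whole node for each \<open>i\<close>.\<close>

definition velocity_field ::
  "real \<Rightarrow> real \<Rightarrow> (3 \<Rightarrow> real) \<Rightarrow> (3 \<Rightarrow> real) \<Rightarrow> (real^3) set \<Rightarrow> (3 \<Rightarrow> real) \<Rightarrow>
   (real^3 \<Rightarrow> real^3) \<Rightarrow> (3 \<Rightarrow> real \<Rightarrow> real) \<Rightarrow> (3 \<Rightarrow> 3 \<Rightarrow> real \<times> (real^2) \<Rightarrow> real) \<Rightarrow> bool" where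
  "velocity_field \<epsilon>0 l0 l h \<Xi> \<v> v0 w vt \<longleftrightarrow>
     (\<forall>j. smooth_bounded_on \<Xi> (\<lambda>\<xi>. v0 \<xi> $ j)) \<and>
     (\<forall>i. smooth_bounded_on {0<..<l i} (w i)) \<and>
     (\<forall>i j. j \<noteq> i \<longrightarrow> smooth_bounded_on ({0<..<l i} \<times> ball 0 (h i)) (vt i j)) \<and>
     (\<forall>t\<in>{0<..<l 1}. w 1 t < 0) \<and>
     (\<forall>t\<in>{0<..<l 2}. w 2 t > 0) \<and>
     (\<forall>t\<in>{0<..<l 3}. w 3 t > 0) \<and>
     (\<forall>i. \<exists>\<delta>>0. \<forall>t\<in>{0<..<l i}. t < \<delta> \<longrightarrow> w i t = \<v> i) \<and>
     (\<forall>i j. j \<noteq> i \<longrightarrow>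
        (\<exists>a b. 0 < a \<and> b < l i \<and>
           (\<forall>t\<in>{0<..<l i} - {a..b}. \<forall>\<xi>\<in>ball 0 (h i). vt i j (t, \<xi>) = 0))) \<and>
     (\<forall>\<epsilon>\<in>{0<..<\<epsilon>0}. \<forall>i. \<forall>x\<in>disc h \<epsilon> i (\<epsilon> * l0).
        V_cyl w vt \<epsilon> i x = \<v> i *\<^sub>R axis i 1 \<and>
        ((\<lambda>y. V_node v0 \<epsilon> y $ i) \<longlongrightarrow> \<v> i) (at x within node \<Xi> \<epsilon>))"

text \<open>The supremum \<open>d\<^sub>i\<close> of the Euclidean norm of the pair of the two transversal profiles.\<close>

definition transversal_sup ::
  "real \<Rightarrow> (3 \<Rightarrow> real) \<Rightarrow> (3 \<Rightarrow> real) \<Rightarrow> (3 \<Rightarrow> 3 \<Rightarrow> real \<times> (real^2) \<Rightarrow> real) \<Rightarrow>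
   real \<Rightarrow> 3 \<Rightarrow> real" where
  "transversal_sup l0 l h vt \<epsilon> i =
     (SUP x \<in> cyl l0 l h \<epsilon> i. norm (bar i (\<chi> j. vt i j (x$i, (1/\<epsilon>) *\<^sub>R bar i x))))"

text \<open>Classical zero-mean solution of the Neumann problem in the node. Derivatives of \<open>p\<close> on the
  boundary are limits from inside \<open>\<Xi>\<close>.\<close>

definition neumann_potential ::
  "real \<Rightarrow> (real^3) set \<Rightarrow> (3 \<Rightarrow> real) \<Rightarrow> (real^3 \<Rightarrow> real) \<Rightarrow> bool" where
  "neumann_potential l0 \<Xi> \<v> p \<longleftrightarrow>
     C_on 2 \<Xi> p \<and>
     (\<forall>\<xi>\<in>\<Xi>. laplacian p \<xi> = 0) \<and>
     (\<forall>i. \<forall>\<xi>\<in>node_face l0 \<Xi> i. (partial i p \<longlongrightarrow> \<v> i) (at \<xi> within \<Xi>)) \<and>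
     (\<forall>\<xi>\<in>frontier \<Xi> - (\<Union>i. node_face l0 \<Xi> i). \<forall>n. outward_unit_normal \<Xi> \<xi> n \<longrightarrow>
        ((\<lambda>y. grad p y \<bullet> n) \<longlongrightarrow> 0) (at \<xi> within \<Xi>)) \<and>
     integrable (lebesgue_on \<Xi>) p \<and> (\<integral>\<xi>. p \<xi> \<partial>lebesgue_on \<Xi>) = 0"


section \<open>The diffusion matrix\<close>

definition D_node :: "(real^3 \<Rightarrow> real^3^3) \<Rightarrow> real \<Rightarrow> real^3 \<Rightarrow> real^3^3" where
  "D_node a0 \<epsilon> x = a0 ((1/\<epsilon>) *\<^sub>R x)"

definition D_cyl :: "(3 \<Rightarrow> real^2 \<Rightarrow> real^3^3) \<Rightarrow> real \<Rightarrow> 3 \<Rightarrow> real^3 \<Rightarrow> real^3^3" where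
  "D_cyl a \<epsilon> i x = a i ((1/\<epsilon>) *\<^sub>R bar i x)"

definition elliptic_matrix_on ::
  "'a::euclidean_space set \<Rightarrow> ('a \<Rightarrow> real^3^3) \<Rightarrow> real \<Rightarrow> real \<Rightarrow> bool" where
  "elliptic_matrix_on S A \<kappa>0 \<kappa>1 \<longleftrightarrow>
     0 < \<kappa>0 \<and> 0 < \<kappa>1 \<and>
     (\<forall>m n. smooth_bounded_on S (\<lambda>\<xi>. A \<xi> $ m $ n)) \<and>
     (\<forall>\<xi>\<in>S. transpose (A \<xi>) = A \<xi>) \<and>
     (\<forall>\<xi>\<in>S. \<forall>y::real^3.
        \<kappa>0 * (norm y)\<^sup>2 \<le> (\<Sum>m\<in>UNIV. \<Sum>n\<in>UNIV. A \<xi> $ m $ n * y$m * y$n) \<and>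
        (\<Sum>m\<in>UNIV. \<Sum>n\<in>UNIV. A \<xi> $ m $ n * y$m * y$n) \<le> \<kappa>1 * (norm y)\<^sup>2)"

text \<open>\<open>\<kappa>0n, \<kappa>1n\<close> are the ellipticity constants of the node (index 0), \<open>\<kappa>0 i, \<kappa>1 i\<close> those of the
  cylinders.\<close>

definition diffusion_matrix ::
  "(3 \<Rightarrow> real) \<Rightarrow> (real^3) set \<Rightarrow> (real^3 \<Rightarrow> real^3^3) \<Rightarrow> (3 \<Rightarrow> real^2 \<Rightarrow> real^3^3) \<Rightarrow>
   real \<Rightarrow> real \<Rightarrow> (3 \<Rightarrow> real) \<Rightarrow> (3 \<Rightarrow> real) \<Rightarrow> bool" where
  "diffusion_matrix h \<Xi> a0 a \<kappa>0n \<kappa>1n \<kappa>0 \<kappa>1 \<longleftrightarrow>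
     elliptic_matrix_on \<Xi> a0 \<kappa>0n \<kappa>1n \<and>
     (\<forall>i. elliptic_matrix_on (ball 0 (h i)) (a i) (\<kappa>0 i) (\<kappa>1 i) \<and>
          (\<exists>c. \<forall>\<xi>\<in>ball 0 (h i). a i \<xi> $ i $ i = c) \<and>
          (\<forall>\<xi>\<in>ball 0 (h i). \<forall>m. m \<noteq> i \<longrightarrow> a i \<xi> $ i $ m = 0 \<and> a i \<xi> $ m $ i = 0))"


section \<open>Weak solutions\<close>

text \<open>\<open>H\<^sup>1\<close> functions on the junction that vanish on the outer ends of the three cylinders.\<close>

definition H1_vanishing ::
  "real \<Rightarrow> (3 \<Rightarrow> real) \<Rightarrow> (3 \<Rightarrow> real) \<Rightarrow> (real^3) set \<Rightarrow> real \<Rightarrow>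
   (real^3 \<Rightarrow> real) \<Rightarrow> (real^3 \<Rightarrow> real^3) \<Rightarrow> bool" where
  "H1_vanishing l0 l h \<Xi> \<epsilon> u Du \<longleftrightarrow>
     H1 (junction l0 l h \<Xi> \<epsilon>) u Du \<and>
     (\<forall>i. has_trace (junction l0 l h \<Xi> \<epsilon>) (disc_measure h \<epsilon> i (l i)) u Du (\<lambda>_. 0))"

text \<open>Here \<open>V\<close> and \<open>D\<close> are the velocity field and the diffusion matrix on the junction, and
  \<open>t i\<close> is the trace of the test function \<open>\<eta>\<close> on the lateral surface of the \<open>i\<close>-th cylinder.\<close>

definition weak_solution ::
  "real \<Rightarrow> (3 \<Rightarrow> real) \<Rightarrow> (3 \<Rightarrow> real) \<Rightarrow> (real^3) set \<Rightarrow> real \<Rightarrow>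
   (real^3 \<Rightarrow> real^3) \<Rightarrow> (real^3 \<Rightarrow> real^3^3) \<Rightarrow>
   (3 \<Rightarrow> real^3 \<Rightarrow> real) \<Rightarrow> (3 \<Rightarrow> real^3 \<Rightarrow> real) \<Rightarrow>
   (real^3 \<Rightarrow> real) \<Rightarrow> (real^3 \<Rightarrow> real^3) \<Rightarrow> bool" where
  "weak_solution l0 l h \<Xi> \<epsilon> V D F \<Phi> \<psi> D\<psi> \<longleftrightarrow>
     H1_vanishing l0 l h \<Xi> \<epsilon> \<psi> D\<psi> \<and>
     (\<forall>\<eta> D\<eta> t.
        H1_vanishing l0 l h \<Xi> \<epsilon> \<eta> D\<eta> \<longrightarrow>
        (\<forall>i. has_trace (junction l0 l h \<Xi> \<epsilon>) (lateral_measure l0 l h \<epsilon> i) \<eta> D\<eta> (t i)) \<longrightarrow>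
        \<epsilon> * (\<integral>x. D\<eta> x \<bullet> (D x *v D\<psi> x) \<partial>lebesgue_on (junction l0 l h \<Xi> \<epsilon>))
          - (\<integral>x. \<psi> x * (V x \<bullet> D\<eta> x) \<partial>lebesgue_on (junction l0 l h \<Xi> \<epsilon>))
        = (\<Sum>i\<in>UNIV. \<integral>x. F i x * \<eta> x \<partial>lebesgue_on (cyl l0 l h \<epsilon> i))
          - \<epsilon> * (\<Sum>i\<in>UNIV. \<integral>x. \<Phi> i x * t i x \<partial>lateral_measure l0 l h \<epsilon> i))"

end

theory Submission
  imports Defs
begin

text \<open>
The weak formulation is tested with \<open>\<eta> = \<psi>\<close>. For functions of class \<open>C\<^sup>1\<close>, twice the convective
term is the integral of \<open>V \<bullet> \<nabla>\<psi>\<^sup>2\<close>. In the node \<open>V\<close> is the gradient of a harmonic function, so this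
integral is the sum of the fluxes \<open>\<v>\<^sub>i \<integral> \<psi>\<^sup>2\<close> through the interfaces. In the \<open>i\<close>-th cylinder the axial
part gives the opposite flux and, since \<open>v\<^sub>i\<close> is nondecreasing, a remaining term of favourable sign.
The transversal part is absorbed by the diffusion, by Friedrichs' inequality and the smallness of
\<open>d\<^sub>i \<ell>\<^sub>i\<close>. Together with a Poincare inequality on the junction whose constant does not depend on
\<open>\<epsilon>\<close>, this bounds \<open>\<epsilon> \<parallel>\<psi>\<parallel>\<^sup>2\<close> by the right-hand side, and a trace inequality on
the thin cylinders controls the boundary terms. All inequalities pass from \<open>C\<^sup>1\<close> functions to Sobolev
functions through the approximating sequences in the definition of traces.

Nothing is known about the regularity of the boundary of the node along the edges of the interfaces,
so the divergence theorem is derived from the Neumann condition by local cutoffs: a field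
without normal component at the boundary has no flux through thin boundary layers.
\<close>

section \<open>Functions of class \<open>C\<^sup>1\<close>\<close>

text \<open>The constants have to leave room. The smallness hypothesis only bounds the transversal
  convection by the full diffusion, so the Friedrichs constant must lie strictly below 1: the value
  3/4 becomes the factor 7/8 in the convection estimate, and one eighth of
  \<open>\<kappa>0 i\<close> survives. Smooth approximations of a function vanishing at the outer
  ends need not vanish there themselves; hence the inequalities for smooth functions carry end
  terms, of which only the decay along the sequence matters. Uniformity in \<open>\<epsilon>\<close>
  comes from scaling the node to a fixed domain and from one-dimensional estimates along the
  cylinders, which do not see the radius. A priori the node could be walled off from a cylinder at
  points of an interface; the nonzero normal velocity \<open>\<v> i\<close> excludes this, so that
  the node fills a half ball below every point of an open interface. Testing with the solution also
  requires its lateral traces, which are constructed as limits of restrictions of the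
  approximations.\<close>

definition C1_on :: "'a::real_inner set \<Rightarrow> ('a \<Rightarrow> real) \<Rightarrow> ('a \<Rightarrow> 'a) \<Rightarrow> bool" where
  "C1_on S f G \<longleftrightarrow> (\<forall>x\<in>S. GDERIV f x :> G x) \<and> continuous_on S G"

lemma C1_onD:
  assumes "C1_on S f G"
  shows "x \<in> S \<Longrightarrow> GDERIV f x :> G x" "continuous_on S G"
  using assms by (auto simp: C1_on_def)

lemma C1_on_continuous: "C1_on S f G \<Longrightarrow> continuous_on S f"
  unfolding C1_on_def gderiv_def
  by (meson continuous_at_imp_continuous_on has_derivative_continuous)

lemma C1_on_subset: "C1_on S f G \<Longrightarrow> T \<subseteq> S \<Longrightarrow> C1_on T f G"
  by (auto simp: C1_on_def intro: continuous_on_subset)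

lemma C1_on_const: "C1_on S (\<lambda>_. c) (\<lambda>_. 0)"
  by (auto simp: C1_on_def GDERIV_const)

lemma C1_on_nth: "C1_on S (\<lambda>x::real^'n. x $ i) (\<lambda>_. axis i 1)"
proof -
  have "((\<lambda>x::real^'n. x $ i) has_derivative (\<lambda>h. h $ i)) (at x)" for x
    by (rule bounded_linear_imp_has_derivative[OF bounded_linear_vec_nth])
  then show ?thesis by (simp add: C1_on_def gderiv_def inner_axis)
qed

lemma C1_on_diff:
  "C1_on S f F \<Longrightarrow> C1_on S g G \<Longrightarrow> C1_on S (\<lambda>x. f x - g x) (\<lambda>x. F x - G x)"
  by (auto simp: C1_on_def intro: GDERIV_diff continuous_intros)

lemma C1_on_mult:
  assumes "C1_on S f F" "C1_on S g G"
  shows "C1_on S (\<lambda>x. f x * g x) (\<lambda>x. f x *\<^sub>R G x + g x *\<^sub>R F x)"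
  using assms C1_on_continuous[OF assms(1)] C1_on_continuous[OF assms(2)]
  unfolding C1_on_def by (auto intro: GDERIV_mult continuous_intros)

lemma C1_on_compose:
  assumes "C1_on S f F" "\<And>t. DERIV b t :> b' t" "continuous_on UNIV b'"
  shows "C1_on S (\<lambda>x. b (f x)) (\<lambda>x. b' (f x) *\<^sub>R F x)"
  unfolding C1_on_def
proof (intro conjI ballI)
  show "GDERIV (\<lambda>x. b (f x)) x :> b' (f x) *\<^sub>R F x" if "x \<in> S" for x
    by (rule GDERIV_DERIV_compose[OF C1_onD(1)[OF assms(1) that] assms(2)])
  show "continuous_on S (\<lambda>x. b' (f x) *\<^sub>R F x)"
    using C1_on_continuous[OF assms(1)] C1_onD(2)[OF assms(1)]
    by (auto intro!: continuous_intros continuous_on_compose2[OF assms(3)])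
qed

lemma C1_on_norm_sq:
  "C1_on S (\<lambda>y::'a::real_inner. (norm (y - a))\<^sup>2) (\<lambda>y. 2 *\<^sub>R (y - a))"
proof -
  have "GDERIV (\<lambda>y. (norm (y - a))\<^sup>2) y :> 2 *\<^sub>R (y - a)" for y :: 'a
    unfolding gderiv_def power2_norm_eq_inner
    by (auto intro!: derivative_eq_intros simp: inner_commute algebra_simps)
  then show ?thesis
    by (auto simp: C1_on_def intro!: continuous_intros)
qed

lemma gderiv_unique: "GDERIV f x :> D \<Longrightarrow> GDERIV f x :> E \<Longrightarrow> D = E"
proof -
  assume "GDERIV f x :> D" "GDERIV f x :> E"
  then have "(\<lambda>h. h \<bullet> D) = (\<lambda>h. h \<bullet> E)"
    unfolding gderiv_def by (rule has_derivative_unique)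
  then have "(D - E) \<bullet> D = (D - E) \<bullet> E" by (rule fun_cong)
  then have "(D - E) \<bullet> (D - E) = 0" by (simp add: inner_diff_right)
  then show "D = E" by simp
qed

lemma gderiv_zero_on_open:
  assumes "open W" "x \<in> W" "\<And>y. y \<in> W \<Longrightarrow> f y = 0" "GDERIV f x :> D"
  shows "D = 0"
proof -
  have "GDERIV f x :> 0"
    unfolding gderiv_def
    by (rule has_derivative_transform_within_open[OF _ assms(1,2)])
       (use assms(3) in \<open>auto intro!: derivative_eq_intros\<close>)
  then show ?thesis using assms(4) gderiv_unique by blast
qed

text \<open>The open sets \<open>W\<close> and \<open>- K\<close> cover the space, and the extension
  is of class C^1 on each: on the second it vanishes identically. Local constructions thereby become
  functions on the whole space.\<close>

lemma C1_on_zero_extension: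
  assumes C: "C1_on W f G" and W: "open W" and K: "closed K" "K \<subseteq> W"
    and z: "\<And>x. x \<in> W - K \<Longrightarrow> f x = 0"
  shows "C1_on UNIV (\<lambda>x. if x \<in> W then f x else 0) (\<lambda>x. if x \<in> W then G x else 0)"
    (is "C1_on UNIV ?f ?G")
proof -
  have G0: "G x = 0" if "x \<in> W - K" for x
    using gderiv_zero_on_open[of "W - K" x f "G x"] that z C1_onD(1)[OF C, of x] W K
    by (auto simp: open_Diff)
  have 1: "C1_on W ?f ?G"
    unfolding C1_on_def
  proof (intro conjI ballI)
    fix x assume x: "x \<in> W"
    have "(f has_derivative (\<lambda>h. h \<bullet> ?G x)) (at x)"
      using C1_onD(1)[OF C x] x by (simp add: gderiv_def)
    then show "GDERIV ?f x :> ?G x"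
      unfolding gderiv_def by (rule has_derivative_transform_within_open[OF _ W x]) simp
  next
    show "continuous_on W ?G"
      using C1_onD(2)[OF C] by (simp cong: continuous_on_cong)
  qed
  have 2: "C1_on (- K) ?f ?G"
    unfolding C1_on_def
  proof (intro conjI ballI)
    fix x assume x: "x \<in> - K"
    have f0: "?f y = 0" if "y \<in> - K" for y using that z by auto
    have "?G x = 0" using x G0 by auto
    moreover have "GDERIV ?f x :> 0"
      unfolding gderiv_def
      by (rule has_derivative_transform_within_open[of "\<lambda>_. 0" _ _ _ "- K"])
         (use x K f0 in \<open>auto intro!: derivative_eq_intros\<close>)
    ultimately show "GDERIV ?f x :> ?G x" by (simp only:)
  next
    have "continuous_on (-K) ?G = continuous_on (-K) (\<lambda>_::'a. 0::'a)"
      using G0 by (intro continuous_on_cong) auto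
    then show "continuous_on (-K) ?G" by simp
  qed
  have U: "UNIV = W \<union> - K" using K by auto
  show ?thesis
    unfolding C1_on_def
  proof (intro conjI ballI)
    show "continuous_on UNIV ?G"
      unfolding U by (rule continuous_on_open_Un[OF W _ C1_onD(2)[OF 1] C1_onD(2)[OF 2]])
        (simp add: K open_Compl)
    show "GDERIV ?f x :> ?G x" for x
    proof (cases "x \<in> W")
      case True then show ?thesis by (rule C1_onD(1)[OF 1])
    next
      case False
      then have "x \<in> - K" using K by auto
      then show ?thesis by (rule C1_onD(1)[OF 2])
    qed
  qed
qed

text \<open>A quadratic spline rising from 0 to 1 on the unit interval, with second derivative 4 on
  the first half and -4 on the second. The cutoffs need only one continuous derivative, and the
  explicit form gives the bound 2 on the slope.\<close>

definition step :: "real \<Rightarrow> real" where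
  "step t = 2 * (max 0 t)\<^sup>2 - 4 * (max 0 (t - 1/2))\<^sup>2 + 2 * (max 0 (t - 1))\<^sup>2"

definition step' :: "real \<Rightarrow> real" where
  "step' t = 4 * max 0 t - 8 * max 0 (t - 1/2) + 4 * max 0 (t - 1)"

lemma DERIV_max_sq: "DERIV (\<lambda>t::real. (max 0 t)\<^sup>2) t :> 2 * max 0 t"
proof -
  consider "t < 0" | "t = 0" | "t > 0" by linarith
  then show ?thesis
  proof cases
    case 1
    have "DERIV (\<lambda>t::real. 0) t :> 2 * max 0 t" using 1 by simp
    then show ?thesis
      by (rule has_field_derivative_transform_within_open[of _ _ _ "{..<0}"]) (use 1 in auto)
  next
    case 3
    have "DERIV (\<lambda>t::real. t\<^sup>2) t :> 2 * max 0 t"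
      using 3 by (auto intro!: derivative_eq_intros)
    then show ?thesis
      by (rule has_field_derivative_transform_within_open[of _ _ _ "{0<..}"]) (use 3 in auto)
  next
    case 2
    have "((\<lambda>h::real. (max 0 h)\<^sup>2 / h) \<longlongrightarrow> 0) (at 0)"
    proof (rule tendsto_rabs_zero_cancel, rule tendsto_sandwich[of "\<lambda>_. 0" _ _ "\<lambda>h. \<bar>h\<bar>"])
      show "\<forall>\<^sub>F h in at (0::real). \<bar>(max 0 h)\<^sup>2 / h\<bar> \<le> \<bar>h\<bar>"
        by (intro always_eventually) (auto simp: max_def power2_eq_square)
      show "((\<lambda>h::real. \<bar>h\<bar>) \<longlongrightarrow> 0) (at 0)"
        by (rule tendsto_eq_intros)+ auto
    qed auto
    then show ?thesis using 2 by (simp add: DERIV_def)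
  qed
qed

lemma DERIV_step: "DERIV step t :> step' t"
  unfolding step_def step'_def
  by (rule derivative_eq_intros DERIV_max_sq[THEN DERIV_chain2] refl)+ auto

lemma continuous_step': "continuous_on S step'"
  unfolding step'_def by (intro continuous_intros)

lemma step_eq: "t \<le> 0 \<Longrightarrow> step t = 0" "t \<ge> 1 \<Longrightarrow> step t = 1"
  by (auto simp: step_def max_def power2_eq_square field_simps)

lemma step'_eq: "t \<le> 0 \<Longrightarrow> step' t = 0" "t \<ge> 1 \<Longrightarrow> step' t = 0"
  by (auto simp: step'_def max_def)

lemma step'_bounds: "0 \<le> step' t" "step' t \<le> 2"
  by (auto simp: step'_def max_def)

lemma step_mono: "s \<le> t \<Longrightarrow> step s \<le> step t"
  by (metis DERIV_nonneg_imp_nondecreasing DERIV_step step'_bounds(1))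

lemma step_bounds: "0 \<le> step t" "step t \<le> 1"
  using step_mono[of "min 0 t" t] step_mono[of t "max 1 t"] step_eq(1)[of "min 0 t"]
    step_eq(2)[of "max 1 t"] by auto

lemma C1_on_step: "C1_on S f F \<Longrightarrow> C1_on S (\<lambda>x. step (f x)) (\<lambda>x. step' (f x) *\<^sub>R F x)"
  by (rule C1_on_compose[OF _ DERIV_step continuous_step'])

section \<open>Integrals of derivatives of compactly supported functions\<close>

lemma integrable_lborel_compact_support:
  fixes f :: "'a::euclidean_space \<Rightarrow> 'b::{banach,second_countable_topology}"
  assumes "continuous_on UNIV f" "\<And>x. norm x > R \<Longrightarrow> f x = 0"
  shows "integrable lborel f"
proof -
  have "f = (\<lambda>x. indicator (cball 0 R) x *\<^sub>R f x)"
    using assms(2) by (force simp: indicator_def)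
  then show ?thesis
    using borel_integrable_compact[of "cball 0 R" f] assms(1) continuous_on_subset
    by (metis (no_types, lifting) compact_cball subset_UNIV)
qed

text \<open>Each difference quotient in the direction \<open>e\<close> has integral zero because
  Lebesgue measure is translation invariant. The quotients converge to the derivative and are
  dominated by the Lipschitz constant on a fixed ball, so no iterated integration is needed.\<close>

lemma integral_partial_compact_support:
  fixes f :: "'a::euclidean_space \<Rightarrow> real"
  assumes C: "C1_on UNIV f G" and R: "\<And>x. norm x > R \<Longrightarrow> f x = 0"
  shows "(\<integral>x. G x \<bullet> e \<partial>lborel) = 0"
proof -
  have cf: "continuous_on UNIV f" using C by (rule C1_on_continuous)
  have cG: "continuous_on UNIV G" using C by (rule C1_onD)
  have if1: "integrable lborel f" using cf R by (rule integrable_lborel_compact_support)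
  have G0: "G x = 0" if "norm x > R" for x
  proof (rule gderiv_zero_on_open[of "- cball 0 R" x f])
    show "GDERIV f x :> G x" using C by (simp add: C1_onD)
  qed (use that R in auto)
  have "compact (G ` cball 0 R)"
    using cG by (intro compact_continuous_image) (auto intro: continuous_on_subset)
  then obtain M where M: "\<And>x. x \<in> cball 0 R \<Longrightarrow> norm (G x) \<le> M"
    using compact_imp_bounded bounded_iff by (metis imageI)
  define B where "B = max M 0"
  have B: "norm (G x) \<le> B" for x
    using M[of x] G0[of x] unfolding B_def by (cases "norm x \<le> R") auto
  define s where "s n x = (f (x + (1/real (Suc n)) *\<^sub>R e) - f x) / (1/real (Suc n))" for n x
  have lip: "\<bar>f (x + y) - f x\<bar> \<le> B * norm y" for x y
  proof -
    have "norm (f (x + y) - f x) \<le> B * norm (x + y - x)"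
    proof (rule differentiable_bound[of UNIV f "\<lambda>x h. h \<bullet> G x"])
      show "(f has_derivative (\<lambda>h. h \<bullet> G x)) (at x within UNIV)" for x
        using C1_onD(1)[OF C, of x] by (simp add: gderiv_def)
      show "onorm (\<lambda>h. h \<bullet> G x) \<le> B" for x
      proof (rule onorm_bound)
        show "0 \<le> B" by (simp add: B_def)
        fix h
        have "norm (h \<bullet> G x) \<le> norm h * norm (G x)" by (simp add: Cauchy_Schwarz_ineq2)
        also have "\<dots> \<le> norm h * B" using B by (simp add: mult_left_mono)
        finally show "norm (h \<bullet> G x) \<le> B * norm h" by (simp add: mult.commute)
      qed
    qed auto
    then show ?thesis by simp
  qed
  have int_s: "(\<integral>x. s n x \<partial>lborel) = 0" for n
  proof -
    let ?y = "(1/real (Suc n)) *\<^sub>R e"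
    have far: "f (x + ?y) = 0" if "norm x > R + norm ?y" for x
      using norm_diff_ineq[of x ?y] that by (intro R) linarith
    have i: "integrable lborel (\<lambda>x. f (x + ?y))"
      by (rule integrable_lborel_compact_support[of _ "R + norm ?y"])
         (use far in \<open>auto intro!: continuous_intros continuous_on_compose2[OF cf]\<close>)
    have "(\<integral>x. f (x + ?y) \<partial>lborel) = (\<integral>x. f x \<partial>distr lborel borel ((+) ?y))"
      using cf by (subst integral_distr) (auto simp: add.commute borel_measurable_continuous_onI)
    also have "\<dots> = (\<integral>x. f x \<partial>lborel)" by (simp only: lborel_distr_plus)
    finally show ?thesis using i if1 unfolding s_def by simp
  qed
  have "(\<lambda>n. \<integral>x. s n x \<partial>lborel) \<longlonglongrightarrow> (\<integral>x. G x \<bullet> e \<partial>lborel)"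
  proof (rule integral_dominated_convergence[where w = "\<lambda>x. indicator (cball 0 (R + norm e)) x *\<^sub>R (B * norm e)"])
    show "(\<lambda>x. G x \<bullet> e) \<in> borel_measurable lborel"
      using cG by (auto intro!: borel_measurable_continuous_onI continuous_intros)
    show "s n \<in> borel_measurable lborel" for n
      unfolding s_def using cf
      by (auto intro!: borel_measurable_continuous_onI continuous_intros continuous_on_compose2[OF cf])
    show "integrable lborel (\<lambda>x. indicator (cball 0 (R + norm e)) x *\<^sub>R (B * norm e))"
      by (intro borel_integrable_compact) auto
    show "AE x in lborel. (\<lambda>n. s n x) \<longlonglongrightarrow> G x \<bullet> e"
    proof (rule AE_I2)
      fix x
      have "((\<lambda>t. f (x + t *\<^sub>R e)) has_real_derivative (e \<bullet> G x)) (at 0)"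
        unfolding has_field_derivative_def
      proof (rule has_derivative_eq_rhs)
        show "((\<lambda>t. f (x + t *\<^sub>R e)) has_derivative (\<lambda>t. (t *\<^sub>R e) \<bullet> G x)) (at 0)"
          by (rule has_derivative_compose[of "\<lambda>t. x + t *\<^sub>R e" "\<lambda>t. t *\<^sub>R e" 0 UNIV f])
            (use C1_onD(1)[OF C, of x] in \<open>auto simp: gderiv_def intro!: derivative_eq_intros\<close>)
      qed (auto simp: fun_eq_iff)
      then have "((\<lambda>t. (f (x + t *\<^sub>R e) - f x) / t) \<longlongrightarrow> e \<bullet> G x) (at 0)"
        by (simp add: DERIV_def)
      then have "(\<lambda>n. (f (x + (1/real (Suc n)) *\<^sub>R e) - f x) / (1/real (Suc n))) \<longlonglongrightarrow> e \<bullet> G x"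
        by (rule filterlim_compose) (intro filterlim_atI LIMSEQ_Suc[OF lim_1_over_n] always_eventually, simp)
      then show "(\<lambda>n. s n x) \<longlonglongrightarrow> G x \<bullet> e" by (simp add: s_def inner_commute)
    qed
    show "AE x in lborel. norm (s n x) \<le> indicator (cball 0 (R + norm e)) x *\<^sub>R (B * norm e)" for n
    proof (rule AE_I2)
      fix x
      \<comment> \<open>The shifts have length at most \<open>norm e\<close>, so all shifted
        supports stay in the ball of radius \<open>R + norm e\<close>.\<close>
      have ne: "norm ((1/real (Suc n)) *\<^sub>R e) \<le> norm e"
        by (simp add: field_simps mult_left_le)
      show "norm (s n x) \<le> indicator (cball 0 (R + norm e)) x *\<^sub>R (B * norm e)"
      proof (cases "norm x \<le> R + norm e")
        case True
        have "\<bar>f (x + (1/real (Suc n)) *\<^sub>R e) - f x\<bar> \<le> (1/real (Suc n)) * (B * norm e)"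
          using lip[of x "(1/real (Suc n)) *\<^sub>R e"] by (simp add: field_simps)
        then have "\<bar>f (x + (1/real (Suc n)) *\<^sub>R e) - f x\<bar> / (1/real (Suc n)) \<le> B * norm e"
          by (simp add: pos_divide_le_eq pos_le_divide_eq del: of_nat_Suc)
        then have "norm (s n x) \<le> B * norm e" unfolding s_def by (simp only: real_norm_def abs_divide)
        then show ?thesis using True by simp
      next
        case False
        then have "norm x > R" using norm_ge_zero[of e] by linarith
        moreover have "norm (x + (1/real (Suc n)) *\<^sub>R e) > R"
          using ne False norm_triangle_ineq2[of x "- ((1/real (Suc n)) *\<^sub>R e)"] by simp
        ultimately show ?thesis using R by (simp add: s_def B_def)
      qed
    qed
  qed
  then show ?thesis by (simp only: int_s) (metis LIMSEQ_unique tendsto_const)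
qed

section \<open>The divergence theorem without boundary flux\<close>

lemma set_integrable_compact_support:
  fixes f :: "'a::euclidean_space \<Rightarrow> 'b::{banach,second_countable_topology}"
  assumes f: "continuous_on W f" and K: "compact K" "K \<subseteq> W" and z: "\<And>x. x \<in> W - K \<Longrightarrow> f x = 0"
  shows "set_integrable lborel W f"
proof -
  have "(\<lambda>x. indicator W x *\<^sub>R f x) = (\<lambda>x. indicator K x *\<^sub>R f x)"
    using K z by (auto simp: indicator_def fun_eq_iff)
  then show ?thesis
    using borel_integrable_compact[OF K(1) continuous_on_subset[OF f K(2)]]
    by (simp add: set_integrable_def)
qed

lemma set_integrable_bounded_continuous:
  fixes f :: "'a::euclidean_space \<Rightarrow> 'b::euclidean_space"
  assumes f: "continuous_on W f" and W: "open W" "bounded W" and B: "\<And>x. x \<in> W \<Longrightarrow> norm (f x) \<le> B"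
  shows "set_integrable lborel W f"
  unfolding set_integrable_def
proof (rule Bochner_Integration.integrable_bound)
  show "integrable lborel (\<lambda>x. indicator W x *\<^sub>R B)"
    using W emeasure_bounded_finite[of W] by (simp add: integrable_real_indicator)
  show "(\<lambda>x. indicator W x *\<^sub>R f x) \<in> borel_measurable lborel"
    using borel_measurable_continuous_on_indicator[OF _ f] W by simp
  show "AE x in lborel. norm (indicator W x *\<^sub>R f x) \<le> norm (indicator W x *\<^sub>R B)"
    using B by (intro AE_I2) (auto simp: indicator_def intro: order_trans[OF B abs_ge_self])
qed

lemma integral_partial_open:
  fixes f :: "'a::euclidean_space \<Rightarrow> real"
  assumes C: "C1_on W f G" and W: "open W" and K: "compact K" "K \<subseteq> W"
    and z: "\<And>x. x \<in> W - K \<Longrightarrow> f x = 0"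
  shows "(LINT x:W|lborel. G x \<bullet> e) = 0"
proof -
  obtain R where R: "K \<subseteq> cball 0 R"
    using bounded_subset_ballD[OF compact_imp_bounded[OF K(1)], of 0] ball_subset_cball by blast
  have "(\<integral>x. (if x \<in> W then G x else 0) \<bullet> e \<partial>lborel) = 0"
  proof (rule integral_partial_compact_support[OF C1_on_zero_extension[OF C W compact_imp_closed[OF K(1)] K(2) z]])
    fix x :: 'a assume "norm x > R"
    then have "x \<notin> K" using R by auto
    then show "(if x \<in> W then f x else 0) = 0" using z by auto
  qed auto
  also have "(\<lambda>x. (if x \<in> W then G x else 0) \<bullet> e) = (\<lambda>x. indicator W x *\<^sub>R (G x \<bullet> e))"
    by (auto simp: fun_eq_iff)
  finally show ?thesis by (simp add: set_lebesgue_integral_def)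
qed

text \<open>\<open>DV i\<close> is the gradient of the i-th component, which makes
  \<open>div_zero\<close> the classical condition. Nothing is assumed about the boundary; the bound
  \<open>B\<close> dominates the integrals when cutoffs near the boundary are removed.\<close>

locale solenoidal =
  fixes \<Xi> :: "(real^3) set" and V :: "real^3 \<Rightarrow> real^3" and DV :: "3 \<Rightarrow> real^3 \<Rightarrow> real^3" and B :: real
  assumes open_dom: "open \<Xi>" and bounded_dom: "bounded \<Xi>"
    and V_C1: "\<And>i. C1_on \<Xi> (\<lambda>x. V x $ i) (DV i)"
    and div_zero: "\<And>x. x \<in> \<Xi> \<Longrightarrow> (\<Sum>i\<in>UNIV. DV i x $ i) = 0"
    and V_bound: "\<And>x. x \<in> \<Xi> \<Longrightarrow> norm (V x) \<le> B"
    and B_nonneg: "0 \<le> B"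
begin

lemma continuous_V: "continuous_on \<Xi> V"
  using C1_on_continuous[OF V_C1] by (subst continuous_on_componentwise) (auto simp: Basis_vec_def inner_axis)

text \<open>The field \<zeta> \<phi> V has compact support in the domain, so its divergence
  integrates to zero; since V is divergence free, only the two terms of the identity remain in that
  divergence.\<close>

lemma flux_cutoff:
  assumes \<zeta>: "C1_on \<Xi> \<zeta> D\<zeta>" and K: "compact K" "K \<subseteq> \<Xi>" "\<And>x. x \<in> \<Xi> - K \<Longrightarrow> \<zeta> x = 0"
    and \<phi>: "C1_on \<Xi> \<phi> D\<phi>"
  shows "set_integrable lborel \<Xi> (\<lambda>x. \<zeta> x * (V x \<bullet> D\<phi> x))"
    and "set_integrable lborel \<Xi> (\<lambda>x. \<phi> x * (V x \<bullet> D\<zeta> x))"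
    and "(LINT x:\<Xi>|lborel. \<zeta> x * (V x \<bullet> D\<phi> x)) = - (LINT x:\<Xi>|lborel. \<phi> x * (V x \<bullet> D\<zeta> x))"
proof -
  note cont = C1_on_continuous[OF \<zeta>] C1_on_continuous[OF \<phi>] C1_onD(2)[OF \<zeta>] C1_onD(2)[OF \<phi>] continuous_V
  have D0: "D\<zeta> x = 0" if "x \<in> \<Xi> - K" for x
    using gderiv_zero_on_open[of "\<Xi> - K" x \<zeta> "D\<zeta> x"] that K C1_onD(1)[OF \<zeta>, of x] open_dom
    by (auto simp: open_Diff compact_imp_closed)
  show 1: "set_integrable lborel \<Xi> (\<lambda>x. \<zeta> x * (V x \<bullet> D\<phi> x))"
    by (rule set_integrable_compact_support[OF _ K(1,2)]) (use K(3) in \<open>auto intro!: continuous_intros cont\<close>)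
  show 2: "set_integrable lborel \<Xi> (\<lambda>x. \<phi> x * (V x \<bullet> D\<zeta> x))"
    by (rule set_integrable_compact_support[OF _ K(1,2)]) (use D0 in \<open>auto intro!: continuous_intros cont\<close>)
  \<comment> \<open>\<open>G i\<close> is the gradient of the i-th component of the field \<zeta>
    \<phi> V; its i-th entry is one summand of the divergence.\<close>
  define G where "G i x = (\<zeta> x * \<phi> x) *\<^sub>R DV i x + V x $ i *\<^sub>R (\<zeta> x *\<^sub>R D\<phi> x + \<phi> x *\<^sub>R D\<zeta> x)" for i x
  have CG: "C1_on \<Xi> (\<lambda>x. (\<zeta> x * \<phi> x) * V x $ i) (G i)" for i
    unfolding G_def by (intro C1_on_mult \<zeta> \<phi> V_C1)
  have iG: "set_integrable lborel \<Xi> (\<lambda>x. G i x \<bullet> axis i 1)" for i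
  proof (rule set_integrable_compact_support[OF _ K(1,2)])
    show "continuous_on \<Xi> (\<lambda>x. G i x \<bullet> axis i 1)"
      using C1_onD(2)[OF CG] by (intro continuous_intros)
    show "G i x \<bullet> axis i 1 = 0" if "x \<in> \<Xi> - K" for x
      using that D0[OF that] K(3)[OF that] by (simp add: G_def)
  qed
  have zG: "(LINT x:\<Xi>|lborel. G i x \<bullet> axis i 1) = 0" for i
    by (rule integral_partial_open[OF CG open_dom K(1,2)]) (use K(3) in auto)
  have "(LINT x:\<Xi>|lborel. \<zeta> x * (V x \<bullet> D\<phi> x)) + (LINT x:\<Xi>|lborel. \<phi> x * (V x \<bullet> D\<zeta> x))
      = (LINT x:\<Xi>|lborel. \<zeta> x * (V x \<bullet> D\<phi> x) + \<phi> x * (V x \<bullet> D\<zeta> x))"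
    using 1 2 by (rule set_integral_add(2)[symmetric])
  also have "\<dots> = (LINT x:\<Xi>|lborel. (\<Sum>i\<in>UNIV. G i x \<bullet> axis i 1))"
  proof (rule set_lebesgue_integral_cong)
    show "\<Xi> \<in> sets lborel" using open_dom by simp
    show "\<forall>x. x \<in> \<Xi> \<longrightarrow> \<zeta> x * (V x \<bullet> D\<phi> x) + \<phi> x * (V x \<bullet> D\<zeta> x) = (\<Sum>i\<in>UNIV. G i x \<bullet> axis i 1)"
    proof (intro allI impI)
      fix x assume x: "x \<in> \<Xi>"
      have "(\<Sum>i\<in>UNIV. G i x \<bullet> axis i 1) = (\<Sum>i\<in>UNIV. (\<zeta> x * \<phi> x) * DV i x $ i + V x $ i * (\<zeta> x * D\<phi> x $ i + \<phi> x * D\<zeta> x $ i))"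
        by (simp add: G_def inner_axis)
      also have "\<dots> = (\<zeta> x * \<phi> x) * (\<Sum>i\<in>UNIV. DV i x $ i) + \<zeta> x * (\<Sum>i\<in>UNIV. V x $ i * D\<phi> x $ i) + \<phi> x * (\<Sum>i\<in>UNIV. V x $ i * D\<zeta> x $ i)"
        by (simp add: sum.distrib sum_distrib_left algebra_simps)
      finally show "\<zeta> x * (V x \<bullet> D\<phi> x) + \<phi> x * (V x \<bullet> D\<zeta> x) = (\<Sum>i\<in>UNIV. G i x \<bullet> axis i 1)"
        using div_zero[OF x] by (simp add: inner_vec_def)
    qed
  qed
  also have "\<dots> = (\<Sum>i\<in>UNIV. LINT x:\<Xi>|lborel. G i x \<bullet> axis i 1)"
    using iG unfolding set_lebesgue_integral_def set_integrable_def
    by (subst Bochner_Integration.integral_sum[symmetric]) (auto simp: sum_distrib_left)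
  finally show "(LINT x:\<Xi>|lborel. \<zeta> x * (V x \<bullet> D\<phi> x)) = - (LINT x:\<Xi>|lborel. \<phi> x * (V x \<bullet> D\<zeta> x))"
    using zG by simp
qed

text \<open>The localization \<open>g\<close> is kept separate from the function \<open>\<phi>\<close>, so that a
  partition of unity can be replaced by multiplying with factors \<open>1 - g\<close>.\<close>

definition no_flux_at :: "real^3 \<Rightarrow> bool" where
  "no_flux_at x \<longleftrightarrow> (\<exists>r>0. \<forall>g Dg \<phi> D\<phi>. C1_on UNIV g Dg \<longrightarrow> (\<forall>y. 0 \<le> g y) \<longrightarrow>
     (\<forall>y. y \<notin> cball x r \<longrightarrow> g y = 0) \<longrightarrow> C1_on UNIV \<phi> D\<phi> \<longrightarrow>
     (LINT y:\<Xi>|lborel. V y \<bullet> (g y *\<^sub>R D\<phi> y + \<phi> y *\<^sub>R Dg y)) = 0)"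

text \<open>The product of \<open>g\<close> and \<open>\<phi>\<close> is supported in a ball inside
  the domain, so it can serve as the cutoff in \<open>flux_cutoff\<close>, tested against the
  constant 1.\<close>

lemma no_flux_interior:
  assumes "x \<in> \<Xi>"
  shows "no_flux_at x"
proof -
  obtain r where r: "r > 0" "cball x r \<subseteq> \<Xi>"
    using open_dom assms open_contains_cball by blast
  show ?thesis
    unfolding no_flux_at_def
  proof (intro exI[of _ r] conjI allI impI r(1))
    fix g \<phi> :: "real^3 \<Rightarrow> real" and Dg D\<phi>
    assume g: "C1_on UNIV g Dg" "\<forall>y. y \<notin> cball x r \<longrightarrow> g y = 0" and \<phi>: "C1_on UNIV \<phi> D\<phi>"
    have "C1_on \<Xi> (\<lambda>y. g y * \<phi> y) (\<lambda>y. g y *\<^sub>R D\<phi> y + \<phi> y *\<^sub>R Dg y)"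
      using C1_on_mult[OF g(1) \<phi>] C1_on_subset by blast
    from flux_cutoff(3)[OF this compact_cball r(2) _ C1_on_const[of _ 1]]
    show "(LINT y:\<Xi>|lborel. V y \<bullet> (g y *\<^sub>R D\<phi> y + \<phi> y *\<^sub>R Dg y)) = 0"
      using g(2) by (simp add: set_lebesgue_integral_def)
  qed
qed

text \<open>The cutoff rises from 0 to 1 in the layer where \<open>\<rho>\<close> lies between -2d
  and -d. Its gradient is of order 1/d there, but the mass of \<open>q d\<close> stays bounded: this
  follows by integrating the derivative of the cutoff in the transversal direction \<open>e\<close>,
  without measuring the layer or the boundary surface. Since V \<bullet> D\<rho> is small in the
  layer, the flux through it tends to zero.\<close>

lemma no_flux_boundary:
  assumes r: "0 < r" "cball x r \<subseteq> U" and U: "open U" and \<rho>: "C1_on U \<rho> D\<rho>"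
    and dom: "\<Xi> \<inter> U = {y\<in>U. \<rho> y < 0}"
    and c: "0 < c" "\<And>y. y \<in> cball x r \<Longrightarrow> D\<rho> y \<bullet> e \<le> - c"
    and neu: "\<And>\<eta>. \<eta> > 0 \<Longrightarrow> \<exists>d>0. \<forall>y\<in>cball x r \<inter> \<Xi>. \<rho> y > - d \<longrightarrow> \<bar>V y \<bullet> D\<rho> y\<bar> \<le> \<eta>"
  shows "no_flux_at x"
  unfolding no_flux_at_def
proof (intro exI[of _ r] conjI allI impI r(1))
  fix g \<phi> :: "real^3 \<Rightarrow> real" and Dg D\<phi>
  assume g: "C1_on UNIV g Dg" and gnn: "\<forall>y. 0 \<le> g y" and g0: "\<forall>y. y \<notin> cball x r \<longrightarrow> g y = 0"
    and \<phi>: "C1_on UNIV \<phi> D\<phi>"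
  have Dg0: "Dg y = 0" if "y \<notin> cball x r" for y
    by (rule gderiv_zero_on_open[of "- cball x r" y g]) (use that g0 C1_onD(1)[OF g] in auto)
  note cont = C1_on_continuous[OF \<phi>] C1_onD(2)[OF \<phi>] C1_on_continuous[OF g] C1_onD(2)[OF g]
  note contU = cont[THEN continuous_on_subset, of U] cont[THEN continuous_on_subset, of \<Xi>]
    C1_on_continuous[OF \<rho>] C1_onD(2)[OF \<rho>] continuous_on_compose2[OF continuous_step'[of UNIV]]
    continuous_on_compose2[OF DERIV_continuous_on[OF DERIV_step]]
  \<comment> \<open>\<open>Z d\<close> is the cutoff, \<open>X d\<close> its product with
    \<open>g\<close>, and \<open>q d\<close> the coefficient of -D\<rho> in the gradient of
    \<open>X d\<close>. Outside the chart \<open>U\<close> they are set to zero, which fits because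
    \<open>g\<close> and its gradient vanish there.\<close>
  define Z where "Z d y = (if y \<in> U then step (- \<rho> y / d - 1) else 0)" for d y
  define q where "q d y = (if y \<in> U then g y * step' (- \<rho> y / d - 1) / d else 0)" for d y
  define X where "X d y = (if y \<in> U then step (- \<rho> y / d - 1) * g y else 0)" for d y
  define DX where "DX d y = Z d y *\<^sub>R Dg y - q d y *\<^sub>R D\<rho> y" for d y
  have CX: "C1_on UNIV (X d) (DX d)" if "d > 0" for d
  proof -
    have 1: "C1_on U (\<lambda>y. step ((-1/d) * \<rho> y - 1) * g y)
      (\<lambda>y. step ((-1/d) * \<rho> y - 1) *\<^sub>R Dg y
        + g y *\<^sub>R (step' ((-1/d) * \<rho> y - 1) *\<^sub>R (((-1/d) *\<^sub>R D\<rho> y + \<rho> y *\<^sub>R 0) - 0)))"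
      by (rule C1_on_mult C1_on_step C1_on_diff C1_on_const \<rho> C1_on_subset[OF g subset_UNIV])+
    have "C1_on UNIV (\<lambda>y. if y \<in> U then step ((-1/d) * \<rho> y - 1) * g y else 0)
      (\<lambda>y. if y \<in> U then step ((-1/d) * \<rho> y - 1) *\<^sub>R Dg y
        + g y *\<^sub>R (step' ((-1/d) * \<rho> y - 1) *\<^sub>R (((-1/d) *\<^sub>R D\<rho> y + \<rho> y *\<^sub>R 0) - 0)) else 0)"
      by (rule C1_on_zero_extension[OF 1 U closed_cball r(2)]) (use g0 in auto)
    moreover have "X d = (\<lambda>y. if y \<in> U then step ((-1/d) * \<rho> y - 1) * g y else 0)"
      by (simp add: X_def fun_eq_iff)
    moreover have "DX d = (\<lambda>y. if y \<in> U then step ((-1/d) * \<rho> y - 1) *\<^sub>R Dg y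
        + g y *\<^sub>R (step' ((-1/d) * \<rho> y - 1) *\<^sub>R (((-1/d) *\<^sub>R D\<rho> y + \<rho> y *\<^sub>R 0) - 0)) else 0)"
      using that by (auto simp: DX_def Z_def q_def fun_eq_iff)
    ultimately show ?thesis by simp
  qed
  \<comment> \<open>The cutoff vanishes where \<rho> > -d, so \<open>K d\<close> contains its
    localized support and is a compact subset of the domain.\<close>
  define K where "K d = {y\<in>cball x r. \<rho> y \<le> - d}" for d
  have K: "compact (K d)" "K d \<subseteq> \<Xi>" if "d > 0" for d
  proof -
    have "closed (cball x r \<inter> \<rho> -` {..-d})"
      by (rule continuous_closed_preimage)
         (use contU(9) r in \<open>auto intro: continuous_on_subset[OF C1_on_continuous[OF \<rho>]]\<close>)
    moreover have "K d = cball x r \<inter> (cball x r \<inter> \<rho> -` {..-d})" by (auto simp: K_def)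
    ultimately show "compact (K d)" by (metis compact_Int_closed compact_cball)
    show "K d \<subseteq> \<Xi>"
    proof
      fix y assume "y \<in> K d"
      then have "y \<in> {y\<in>U. \<rho> y < 0}" using that r by (auto simp: K_def)
      then show "y \<in> \<Xi>" using dom by blast
    qed
  qed
  have X0: "X d y = 0" if "y \<notin> K d" "d > 0" for d y
  proof (cases "y \<in> cball x r \<and> y \<in> U")
    case True
    then have "- \<rho> y / d - 1 \<le> 0" using that by (auto simp: K_def field_simps)
    then show ?thesis by (simp add: X_def step_eq)
  qed (use g0 in \<open>auto simp: X_def\<close>)
  have qnn: "0 \<le> q d y" if "d > 0" for d y
    using that gnn step'_bounds by (auto simp: q_def)
  have iq: "integrable lborel (q d)" if "d > 0" for d
  proof -
    have "set_integrable lborel U (\<lambda>y. g y * step' (- \<rho> y / d - 1) / d)"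
      by (rule set_integrable_compact_support[OF _ compact_cball r(2)])
         (use g0 that in \<open>auto intro!: continuous_intros contU\<close>)
    then show ?thesis
      unfolding set_integrable_def q_def by (rule Bochner_Integration.integrable_cong[THEN iffD1, rotated -1]) auto
  qed
  have "compact ((\<lambda>y. \<bar>\<phi> y\<bar> + norm (D\<phi> y) + \<bar>g y\<bar> + norm (Dg y)) ` cball x r)"
    by (intro compact_continuous_image compact_cball continuous_intros cont[THEN continuous_on_subset]) auto
  then obtain M where M: "\<And>y. y \<in> cball x r \<Longrightarrow> \<bar>\<phi> y\<bar> + norm (D\<phi> y) + \<bar>g y\<bar> + norm (Dg y) \<le> M"
    using compact_imp_bounded bounded_iff by (metis (no_types, lifting) abs_le_iff imageI real_norm_def)
  have M0: "0 \<le> M" using M[of x] r by (smt (verit) centre_in_cball norm_ge_zero)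
  have Dgb: "norm (Dg y) \<le> indicator (cball x r) y * M" for y
    using M[of y] Dg0[of y] by (auto simp: indicator_def) (smt (verit) norm_ge_zero)
  define I where "I = (\<integral>y. indicator (cball x r) y * (M * norm e) \<partial>lborel)"
  have iI: "integrable lborel (\<lambda>y. indicator (cball x r) y * (M * norm e))"
    using borel_integrable_compact[of "cball x r" "\<lambda>_. M * norm e"] by simp
  \<comment> \<open>The derivative of \<open>X d\<close> along \<open>e\<close> integrates to zero.
    Its singular part is at least \<open>c * q d\<close>, its regular part at least
    \<open>- (M * norm e)\<close> on the ball and zero elsewhere; this gives a bound free of
    \<open>d\<close>.\<close>
  have iq_bound: "(\<integral>y. q d y \<partial>lborel) \<le> I / c" if d: "d > 0" for d
  proof -
    obtain R where R: "cball x r \<subseteq> cball 0 R"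
      by (metis bounded_cball bounded_subset_ballD ball_subset_cball order_trans)
    have Rout: "y \<notin> cball x r" if "norm y > R" for y using R that by auto
    have cDX: "continuous_on UNIV (DX d)" using CX[OF d] by (rule C1_onD)
    have DX0: "DX d y = 0" if "y \<notin> cball x r" for y
      using Dg0[OF that] g0 that by (auto simp: DX_def q_def)
    have z: "(\<integral>y. DX d y \<bullet> e \<partial>lborel) = 0"
      by (rule integral_partial_compact_support[OF CX[OF d], of R])
         (use X0[OF _ d] Rout in \<open>auto simp: K_def\<close>)
    have i: "integrable lborel (\<lambda>y. DX d y \<bullet> e)"
      by (rule integrable_lborel_compact_support[of _ R])
         (use DX0[OF Rout] cDX in \<open>auto intro!: continuous_intros\<close>)
    have le: "c * q d y \<le> indicator (cball x r) y * (M * norm e) + DX d y \<bullet> e" for y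
    proof (cases "y \<in> cball x r")
      case True
      have "Z d y * (Dg y \<bullet> e) \<ge> - (M * norm e)"
      proof -
        have "\<bar>Z d y * (Dg y \<bullet> e)\<bar> \<le> 1 * (norm (Dg y) * norm e)"
          unfolding abs_mult using step_bounds by (intro mult_mono Cauchy_Schwarz_ineq2) (auto simp: Z_def)
        also have "\<dots> \<le> M * norm e" using Dgb[of y] True by (simp add: mult_right_mono)
        finally show ?thesis by linarith
      qed
      moreover have "q d y * (D\<rho> y \<bullet> e) \<le> q d y * (- c)"
        using c(2)[OF True] qnn[OF d] by (rule mult_left_mono)
      ultimately show ?thesis using True by (simp add: DX_def inner_diff_left algebra_simps)
    next
      case False
      then show ?thesis using DX0[OF False] g0 by (simp add: q_def)
    qed
    have "c * (\<integral>y. q d y \<partial>lborel) = (\<integral>y. c * q d y \<partial>lborel)" by simp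
    also have "\<dots> \<le> (\<integral>y. indicator (cball x r) y * (M * norm e) + DX d y \<bullet> e \<partial>lborel)"
      using le iI i iq[OF d] by (intro integral_mono) auto
    also have "\<dots> = I" using iI i z by (simp add: I_def)
    finally show ?thesis using c by (simp add: field_simps)
  qed
  \<comment> \<open>\<open>L d\<close> collects the terms that have a limit as \<open>d\<close>
    tends to zero. By \<open>flux_cutoff\<close> it equals the remaining singular term, the integral
    of \<open>\<phi> * q d\<close> times V \<bullet> D\<rho>.\<close>
  define L where "L d = (LINT y:\<Xi>|lborel. X d y * (V y \<bullet> D\<phi> y) + \<phi> y * (Z d y * (V y \<bullet> Dg y)))" for d
  have L_bound: "\<exists>d0>0. \<forall>d. 0 < d \<and> d < d0 \<longrightarrow> \<bar>L d\<bar> \<le> M * \<eta> * (I / c)" if \<eta>: "\<eta> > 0" for \<eta>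
  proof -
    obtain d0 where d0: "d0 > 0" "\<And>y. y \<in> cball x r \<inter> \<Xi> \<Longrightarrow> \<rho> y > - d0 \<Longrightarrow> \<bar>V y \<bullet> D\<rho> y\<bar> \<le> \<eta>"
      using neu[OF \<eta>] by blast
    show ?thesis
    proof (intro exI[of _ "d0 / 2"] conjI allI impI)
      fix d assume d: "0 < d \<and> d < d0 / 2"
      then have dp: "d > 0" by simp
      have CXi: "C1_on \<Xi> (X d) (DX d)" "C1_on \<Xi> \<phi> D\<phi>"
        using CX[OF dp] \<phi> C1_on_subset by blast+
      note fc = flux_cutoff[OF CXi(1) K(1)[OF dp] K(2)[OF dp] _ CXi(2)]
      have X0': "X d y = 0" if "y \<in> \<Xi> - K d" for y using X0[OF _ dp] that by blast
      note fc = fc[OF X0']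
      have b: "\<bar>\<phi> y * (q d y * (V y \<bullet> D\<rho> y))\<bar> \<le> M * \<eta> * q d y" if y: "y \<in> \<Xi>" for y
      proof (cases "q d y = 0")
        case False
        then have yr: "y \<in> cball x r" "y \<in> U" using g0 by (auto simp: q_def split: if_splits)
        have "step' (- \<rho> y / d - 1) \<noteq> 0" using False by (auto simp: q_def split: if_splits)
        then have "- \<rho> y / d - 1 < 1" using step'_eq(2)[of "- \<rho> y / d - 1"] by linarith
        then have "\<rho> y > - d0" using d by (simp add: field_simps)
        then have "\<bar>V y \<bullet> D\<rho> y\<bar> \<le> \<eta>" using d0(2) yr y by blast
        moreover have "\<bar>\<phi> y\<bar> \<le> M" using M[OF yr(1)] by (smt (verit) norm_ge_zero)
        ultimately have "\<bar>\<phi> y\<bar> * (q d y * \<bar>V y \<bullet> D\<rho> y\<bar>) \<le> M * (q d y * \<eta>)"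
          using qnn[OF dp] M0 by (intro mult_mono mult_left_mono) auto
        then show ?thesis using qnn[OF dp, of y] by (simp add: abs_mult mult_ac)
      qed simp
      have eq: "\<phi> y * (Z d y * (V y \<bullet> Dg y)) - \<phi> y * (q d y * (V y \<bullet> D\<rho> y)) = \<phi> y * (V y \<bullet> DX d y)" for y
        by (simp add: DX_def inner_diff_right algebra_simps)
      have iq': "set_integrable lborel \<Xi> (\<lambda>y. \<phi> y * (q d y * (V y \<bullet> D\<rho> y)))"
      proof -
        have "set_integrable lborel (\<Xi> \<inter> U) (\<lambda>y. \<phi> y * (q d y * (V y \<bullet> D\<rho> y)))"
        proof (rule set_integrable_compact_support[OF _ K(1)[OF dp]])
          show "K d \<subseteq> \<Xi> \<inter> U" using K(2)[OF dp] r by (auto simp: K_def)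
          have "continuous_on (\<Xi> \<inter> U) (\<lambda>y. \<phi> y * (g y * step' (- \<rho> y / d - 1) / d * (V y \<bullet> D\<rho> y)))"
            using dp by (intro continuous_intros continuous_on_subset[OF cont(1)] continuous_on_subset[OF cont(3)]
              continuous_on_subset[OF continuous_V] continuous_on_compose2[OF continuous_step'[of UNIV]]
              continuous_on_subset[OF C1_on_continuous[OF \<rho>]] continuous_on_subset[OF C1_onD(2)[OF \<rho>]]) auto
          then show "continuous_on (\<Xi> \<inter> U) (\<lambda>y. \<phi> y * (q d y * (V y \<bullet> D\<rho> y)))"
            by (rule continuous_on_cong[THEN iffD1, rotated -1]) (auto simp: q_def)
          fix y assume y: "y \<in> \<Xi> \<inter> U - K d"
          have "q d y = 0"
          proof (cases "y \<in> cball x r")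
            case True
            then have "- \<rho> y / d - 1 \<le> 0" using y dp by (auto simp: K_def field_simps)
            then show ?thesis by (simp add: q_def step'_eq)
          qed (use g0 in \<open>auto simp: q_def\<close>)
          then show "\<phi> y * (q d y * (V y \<bullet> D\<rho> y)) = 0" by simp
        qed
        then show ?thesis unfolding set_integrable_def
          by (rule Bochner_Integration.integrable_cong[THEN iffD1, rotated -1]) (auto simp: q_def indicator_def)
      qed
      have iZ: "set_integrable lborel \<Xi> (\<lambda>y. \<phi> y * (Z d y * (V y \<bullet> Dg y)))"
        using set_integral_add(1)[OF fc(2) iq'] eq by (simp add: algebra_simps)
      have "L d = (LINT y:\<Xi>|lborel. X d y * (V y \<bullet> D\<phi> y)) + (LINT y:\<Xi>|lborel. \<phi> y * (Z d y * (V y \<bullet> Dg y)))"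
        unfolding L_def using fc(1) iZ by (simp add: set_integral_add)
      also have "\<dots> = (LINT y:\<Xi>|lborel. \<phi> y * (Z d y * (V y \<bullet> Dg y))) - (LINT y:\<Xi>|lborel. \<phi> y * (V y \<bullet> DX d y))"
        using fc(3) by simp
      also have "\<dots> = (LINT y:\<Xi>|lborel. \<phi> y * (q d y * (V y \<bullet> D\<rho> y)))"
        using iZ fc(2) eq by (simp add: set_integral_diff(2)[symmetric] algebra_simps)
      finally have "\<bar>L d\<bar> \<le> (LINT y:\<Xi>|lborel. \<bar>\<phi> y * (q d y * (V y \<bullet> D\<rho> y))\<bar>)"
        using set_integral_norm_bound[OF iq'] by simp
      also have "\<dots> \<le> (\<integral>y. M * \<eta> * q d y \<partial>lborel)"
        unfolding set_lebesgue_integral_def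
        using b M0 \<eta> qnn[OF dp] iq[OF dp] set_integrable_abs[OF iq']
        by (intro integral_mono) (auto simp: indicator_def set_integrable_def)
      also have "\<dots> \<le> M * \<eta> * (I / c)"
        unfolding integral_mult_right_zero using iq_bound[OF dp] M0 \<eta> by (intro mult_left_mono) auto
      finally show "\<bar>L d\<bar> \<le> M * \<eta> * (I / c)" .
    qed (use d0 in auto)
  qed
  have lim0: "(\<lambda>n. L (1 / real (Suc n))) \<longlonglongrightarrow> 0"
  proof (rule LIMSEQ_I)
    fix s :: real assume s: "s > 0"
    have I0: "0 \<le> I" unfolding I_def using M0 by (intro integral_nonneg_AE) auto
    \<comment> \<open>The summand 1 keeps the denominator positive even if \<open>M\<close> or
      \<open>I\<close> vanishes, and makes the resulting bound strictly smaller than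
      \<open>s\<close>.\<close>
    define \<eta> where "\<eta> = s / (M * (I / c) + 1)"
    have \<eta>: "\<eta> > 0" unfolding \<eta>_def using s M0 I0 c by (intro divide_pos_pos add_nonneg_pos) auto
    have sm: "M * \<eta> * (I / c) < s"
    proof -
      have p: "M * (I / c) \<ge> 0" using M0 I0 c by auto
      have frac: "t / (t + 1) < 1" if "t \<ge> 0" for t :: real using that by simp
      have "M * \<eta> * (I / c) = s * (M * (I / c) / (M * (I / c) + 1))" by (simp add: \<eta>_def mult_ac)
      also have "\<dots> < s * 1" using s frac[OF p] by (intro mult_strict_left_mono)
      finally show ?thesis by simp
    qed
    obtain d0 where d0: "d0 > 0" "\<And>d. 0 < d \<and> d < d0 \<Longrightarrow> \<bar>L d\<bar> \<le> M * \<eta> * (I / c)"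
      using L_bound[OF \<eta>] by blast
    obtain N where N: "1 / real (Suc N) < d0" using d0(1) nat_approx_posE by blast
    show "\<exists>no. \<forall>n\<ge>no. norm (L (1 / real (Suc n)) - 0) < s"
    proof (intro exI[of _ N] allI impI)
      fix n assume "n \<ge> N"
      then have "1 / real (Suc n) \<le> 1 / real (Suc N)" by (simp add: field_simps)
      then have "\<bar>L (1 / real (Suc n))\<bar> \<le> M * \<eta> * (I / c)" using d0(2) N by simp
      then show "norm (L (1 / real (Suc n)) - 0) < s" using sm by simp
    qed
  qed
  \<comment> \<open>At every point of the domain inside the chart the integrand is eventually
    constant: the cutoff equals 1 as soon as the layer parameter is at most half of -\<rho>.\<close>
  have lim1: "(\<lambda>n. L (1 / real (Suc n))) \<longlonglongrightarrow> (LINT y:\<Xi>|lborel. V y \<bullet> (g y *\<^sub>R D\<phi> y + \<phi> y *\<^sub>R Dg y))"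
    unfolding L_def set_lebesgue_integral_def
  proof (rule integral_dominated_convergence[where w = "\<lambda>y. indicator (cball x r) y * (2 * B * (M * M))"])
    show "integrable lborel (\<lambda>y. indicator (cball x r) y * (2 * B * (M * M)))"
      using borel_integrable_compact[of "cball x r" "\<lambda>_. 2 * B * (M * M)"] by simp
    show "(\<lambda>y. indicator \<Xi> y *\<^sub>R (V y \<bullet> (g y *\<^sub>R D\<phi> y + \<phi> y *\<^sub>R Dg y))) \<in> borel_measurable lborel"
      unfolding measurable_lborel2 by (rule borel_measurable_continuous_on_indicator)
        (use open_dom in \<open>auto intro!: continuous_intros contU continuous_V\<close>)
  next
    fix n
    define d where "d = 1 / real (Suc n)"
    have d: "d > 0" by (simp add: d_def)
    have "(\<lambda>y. indicator \<Xi> y *\<^sub>R (X d y * (V y \<bullet> D\<phi> y) + \<phi> y * (Z d y * (V y \<bullet> Dg y))))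
      = (\<lambda>y. indicator \<Xi> y *\<^sub>R (X d y * (V y \<bullet> D\<phi> y)) + indicator \<Xi> y * \<phi> y * ((indicator U y *\<^sub>R step (- \<rho> y / d - 1)) * (indicator \<Xi> y *\<^sub>R (V y \<bullet> Dg y))))"
      by (auto simp: Z_def indicator_def fun_eq_iff)
    moreover have "\<dots> \<in> borel_measurable lborel"
      unfolding measurable_lborel2
      by (intro borel_measurable_add borel_measurable_times;
          (rule borel_measurable_continuous_on_indicator)?)
         (use open_dom U d in \<open>auto intro!: continuous_intros contU continuous_V C1_on_continuous[OF CX, THEN continuous_on_subset] borel_measurable_continuous_onI cont\<close>)
    ultimately show "(\<lambda>y. indicator \<Xi> y *\<^sub>R (X (1 / real (Suc n)) y * (V y \<bullet> D\<phi> y) + \<phi> y * (Z (1 / real (Suc n)) y * (V y \<bullet> Dg y)))) \<in> borel_measurable lborel"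
      by (simp add: d_def)
    show "AE y in lborel. norm (indicator \<Xi> y *\<^sub>R (X (1 / real (Suc n)) y * (V y \<bullet> D\<phi> y) + \<phi> y * (Z (1 / real (Suc n)) y * (V y \<bullet> Dg y)))) \<le> indicator (cball x r) y * (2 * B * (M * M))"
      unfolding d_def[symmetric]
    proof (rule AE_I2)
      fix y
      show "norm (indicator \<Xi> y *\<^sub>R (X d y * (V y \<bullet> D\<phi> y) + \<phi> y * (Z d y * (V y \<bullet> Dg y)))) \<le> indicator (cball x r) y * (2 * B * (M * M))"
      proof (cases "y \<in> \<Xi> \<and> y \<in> cball x r")
        case True
        have Mb: "\<bar>\<phi> y\<bar> \<le> M" "norm (D\<phi> y) \<le> M" "\<bar>g y\<bar> \<le> M" "norm (Dg y) \<le> M"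
          using M[of y] True norm_ge_zero[of "D\<phi> y"] norm_ge_zero[of "Dg y"] abs_ge_zero[of "g y"] abs_ge_zero[of "\<phi> y"]
          by linarith+
        have Bb: "norm (V y) \<le> B" "0 \<le> B" using V_bound True norm_ge_zero order_trans by blast+
        have Xb: "\<bar>X d y\<bar> \<le> 1 * M"
        proof (cases "y \<in> U")
          case True
          have "step (- \<rho> y / d - 1) * \<bar>g y\<bar> \<le> 1 * M"
            using Mb(3) step_bounds by (intro mult_mono) auto
          then show ?thesis using True step_bounds by (simp add: X_def abs_mult)
        qed (use M0 in \<open>simp add: X_def\<close>)
        have Zb: "\<bar>Z d y\<bar> \<le> 1" using step_bounds by (auto simp: Z_def)
        have a: "\<bar>X d y * (V y \<bullet> D\<phi> y)\<bar> \<le> (1 * M) * (B * M)"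
          unfolding abs_mult using Xb Mb Bb M0
          by (intro mult_mono order_trans[OF Cauchy_Schwarz_ineq2]) auto
        have b: "\<bar>\<phi> y * (Z d y * (V y \<bullet> Dg y))\<bar> \<le> M * (1 * (B * M))"
          unfolding abs_mult using Zb Mb Bb M0
          by (intro mult_mono order_trans[OF Cauchy_Schwarz_ineq2]) auto
        show ?thesis using True a b by (simp add: algebra_simps)
      next
        case False
        then show ?thesis
          using Dg0[of y] g0 M0 B_nonneg by (auto simp: X_def indicator_def)
      qed
    qed
  next
    show "AE y in lborel. (\<lambda>n. indicator \<Xi> y *\<^sub>R (X (1 / real (Suc n)) y * (V y \<bullet> D\<phi> y) + \<phi> y * (Z (1 / real (Suc n)) y * (V y \<bullet> Dg y))))
      \<longlonglongrightarrow> indicator \<Xi> y *\<^sub>R (V y \<bullet> (g y *\<^sub>R D\<phi> y + \<phi> y *\<^sub>R Dg y))"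
    proof (rule AE_I2, rule tendsto_eventually)
      fix y
      show "\<forall>\<^sub>F n in sequentially. indicator \<Xi> y *\<^sub>R (X (1 / real (Suc n)) y * (V y \<bullet> D\<phi> y) + \<phi> y * (Z (1 / real (Suc n)) y * (V y \<bullet> Dg y)))
        = indicator \<Xi> y *\<^sub>R (V y \<bullet> (g y *\<^sub>R D\<phi> y + \<phi> y *\<^sub>R Dg y))"
      proof (cases "y \<in> \<Xi> \<and> y \<in> U")
        case True
        then have "\<rho> y < 0" using dom by auto
        then have "0 < - \<rho> y / 2" by simp
        then obtain N where N: "1 / real (Suc N) < - \<rho> y / 2" using nat_approx_posE by blast
        show ?thesis
        proof (rule eventually_sequentiallyI[of N])
          fix n assume "N \<le> n"
          then have "1 / real (Suc n) \<le> 1 / real (Suc N)" by (simp add: field_simps)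
          then have "1 / real (Suc n) < - \<rho> y / 2" using N by linarith
          then have "- \<rho> y / (1 / real (Suc n)) - 1 \<ge> 1" by (simp add: field_simps)
          then show "indicator \<Xi> y *\<^sub>R (X (1 / real (Suc n)) y * (V y \<bullet> D\<phi> y) + \<phi> y * (Z (1 / real (Suc n)) y * (V y \<bullet> Dg y)))
            = indicator \<Xi> y *\<^sub>R (V y \<bullet> (g y *\<^sub>R D\<phi> y + \<phi> y *\<^sub>R Dg y))"
            using True by (simp only: X_def Z_def if_True step_eq) (simp add: inner_add_right)
        qed
      next
        case False
        show ?thesis
        proof (cases "y \<in> \<Xi>")
          case True
          then have "y \<notin> cball x r" using False r by auto
          then show ?thesis using Dg0 g0 by (simp add: X_def)
        qed simp
      qed
    qed
  qed
  show "(LINT y:\<Xi>|lborel. V y \<bullet> (g y *\<^sub>R D\<phi> y + \<phi> y *\<^sub>R Dg y)) = 0"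
    using LIMSEQ_unique[OF lim1 lim0] .
qed

lemma integrable_V_inner:
  assumes "C1_on UNIV \<phi> D\<phi>"
  shows "set_integrable lborel \<Xi> (\<lambda>x. V x \<bullet> D\<phi> x)"
proof -
  have c: "continuous_on UNIV D\<phi>" using assms by (rule C1_onD)
  have "compact (D\<phi> ` closure \<Xi>)"
    using bounded_dom by (intro compact_continuous_image continuous_on_subset[OF c]) auto
  then obtain M where M: "\<And>x. x \<in> closure \<Xi> \<Longrightarrow> norm (D\<phi> x) \<le> M"
    using compact_imp_bounded bounded_iff by (metis imageI)
  show ?thesis
  proof (rule set_integrable_bounded_continuous[OF _ open_dom bounded_dom])
    show "continuous_on \<Xi> (\<lambda>x. V x \<bullet> D\<phi> x)"
      using continuous_V continuous_on_subset[OF c] by (intro continuous_intros) auto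
    fix x assume x: "x \<in> \<Xi>"
    have "norm (V x \<bullet> D\<phi> x) \<le> norm (V x) * norm (D\<phi> x)" by (simp add: Cauchy_Schwarz_ineq2)
    also have "\<dots> \<le> B * M"
      using V_bound[OF x] M[of x] x closure_subset by (intro mult_mono) (auto intro: order_trans[OF norm_ge_zero])
    finally show "norm (V x \<bullet> D\<phi> x) \<le> B * M" .
  qed
qed

text \<open>Finitely many of the balls supplied by \<open>no_flux_at\<close> cover the part of the
  support of \<open>\<phi>\<close> in the closed domain. Multiplying \<open>\<phi>\<close> by
  factors 1 - g, one ball at a time, does not change its flux, and the final product vanishes in the
  whole domain.\<close>

lemma no_flux:
  assumes \<phi>: "C1_on UNIV \<phi> D\<phi>"
    and nf: "\<And>x. x \<in> closure \<Xi> \<Longrightarrow> x \<in> closure {y. \<phi> y \<noteq> 0} \<Longrightarrow> no_flux_at x"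
  shows "(LINT x:\<Xi>|lborel. V x \<bullet> D\<phi> x) = 0"
proof -
  define K where "K = closure \<Xi> \<inter> closure {y. \<phi> y \<noteq> 0}"
  have K: "compact K" unfolding K_def using bounded_dom by (intro compact_Int_closed) auto
  \<comment> \<open>The content of \<open>no_flux_at\<close> with the radius exposed, so that one
    radius can be chosen for each point of the compact set.\<close>
  define P where "P x r \<longleftrightarrow> (\<forall>g Dg \<phi> D\<phi>. C1_on UNIV g Dg \<longrightarrow> (\<forall>y. 0 \<le> g y) \<longrightarrow>
     (\<forall>y. y \<notin> cball x r \<longrightarrow> g y = 0) \<longrightarrow> C1_on UNIV \<phi> D\<phi> \<longrightarrow>
     (LINT y:\<Xi>|lborel. V y \<bullet> (g y *\<^sub>R D\<phi> y + \<phi> y *\<^sub>R Dg y)) = 0)" for x r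
  have "\<forall>x\<in>K. \<exists>r>0. P x r" using nf unfolding K_def P_def no_flux_at_def by blast
  then obtain r where r: "\<And>x. x \<in> K \<Longrightarrow> r x > 0" "\<And>x. x \<in> K \<Longrightarrow> P x (r x)" by metis
  obtain D where D: "finite D" "D \<subseteq> K" "K \<subseteq> (\<Union>x\<in>D. ball x (r x / 2))"
    by (rule compactE_image[OF K, of K "\<lambda>x. ball x (r x / 2)"])
       (use r in \<open>force intro!: exI\<close>)+
  \<comment> \<open>The factor 4/3 is chosen so that the argument of \<open>step\<close> equals 1 at
    distance \<open>r x / 2\<close> and 0 at distance \<open>r x\<close>.\<close>
  define g where "g x y = step ((4 / (3 * (r x)\<^sup>2)) * ((r x)\<^sup>2 - (norm (y - x))\<^sup>2))" for x y
  have Cg: "\<exists>Dg. C1_on UNIV (g x) Dg" for x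
    unfolding g_def by (rule exI, (rule C1_on_step C1_on_mult C1_on_diff C1_on_const C1_on_norm_sq)+)
  have gnn: "0 \<le> g x y" for x y by (simp add: g_def step_bounds)
  have g1: "g x y = 1" if "x \<in> K" "y \<in> ball x (r x / 2)" for x y
  proof -
    have "norm (y - x) \<le> r x / 2" using that by (simp add: dist_norm norm_minus_commute)
    then have "(norm (y - x))\<^sup>2 \<le> (r x / 2)\<^sup>2" by (intro power_mono) auto
    then show ?thesis
      unfolding g_def using r(1)[OF that(1)] by (intro step_eq) (simp add: field_simps)
  qed
  have g0: "g x y = 0" if "x \<in> K" "y \<notin> cball x (r x)" for x y
  proof -
    have "r x \<le> norm (y - x)" using that by (simp add: dist_norm norm_minus_commute)
    then have "(r x)\<^sup>2 \<le> (norm (y - x))\<^sup>2" using r(1)[OF that(1)] by (intro power_mono) auto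
    then show ?thesis
      unfolding g_def using r(1)[OF that(1)] by (intro step_eq mult_nonneg_nonpos) auto
  qed
  \<comment> \<open>Passing from F to F (1 - g) changes the flux only by that of g F, which is zero
    by the choice of the radius of the ball.\<close>
  have ind: "\<exists>DF. C1_on UNIV (\<lambda>y. \<phi> y * (\<Prod>x\<in>E. 1 - g x y)) DF \<and>
      (LINT x:\<Xi>|lborel. V x \<bullet> DF x) = (LINT x:\<Xi>|lborel. V x \<bullet> D\<phi> x)"
    if "finite E" "E \<subseteq> K" for E using that
  proof (induction E rule: finite_induct)
    case empty
    then show ?case using \<phi> by (auto intro!: exI[of _ D\<phi>])
  next
    case (insert x E)
    then obtain DF where DF: "C1_on UNIV (\<lambda>y. \<phi> y * (\<Prod>x\<in>E. 1 - g x y)) DF"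
      "(LINT x:\<Xi>|lborel. V x \<bullet> DF x) = (LINT x:\<Xi>|lborel. V x \<bullet> D\<phi> x)" by auto
    define F where "F y = \<phi> y * (\<Prod>x\<in>E. 1 - g x y)" for y
    obtain Dg where Dg: "C1_on UNIV (g x) Dg" using Cg by blast
    have CF: "C1_on UNIV F DF" using DF unfolding F_def by simp
    define H where "H y = g x y *\<^sub>R DF y + F y *\<^sub>R Dg y" for y
    have CH: "C1_on UNIV (\<lambda>y. g x y * F y) H" unfolding H_def by (rule C1_on_mult[OF Dg CF])
    have CFH: "C1_on UNIV (\<lambda>y. F y - g x y * F y) (\<lambda>y. DF y - H y)" by (rule C1_on_diff[OF CF CH])
    have eq: "(\<lambda>y. \<phi> y * (\<Prod>x\<in>insert x E. 1 - g x y)) = (\<lambda>y. F y - g x y * F y)"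
      using insert.hyps by (simp add: F_def algebra_simps fun_eq_iff)
    have xK: "x \<in> K" using insert.prems by simp
    have "(LINT y:\<Xi>|lborel. V y \<bullet> H y) = 0"
      unfolding H_def
      using r(2)[OF xK, unfolded P_def, rule_format, OF Dg gnn g0[OF xK] CF] .
    moreover have "(LINT y:\<Xi>|lborel. V y \<bullet> DF y - V y \<bullet> H y) = (LINT y:\<Xi>|lborel. V y \<bullet> DF y) - (LINT y:\<Xi>|lborel. V y \<bullet> H y)"
      using integrable_V_inner[OF CF] integrable_V_inner[OF CH] by (rule set_integral_diff(2))
    ultimately have "(LINT y:\<Xi>|lborel. V y \<bullet> (DF y - H y)) = (LINT x:\<Xi>|lborel. V x \<bullet> D\<phi> x)"
      using DF(2) by (simp add: inner_diff_right)
    then show ?case unfolding eq using CFH by blast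
  qed
  obtain DF where DF: "C1_on UNIV (\<lambda>y. \<phi> y * (\<Prod>x\<in>D. 1 - g x y)) DF"
      "(LINT x:\<Xi>|lborel. V x \<bullet> DF x) = (LINT x:\<Xi>|lborel. V x \<bullet> D\<phi> x)"
    using ind[OF D(1,2)] by blast
  have F0: "\<phi> y * (\<Prod>x\<in>D. 1 - g x y) = 0" if y: "y \<in> \<Xi>" for y
  proof (cases "\<phi> y = 0")
    case False
    then have "y \<in> K"
      using y subsetD[OF closure_subset, of y \<Xi>] subsetD[OF closure_subset, of y "{y. \<phi> y \<noteq> 0}"]
      by (simp add: K_def)
    then obtain x where x: "x \<in> D" "y \<in> ball x (r x / 2)" using D(3) by blast
    then have "g x y = 1" using D(2) by (intro g1) auto
    then have "(\<Prod>x\<in>D. 1 - g x y) = 0" using x(1) by (intro prod_zero[OF D(1)]) auto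
    then show ?thesis by simp
  qed simp
  have "DF y = 0" if "y \<in> \<Xi>" for y
    using gderiv_zero_on_open[OF open_dom that F0 C1_onD(1)[OF DF(1)]] by simp
  then have "(LINT x:\<Xi>|lborel. V x \<bullet> DF x) = (LINT x:\<Xi>|lborel. 0)"
    using open_dom by (intro set_lebesgue_integral_cong) auto
  then show ?thesis using DF by simp
qed

end

section \<open>Cylinders\<close>

lemma vector_2_nth [simp]: "(vector [a, b] :: 'a::zero^2) $ 1 = a" "(vector [a, b] :: 'a::zero^2) $ 2 = b"
  by (simp_all add: vector_def)

lemma vec2_eq_iff: "z = w \<longleftrightarrow> z $ 1 = w $ 1 \<and> z $ 2 = w $ 2" for z w :: "'a^2"
  by (auto simp: vec_eq_iff forall_2)

lemma vec3_eq_iff: "z = w \<longleftrightarrow> z $ 1 = w $ 1 \<and> z $ 2 = w $ 2 \<and> z $ 3 = w $ 3" for z w :: "'a^3"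
  by (auto simp: vec_eq_iff forall_3)

lemma insert_coord_nth [simp]: "insert_coord i t z $ i = t"
  using exhaust_3[of i] by (auto simp: insert_coord_def)

lemma bar_insert_coord [simp]: "bar i (insert_coord i t z) = z"
  using exhaust_3[of i] by (auto simp: insert_coord_def bar_def vec2_eq_iff)

lemma insert_coord_bar [simp]: "insert_coord i (x $ i) (bar i x) = x"
  using exhaust_3[of i] by (auto simp: insert_coord_def bar_def vec3_eq_iff)

lemma bar_add: "bar i (x + y) = bar i x + bar i y"
  and bar_scaleR: "bar i (c *\<^sub>R x) = c *\<^sub>R bar i x"
  and bar_diff: "bar i (x - y) = bar i x - bar i y"
  using exhaust_3[of i] by (auto simp: bar_def vec2_eq_iff)

lemma linear_bar: "linear (bar i)"
  by (intro linearI bar_add bar_scaleR)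

lemma continuous_on_bar [continuous_intros]:
  "continuous_on S f \<Longrightarrow> continuous_on S (\<lambda>x. bar i (f x))"
  by (rule bounded_linear.continuous_on[OF linear_bar[unfolded linear_conv_bounded_linear]])

lemma insert_coord_eq: "insert_coord i t z = insert_coord i 0 z + t *\<^sub>R axis i 1"
  using exhaust_3[of i] by (auto simp: insert_coord_def vec3_eq_iff axis_def)

lemma insert_coord_add: "insert_coord i (s + t) (z + w) = insert_coord i s z + insert_coord i t w"
  and insert_coord_scaleR: "insert_coord i (c * t) (c *\<^sub>R z) = c *\<^sub>R insert_coord i t z"
  using exhaust_3[of i] by (auto simp: insert_coord_def vec3_eq_iff)

lemma linear_insert_coord: "linear (\<lambda>p. insert_coord i (fst p) (snd p))"
  by (rule linearI) (simp_all add: insert_coord_add insert_coord_scaleR flip: insert_coord_add insert_coord_scaleR)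

lemma continuous_on_insert_coord [continuous_intros]:
  assumes "continuous_on S f" "continuous_on S g"
  shows "continuous_on S (\<lambda>x. insert_coord i (f x) (g x))"
  using bounded_linear.continuous_on[OF linear_insert_coord[of i, unfolded linear_conv_bounded_linear]
      continuous_on_Pair[OF assms]] by simp

lemma norm_sq_bar: "(norm x)\<^sup>2 = (x $ i)\<^sup>2 + (norm (bar i x))\<^sup>2"
  unfolding power2_norm_eq_inner using exhaust_3[of i]
  by (auto simp: inner_vec_def sum_2 sum_3 bar_def power2_eq_square)

lemma norm_bar_le: "norm (bar i x) \<le> norm x"
  by (rule power2_le_imp_le) (simp_all add: norm_sq_bar[of x i])

lemma abs_nth_le_norm_bar: "j \<noteq> i \<Longrightarrow> \<bar>x $ j\<bar> \<le> norm (bar i x)"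
proof -
  assume "j \<noteq> i"
  then have "(x $ j)\<^sup>2 \<le> (norm (bar i x))\<^sup>2"
    unfolding power2_norm_eq_inner using exhaust_3[of i] exhaust_3[of j]
    by (auto simp: inner_vec_def sum_2 bar_def power2_eq_square)
  then show ?thesis by (metis abs_le_square_iff abs_norm_cancel)
qed

lemma prod_Basis_cart: "(\<Prod>b\<in>Basis. (x::real^'n) \<bullet> b) = (\<Prod>i\<in>UNIV. x $ i)"
proof -
  have "(Basis :: (real^'n) set) = (\<lambda>i. axis i 1) ` UNIV"
    by (auto simp: Basis_vec_def)
  moreover have "inj (\<lambda>i::'n. axis i (1::real))" by (simp add: inj_def axis_eq_axis)
  ultimately show ?thesis
    using prod.reindex[of "\<lambda>i::'n. axis i (1::real)" UNIV "\<lambda>b. x \<bullet> b"] by (simp add: inner_axis)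
qed

lemma prod_2: "(\<Prod>j\<in>(UNIV::2 set). f j) = f 1 * (f 2 :: real)"
  by (simp add: UNIV_2)

lemma prod_3: "(\<Prod>j\<in>(UNIV::3 set). f j) = f 1 * f 2 * (f 3 :: real)"
  unfolding UNIV_3 by (simp add: mult.assoc)

text \<open>Lebesgue measure on space is the product of the axial and the cross-sectional measure,
  whichever axis is singled out; a comparison on boxes suffices. Every reduction to axial lines or
  cross-sections rests on this.\<close>

lemma lborel_insert_coord:
  "distr (lborel \<Otimes>\<^sub>M lborel) borel (\<lambda>(t, z). insert_coord i t z) = lborel"
proof (rule lborel_eqI[symmetric])
  have m: "(\<lambda>(t, z). insert_coord i t z) \<in> lborel \<Otimes>\<^sub>M lborel \<rightarrow>\<^sub>M borel"
    unfolding lborel_prod measurable_lborel2 case_prod_beta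
    by (intro borel_measurable_continuous_onI continuous_intros)
  fix l u :: "real^3"
  assume lu: "\<And>b. b \<in> Basis \<Longrightarrow> l \<bullet> b \<le> u \<bullet> b"
  then have le: "l $ j \<le> u $ j" for j
    using lu[of "axis j 1"] by (simp add: inner_axis)
  have "(\<lambda>(t, z). insert_coord i t z) -` box l u \<inter> space (lborel \<Otimes>\<^sub>M lborel)
    = {l $ i<..<u $ i} \<times> box (bar i l) (bar i u)"
    using exhaust_3[of i]
    by (auto simp: space_pair_measure mem_box_cart forall_2 forall_3 bar_def insert_coord_def)
  then have "emeasure (distr (lborel \<Otimes>\<^sub>M lborel) borel (\<lambda>(t, z). insert_coord i t z)) (box l u)
    = emeasure (lborel \<Otimes>\<^sub>M lborel) ({l $ i<..<u $ i} \<times> box (bar i l) (bar i u))"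
    using m by (simp add: emeasure_distr)
  also have "\<dots> = emeasure lborel {l $ i<..<u $ i} * emeasure lborel (box (bar i l) (bar i u))"
    by (rule lborel.emeasure_pair_measure_Times) auto
  also have "emeasure lborel (box (bar i l) (bar i u)) = ennreal (\<Prod>j\<in>UNIV. (bar i u - bar i l) $ j)"
  proof -
    have "bar i l $ j \<le> bar i u $ j" for j
      using le exhaust_3[of i] exhaust_2[of j] by (auto simp: bar_def)
    then have "bar i l \<bullet> b \<le> bar i u \<bullet> b" if "b \<in> Basis" for b
      using that by (auto simp: Basis_vec_def inner_axis)
    then show ?thesis by (simp add: emeasure_lborel_box prod_Basis_cart)
  qed
  also have "emeasure lborel {l $ i<..<u $ i} = ennreal (u $ i - l $ i)" using le by simp
  also have "ennreal (u $ i - l $ i) * ennreal (\<Prod>j\<in>UNIV. (bar i u - bar i l) $ j) = ennreal (\<Prod>b\<in>Basis. (u - l) \<bullet> b)"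
  proof -
    have "(\<Prod>b\<in>Basis. (u - l) \<bullet> b) = (u $ i - l $ i) * (\<Prod>j\<in>UNIV. (bar i u - bar i l) $ j)"
      unfolding prod_Basis_cart using exhaust_3[of i] by (elim disjE) (simp_all only: prod_2 prod_3 bar_def vector_2_nth vector_minus_component one_neq_zero, simp_all)
    moreover have "0 \<le> (\<Prod>j\<in>UNIV. (bar i u - bar i l) $ j)"
      using le exhaust_3[of i] by (elim disjE) (simp_all add: prod_2 bar_def)
    ultimately show ?thesis using le[of i] by (simp add: ennreal_mult)
  qed
  finally show "emeasure (distr (lborel \<Otimes>\<^sub>M lborel) borel (\<lambda>(t, z). insert_coord i t z)) (box l u)
    = ennreal (\<Prod>b\<in>Basis. (u - l) \<bullet> b)" .
qed simp

lemma fubini_insert_coord: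
  fixes f :: "real^3 \<Rightarrow> real"
  assumes f: "integrable lborel f"
  shows "(\<integral>x. f x \<partial>lborel) = (\<integral>z. (\<integral>t. f (insert_coord i t z) \<partial>lborel) \<partial>lborel)"
    and "integrable lborel (\<lambda>z. \<integral>t. f (insert_coord i t z) \<partial>lborel)"
    and "integrable (lborel \<Otimes>\<^sub>M lborel) (\<lambda>(t, z). f (insert_coord i t z))"
proof -
  have m: "(\<lambda>(t, z). insert_coord i t z) \<in> lborel \<Otimes>\<^sub>M lborel \<rightarrow>\<^sub>M borel"
    unfolding lborel_prod measurable_lborel2 case_prod_beta
    by (intro borel_measurable_continuous_onI continuous_intros)
  have fm: "f \<in> borel_measurable borel" using f by auto
  have 1: "integrable (lborel \<Otimes>\<^sub>M lborel) (\<lambda>p. f ((\<lambda>(t, z). insert_coord i t z) p))"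
    using f integrable_distr_eq[OF m fm] lborel_insert_coord by metis
  then show 2: "integrable (lborel \<Otimes>\<^sub>M lborel) (\<lambda>(t, z). f (insert_coord i t z))"
    by (simp add: split_beta')
  have "(\<integral>x. f x \<partial>lborel) = (\<integral>p. f ((\<lambda>(t, z). insert_coord i t z) p) \<partial>(lborel \<Otimes>\<^sub>M lborel))"
    using integral_distr[OF m fm] lborel_insert_coord by metis
  also have "\<dots> = (\<integral>(t, z). f (insert_coord i t z) \<partial>(lborel \<Otimes>\<^sub>M lborel))"
    by (simp add: split_beta')
  also have "\<dots> = (\<integral>z. (\<integral>t. f (insert_coord i t z) \<partial>lborel) \<partial>lborel)"
    using 2 by (rule lborel_pair.integral_snd[symmetric])
  finally show "(\<integral>x. f x \<partial>lborel) = (\<integral>z. (\<integral>t. f (insert_coord i t z) \<partial>lborel) \<partial>lborel)" .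
  show "integrable lborel (\<lambda>z. \<integral>t. f (insert_coord i t z) \<partial>lborel)"
    using 2 by (rule lborel_pair.integrable_snd)
qed

text \<open>Kept independent of the junction: the same estimates are applied to the thin cylinders
  and to a small cylinder below an interface in the unscaled node.\<close>

definition cylinder :: "3 \<Rightarrow> real \<Rightarrow> real \<Rightarrow> real \<Rightarrow> (real^3) set" where
  "cylinder i a b R = {x. a < x $ i \<and> x $ i < b \<and> norm (bar i x) < R}"

lemma cyl_eq_cylinder: "cyl l0 l h \<epsilon> i = cylinder i (\<epsilon> * l0) (l i) (\<epsilon> * h i)"
  by (simp add: cyl_def cylinder_def)

lemma open_cylinder: "open (cylinder i a b R)"
  unfolding cylinder_def by (intro open_Collect_conj open_Collect_less continuous_intros)

lemma bounded_cylinder: "bounded (cylinder i a b R)"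
proof -
  have "norm x \<le> \<bar>a\<bar> + \<bar>b\<bar> + \<bar>R\<bar>" if "x \<in> cylinder i a b R" for x
  proof -
    have "norm x = norm (insert_coord i 0 (bar i x) + (x $ i) *\<^sub>R axis i 1)"
      using insert_coord_eq[of i "x $ i" "bar i x"] by simp
    also have "\<dots> \<le> norm (insert_coord i 0 (bar i x)) + norm ((x $ i) *\<^sub>R (axis i 1 :: real^3))"
      by (rule norm_triangle_ineq)
    also have "norm (insert_coord i 0 (bar i x)) = norm (bar i x)"
      by (rule power2_eq_imp_eq) (simp_all add: norm_sq_bar[of _ i])
    finally show ?thesis using that by (auto simp: cylinder_def)
  qed
  then show ?thesis unfolding bounded_iff by blast
qed

lemma indicator_cylinder:
  "indicator (cylinder i a b R) (insert_coord i t z) = (indicator (ball 0 R) z * indicator {a<..<b} t :: real)"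
  by (auto simp: indicator_def cylinder_def)

lemma cylinder_fubini:
  fixes f :: "real^3 \<Rightarrow> real"
  assumes "set_integrable lborel (cylinder i a b R) f"
  shows "(LINT x:cylinder i a b R|lborel. f x) = (LINT z:ball 0 R|lborel. (LINT t:{a<..<b}|lborel. f (insert_coord i t z)))"
    and "set_integrable lborel (ball 0 R) (\<lambda>z. LINT t:{a<..<b}|lborel. f (insert_coord i t z))"
  using fubini_insert_coord[OF assms[unfolded set_integrable_def], of i]
  by (simp_all add: set_lebesgue_integral_def set_integrable_def indicator_cylinder mult.assoc)

lemma set_integrable_cylinder:
  fixes f :: "real^3 \<Rightarrow> real"
  assumes "continuous_on UNIV f"
  shows "set_integrable lborel (cylinder i a b R) f"
proof -
  have "compact (f ` closure (cylinder i a b R))"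
    using bounded_cylinder by (intro compact_continuous_image continuous_on_subset[OF assms]) auto
  then obtain M where M: "\<And>x. x \<in> closure (cylinder i a b R) \<Longrightarrow> norm (f x) \<le> M"
    using compact_imp_bounded bounded_iff by (metis imageI)
  show ?thesis
    by (rule set_integrable_bounded_continuous[OF continuous_on_subset[OF assms] open_cylinder bounded_cylinder M])
      (use closure_subset in auto)
qed

lemma set_integrable_ball:
  fixes f :: "'a::euclidean_space \<Rightarrow> real"
  assumes "continuous_on UNIV f"
  shows "set_integrable lborel (ball a R) f"
proof -
  have "set_integrable lborel (cball a R) f"
    using borel_integrable_compact[OF compact_cball continuous_on_subset[OF assms subset_UNIV]]
    by (simp add: set_integrable_def)
  then show ?thesis by (rule set_integrable_subset) auto
qed

section \<open>Integrals and inequalities on an interval\<close>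

lemma set_integrable_Icc:
  fixes f :: "real \<Rightarrow> real"
  assumes "continuous_on {a..b} f"
  shows "set_integrable lborel {a..b} f"
  using borel_integrable_compact[OF compact_Icc assms] by (simp add: set_integrable_def)

lemma set_integrable_Ioo:
  fixes f :: "real \<Rightarrow> real"
  assumes "continuous_on {a..b} f"
  shows "set_integrable lborel {a<..<b} f"
  by (rule set_integrable_subset[OF set_integrable_Icc[OF assms]]) auto

lemma set_integral_mono_set:
  fixes f :: "'a \<Rightarrow> real"
  assumes "set_integrable M A f" "set_integrable M B f" "A \<subseteq> B" "\<And>x. x \<in> B \<Longrightarrow> 0 \<le> f x"
  shows "(LINT x:A|M. f x) \<le> (LINT x:B|M. f x)"
  using assms unfolding set_lebesgue_integral_def set_integrable_def
  by (intro integral_mono) (auto simp: indicator_def)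

lemma LINT_Ioo_Icc:
  fixes f :: "real \<Rightarrow> real"
  assumes "f \<in> borel_measurable borel"
  shows "(LINT t:{a<..<b}|lborel. f t) = (LINT t:{a..b}|lborel. f t)"
  unfolding set_lebesgue_integral_def
proof (rule integral_cong_AE)
  show "AE t in lborel. indicator {a<..<b} t *\<^sub>R f t = indicator {a..b} t *\<^sub>R f t"
    using AE_lborel_singleton[of a] AE_lborel_singleton[of b]
    by eventually_elim (auto simp: indicator_def)
qed (use assms in auto)

lemma LINT_mono_Ioo:
  fixes f g :: "real \<Rightarrow> real"
  assumes "continuous_on {a..b} f" "continuous_on {a..b} g" "\<And>t. a < t \<Longrightarrow> t < b \<Longrightarrow> f t \<le> g t"
  shows "(LINT t:{a<..<b}|lborel. f t) \<le> (LINT t:{a<..<b}|lborel. g t)"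
  using assms by (intro set_integral_mono set_integrable_Ioo) auto

text \<open>With \<open>m\<close> the mean slope between \<open>s\<close> and \<open>t\<close>, the
  integral of (f' - m)^2 over this interval is nonnegative, and expanding the square gives the
  Cauchy-Schwarz bound. The integral of f'^2 is then enlarged to the fixed interval.\<close>

lemma increment_sq_le:
  fixes f f' :: "real \<Rightarrow> real"
  assumes f: "\<And>t. DERIV f t :> f' t" "continuous_on UNIV f'" and st: "a \<le> s" "s \<le> t" "t \<le> b"
  shows "(f t - f s)\<^sup>2 \<le> (t - s) * (LINT u:{a<..<b}|lborel. (f' u)\<^sup>2)"
proof (cases "s = t")
  case False
  with st have lt: "s < t" by simp
  define m where "m = (f t - f s) / (t - s)"
  have c: "continuous_on S f'" for S using f(2) continuous_on_subset by blast
  have i: "set_integrable lborel {s..t} g" if "continuous_on UNIV g" for g :: "real \<Rightarrow> real"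
    using borel_integrable_compact[OF compact_Icc continuous_on_subset[OF that subset_UNIV]]
    by (simp add: set_integrable_def)
  have ftc: "(LINT u:{s..t}|lborel. f' u) = f t - f s"
    unfolding set_lebesgue_integral_def
    by (rule integral_FTC_Icc) (use f st c in \<open>auto simp: has_real_derivative_iff_has_vector_derivative[symmetric] intro: has_field_derivative_at_within\<close>)
  have "0 \<le> (LINT u:{s..t}|lborel. (f' u - m)\<^sup>2)"
    unfolding set_lebesgue_integral_def by (intro integral_nonneg_AE) auto
  also have "\<dots> = (LINT u:{s..t}|lborel. ((f' u)\<^sup>2 - (2 * m) * f' u) + m\<^sup>2)"
    by (simp add: power2_diff algebra_simps)
  also have "\<dots> = (LINT u:{s..t}|lborel. (f' u)\<^sup>2) - (2 * m) * (LINT u:{s..t}|lborel. f' u) + (LINT u:{s..t}|lborel. m\<^sup>2)"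
    by (subst set_integral_add set_integral_diff, (intro i set_integral_diff continuous_intros c)+)+ simp
  also have "(LINT u:{s..t}|lborel. m\<^sup>2) = (t - s) * m\<^sup>2"
    using lt by (simp add: set_lebesgue_integral_def)
  finally have "(2 * m) * (f t - f s) - (t - s) * m\<^sup>2 \<le> (LINT u:{s..t}|lborel. (f' u)\<^sup>2)"
    by (simp add: ftc)
  moreover have "(2 * (d / L)) * d - L * (d / L)\<^sup>2 = d\<^sup>2 / L" if "L \<noteq> 0" for d L :: real
    using that by (simp add: power2_eq_square)
  from this[of "t - s" "f t - f s"]
  have "(2 * m) * (f t - f s) - (t - s) * m\<^sup>2 = (f t - f s)\<^sup>2 / (t - s)"
    using lt unfolding m_def by linarith
  moreover have "(LINT u:{s..t}|lborel. (f' u)\<^sup>2) \<le> (LINT u:{a..b}|lborel. (f' u)\<^sup>2)"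
    using st i[of "\<lambda>u. (f' u)\<^sup>2"] set_integrable_Icc[of a b "\<lambda>u. (f' u)\<^sup>2"] c[of UNIV] c[of "{a..b}"]
    by (intro set_integral_mono_set) (auto intro!: continuous_intros)
  moreover have "(LINT u:{a..b}|lborel. (f' u)\<^sup>2) = (LINT u:{a<..<b}|lborel. (f' u)\<^sup>2)"
    by (rule LINT_Ioo_Icc[symmetric]) (intro borel_measurable_continuous_onI continuous_intros c)
  ultimately have "(f t - f s)\<^sup>2 / (t - s) \<le> (LINT u:{a<..<b}|lborel. (f' u)\<^sup>2)" by linarith
  then show ?thesis using lt by (simp add: pos_divide_le_eq mult.commute)
qed simp

context
  fixes f f' :: "real \<Rightarrow> real" and a b :: real
  assumes f: "\<And>t. DERIV f t :> f' t" "continuous_on UNIV f'" and ab: "a < b"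
begin

private lemma cf: "continuous_on S f"
  by (rule DERIV_continuous_on) (use f in \<open>auto intro: has_field_derivative_at_within\<close>)

private lemma LINT_const: "(LINT t:{a<..<b}|lborel. c) = (b - a) * c" for c :: real
  using ab by (simp add: set_lebesgue_integral_def)

text \<open>The splitting f(t)^2 \<le> 3 f(b)^2 + (3/2) (f(b) - f(t))^2 puts the larger weight on
  the end value, which disappears in the limit later on. Integrating b - t contributes the factor
  1/2, and the product 3/4 stays below 1, as the absorption of the transversal convection
  requires.\<close>

lemma friedrichs_1d:
  "(LINT t:{a<..<b}|lborel. (f t)\<^sup>2) \<le> 3 * (b - a) * (f b)\<^sup>2 + (3/4) * (b - a)\<^sup>2 * (LINT t:{a<..<b}|lborel. (f' t)\<^sup>2)"
proof -
  let ?I = "LINT u:{a<..<b}|lborel. (f' u)\<^sup>2"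
  have "(LINT t:{a<..<b}|lborel. (f t)\<^sup>2) \<le> (LINT t:{a<..<b}|lborel. (3 * (f b)\<^sup>2 + (3/2) * b * ?I) - (3/2) * ?I * t)"
  proof (rule LINT_mono_Ioo)
    fix t assume t: "a < t" "t < b"
    have "(f t)\<^sup>2 \<le> 3 * (f b)\<^sup>2 + (3/2) * (f b - f t)\<^sup>2"
      using zero_le_power2[of "f t - 3 * f b"] by (simp add: power2_eq_square algebra_simps)
    moreover have "(f b - f t)\<^sup>2 \<le> (b - t) * ?I"
      using increment_sq_le[OF f, of a t b b] t by simp
    ultimately show "(f t)\<^sup>2 \<le> (3 * (f b)\<^sup>2 + (3/2) * b * ?I) - (3/2) * ?I * t"
      by (simp add: algebra_simps)
  qed (intro continuous_intros cf)+
  also have "\<dots> = (LINT t:{a<..<b}|lborel. 3 * (f b)\<^sup>2 + (3/2) * b * ?I) - (LINT t:{a<..<b}|lborel. (3/2) * ?I * t)"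
    by (intro set_integral_diff set_integrable_Ioo continuous_intros)
  also have "\<dots> = (b - a) * (3 * (f b)\<^sup>2 + (3/2) * b * ?I) - (3/2) * ?I * (LINT t:{a<..<b}|lborel. t)"
    by (simp only: LINT_const set_integral_mult_right)
  also have "(LINT t:{a<..<b}|lborel. t) = b\<^sup>2 / 2 - a\<^sup>2 / 2"
    by (subst LINT_Ioo_Icc, simp, unfold set_lebesgue_integral_def, rule integral_FTC_Icc) (use ab in \<open>auto simp: has_real_derivative_iff_has_vector_derivative[symmetric] intro!: derivative_eq_intros continuous_intros\<close>)
  finally have *: "(LINT t:{a<..<b}|lborel. (f t)\<^sup>2)
    \<le> (b - a) * (3 * (f b)\<^sup>2 + (3/2) * b * ?I) - (3/2) * ?I * (b\<^sup>2 / 2 - a\<^sup>2 / 2)" .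
  have "(b - a) * (3 * F + (3/2) * b * I) - (3/2) * I * (b\<^sup>2 / 2 - a\<^sup>2 / 2)
    = 3 * (b - a) * F + (3/4) * (b - a)\<^sup>2 * I" for F I
    by (simp add: power2_eq_square field_simps)
  from *[unfolded this] show ?thesis .
qed

text \<open>The end value is compared with f(t), and the comparison is averaged over t; this
  explains the inverse length in front of the integral of f^2.\<close>

lemma trace_right_1d:
  "(f b)\<^sup>2 \<le> 2 / (b - a) * (LINT t:{a<..<b}|lborel. (f t)\<^sup>2) + 2 * (b - a) * (LINT t:{a<..<b}|lborel. (f' t)\<^sup>2)"
proof -
  let ?I = "LINT u:{a<..<b}|lborel. (f' u)\<^sup>2"
  have I0: "0 \<le> ?I" unfolding set_lebesgue_integral_def by (intro integral_nonneg_AE) auto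
  have "(b - a) * (f b)\<^sup>2 = (LINT t:{a<..<b}|lborel. (f b)\<^sup>2)" by (simp only: LINT_const)
  also have "\<dots> \<le> (LINT t:{a<..<b}|lborel. 2 * (f t)\<^sup>2 + 2 * (b - a) * ?I)"
  proof (rule LINT_mono_Ioo)
    fix t assume t: "a < t" "t < b"
    have "(f b)\<^sup>2 \<le> 2 * (f t)\<^sup>2 + 2 * (f b - f t)\<^sup>2"
      using zero_le_power2[of "f b - 2 * f t"] by (simp add: power2_eq_square algebra_simps)
    moreover have "(f b - f t)\<^sup>2 \<le> (b - t) * ?I"
      using increment_sq_le[OF f, of a t b b] t by simp
    moreover have "(b - t) * ?I \<le> (b - a) * ?I" using t I0 by (intro mult_right_mono) auto
    ultimately show "(f b)\<^sup>2 \<le> 2 * (f t)\<^sup>2 + 2 * (b - a) * ?I" by (simp only: mult.assoc)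
  qed (intro continuous_intros cf)+
  also have "\<dots> = (LINT t:{a<..<b}|lborel. 2 * (f t)\<^sup>2) + (LINT t:{a<..<b}|lborel. 2 * (b - a) * ?I)"
    by (intro set_integral_add set_integrable_Ioo continuous_intros cf)
  also have "\<dots> = 2 * (LINT t:{a<..<b}|lborel. (f t)\<^sup>2) + (b - a) * (2 * (b - a) * ?I)"
    by (simp only: LINT_const set_integral_mult_right)
  finally have *: "(b - a) * (f b)\<^sup>2 \<le> 2 * (LINT t:{a<..<b}|lborel. (f t)\<^sup>2) + (b - a) * (2 * (b - a) * ?I)" .
  have "F \<le> 2 / L * J + I" if "L * F \<le> 2 * J + L * I" "L > 0" for F J I L :: real
    using that by (simp add: field_simps)
  from this[OF *] show ?thesis using ab by simp
qed

lemma trace_left_1d: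
  "(f a)\<^sup>2 \<le> 2 * (f b)\<^sup>2 + 2 * (b - a) * (LINT t:{a<..<b}|lborel. (f' t)\<^sup>2)"
proof -
  have "(f a)\<^sup>2 \<le> 2 * (f b)\<^sup>2 + 2 * (f b - f a)\<^sup>2"
    using zero_le_power2[of "f a - 2 * f b"] by (simp add: power2_eq_square algebra_simps)
  moreover have "(f b - f a)\<^sup>2 \<le> (b - a) * (LINT u:{a<..<b}|lborel. (f' u)\<^sup>2)"
    using increment_sq_le[OF f, of a a b b] ab by simp
  ultimately show ?thesis by (simp only: mult.assoc)
qed

text \<open>Since w' f is nonnegative, w f' is at most the derivative of w f. The coefficient is
  controlled only on the half-open interval and need not extend to \<open>b\<close>, so the estimate
  is made up to points below \<open>b\<close>, where \<open>M\<close> bounds the end term, and then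
  passed to the limit.\<close>

lemma convection_1d:
  fixes w w' :: "real \<Rightarrow> real"
  assumes w: "\<And>t. a \<le> t \<Longrightarrow> t < b \<Longrightarrow> DERIV w t :> w' t" "continuous_on {a..<b} w'"
    and w': "\<And>t. a \<le> t \<Longrightarrow> t < b \<Longrightarrow> 0 \<le> w' t" and M: "\<And>t. a \<le> t \<Longrightarrow> t < b \<Longrightarrow> \<bar>w t\<bar> \<le> M"
    and nn: "\<And>t. 0 \<le> f t"
  shows "(LINT t:{a<..<b}|lborel. w t * f' t) \<le> M * f b - w a * f a"
proof -
  have cw: "continuous_on {a..<b} w"
    by (rule DERIV_continuous_on) (use w in \<open>auto intro: has_field_derivative_at_within\<close>)
  have c: "continuous_on S f'" for S using f(2) continuous_on_subset by blast
  have le: "(LINT t:{a..s}|lborel. w t * f' t) \<le> M * f s - w a * f a" if s: "a \<le> s" "s < b" for s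
  proof -
    have sub: "{a..s} \<subseteq> {a..<b}" using s by auto
    have cont: "continuous_on {a..s} (\<lambda>t. w t * f' t)" "continuous_on {a..s} (\<lambda>t. w' t * f t)"
      by (intro continuous_intros c cf continuous_on_subset[OF cw sub] continuous_on_subset[OF w(2) sub])+
    have "(LINT t:{a..s}|lborel. w t * f' t) \<le> (LINT t:{a..s}|lborel. w t * f' t + w' t * f t)"
      using borel_integrable_compact[OF compact_Icc cont(1)] s w' nn
        borel_integrable_compact[OF compact_Icc continuous_on_add[OF cont]]
      by (intro set_integral_mono) (auto simp: set_integrable_def)
    also have "\<dots> = w s * f s - w a * f a"
      unfolding set_lebesgue_integral_def
    proof (rule integral_FTC_Icc[OF s(1)])
      fix t assume t: "a \<le> t" "t \<le> s"
      have "DERIV (\<lambda>t. w t * f t) t :> w t * f' t + w' t * f t"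
        using DERIV_mult[OF w(1)[of t] f(1)[of t]] t s by (simp add: algebra_simps)
      then show "((\<lambda>t. w t * f t) has_vector_derivative w t * f' t + w' t * f t) (at t within {a..s})"
        by (simp add: has_real_derivative_iff_has_vector_derivative has_vector_derivative_at_within)
    qed (intro continuous_on_add cont)
    also have "w s * f s \<le> M * f s" using M[of s] s nn[of s] by (intro mult_right_mono) auto
    finally show ?thesis by simp
  qed
  define s where "s n = b - (b - a) / real (Suc n)" for n
  have s: "a \<le> s n" "s n < b" for n
  proof -
    have "(b - a) / real (Suc n) \<le> (b - a) / 1" using ab by (intro divide_left_mono) auto
    then show "a \<le> s n" by (simp add: s_def)
    show "s n < b" using ab by (simp add: s_def)
  qed
  have slim: "s \<longlonglongrightarrow> b"
  proof -
    have "(\<lambda>n. b - (b - a) / real (Suc n)) \<longlonglongrightarrow> b - 0"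
      by (intro tendsto_diff tendsto_const LIMSEQ_Suc[OF lim_const_over_n])
    then show ?thesis by (simp add: s_def[abs_def])
  qed
  have M0: "0 \<le> M" using M[of a] ab by simp
  have "(\<lambda>n. LINT t:{a..s n}|lborel. w t * f' t) \<longlonglongrightarrow> (LINT t:{a..<b}|lborel. w t * f' t)"
    unfolding set_lebesgue_integral_def
  proof (rule integral_dominated_convergence[where w = "\<lambda>t. indicator {a..b} t *\<^sub>R (M * \<bar>f' t\<bar>)"])
    show "integrable lborel (\<lambda>t. indicator {a..b} t *\<^sub>R (M * \<bar>f' t\<bar>))"
      by (intro borel_integrable_compact continuous_intros c) auto
    show "(\<lambda>t. indicator {a..<b} t *\<^sub>R (w t * f' t)) \<in> borel_measurable lborel"
      unfolding measurable_lborel2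
      by (rule borel_measurable_continuous_on_indicator) (auto intro!: continuous_intros cw c)
    show "(\<lambda>t. indicator {a..s n} t *\<^sub>R (w t * f' t)) \<in> borel_measurable lborel" for n
      unfolding measurable_lborel2
      by (rule borel_measurable_continuous_on_indicator)
        (use s[of n] in \<open>auto intro!: continuous_intros continuous_on_subset[OF cw] c\<close>)
    show "AE t in lborel. norm (indicator {a..s n} t *\<^sub>R (w t * f' t)) \<le> indicator {a..b} t *\<^sub>R (M * \<bar>f' t\<bar>)" for n
      using s[of n] M M0 by (intro AE_I2) (auto simp: indicator_def abs_mult intro!: mult_right_mono)
    show "AE t in lborel. (\<lambda>n. indicator {a..s n} t *\<^sub>R (w t * f' t)) \<longlonglongrightarrow> indicator {a..<b} t *\<^sub>R (w t * f' t)"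
    proof (rule AE_I2, rule tendsto_eventually)
      fix t
      show "\<forall>\<^sub>F n in sequentially. indicator {a..s n} t *\<^sub>R (w t * f' t) = indicator {a..<b} t *\<^sub>R (w t * f' t)"
      proof (cases "a \<le> t \<and> t < b")
        case True
        then have "\<forall>\<^sub>F n in sequentially. t < s n" using slim order_tendstoD(1) by blast
        then show ?thesis by eventually_elim (use True in auto)
      next
        case False
        then have "indicator {a..s n} t *\<^sub>R (w t * f' t) = indicator {a..<b} t *\<^sub>R (w t * f' t)" for n
          using s[of n] by (auto simp: indicator_def)
        then show ?thesis by simp
      qed
    qed
  qed
  moreover have "(\<lambda>n. M * f (s n) - w a * f a) \<longlonglongrightarrow> M * f b - w a * f a"
    by (intro tendsto_intros continuous_on_tendsto_compose[OF cf[of UNIV] slim]) auto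
  ultimately have "(LINT t:{a..<b}|lborel. w t * f' t) \<le> M * f b - w a * f a"
    by (rule LIMSEQ_le) (use le s in auto)
  moreover have "(LINT t:{a..<b}|lborel. w t * f' t) = (LINT t:{a<..<b}|lborel. w t * f' t)"
    unfolding set_lebesgue_integral_def
  proof (rule integral_cong_AE)
    show "AE t in lborel. indicator {a..<b} t *\<^sub>R (w t * f' t) = indicator {a<..<b} t *\<^sub>R (w t * f' t)"
      using AE_lborel_singleton[of a] by eventually_elim (auto simp: indicator_def)
    show "(\<lambda>t. indicator {a..<b} t *\<^sub>R (w t * f' t)) \<in> borel_measurable lborel"
      "(\<lambda>t. indicator {a<..<b} t *\<^sub>R (w t * f' t)) \<in> borel_measurable lborel"
      unfolding measurable_lborel2
      by (rule borel_measurable_continuous_on_indicator;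
          auto intro!: continuous_intros continuous_on_subset[OF cw] c)+
  qed
  ultimately show ?thesis by simp
qed

end

section \<open>Inequalities on cylinders by slicing along the axis\<close>

lemma DERIV_slice:
  assumes "GDERIV u (insert_coord i t z) :> D"
  shows "DERIV (\<lambda>t. u (insert_coord i t z)) t :> D $ i"
proof -
  have "((\<lambda>t. u (insert_coord i 0 z + t *\<^sub>R axis i 1)) has_derivative (\<lambda>s. (s *\<^sub>R axis i 1) \<bullet> D)) (at t)"
    by (rule has_derivative_compose[of "\<lambda>t. insert_coord i 0 z + t *\<^sub>R axis i 1" "\<lambda>t. t *\<^sub>R axis i 1" t UNIV u])
      (use assms insert_coord_eq[of i t z] in \<open>auto simp: gderiv_def intro!: derivative_eq_intros\<close>)
  moreover have "(\<lambda>t. u (insert_coord i 0 z + t *\<^sub>R axis i 1)) = (\<lambda>t. u (insert_coord i t z))"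
    by (simp only: insert_coord_eq[symmetric])
  moreover have "(\<lambda>s. (s *\<^sub>R axis i 1) \<bullet> D) = (*) (D $ i)"
    by (simp add: inner_axis' fun_eq_iff)
  ultimately show ?thesis by (simp add: has_field_derivative_def)
qed

context
  fixes u :: "real^3 \<Rightarrow> real" and Du and i :: 3 and a b R :: real
  assumes u: "C1_on UNIV u Du" and ab: "a < b"
begin

private lemma cu: "continuous_on S f \<Longrightarrow> continuous_on S (\<lambda>x. u (f x))"
  by (rule continuous_on_compose2[OF C1_on_continuous[OF u]]) auto

private lemma cDu: "continuous_on S f \<Longrightarrow> continuous_on S (\<lambda>x. Du (f x) $ j)"
  by (intro continuous_intros continuous_on_compose2[OF C1_onD(2)[OF u]]) auto

private lemmas slice = DERIV_slice[OF C1_onD(1)[OF u UNIV_I], of i]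
  cDu[OF continuous_on_insert_coord[OF continuous_on_id continuous_on_const, unfolded id_def], of UNIV i _ i]

private abbreviation "E c \<equiv> LINT z:ball 0 R|lborel. (u (insert_coord i c z))\<^sup>2"
private abbreviation "Z \<equiv> cylinder i a b R"

private lemma iE: "set_integrable lborel (ball 0 R) (\<lambda>z. (u (insert_coord i c z))\<^sup>2)"
  by (intro set_integrable_ball continuous_intros cu)

private lemma fub:
  "continuous_on UNIV f \<Longrightarrow> (LINT x:Z|lborel. f x) = (LINT z:ball 0 R|lborel. (LINT t:{a<..<b}|lborel. f (insert_coord i t z)))"
  "continuous_on UNIV f \<Longrightarrow> set_integrable lborel (ball 0 R) (\<lambda>z. LINT t:{a<..<b}|lborel. f (insert_coord i t z))"
  for f :: "real^3 \<Rightarrow> real"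
  by (rule cylinder_fubini[OF set_integrable_cylinder], assumption)+

private lemma cont: "continuous_on UNIV (\<lambda>x. (u x)\<^sup>2)" "continuous_on UNIV (\<lambda>x. (Du x $ i)\<^sup>2)"
  by (intro continuous_intros cu cDu)+

text \<open>Only the axial derivative enters, so the constants depend on the length and not on the
  radius. This is one source of the uniformity for thin cylinders.\<close>

lemma cylinder_friedrichs:
  "(LINT x:cylinder i a b R|lborel. (u x)\<^sup>2) \<le> 3 * (b - a) * (LINT z:ball 0 R|lborel. (u (insert_coord i b z))\<^sup>2)
    + (3/4) * (b - a)\<^sup>2 * (LINT x:cylinder i a b R|lborel. (Du x $ i)\<^sup>2)"
proof -
  have "(LINT x:Z|lborel. (u x)\<^sup>2) \<le> (LINT z:ball 0 R|lborel. 3 * (b - a) * (u (insert_coord i b z))\<^sup>2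
      + (3/4) * (b - a)\<^sup>2 * (LINT t:{a<..<b}|lborel. (Du (insert_coord i t z) $ i)\<^sup>2))"
    unfolding fub(1)[OF cont(1)]
    by (intro set_integral_mono fub(2) cont set_integral_add(1) set_integrable_mult_right iE)
       (rule friedrichs_1d[OF slice ab])
  also have "\<dots> = 3 * (b - a) * E b + (3/4) * (b - a)\<^sup>2 * (LINT x:Z|lborel. (Du x $ i)\<^sup>2)"
    unfolding fub(1)[OF cont(2)]
    by (subst set_integral_add) (intro set_integrable_mult_right iE fub(2) cont, simp)+
  finally show ?thesis .
qed

lemma cylinder_trace_right:
  "(LINT z:ball 0 R|lborel. (u (insert_coord i b z))\<^sup>2) \<le> 2 / (b - a) * (LINT x:cylinder i a b R|lborel. (u x)\<^sup>2)
    + 2 * (b - a) * (LINT x:cylinder i a b R|lborel. (Du x $ i)\<^sup>2)"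
proof -
  have "E b \<le> (LINT z:ball 0 R|lborel. 2 / (b - a) * (LINT t:{a<..<b}|lborel. (u (insert_coord i t z))\<^sup>2)
      + 2 * (b - a) * (LINT t:{a<..<b}|lborel. (Du (insert_coord i t z) $ i)\<^sup>2))"
    by (intro set_integral_mono fub(2) cont set_integral_add(1) set_integrable_mult_right iE)
       (rule trace_right_1d[OF slice ab])
  also have "\<dots> = 2 / (b - a) * (LINT x:Z|lborel. (u x)\<^sup>2) + 2 * (b - a) * (LINT x:Z|lborel. (Du x $ i)\<^sup>2)"
    unfolding fub(1)[OF cont(2)] fub(1)[OF cont(1)]
    by (subst set_integral_add) (intro set_integrable_mult_right fub(2) cont, simp)+
  finally show ?thesis .
qed

lemma cylinder_trace_left:
  "(LINT z:ball 0 R|lborel. (u (insert_coord i a z))\<^sup>2) \<le> 2 * (LINT z:ball 0 R|lborel. (u (insert_coord i b z))\<^sup>2)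
    + 2 * (b - a) * (LINT x:cylinder i a b R|lborel. (Du x $ i)\<^sup>2)"
proof -
  have "E a \<le> (LINT z:ball 0 R|lborel. 2 * (u (insert_coord i b z))\<^sup>2
      + 2 * (b - a) * (LINT t:{a<..<b}|lborel. (Du (insert_coord i t z) $ i)\<^sup>2))"
    by (intro set_integral_mono fub(2) cont set_integral_add(1) set_integrable_mult_right iE)
       (rule trace_left_1d[OF slice ab])
  also have "\<dots> = 2 * E b + 2 * (b - a) * (LINT x:Z|lborel. (Du x $ i)\<^sup>2)"
    unfolding fub(1)[OF cont(2)]
    by (subst set_integral_add) (intro set_integrable_mult_right iE fub(2) cont, simp)+
  finally show ?thesis .
qed

text \<open>The one-dimensional estimate is applied on each axial line to the square of
  \<open>u\<close>, whose nonnegativity permits dropping the term with the derivative of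
  \<open>w\<close>.\<close>

lemma cylinder_convection:
  fixes w w' :: "real \<Rightarrow> real"
  assumes w: "\<And>t. a \<le> t \<Longrightarrow> t < b \<Longrightarrow> DERIV w t :> w' t" "continuous_on {a..<b} w'"
    and w': "\<And>t. a \<le> t \<Longrightarrow> t < b \<Longrightarrow> 0 \<le> w' t" and M: "\<And>t. a \<le> t \<Longrightarrow> t < b \<Longrightarrow> \<bar>w t\<bar> \<le> M"
  shows "set_integrable lborel (cylinder i a b R) (\<lambda>x. w (x $ i) * (2 * u x * Du x $ i))"
    and "(LINT x:cylinder i a b R|lborel. w (x $ i) * (2 * u x * Du x $ i))
      \<le> M * (LINT z:ball 0 R|lborel. (u (insert_coord i b z))\<^sup>2) - w a * (LINT z:ball 0 R|lborel. (u (insert_coord i a z))\<^sup>2)"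
proof -
  have cw: "continuous_on {a..<b} w"
    by (rule DERIV_continuous_on) (use w in \<open>auto intro: has_field_derivative_at_within\<close>)
  have M0: "0 \<le> M" using M[of a] ab by simp
  have cf: "continuous_on UNIV (\<lambda>x. 2 * u x * Du x $ i)" by (intro continuous_intros cu cDu)
  have "compact ((\<lambda>x. 2 * u x * Du x $ i) ` closure Z)"
    using bounded_cylinder by (intro compact_continuous_image continuous_on_subset[OF cf]) auto
  then obtain B where B: "\<And>x. x \<in> closure Z \<Longrightarrow> norm (2 * u x * Du x $ i) \<le> B"
    using compact_imp_bounded bounded_iff by (metis (no_types, lifting) imageI)
  show 1: "set_integrable lborel Z (\<lambda>x. w (x $ i) * (2 * u x * Du x $ i))"
  proof (rule set_integrable_bounded_continuous[OF _ open_cylinder bounded_cylinder])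
    show "continuous_on Z (\<lambda>x. w (x $ i) * (2 * u x * Du x $ i))"
      by (intro continuous_on_mult continuous_on_compose2[OF cw] continuous_on_subset[OF cf] continuous_intros cu cDu)
         (auto simp: cylinder_def)
    fix x assume x: "x \<in> Z"
    have "norm (w (x $ i)) \<le> M" using x M[of "x $ i"] by (auto simp: cylinder_def)
    then show "norm (w (x $ i) * (2 * u x * Du x $ i)) \<le> M * B"
      unfolding norm_mult[of "w (x $ i)"] using B[of x] x closure_subset[of Z] M0
      by (intro mult_mono) auto
  qed
  have "(LINT x:Z|lborel. w (x $ i) * (2 * u x * Du x $ i)) = (LINT z:ball 0 R|lborel.
     (LINT t:{a<..<b}|lborel. w t * (2 * u (insert_coord i t z) * Du (insert_coord i t z) $ i)))"
    using cylinder_fubini(1)[OF 1] by simp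
  also have "\<dots> \<le> (LINT z:ball 0 R|lborel. M * (u (insert_coord i b z))\<^sup>2 - w a * (u (insert_coord i a z))\<^sup>2)"
  proof (intro set_integral_mono)
    show "set_integrable lborel (ball 0 R) (\<lambda>z. LINT t:{a<..<b}|lborel. w t * (2 * u (insert_coord i t z) * Du (insert_coord i t z) $ i))"
      using cylinder_fubini(2)[OF 1] by simp
    show "set_integrable lborel (ball 0 R) (\<lambda>z. M * (u (insert_coord i b z))\<^sup>2 - w a * (u (insert_coord i a z))\<^sup>2)"
      by (intro set_integral_diff(1) set_integrable_mult_right iE)
    fix z
    show "(LINT t:{a<..<b}|lborel. w t * (2 * u (insert_coord i t z) * Du (insert_coord i t z) $ i))
      \<le> M * (u (insert_coord i b z))\<^sup>2 - w a * (u (insert_coord i a z))\<^sup>2"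
    proof (rule convection_1d[OF _ _ ab w w' M])
      show "DERIV (\<lambda>t. (u (insert_coord i t z))\<^sup>2) t :> 2 * u (insert_coord i t z) * Du (insert_coord i t z) $ i" for t
        using DERIV_power[OF slice(1)[of z t], of 2] by (simp add: mult_ac)
      show "continuous_on UNIV (\<lambda>t. 2 * u (insert_coord i t z) * Du (insert_coord i t z) $ i)"
        by (intro continuous_intros cu cDu)
    qed auto
  qed
  also have "\<dots> = M * E b - w a * E a"
    by (subst set_integral_diff, (intro set_integrable_mult_right iE)+, simp)
  finally show "(LINT x:Z|lborel. w (x $ i) * (2 * u x * Du x $ i)) \<le> M * E b - w a * E a" .
qed

end

section \<open>Traces on lateral surfaces\<close>

lemma continuous_on_vector_2 [continuous_intros]:
  assumes "continuous_on S f" "continuous_on S g"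
  shows "continuous_on S (\<lambda>x. vector [f x, g x] :: real^2)"
proof -
  have "(\<lambda>x. vector [f x, g x] :: real^2) = (\<lambda>x. f x *\<^sub>R axis 1 1 + g x *\<^sub>R axis 2 1)"
    by (auto simp: vec2_eq_iff axis_def fun_eq_iff)
  then show ?thesis by (simp only:) (intro continuous_intros assms)
qed

text \<open>The change to polar coordinates takes place in \<open>real^2\<close>, whereas surfaces
  are parametrized by pairs; this identifies the two measures.\<close>

lemma lborel_vector_2:
  "distr (lborel \<Otimes>\<^sub>M lborel) borel (\<lambda>(r, \<theta>). vector [r, \<theta>] :: real^2) = lborel"
proof (rule lborel_eqI[symmetric])
  have m: "(\<lambda>(r, \<theta>). vector [r, \<theta>] :: real^2) \<in> lborel \<Otimes>\<^sub>M lborel \<rightarrow>\<^sub>M borel"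
    unfolding lborel_prod measurable_lborel2 case_prod_beta
    by (intro borel_measurable_continuous_onI continuous_intros)
  fix l u :: "real^2"
  assume lu: "\<And>b. b \<in> Basis \<Longrightarrow> l \<bullet> b \<le> u \<bullet> b"
  then have le: "l $ j \<le> u $ j" for j
    using lu[of "axis j 1"] by (simp add: inner_axis)
  have "(\<lambda>(r, \<theta>). vector [r, \<theta>] :: real^2) -` box l u \<inter> space (lborel \<Otimes>\<^sub>M lborel)
    = {l $ 1<..<u $ 1} \<times> {l $ 2<..<u $ 2}"
    by (auto simp: space_pair_measure mem_box_cart forall_2)
  then have "emeasure (distr (lborel \<Otimes>\<^sub>M lborel) borel (\<lambda>(r, \<theta>). vector [r, \<theta>] :: real^2)) (box l u)
    = emeasure (lborel \<Otimes>\<^sub>M lborel) ({l $ 1<..<u $ 1} \<times> {l $ 2<..<u $ 2})"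
    using m by (simp add: emeasure_distr)
  also have "\<dots> = emeasure lborel {l $ 1<..<u $ 1} * emeasure lborel {l $ 2<..<u $ 2}"
    by (rule lborel.emeasure_pair_measure_Times) auto
  also have "\<dots> = ennreal (\<Prod>b\<in>Basis. (u - l) \<bullet> b)"
    using le by (simp add: prod_Basis_cart prod_2 ennreal_mult)
  finally show "emeasure (distr (lborel \<Otimes>\<^sub>M lborel) borel (\<lambda>(r, \<theta>). vector [r, \<theta>] :: real^2)) (box l u)
    = ennreal (\<Prod>b\<in>Basis. (u - l) \<bullet> b)" .
qed simp

definition polar :: "real^2 \<Rightarrow> real^2" where
  "polar p = (p $ 1) *\<^sub>R vector [cos (p $ 2), sin (p $ 2)]"

lemma inj_on_polar: "inj_on polar {p. 0 < p $ 1 \<and> p $ 1 < R \<and> 0 < p $ 2 \<and> p $ 2 < 2 * pi}"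
proof (rule inj_onI)
  fix p q :: "real^2"
  assume p: "p \<in> {p. 0 < p $ 1 \<and> p $ 1 < R \<and> 0 < p $ 2 \<and> p $ 2 < 2 * pi}"
    and q: "q \<in> {p. 0 < p $ 1 \<and> p $ 1 < R \<and> 0 < p $ 2 \<and> p $ 2 < 2 * pi}"
    and eq: "polar p = polar q"
  have e: "p $ 1 * cos (p $ 2) = q $ 1 * cos (q $ 2)" "p $ 1 * sin (p $ 2) = q $ 1 * sin (q $ 2)"
    using eq by (auto simp: polar_def vec2_eq_iff)
  have sq: "(r * cos t)\<^sup>2 + (r * sin t)\<^sup>2 = r\<^sup>2" for r t :: real
    by (simp add: power_mult_distrib flip: distrib_left)
  have "(p $ 1)\<^sup>2 = (q $ 1)\<^sup>2"
    using sq[of "p $ 1" "p $ 2"] sq[of "q $ 1" "q $ 2"] e by simp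
  then have 1: "p $ 1 = q $ 1" using p q by (auto intro: power2_eq_imp_eq)
  then have "sin (q $ 2) = sin (p $ 2) \<and> cos (q $ 2) = cos (p $ 2)" using e p by auto
  then obtain n :: int where n: "q $ 2 = p $ 2 + 2 * pi * n" using sin_cos_eq_iff by blast
  then have "\<bar>2 * pi * n\<bar> < 2 * pi" using p q by auto
  then have "\<bar>real_of_int n\<bar> < 1" by (simp add: abs_mult)
  then have "n = 0" by linarith
  then show "p = q" using 1 n by (simp add: vec2_eq_iff)
qed

lemma has_derivative_polar:
  "(polar has_derivative (\<lambda>h. vector [h $ 1 * cos (p $ 2) - h $ 2 * (p $ 1 * sin (p $ 2)),
      h $ 1 * sin (p $ 2) + h $ 2 * (p $ 1 * cos (p $ 2))])) (at p within S)"
proof -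
  have 1: "((\<lambda>p::real^2. p $ j) has_derivative (\<lambda>h. h $ j)) (at p within S)" for j
    by (rule bounded_linear_imp_has_derivative[OF bounded_linear_vec_nth])
  have "((\<lambda>p. polar p $ j) has_derivative (\<lambda>h. vector [h $ 1 * cos (p $ 2) - h $ 2 * (p $ 1 * sin (p $ 2)),
      h $ 1 * sin (p $ 2) + h $ 2 * (p $ 1 * cos (p $ 2))] $ j)) (at p within S)" for j
    using exhaust_2[of j] by (auto simp: polar_def intro!: derivative_eq_intros 1)
  then show ?thesis
    by (subst has_derivative_componentwise_within) (auto simp: Basis_vec_def inner_axis)
qed

text \<open>An inequality is enough for a trace estimate. It spares the determination of the image
  of the open parameter rectangle, which misses a radius of the disc: for a nonnegative integrand
  the inclusion of the image in the ball suffices.\<close>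

lemma polar_integral_le:
  fixes \<phi> :: "real^2 \<Rightarrow> real"
  assumes \<phi>: "continuous_on UNIV \<phi>" and nn: "\<And>z. 0 \<le> \<phi> z"
  shows "set_integrable lborel ({0<..<R} \<times> {0<..<2*pi}) (\<lambda>p. fst p * \<phi> (fst p *\<^sub>R vector [cos (snd p), sin (snd p)]))"
    and "(LINT p:({0<..<R} \<times> {0<..<2*pi})|lborel. fst p * \<phi> (fst p *\<^sub>R vector [cos (snd p), sin (snd p)]))
      \<le> (LINT z:ball 0 R|lborel. \<phi> z)"
proof -
  let ?S = "{p::real^2. 0 < p $ 1 \<and> p $ 1 < R \<and> 0 < p $ 2 \<and> p $ 2 < 2 * pi}"
  let ?D = "\<lambda>p h. vector [h $ 1 * cos (p $ 2) - h $ 2 * (p $ 1 * sin (p $ 2)),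
      h $ 1 * sin (p $ 2) + h $ 2 * (p $ 1 * cos (p $ 2))] :: real^2"
  have oS: "open ?S" by (intro open_Collect_conj open_Collect_less continuous_intros)
  have Sm: "?S \<in> sets lebesgue" using oS by (simp add: borel_open sets_completionI_sets)
  have det: "\<bar>det (matrix (?D p))\<bar> = p $ 1" if "p \<in> ?S" for p
  proof -
    have "det (matrix (?D p)) = p $ 1 * (cos (p $ 2) * cos (p $ 2)) + p $ 1 * (sin (p $ 2) * sin (p $ 2))"
      unfolding det_2 matrix_def by (simp add: axis_def mult_ac)
    also have "\<dots> = p $ 1 * ((sin (p $ 2))\<^sup>2 + (cos (p $ 2))\<^sup>2)"
      by (simp only: power2_eq_square distrib_left add.commute)
    finally show ?thesis using that by simp
  qed
  have sub: "polar ` ?S \<subseteq> ball 0 R"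
  proof -
    have "norm (polar p) = \<bar>p $ 1\<bar>" for p
      by (simp add: polar_def norm_eq_sqrt_inner[of "vector [_, _]"] inner_vec_def sum_2 flip: power2_eq_square)
    then show ?thesis by auto
  qed
  \<comment> \<open>Invariance of domain makes the image open, hence measurable.\<close>
  have oP: "open (polar ` ?S)"
    by (rule invariance_of_domain[OF _ oS inj_on_polar])
       (intro has_derivative_continuous_on[OF has_derivative_polar])
 have eq: "(LINT x:A|lebesgue. f x) = (LINT x:A|lborel. f x)" "set_integrable lebesgue A f \<longleftrightarrow> set_integrable lborel A f"
    if "open A" "continuous_on UNIV f" for A and f :: "real^2 \<Rightarrow> real"
    using that borel_measurable_continuous_on_indicator[of A f] continuous_on_subset[OF that(2)]
    by (auto simp: set_lebesgue_integral_def set_integrable_def integral_completion integrable_completion)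
  have "set_integrable lborel (ball 0 R) \<phi>" by (rule set_integrable_ball[OF \<phi>])
  moreover from this have "set_integrable lborel (polar ` ?S) \<phi>"
    by (rule set_integrable_subset) (use oP sub in auto)
  ultimately have le: "(LINT z:polar ` ?S|lborel. \<phi> z) \<le> (LINT z:ball 0 R|lborel. \<phi> z)"
    and int: "\<phi> absolutely_integrable_on polar ` ?S"
    using set_integral_mono_set[OF _ _ sub] nn eq(2)[OF oP \<phi>] by blast+
  have cpolar: "continuous_on A polar" for A
    unfolding polar_def by (intro continuous_intros)
  have cF: "continuous_on A (\<lambda>p. p $ 1 * \<phi> (polar p))" for A
    by (intro continuous_intros continuous_on_compose2[OF \<phi> cpolar]) auto
  \<comment> \<open>The change of variables is stated for vector-valued integrands, hence the
    passage through \<open>real^1\<close>.\<close>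
  have "(\<lambda>p. \<bar>det (matrix (?D p))\<bar> *\<^sub>R (vec (\<phi> (polar p)) :: real^1)) absolutely_integrable_on ?S \<and>
     integral ?S (\<lambda>p. \<bar>det (matrix (?D p))\<bar> *\<^sub>R (vec (\<phi> (polar p)) :: real^1)) = vec (integral (polar ` ?S) \<phi>)
     \<longleftrightarrow> (\<lambda>z. vec (\<phi> z) :: real^1) absolutely_integrable_on (polar ` ?S) \<and>
       integral (polar ` ?S) (\<lambda>z. vec (\<phi> z) :: real^1) = vec (integral (polar ` ?S) \<phi>)"
    by (intro has_absolute_integral_change_of_variables Sm has_derivative_polar inj_on_polar)
  then have 1: "(\<lambda>p. \<bar>det (matrix (?D p))\<bar> * \<phi> (polar p)) absolutely_integrable_on ?S"
    "integral ?S (\<lambda>p. \<bar>det (matrix (?D p))\<bar> * \<phi> (polar p)) = integral (polar ` ?S) \<phi>"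
    using int by (simp_all add: absolutely_integrable_on_1_iff integral_on_1_eq)
  have "integral ?S (\<lambda>p. \<bar>det (matrix (?D p))\<bar> * \<phi> (polar p)) = integral ?S (\<lambda>p. p $ 1 * \<phi> (polar p))"
    using det by (intro integral_cong) auto
  moreover have i2: "(\<lambda>p. p $ 1 * \<phi> (polar p)) absolutely_integrable_on ?S"
    using 1(1) det by (subst set_integrable_cong[OF refl refl]) auto
  ultimately have "(LINT p:?S|lborel. p $ 1 * \<phi> (polar p)) = (LINT z:polar ` ?S|lborel. \<phi> z)"
    using set_lebesgue_integral_eq_integral(2)[OF i2] set_lebesgue_integral_eq_integral(2)[OF int] 1(2)
      eq(1)[OF oP \<phi>] eq(1)[OF oS cF] by simp
  with le have le': "(\<integral>p. indicator ?S p *\<^sub>R (p $ 1 * \<phi> (polar p)) \<partial>lborel) \<le> (LINT z:ball 0 R|lborel. \<phi> z)"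
    by (simp add: set_lebesgue_integral_def)
  have i3: "integrable lborel (\<lambda>p. indicator ?S p *\<^sub>R (p $ 1 * \<phi> (polar p)))"
    using i2 eq(2)[OF oS cF] by (simp add: set_integrable_def)
  have m: "(\<lambda>(r, \<theta>). vector [r, \<theta>] :: real^2) \<in> lborel \<Otimes>\<^sub>M lborel \<rightarrow>\<^sub>M borel"
    unfolding lborel_prod measurable_lborel2 case_prod_beta
    by (intro borel_measurable_continuous_onI continuous_intros)
  let ?F = "\<lambda>p::real^2. indicator ?S p *\<^sub>R (p $ 1 * \<phi> (polar p))"
  have Fm: "?F \<in> borel_measurable borel" using i3 by auto
  have F: "?F ((\<lambda>(r, \<theta>). vector [r, \<theta>]) p)
      = indicator ({0<..<R} \<times> {0<..<2*pi}) p *\<^sub>R (fst p * \<phi> (fst p *\<^sub>R vector [cos (snd p), sin (snd p)]))" for p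
    by (auto simp: indicator_def polar_def split: prod.splits)
  have "integrable (lborel \<Otimes>\<^sub>M lborel) (\<lambda>p. ?F ((\<lambda>(r, \<theta>). vector [r, \<theta>]) p))"
    using i3 integrable_distr_eq[OF m Fm] lborel_vector_2 by metis
  then show "set_integrable lborel ({0<..<R} \<times> {0<..<2*pi}) (\<lambda>p. fst p * \<phi> (fst p *\<^sub>R vector [cos (snd p), sin (snd p)]))"
    unfolding F set_integrable_def lborel_prod .
  have "(\<integral>p. ?F p \<partial>lborel) = (\<integral>p. ?F ((\<lambda>(r, \<theta>). vector [r, \<theta>]) p) \<partial>(lborel \<Otimes>\<^sub>M lborel))"
    using integral_distr[OF m Fm] lborel_vector_2 by metis
  then show "(LINT p:({0<..<R} \<times> {0<..<2*pi})|lborel. fst p * \<phi> (fst p *\<^sub>R vector [cos (snd p), sin (snd p)]))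
      \<le> (LINT z:ball 0 R|lborel. \<phi> z)"
    using le' unfolding F set_lebesgue_integral_def lborel_prod by simp
qed

text \<open>The trace inequality on a circle comes from integrating the radial derivative of
  \<open>r\<^sup>2 v\<^sup>2\<close> along radii; the factor \<open>r\<^sup>2\<close> removes the boundary term at the centre and
  provides the weight \<open>r\<close> of polar coordinates.\<close>

lemma circle_trace:
  fixes v :: "real^2 \<Rightarrow> real"
  assumes v: "C1_on UNIV v Dv" and R: "0 < R"
  shows "R\<^sup>2 * (LINT \<theta>:{0<..<2*pi}|lborel. (v (R *\<^sub>R vector [cos \<theta>, sin \<theta>]))\<^sup>2)
    \<le> (LINT z:ball 0 R|lborel. 3 * (v z)\<^sup>2 + R\<^sup>2 * (norm (Dv z))\<^sup>2)"
proof -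
  define e :: "real \<Rightarrow> real^2" where "e \<theta> = vector [cos \<theta>, sin \<theta>]" for \<theta>
  have ne: "norm (e \<theta>) = 1" for \<theta>
    by (simp add: e_def norm_eq_sqrt_inner inner_vec_def sum_2 flip: power2_eq_square)
  have ce [continuous_intros]: "continuous_on S f \<Longrightarrow> continuous_on S (\<lambda>x. e (f x))" for S :: "'a::t2_space set" and f
    unfolding e_def by (intro continuous_intros)
  have cv [continuous_intros]: "continuous_on S f \<Longrightarrow> continuous_on S (\<lambda>x. v (f x))" for S :: "'a::t2_space set" and f
    by (rule continuous_on_compose2[OF C1_on_continuous[OF v]]) auto
  have cDv [continuous_intros]: "continuous_on S f \<Longrightarrow> continuous_on S (\<lambda>x. Dv (f x))" for S :: "'a::t2_space set" and f
    by (rule continuous_on_compose2[OF C1_onD(2)[OF v]]) auto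
  \<comment> \<open>Differentiating r^2 v^2 and dividing by r gives 2 v^2 plus a mixed term; Young's
    inequality bounds the latter by v^2 + R^2 |Dv|^2, which makes the coefficient 3.\<close>
  define \<phi> where "\<phi> z = 3 * (v z)\<^sup>2 + R\<^sup>2 * (norm (Dv z))\<^sup>2" for z
  have c\<phi> [continuous_intros]: "continuous_on S f \<Longrightarrow> continuous_on S (\<lambda>x. \<phi> (f x))" for S :: "'a::t2_space set" and f
    unfolding \<phi>_def by (intro continuous_intros)
  have \<phi>0: "0 \<le> \<phi> z" for z by (simp add: \<phi>_def)
  note pol = polar_integral_le[OF c\<phi>[OF continuous_on_id, unfolded id_def] \<phi>0, of R, folded e_def]
  have slice: "R\<^sup>2 * (v (R *\<^sub>R e \<theta>))\<^sup>2 \<le> (LINT r:{0<..<R}|lborel. r * \<phi> (r *\<^sub>R e \<theta>))" for \<theta>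
  proof -
    let ?g = "\<lambda>r. 2 * r * (v (r *\<^sub>R e \<theta>))\<^sup>2 + r\<^sup>2 * (2 * v (r *\<^sub>R e \<theta>) * (e \<theta> \<bullet> Dv (r *\<^sub>R e \<theta>)))"
    have d: "DERIV (\<lambda>r. r\<^sup>2 * (v (r *\<^sub>R e \<theta>))\<^sup>2) r :> ?g r" for r
    proof -
      have "((\<lambda>r. v (r *\<^sub>R e \<theta>)) has_derivative (\<lambda>s. (s *\<^sub>R e \<theta>) \<bullet> Dv (r *\<^sub>R e \<theta>))) (at r)"
        by (rule has_derivative_compose[of "\<lambda>r. r *\<^sub>R e \<theta>" "\<lambda>s. s *\<^sub>R e \<theta>" r UNIV v])
          (use C1_onD(1)[OF v, of "r *\<^sub>R e \<theta>"] in \<open>auto simp: gderiv_def intro!: derivative_eq_intros\<close>)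
      moreover have "(\<lambda>s. (s *\<^sub>R e \<theta>) \<bullet> Dv (r *\<^sub>R e \<theta>)) = (*) (e \<theta> \<bullet> Dv (r *\<^sub>R e \<theta>))"
        by (simp add: fun_eq_iff)
      ultimately have 1: "DERIV (\<lambda>r. v (r *\<^sub>R e \<theta>)) r :> e \<theta> \<bullet> Dv (r *\<^sub>R e \<theta>)"
        by (simp add: has_field_derivative_def)
      show ?thesis by (rule derivative_eq_intros 1 refl)+ simp
    qed
    have cg: "continuous_on A ?g" for A by (intro continuous_intros)
    have "R\<^sup>2 * (v (R *\<^sub>R e \<theta>))\<^sup>2 = (LINT r:{0..R}|lborel. ?g r)"
      unfolding set_lebesgue_integral_def
      by (subst integral_FTC_Icc[of 0 R "\<lambda>r. r\<^sup>2 * (v (r *\<^sub>R e \<theta>))\<^sup>2"])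
        (use R d cg in \<open>auto simp: has_real_derivative_iff_has_vector_derivative[symmetric] intro: has_field_derivative_at_within\<close>)
    also have "\<dots> = (LINT r:{0<..<R}|lborel. ?g r)"
      by (rule LINT_Ioo_Icc[symmetric]) (intro borel_measurable_continuous_onI cg)
    also have "\<dots> \<le> (LINT r:{0<..<R}|lborel. r * \<phi> (r *\<^sub>R e \<theta>))"
    proof (rule LINT_mono_Ioo)
      fix r assume r: "0 < r" "r < R"
      let ?v = "v (r *\<^sub>R e \<theta>)" and ?D = "Dv (r *\<^sub>R e \<theta>)"
      have "\<bar>e \<theta> \<bullet> ?D\<bar> \<le> norm ?D" using Cauchy_Schwarz_ineq2[of "e \<theta>" ?D] ne by simp
      then have "?v * (e \<theta> \<bullet> ?D) \<le> \<bar>?v\<bar> * norm ?D"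
        using abs_ge_self[of "?v * (e \<theta> \<bullet> ?D)"] mult_left_mono[of "\<bar>e \<theta> \<bullet> ?D\<bar>" "norm ?D" "\<bar>?v\<bar>"]
        by (simp add: abs_mult)
      then have "r * (2 * (?v * (e \<theta> \<bullet> ?D))) \<le> r * (2 * (\<bar>?v\<bar> * norm ?D))"
        using r by (intro mult_left_mono) auto
      also have "\<dots> \<le> R * (2 * (\<bar>?v\<bar> * norm ?D))"
        using r by (intro mult_right_mono) auto
      also have "\<dots> \<le> ?v\<^sup>2 + R\<^sup>2 * (norm ?D)\<^sup>2"
        using sum_squares_bound[of "\<bar>?v\<bar>" "R * norm ?D"] by (simp add: power_mult_distrib mult_ac)
      finally have "2 * ?v\<^sup>2 + r * (2 * (?v * (e \<theta> \<bullet> ?D))) \<le> \<phi> (r *\<^sub>R e \<theta>)" by (simp add: \<phi>_def)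
      then have "r * (2 * ?v\<^sup>2 + r * (2 * (?v * (e \<theta> \<bullet> ?D)))) \<le> r * \<phi> (r *\<^sub>R e \<theta>)"
        using r by (intro mult_left_mono) auto
      then show "?g r \<le> r * \<phi> (r *\<^sub>R e \<theta>)" by (simp add: power2_eq_square algebra_simps)
    qed (intro continuous_intros cg)+
    finally show ?thesis .
  qed
  have ip: "integrable (lborel \<Otimes>\<^sub>M lborel) (\<lambda>(r, \<theta>). indicator {0<..<R} r * indicator {0<..<2*pi} \<theta> * (r * \<phi> (r *\<^sub>R e \<theta>)))"
    using pol(1) unfolding set_integrable_def lborel_prod
    by (rule Bochner_Integration.integrable_cong[THEN iffD1, rotated -1]) (auto simp: indicator_def)
  have Fub: "(LINT p:({0<..<R} \<times> {0<..<2*pi})|lborel. fst p * \<phi> (fst p *\<^sub>R e (snd p)))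
    = (LINT \<theta>:{0<..<2*pi}|lborel. (LINT r:{0<..<R}|lborel. r * \<phi> (r *\<^sub>R e \<theta>)))"
  proof -
    have "(LINT p:({0<..<R} \<times> {0<..<2*pi})|lborel. fst p * \<phi> (fst p *\<^sub>R e (snd p)))
      = (\<integral>(r, \<theta>). indicator {0<..<R} r * indicator {0<..<2*pi} \<theta> * (r * \<phi> (r *\<^sub>R e \<theta>)) \<partial>(lborel \<Otimes>\<^sub>M lborel))"
      unfolding set_lebesgue_integral_def lborel_prod
      by (intro Bochner_Integration.integral_cong) (auto simp: indicator_def)
    also have "\<dots> = (\<integral>\<theta>. (\<integral>r. indicator {0<..<R} r * indicator {0<..<2*pi} \<theta> * (r * \<phi> (r *\<^sub>R e \<theta>)) \<partial>lborel) \<partial>lborel)"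
      by (rule lborel_pair.integral_snd[OF ip, symmetric])
    also have "\<dots> = (LINT \<theta>:{0<..<2*pi}|lborel. (LINT r:{0<..<R}|lborel. r * \<phi> (r *\<^sub>R e \<theta>)))"
      by (simp add: set_lebesgue_integral_def mult_ac flip: integral_mult_right_zero)
    finally show ?thesis .
  qed
  have "set_integrable lborel {0<..<2*pi} (\<lambda>\<theta>. LINT r:{0<..<R}|lborel. r * \<phi> (r *\<^sub>R e \<theta>))"
    using lborel_pair.integrable_snd[OF ip]
    by (simp add: set_integrable_def set_lebesgue_integral_def mult_ac flip: integral_mult_right_zero)
  then have "(LINT \<theta>:{0<..<2*pi}|lborel. R\<^sup>2 * (v (R *\<^sub>R e \<theta>))\<^sup>2) \<le> (LINT \<theta>:{0<..<2*pi}|lborel. (LINT r:{0<..<R}|lborel. r * \<phi> (r *\<^sub>R e \<theta>)))"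
    using slice by (intro set_integral_mono[OF set_integrable_Ioo]) (intro continuous_intros | assumption)+
  then show ?thesis
    using pol(2) unfolding Fub e_def[symmetric] \<phi>_def[symmetric] by simp
qed

lemma C1_on_slice:
  assumes u: "C1_on UNIV u Du"
  shows "C1_on UNIV (\<lambda>z. u (insert_coord i t z)) (\<lambda>z. bar i (Du (insert_coord i t z)))"
  unfolding C1_on_def
proof (intro conjI ballI)
  fix z
  have eq: "(\<lambda>z. insert_coord i t 0 + insert_coord i 0 z) = (\<lambda>z. insert_coord i t z)"
    by (simp only: insert_coord_add[symmetric] add_0_left add_0_right)
  have bl: "bounded_linear (\<lambda>z. insert_coord i 0 z)"
    unfolding linear_conv_bounded_linear[symmetric]
    by (intro linearI) (simp_all flip: insert_coord_add insert_coord_scaleR)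
  have "((\<lambda>z. insert_coord i t 0 + insert_coord i 0 z) has_derivative (\<lambda>h. 0 + insert_coord i 0 h)) (at z)"
    by (intro has_derivative_add has_derivative_const bounded_linear_imp_has_derivative[OF bl])
  then have d: "((\<lambda>z. insert_coord i t z) has_derivative (\<lambda>h. insert_coord i 0 h)) (at z)"
    unfolding eq by simp
  have "((\<lambda>z. u (insert_coord i t z)) has_derivative (\<lambda>h. insert_coord i 0 h \<bullet> Du (insert_coord i t z))) (at z)"
    by (rule has_derivative_compose[OF d]) (use C1_onD(1)[OF u] in \<open>simp add: gderiv_def\<close>)
  moreover have "insert_coord i 0 h \<bullet> D = h \<bullet> bar i D" for h D
    using exhaust_3[of i] by (auto simp: insert_coord_def bar_def inner_vec_def sum_2 sum_3)
  ultimately show "GDERIV (\<lambda>z. u (insert_coord i t z)) z :> bar i (Du (insert_coord i t z))"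
    by (simp add: gderiv_def)
  show "continuous_on UNIV (\<lambda>z. bar i (Du (insert_coord i t z)))"
    by (intro continuous_intros continuous_on_compose2[OF C1_onD(2)[OF u]]) auto
qed

text \<open>The same reduction with the axial integral outermost, the order required when an
  estimate acts inside the cross-sections.\<close>

lemma cylinder_fubini':
  fixes f :: "real^3 \<Rightarrow> real"
  assumes "set_integrable lborel (cylinder i a b R) f"
  shows "(LINT x:cylinder i a b R|lborel. f x) = (LINT t:{a<..<b}|lborel. (LINT z:ball 0 R|lborel. f (insert_coord i t z)))"
    and "set_integrable lborel {a<..<b} (\<lambda>t. LINT z:ball 0 R|lborel. f (insert_coord i t z))"
proof -
  let ?f = "\<lambda>x. indicator (cylinder i a b R) x *\<^sub>R f x"
  note F = fubini_insert_coord[OF assms[unfolded set_integrable_def], of i]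
  have eq: "(\<integral>z. ?f (insert_coord i t z) \<partial>lborel) = indicator {a<..<b} t *\<^sub>R (LINT z:ball 0 R|lborel. f (insert_coord i t z))" for t
    by (simp add: set_lebesgue_integral_def indicator_cylinder mult_ac flip: integral_mult_right_zero)
  have "(LINT x:cylinder i a b R|lborel. f x) = (\<integral>t. (\<integral>z. ?f (insert_coord i t z) \<partial>lborel) \<partial>lborel)"
    unfolding set_lebesgue_integral_def F(1) by (rule lborel_pair.Fubini_integral[OF F(3)])
  then show "(LINT x:cylinder i a b R|lborel. f x) = (LINT t:{a<..<b}|lborel. (LINT z:ball 0 R|lborel. f (insert_coord i t z)))"
    unfolding eq by (simp add: set_lebesgue_integral_def)
  show "set_integrable lborel {a<..<b} (\<lambda>t. LINT z:ball 0 R|lborel. f (insert_coord i t z))"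
    using lborel_pair.integrable_fst[OF F(3)] unfolding eq set_integrable_def .
qed

text \<open>\<open>circle_trace\<close> is applied in every cross-section and integrated along the
  axis. The factor \<open>R\<close> on the left is the density of the surface measure; dividing by
  R^2 leaves the factor 1/R that a thin cylinder costs.\<close>

lemma lateral_trace:
  assumes u: "C1_on UNIV u Du" and R: "0 < R"
  shows "set_integrable lborel ({a<..<b} \<times> {0..<2*pi}) (\<lambda>p. (u (insert_coord i (fst p) (R *\<^sub>R vector [cos (snd p), sin (snd p)])))\<^sup>2)"
    and "R * (LINT p:({a<..<b} \<times> {0..<2*pi})|lborel. (u (insert_coord i (fst p) (R *\<^sub>R vector [cos (snd p), sin (snd p)])))\<^sup>2)
    \<le> (1 / R) * (LINT x:cylinder i a b R|lborel. 3 * (u x)\<^sup>2 + R\<^sup>2 * (norm (Du x))\<^sup>2)"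
proof -
  define e :: "real \<Rightarrow> real^2" where "e \<theta> = vector [cos \<theta>, sin \<theta>]" for \<theta>
  have ce [continuous_intros]: "continuous_on S f \<Longrightarrow> continuous_on S (\<lambda>x. e (f x))" for S :: "'a::t2_space set" and f
    unfolding e_def by (intro continuous_intros)
  have cu [continuous_intros]: "continuous_on S f \<Longrightarrow> continuous_on S (\<lambda>x. u (f x))" for S :: "'a::t2_space set" and f
    by (rule continuous_on_compose2[OF C1_on_continuous[OF u]]) auto
  have cDu [continuous_intros]: "continuous_on S f \<Longrightarrow> continuous_on S (\<lambda>x. Du (f x))" for S :: "'a::t2_space set" and f
    by (rule continuous_on_compose2[OF C1_onD(2)[OF u]]) auto
  define g where "g t \<theta> = (u (insert_coord i t (R *\<^sub>R e \<theta>)))\<^sup>2" for t \<theta>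
  have cg [continuous_intros]: "continuous_on S f \<Longrightarrow> continuous_on S h \<Longrightarrow> continuous_on S (\<lambda>x. g (f x) (h x))" for S :: "'a::t2_space set" and f h
    unfolding g_def by (intro continuous_intros)
  define \<phi> where "\<phi> x = 3 * (u x)\<^sup>2 + R\<^sup>2 * (norm (Du x))\<^sup>2" for x
  have c\<phi> [continuous_intros]: "continuous_on S f \<Longrightarrow> continuous_on S (\<lambda>x. \<phi> (f x))" for S :: "'a::t2_space set" and f
    unfolding \<phi>_def by (intro continuous_intros)
  have "set_integrable lborel ({a..b} \<times> {0..2*pi}) (\<lambda>p. g (fst p) (snd p))"
    unfolding set_integrable_def
    by (intro borel_integrable_compact compact_Times compact_Icc continuous_intros)
  moreover have meas: "{a<..<b} \<times> {0..<2*pi} \<in> sets lborel" by (simp add: borel_Times)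
  ultimately have i: "set_integrable lborel ({a<..<b} \<times> {0..<2*pi}) (\<lambda>p. g (fst p) (snd p))"
    by (rule set_integrable_subset) auto
  then show "set_integrable lborel ({a<..<b} \<times> {0..<2*pi}) (\<lambda>p. (u (insert_coord i (fst p) (R *\<^sub>R vector [cos (snd p), sin (snd p)])))\<^sup>2)"
    by (simp add: g_def e_def)
  have ip: "integrable (lborel \<Otimes>\<^sub>M lborel) (\<lambda>(t, \<theta>). indicator {a<..<b} t * (indicator {0..<2*pi} \<theta> * g t \<theta>))"
    using i unfolding set_integrable_def lborel_prod
    by (rule Bochner_Integration.integrable_cong[THEN iffD1, rotated -1]) (auto simp: indicator_def)
  have eq: "(LINT p:({a<..<b} \<times> {0..<2*pi})|lborel. g (fst p) (snd p)) = (LINT t:{a<..<b}|lborel. (LINT \<theta>:{0..<2*pi}|lborel. g t \<theta>))"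
  proof -
    have "(LINT p:({a<..<b} \<times> {0..<2*pi})|lborel. g (fst p) (snd p))
      = (\<integral>(t, \<theta>). indicator {a<..<b} t * (indicator {0..<2*pi} \<theta> * g t \<theta>) \<partial>(lborel \<Otimes>\<^sub>M lborel))"
      unfolding set_lebesgue_integral_def lborel_prod
      by (intro Bochner_Integration.integral_cong) (auto simp: indicator_def)
    also have "\<dots> = (\<integral>t. (\<integral>\<theta>. indicator {a<..<b} t * (indicator {0..<2*pi} \<theta> * g t \<theta>) \<partial>lborel) \<partial>lborel)"
      by (rule lborel_pair.integral_fst[OF ip, symmetric])
    finally show ?thesis by (simp add: set_lebesgue_integral_def)
  qed
  have ig: "set_integrable lborel {a<..<b} (\<lambda>t. LINT \<theta>:{0..<2*pi}|lborel. g t \<theta>)"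
    using lborel_pair.integrable_fst[OF ip] by (simp add: set_integrable_def set_lebesgue_integral_def)
  have i\<phi>: "set_integrable lborel (cylinder i a b R) \<phi>"
    by (rule set_integrable_cylinder) (intro continuous_intros)
  have circ: "R\<^sup>2 * (LINT \<theta>:{0..<2*pi}|lborel. g t \<theta>) \<le> (LINT z:ball 0 R|lborel. \<phi> (insert_coord i t z))" for t
  proof -
    have "(LINT \<theta>:{0..<2*pi}|lborel. g t \<theta>) = (LINT \<theta>:{0<..<2*pi}|lborel. g t \<theta>)"
      unfolding set_lebesgue_integral_def
    proof (rule integral_cong_AE)
      show "AE \<theta> in lborel. indicator {0..<2*pi} \<theta> *\<^sub>R g t \<theta> = indicator {0<..<2*pi} \<theta> *\<^sub>R g t \<theta>"
        using AE_lborel_singleton[of 0] by eventually_elim (auto simp: indicator_def)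
      have "g t \<in> borel_measurable borel" by (intro borel_measurable_continuous_onI continuous_intros)
      then show "(\<lambda>\<theta>. indicator {0..<2*pi} \<theta> *\<^sub>R g t \<theta>) \<in> borel_measurable lborel"
        "(\<lambda>\<theta>. indicator {0<..<2*pi} \<theta> *\<^sub>R g t \<theta>) \<in> borel_measurable lborel" by auto
    qed
    moreover have "R\<^sup>2 * (LINT \<theta>:{0<..<2*pi}|lborel. g t \<theta>)
      \<le> (LINT z:ball 0 R|lborel. 3 * (u (insert_coord i t z))\<^sup>2 + R\<^sup>2 * (norm (bar i (Du (insert_coord i t z))))\<^sup>2)"
      using circle_trace[OF C1_on_slice[OF u] R] by (simp add: g_def e_def)
    moreover have "\<dots> \<le> (LINT z:ball 0 R|lborel. \<phi> (insert_coord i t z))"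
      by (intro set_integral_mono set_integrable_ball continuous_intros)
        (simp add: \<phi>_def norm_bar_le power_mono mult_left_mono)
    ultimately show ?thesis by simp
  qed
  have "(LINT t:{a<..<b}|lborel. R\<^sup>2 * (LINT \<theta>:{0..<2*pi}|lborel. g t \<theta>)) \<le> (LINT t:{a<..<b}|lborel. (LINT z:ball 0 R|lborel. \<phi> (insert_coord i t z)))"
    using circ ig cylinder_fubini'(2)[OF i\<phi>] by (intro set_integral_mono) auto
  then have "R\<^sup>2 * (LINT p:({a<..<b} \<times> {0..<2*pi})|lborel. g (fst p) (snd p)) \<le> (LINT x:cylinder i a b R|lborel. \<phi> x)"
    unfolding eq cylinder_fubini'(1)[OF i\<phi>] by simp
  moreover have "R * G \<le> 1 / R * P" if "R\<^sup>2 * G \<le> P" for G P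
    using that R by (simp add: power2_eq_square field_simps)
  ultimately show "R * (LINT p:({a<..<b} \<times> {0..<2*pi})|lborel. (u (insert_coord i (fst p) (R *\<^sub>R vector [cos (snd p), sin (snd p)])))\<^sup>2)
    \<le> (1 / R) * (LINT x:cylinder i a b R|lborel. 3 * (u x)\<^sup>2 + R\<^sup>2 * (norm (Du x))\<^sup>2)"
    by (simp add: g_def e_def \<phi>_def)
qed

section \<open>Flux through flat faces\<close>

lemma C1_on_prod:
  assumes "finite I" "\<And>i. i \<in> I \<Longrightarrow> C1_on S (f i) (F i)"
  shows "C1_on S (\<lambda>x. \<Prod>i\<in>I. f i x) (\<lambda>x. \<Sum>i\<in>I. (\<Prod>j\<in>I-{i}. f j x) *\<^sub>R F i x)"
  using assms
proof (induction I rule: finite_induct)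
  case empty
  then show ?case using C1_on_const[of S 1] by simp
next
  case (insert k I)
  have "C1_on S (\<lambda>x. f k x * (\<Prod>i\<in>I. f i x))
    (\<lambda>x. f k x *\<^sub>R (\<Sum>i\<in>I. (\<Prod>j\<in>I-{i}. f j x) *\<^sub>R F i x) + (\<Prod>i\<in>I. f i x) *\<^sub>R F k x)"
    using insert by (intro C1_on_mult) auto
  moreover have "(\<Sum>i\<in>insert k I. (\<Prod>j\<in>insert k I-{i}. f j x) *\<^sub>R F i x)
    = f k x *\<^sub>R (\<Sum>i\<in>I. (\<Prod>j\<in>I-{i}. f j x) *\<^sub>R F i x) + (\<Prod>i\<in>I. f i x) *\<^sub>R F k x" for x
  proof -
    have "(\<Prod>j\<in>insert k I-{i}. f j x) = f k x * (\<Prod>j\<in>I-{i}. f j x)" if "i \<in> I" for i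
    proof -
      have "insert k I - {i} = insert k (I - {i})" using insert.hyps that by auto
      then show ?thesis using insert.hyps by simp
    qed
    moreover have "insert k I - {k} = I" using insert.hyps by auto
    ultimately show ?thesis using insert.hyps by (simp add: scaleR_sum_right add.commute cong: sum.cong)
  qed
  moreover have "(\<lambda>x. \<Prod>i\<in>insert k I. f i x) = (\<lambda>x. f k x * (\<Prod>i\<in>I. f i x))"
    using insert.hyps by simp
  ultimately show ?case by (simp only:)
qed

text \<open>Total mass 1 is the reason why a thin layer below a face reproduces exactly the flux
  through that face.\<close>

lemma integral_step': "(\<integral>s. step' (s - 1) \<partial>lborel) = 1"
proof -
  have "(\<integral>s. step' (s - 1) \<partial>lborel) = (LINT s:{1..2}|lborel. step' (s - 1))"
    unfolding set_lebesgue_integral_def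
  proof (intro Bochner_Integration.integral_cong refl)
    fix s :: real
    show "step' (s - 1) = indicator {1..2} s *\<^sub>R step' (s - 1)"
      using step'_eq[of "s - 1"] by (cases "s \<in> {1..2}") auto
  qed
  also have "\<dots> = step (2 - 1) - step (1 - 1)"
    unfolding set_lebesgue_integral_def
  proof (rule integral_FTC_Icc)
    fix x :: real
    have "DERIV (\<lambda>s. step (s - 1)) x :> step' (x - 1)"
      by (rule DERIV_chain2[OF DERIV_step, THEN DERIV_cong]) (auto intro!: derivative_eq_intros)
    then show "((\<lambda>s. step (s - 1)) has_vector_derivative step' (x - 1)) (at x within {1..2})"
      by (simp add: has_real_derivative_iff_has_vector_derivative has_vector_derivative_at_within)
  qed (auto simp: step'_def intro!: continuous_intros)
  finally show ?thesis by (simp add: step_eq)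
qed

text \<open>Discards the rims of the discs, where the pointwise limit in the face layer is not
  determined.\<close>

lemma AE_norm_neq:
  fixes r :: real
  shows "AE z::real^2 in lborel. norm z \<noteq> r"
proof -
  have "negligible (sphere (0::real^2) r)" by (rule negligible_sphere)
  then have "sphere (0::real^2) r \<in> null_sets lebesgue" by (simp add: negligible_iff_null_sets)
  then have "sphere (0::real^2) r \<in> null_sets lborel"
    by (simp add: null_sets_completion_iff)
  then show ?thesis by (rule AE_not_in[THEN AE_mp]) (auto intro!: AE_I2 simp: dist_norm)
qed

text \<open>\<open>disc\<close> says that the domain fills a half ball below every point of an open
  disc, \<open>V_disc\<close> gives only the normal velocity there, and \<open>no_flux_side\<close>
  treats the points below all face planes. On the rims of the discs nothing is prescribed for the
  field. The bound \<open>h i \<le> l0\<close> keeps an open disc strictly below the other two face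
  planes.\<close>

locale node_flux = solenoidal +
  fixes l0 :: real and h \<v> :: "3 \<Rightarrow> real"
  assumes l0: "0 < l0" and h: "\<And>i. 0 < h i" "\<And>i. h i \<le> l0"
    and below: "\<And>x i. x \<in> \<Xi> \<Longrightarrow> x $ i < l0"
    and face: "\<And>x i. x \<in> closure \<Xi> \<Longrightarrow> x $ i = l0 \<Longrightarrow> norm (bar i x) \<le> h i"
    and disc: "\<And>x i. x $ i = l0 \<Longrightarrow> norm (bar i x) < h i \<Longrightarrow>
       \<exists>d>0. \<forall>y. dist y x < d \<longrightarrow> y $ i < l0 \<longrightarrow> y \<in> \<Xi>"
    and V_disc: "\<And>x i. x $ i = l0 \<Longrightarrow> norm (bar i x) < h i \<Longrightarrow> ((\<lambda>y. V y $ i) \<longlongrightarrow> \<v> i) (at x within \<Xi>)"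
    and no_flux_side: "\<And>x. x \<in> closure \<Xi> \<Longrightarrow> (\<And>i. x $ i < l0) \<Longrightarrow> no_flux_at x"
begin

text \<open>For positive \<tau> it vanishes up to distance \<tau> below the face plane and equals 1
  from distance 2 \<tau> on.\<close>

definition cut :: "real \<Rightarrow> 3 \<Rightarrow> real^3 \<Rightarrow> real" where
  "cut \<tau> i x = step ((l0 - x $ i) / \<tau> - 1)"

text \<open>Minus the derivative of \<open>cut\<close> in its own direction; the sign makes it
  nonnegative for positive \<tau>.\<close>

definition cut' :: "real \<Rightarrow> 3 \<Rightarrow> real^3 \<Rightarrow> real" where
  "cut' \<tau> i x = step' ((l0 - x $ i) / \<tau> - 1) / \<tau>"

lemma C1_on_cut: "C1_on UNIV (cut \<tau> i) (\<lambda>x. - cut' \<tau> i x *\<^sub>R axis i 1)"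
proof -
  have "C1_on UNIV (\<lambda>x. step (((1 / \<tau>) * (l0 - x $ i)) - 1))
     (\<lambda>x. step' (((1 / \<tau>) * (l0 - x $ i)) - 1) *\<^sub>R (((1 / \<tau>) *\<^sub>R (0 - axis i 1) + (l0 - x $ i) *\<^sub>R 0) - 0))"
    by (rule C1_on_step C1_on_diff C1_on_mult C1_on_const C1_on_nth)+
  then show ?thesis by (simp add: cut_def[abs_def] cut'_def)
qed

text \<open>The variable s = (l0 - x_i) / \<tau> stretches the layer to the fixed interval from 1 to
  2, and its Jacobian cancels the factor 1/\<tau> of \<open>cut'\<close>. Over the open disc the
  normal velocity tends to \<open>\<v> i\<close> and the other two cutoffs become 1; off the closed
  disc the stretched points eventually leave the domain. Dominated convergence does the rest, in
  \<open>s\<close> and then in the cross-section.\<close>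

lemma face_limit:
  assumes c\<phi>: "continuous_on UNIV \<phi>"
  shows "(\<lambda>n. LINT x:\<Xi>|lborel. (\<Prod>j\<in>UNIV-{i}. cut (1 / real (Suc n)) j x) * cut' (1 / real (Suc n)) i x * \<phi> x * V x $ i)
    \<longlonglongrightarrow> \<v> i * (LINT z:ball 0 (h i)|lborel. \<phi> (insert_coord i l0 z))"
proof -
  obtain R where R: "\<Xi> \<subseteq> cball 0 R" "0 < R"
    using bounded_subset_ballD[OF bounded_dom, of 0] ball_subset_cball by blast
  have "compact (\<phi> ` cball 0 R)" by (intro compact_continuous_image continuous_on_subset[OF c\<phi>]) auto
  then obtain M where M: "\<And>x. x \<in> cball 0 R \<Longrightarrow> norm (\<phi> x) \<le> M"
    using compact_imp_bounded bounded_iff by (metis imageI)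
  have M0: "0 \<le> M" using M[of 0] R(2) by (auto intro: order_trans[OF norm_ge_zero])
  define \<tau> where "\<tau> n = 1 / real (Suc n)" for n
  have \<tau>: "0 < \<tau> n" for n by (simp add: \<tau>_def)
  have \<tau>0: "\<tau> \<longlonglongrightarrow> 0" unfolding \<tau>_def[abs_def] by (rule LIMSEQ_Suc[OF lim_1_over_n])
  define P where "P n x = (\<Prod>j\<in>UNIV-{i}. cut (\<tau> n) j x)" for n x
  have P01: "0 \<le> P n x" "P n x \<le> 1" for n x
    unfolding P_def using step_bounds by (auto simp: cut_def intro!: prod_nonneg prod_le_1)
  define G where "G n x = P n x * cut' (\<tau> n) i x * \<phi> x * V x $ i" for n x
  define X where "X n s z = insert_coord i (l0 - \<tau> n * s) z" for n s z
  \<comment> \<open>\<open>H n\<close> is \<open>G n\<close> in the stretched variable, multiplied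
    by the Jacobian; it is bounded and supported in \<open>s\<close> between 1 and 2, uniformly in
    \<open>n\<close>.\<close>
  define H where "H n s z = indicator \<Xi> (X n s z) * (P n (X n s z) * step' (s - 1) * \<phi> (X n s z) * V (X n s z) $ i)" for n s z
  have cG: "continuous_on \<Xi> (G n)" for n
    unfolding G_def P_def cut_def[abs_def] cut'_def
    using \<tau>[of n] DERIV_continuous_on[OF DERIV_step]
    by (intro continuous_intros continuous_on_subset[OF c\<phi>] continuous_V
        continuous_on_compose2[OF continuous_step'[of UNIV]] continuous_on_compose2[OF DERIV_continuous_on[OF DERIV_step]]) auto
  have Vb: "\<bar>V x $ j\<bar> \<le> B" if "x \<in> \<Xi>" for x j
    using component_le_norm_cart[of "V x" j] V_bound[OF that] by linarith
  have iG: "set_integrable lborel \<Xi> (G n)" for n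
  proof (rule set_integrable_bounded_continuous[OF cG open_dom bounded_dom])
    fix x assume x: "x \<in> \<Xi>"
    have "norm (G n x) = P n x * cut' (\<tau> n) i x * \<bar>\<phi> x\<bar> * \<bar>V x $ i\<bar>"
      using P01[of n x] step'_bounds \<tau>[of n] by (simp add: G_def abs_mult cut'_def)
    also have "\<dots> \<le> 1 * (2 / \<tau> n) * M * B"
      using P01[of n x] step'_bounds[of "(l0 - x $ i) / \<tau> n - 1"] \<tau>[of n] Vb[OF x, of i] M[of x] x R M0
      by (intro mult_mono mult_nonneg_nonneg) (auto simp: cut'_def divide_right_mono)
    finally show "norm (G n x) \<le> 1 * (2 / \<tau> n) * M * B" .
  qed
  have GH: "(LINT x:\<Xi>|lborel. G n x) = (\<integral>z. (\<integral>s. H n s z \<partial>lborel) \<partial>lborel)"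
    and iH: "integrable lborel (\<lambda>z. \<integral>s. H n s z \<partial>lborel)" for n
  proof -
    note F = fubini_insert_coord[OF iG[of n, unfolded set_integrable_def], of i]
    have inner: "(\<integral>t. indicator \<Xi> (insert_coord i t z) *\<^sub>R G n (insert_coord i t z) \<partial>lborel) = (\<integral>s. H n s z \<partial>lborel)" for z
    proof -
      have "(\<integral>t. indicator \<Xi> (insert_coord i t z) *\<^sub>R G n (insert_coord i t z) \<partial>lborel)
        = \<bar>- \<tau> n\<bar> *\<^sub>R (\<integral>s. indicator \<Xi> (insert_coord i (l0 + - \<tau> n * s) z) *\<^sub>R G n (insert_coord i (l0 + - \<tau> n * s) z) \<partial>lborel)"
        using \<tau>[of n] by (intro lborel_integral_real_affine) auto
      also have "\<dots> = (\<integral>s. H n s z \<partial>lborel)"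
        unfolding integral_scaleR_right[symmetric]
        by (intro Bochner_Integration.integral_cong) (use \<tau>[of n] in \<open>auto simp: H_def G_def X_def cut'_def mult_ac\<close>)
      finally show ?thesis .
    qed
    show "(LINT x:\<Xi>|lborel. G n x) = (\<integral>z. (\<integral>s. H n s z \<partial>lborel) \<partial>lborel)"
      using F(1) unfolding set_lebesgue_integral_def inner .
    show "integrable lborel (\<lambda>z. \<integral>s. H n s z \<partial>lborel)"
      using F(2) unfolding inner .
  qed
  define W where "W = M * B"
  have W0: "0 \<le> W" unfolding W_def using M0 B_nonneg by simp
  have Hb: "\<bar>H n s z\<bar> \<le> indicator {1..2} s * (2 * W)" for n s z
  proof (cases "X n s z \<in> \<Xi> \<and> s \<in> {1..2}")
    case True
    have xR: "X n s z \<in> cball 0 R" using R(1) True by blast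
    have "\<bar>H n s z\<bar> = P n (X n s z) * step' (s - 1) * \<bar>\<phi> (X n s z)\<bar> * \<bar>V (X n s z) $ i\<bar>"
      using True P01[of n "X n s z"] step'_bounds by (simp add: H_def abs_mult)
    also have "\<dots> \<le> 1 * 2 * M * B"
      using P01[of n "X n s z"] step'_bounds[of "s - 1"] Vb[OF conjunct1[OF True], of i] M[OF xR] M0
      by (intro mult_mono mult_nonneg_nonneg) auto
    finally show ?thesis using True by (simp add: W_def)
  next
    case False
    then have "H n s z = 0" by (auto simp: H_def step'_eq)
    then show ?thesis using W0 by simp
  qed
  have H0: "H n s z = 0" if "norm z > R" for n s z
  proof -
    have "norm (X n s z) > R" using that norm_bar_le[of i "X n s z"] by (simp add: X_def)
    then have "X n s z \<notin> \<Xi>" using R by auto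
    then show ?thesis by (simp add: H_def)
  qed
  have iW: "integrable lborel (\<lambda>s::real. indicator {1..2} s * (2 * W))"
    by (simp add: integrable_real_indicator)
  have intW: "(\<integral>s. indicator {1..2::real} s * (2 * W) \<partial>lborel) = 2 * W" by simp
  have Hm: "(\<lambda>s. H n s z) \<in> borel_measurable lborel" for n z
  proof -
    have "(\<lambda>x. indicator \<Xi> x *\<^sub>R G n x) \<in> borel_measurable borel"
      using iG[of n] by (auto simp: set_integrable_def)
    moreover have "(\<lambda>s. X n s z) \<in> borel_measurable borel"
      unfolding X_def by (intro borel_measurable_continuous_onI continuous_intros)
    ultimately have "(\<lambda>s. indicator \<Xi> (X n s z) *\<^sub>R G n (X n s z)) \<in> borel_measurable borel"
      using measurable_compose by blast
    then have "(\<lambda>s. \<tau> n * (indicator \<Xi> (X n s z) *\<^sub>R G n (X n s z))) \<in> borel_measurable borel"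
      by (intro borel_measurable_times borel_measurable_const)
    moreover have "(\<lambda>s. \<tau> n * (indicator \<Xi> (X n s z) *\<^sub>R G n (X n s z))) = (\<lambda>s. H n s z)"
      using \<tau>[of n] by (simp add: H_def G_def X_def cut'_def fun_eq_iff)
    ultimately show ?thesis by simp
  qed
  have inner_lim: "(\<lambda>n. \<integral>s. H n s z \<partial>lborel) \<longlonglongrightarrow> indicator (ball 0 (h i)) z *\<^sub>R (\<v> i * \<phi> (insert_coord i l0 z))"
    if z: "norm z \<noteq> h i" for z
  proof -
    have Xlim: "(\<lambda>n. X n s z) \<longlonglongrightarrow> insert_coord i l0 z" for s
    proof -
      have "(\<lambda>n. insert_coord i 0 z + (l0 - \<tau> n * s) *\<^sub>R axis i 1) \<longlonglongrightarrow> insert_coord i 0 z + (l0 - 0 * s) *\<^sub>R axis i 1"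
        by (intro tendsto_intros \<tau>0)
      then show ?thesis unfolding X_def insert_coord_eq[of i "_ - _" z] insert_coord_eq[of i l0 z] by simp
    qed
    have "(\<lambda>n. \<integral>s. H n s z \<partial>lborel) \<longlonglongrightarrow> (\<integral>s. indicator (ball 0 (h i)) z * (\<v> i * \<phi> (insert_coord i l0 z)) * step' (s - 1) \<partial>lborel)"
    proof (rule integral_dominated_convergence[OF _ Hm iW])
      show "(\<lambda>s. indicator (ball 0 (h i)) z * (\<v> i * \<phi> (insert_coord i l0 z)) * step' (s - 1)) \<in> borel_measurable lborel"
        unfolding measurable_lborel2 step'_def by (intro borel_measurable_continuous_onI continuous_intros)
      show "AE s in lborel. norm (H n s z) \<le> indicator {1..2} s * (2 * W)" for n
        using Hb by (intro AE_I2) simp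
      show "AE s in lborel. (\<lambda>n. H n s z) \<longlonglongrightarrow> indicator (ball 0 (h i)) z * (\<v> i * \<phi> (insert_coord i l0 z)) * step' (s - 1)"
      proof (rule AE_I2)
        fix s
        show "(\<lambda>n. H n s z) \<longlonglongrightarrow> indicator (ball 0 (h i)) z * (\<v> i * \<phi> (insert_coord i l0 z)) * step' (s - 1)"
        proof (cases "s \<le> 1")
          case True
          then show ?thesis by (simp add: H_def step'_eq)
        next
          case s: False
          show ?thesis
          proof (cases "norm z < h i")
            case True
            let ?x = "insert_coord i l0 z"
            obtain d where d: "d > 0" "\<And>y. dist y ?x < d \<Longrightarrow> y $ i < l0 \<Longrightarrow> y \<in> \<Xi>"
              using disc[of ?x i] True by auto
            have ev\<Xi>: "\<forall>\<^sub>F n in sequentially. X n s z \<in> \<Xi>"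
              using tendstoD[OF Xlim[of s] d(1)]
            proof eventually_elim
              case (elim n)
              have "X n s z $ i < l0" using s \<tau>[of n] by (simp add: X_def)
              then show ?case using d elim by blast
            qed
            have "filterlim (\<lambda>n. X n s z) (at ?x within \<Xi>) sequentially"
              unfolding at_within_def filterlim_inf filterlim_principal
            proof (intro conjI Xlim)
              show "\<forall>\<^sub>F n in sequentially. X n s z \<in> \<Xi> - {?x}"
                using ev\<Xi> by eventually_elim (use below[of ?x i] in auto)
            qed
            then have Vl: "(\<lambda>n. V (X n s z) $ i) \<longlonglongrightarrow> \<v> i"
              using filterlim_compose[OF V_disc[of ?x i]] True by simp
            have \<phi>l: "(\<lambda>n. \<phi> (X n s z)) \<longlonglongrightarrow> \<phi> ?x"
              by (rule continuous_on_tendsto_compose[OF c\<phi> Xlim]) auto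
            \<comment> \<open>The other coordinates are bounded by the norm of \<open>z\<close>,
              hence strictly below \<open>h i \<le> l0\<close>, and they do not change with
              \<open>n\<close>.\<close>
            have cutl: "\<forall>\<^sub>F n in sequentially. cut (\<tau> n) j (X n s z) = 1" if "j \<noteq> i" for j
            proof -
              have Xj: "X n s z $ j = ?x $ j" for n
                using that unfolding X_def insert_coord_eq[of i "_ - _" z] insert_coord_eq[of i l0 z]
                by (simp add: axis_def)
              have "\<bar>?x $ j\<bar> \<le> norm (bar i ?x)" using that by (rule abs_nth_le_norm_bar)
              then have pos: "0 < (l0 - ?x $ j) / 2" using True h(2)[of i] by simp
              have "\<forall>\<^sub>F n in sequentially. \<tau> n < (l0 - ?x $ j) / 2"
                using order_tendstoD(2)[OF \<tau>0 pos] .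
              then show ?thesis
              proof eventually_elim
                case (elim n)
                then have "(l0 - X n s z $ j) / \<tau> n - 1 \<ge> 1" using \<tau>[of n] by (simp add: Xj field_simps)
                then show ?case unfolding cut_def by (rule step_eq(2))
              qed
            qed
            have "\<forall>\<^sub>F n in sequentially. \<forall>j\<in>UNIV-{i}. cut (\<tau> n) j (X n s z) = 1"
              by (rule eventually_ball_finite) (use cutl in auto)
            then have P1: "\<forall>\<^sub>F n in sequentially. P n (X n s z) = 1"
              by eventually_elim (simp add: P_def)
            have "(\<lambda>n. 1 * (1 * step' (s - 1) * \<phi> (X n s z) * V (X n s z) $ i)) \<longlonglongrightarrow> 1 * (1 * step' (s - 1) * \<phi> ?x * \<v> i)"
              by (intro tendsto_intros \<phi>l Vl)
            moreover have "\<forall>\<^sub>F n in sequentially. 1 * (1 * step' (s - 1) * \<phi> (X n s z) * V (X n s z) $ i) = H n s z"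
              using ev\<Xi> P1 by eventually_elim (simp add: H_def)
            ultimately have "(\<lambda>n. H n s z) \<longlonglongrightarrow> 1 * (1 * step' (s - 1) * \<phi> ?x * \<v> i)"
              by (rule Lim_transform_eventually)
            then show ?thesis using True by (simp add: mult_ac)
          next
            case False
            let ?x = "insert_coord i l0 z"
            \<comment> \<open>Here \<open>norm z\<close> exceeds \<open>h i\<close>, since equality
              was excluded; the point therefore lies off the closed face.\<close>
            have "?x \<notin> closure \<Xi>" using face[of ?x i] z False by auto
            then have "?x \<in> - closure \<Xi>" by simp
            then have "\<forall>\<^sub>F n in sequentially. X n s z \<in> - closure \<Xi>"
              by (intro topological_tendstoD[OF Xlim]) auto
            then have "\<forall>\<^sub>F n in sequentially. H n s z = 0"
              by eventually_elim (use closure_subset[of \<Xi>] in \<open>auto simp: H_def indicator_def\<close>)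
            then show ?thesis using False by (simp add: tendsto_eventually)
          qed
        qed
      qed
    qed
    then show ?thesis by (simp add: integral_step')
  qed
  have "(\<lambda>n. \<integral>z. (\<integral>s. H n s z \<partial>lborel) \<partial>lborel) \<longlonglongrightarrow> (\<integral>z. indicator (ball 0 (h i)) z *\<^sub>R (\<v> i * \<phi> (insert_coord i l0 z)) \<partial>lborel)"
  proof (rule integral_dominated_convergence[where w = "\<lambda>z. indicator (cball 0 R) z * (2 * W)"])
    show "(\<lambda>z. indicator (ball 0 (h i)) z *\<^sub>R (\<v> i * \<phi> (insert_coord i l0 z))) \<in> borel_measurable lborel"
      unfolding measurable_lborel2
      by (rule borel_measurable_continuous_on_indicator)
        (auto intro!: continuous_intros continuous_on_compose2[OF c\<phi>])
    show "(\<lambda>z. \<integral>s. H n s z \<partial>lborel) \<in> borel_measurable lborel" for n using iH by auto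
    show "integrable lborel (\<lambda>z::real^2. indicator (cball 0 R) z * (2 * W))"
      using borel_integrable_compact[of "cball (0::real^2) R" "\<lambda>_. 2 * W"] by simp
    show "AE z in lborel. (\<lambda>n. \<integral>s. H n s z \<partial>lborel) \<longlonglongrightarrow> indicator (ball 0 (h i)) z *\<^sub>R (\<v> i * \<phi> (insert_coord i l0 z))"
      using AE_norm_neq[of "h i"] by eventually_elim (rule inner_lim)
    show "AE z in lborel. norm (\<integral>s. H n s z \<partial>lborel) \<le> indicator (cball 0 R) z * (2 * W)" for n
    proof (rule AE_I2)
      fix z :: "real^2"
      show "norm (\<integral>s. H n s z \<partial>lborel) \<le> indicator (cball 0 R) z * (2 * W)"
      proof (cases "norm z > R")
        case True
        then show ?thesis using H0[OF True] by simp
      next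
        case False
        have "integrable lborel (\<lambda>s. H n s z)"
          by (rule Bochner_Integration.integrable_bound[OF iW Hm]) (use Hb W0 in \<open>auto intro!: AE_I2 order_trans[OF Hb]\<close>)
        then have "norm (\<integral>s. H n s z \<partial>lborel) \<le> (\<integral>s. indicator {1..2::real} s * (2 * W) \<partial>lborel)"
          by (intro order_trans[OF integral_norm_bound] integral_mono iW) (use Hb in auto)
        then show ?thesis using False intW by simp
      qed
    qed
  qed
  then have "(\<lambda>n. LINT x:\<Xi>|lborel. G n x) \<longlonglongrightarrow> \<v> i * (LINT z:ball 0 (h i)|lborel. \<phi> (insert_coord i l0 z))"
    unfolding GH[symmetric] by (simp add: set_lebesgue_integral_def mult_ac flip: integral_mult_right_zero)
  then show ?thesis by (simp add: G_def P_def \<tau>_def)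
qed

text \<open>The product \<open>K n\<close> of the three cuts times \<open>\<phi>\<close> is
  supported away from all face planes and so has no flux by \<open>no_flux\<close>. Hence the flux
  weighted with \<open>K n\<close> equals the contributions of the three layers, and
  \<open>face_limit\<close> evaluates these as the layers shrink.\<close>

theorem flux_through_faces:
  assumes \<phi>: "C1_on UNIV \<phi> D\<phi>"
  shows "(LINT x:\<Xi>|lborel. V x \<bullet> D\<phi> x) = (\<Sum>i\<in>UNIV. \<v> i * (LINT z:ball 0 (h i)|lborel. \<phi> (insert_coord i l0 z)))"
proof -
  define \<tau> where "\<tau> n = 1 / real (Suc n)" for n
  have \<tau>: "0 < \<tau> n" for n by (simp add: \<tau>_def)
  have \<tau>0: "\<tau> \<longlonglongrightarrow> 0" unfolding \<tau>_def[abs_def] by (rule LIMSEQ_Suc[OF lim_1_over_n])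
  define K where "K n x = (\<Prod>i\<in>UNIV. cut (\<tau> n) i x)" for n x
  define DK where "DK n x = (\<Sum>i\<in>UNIV. (\<Prod>j\<in>UNIV-{i}. cut (\<tau> n) j x) *\<^sub>R (- cut' (\<tau> n) i x *\<^sub>R axis i (1::real)))" for n and x :: "real^3"
  have CK: "C1_on UNIV (K n) (DK n)" for n
    unfolding K_def[abs_def] DK_def[abs_def] by (rule C1_on_prod[OF finite]) (rule C1_on_cut)
  have c\<phi>: "continuous_on UNIV \<phi>" using \<phi> by (rule C1_on_continuous)
  have K01: "0 \<le> K n x" "K n x \<le> 1" for n x
    unfolding K_def using step_bounds by (auto simp: cut_def intro!: prod_nonneg prod_le_1)
  have zero: "(LINT x:\<Xi>|lborel. V x \<bullet> (K n x *\<^sub>R D\<phi> x + \<phi> x *\<^sub>R DK n x)) = 0" for n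
  proof (rule no_flux[OF C1_on_mult[OF CK \<phi>]])
    fix x assume x: "x \<in> closure \<Xi>" "x \<in> closure {y. K n y * \<phi> y \<noteq> 0}"
    show "no_flux_at x"
    proof (rule no_flux_side[OF x(1)])
      fix i
      \<comment> \<open>Where the product is nonzero, every coordinate is at most
        \<open>l0 - \<tau> n\<close>. This closed condition survives on the closure, which is what
        keeps the support off the face planes.\<close>
      have "{y. K n y * \<phi> y \<noteq> 0} \<subseteq> {y. y $ i \<le> l0 - \<tau> n}"
      proof
        fix y assume "y \<in> {y. K n y * \<phi> y \<noteq> 0}"
        then have "cut (\<tau> n) i y \<noteq> 0" by (auto simp: K_def)
        then have "\<not> (l0 - y $ i) / \<tau> n - 1 \<le> 0" using step_eq(1) unfolding cut_def by blast
        then show "y \<in> {y. y $ i \<le> l0 - \<tau> n}" using \<tau>[of n] by (simp add: field_simps)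
      qed
      moreover have "closed {y::real^3. y $ i \<le> l0 - \<tau> n}"
        by (intro closed_Collect_le continuous_intros)
      ultimately have "closure {y. K n y * \<phi> y \<noteq> 0} \<subseteq> {y. y $ i \<le> l0 - \<tau> n}"
        by (rule closure_minimal)
      then show "x $ i < l0" using x(2) \<tau>[of n] by auto
    qed
  qed
  define G where "G n i x = (\<Prod>j\<in>UNIV-{i}. cut (\<tau> n) j x) * cut' (\<tau> n) i x * \<phi> x * V x $ i" for n i x
  have iV: "set_integrable lborel \<Xi> (\<lambda>x. V x \<bullet> D\<phi> x)" by (rule integrable_V_inner[OF \<phi>])
  have iK: "set_integrable lborel \<Xi> (\<lambda>x. K n x * (V x \<bullet> D\<phi> x))" for n
  proof -
    have "integrable lborel (\<lambda>x. K n x * (indicator \<Xi> x *\<^sub>R (V x \<bullet> D\<phi> x)))"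
    proof (rule Bochner_Integration.integrable_bound[OF iV[unfolded set_integrable_def]])
      show "(\<lambda>x. K n x * (indicator \<Xi> x *\<^sub>R (V x \<bullet> D\<phi> x))) \<in> borel_measurable lborel"
        using iV borel_measurable_continuous_onI[OF C1_on_continuous[OF CK]]
        by (intro borel_measurable_times) (auto simp: set_integrable_def)
      show "AE x in lborel. norm (K n x * (indicator \<Xi> x *\<^sub>R (V x \<bullet> D\<phi> x))) \<le> norm (indicator \<Xi> x *\<^sub>R (V x \<bullet> D\<phi> x))"
        using K01 by (intro AE_I2) (auto simp: abs_mult intro!: mult_left_le_one_le)
    qed
    then show ?thesis by (simp add: set_integrable_def mult_ac)
  qed
  have iG: "set_integrable lborel \<Xi> (G n i)" for n i
  proof -
    define Q where "Q x = - ((\<Prod>j\<in>UNIV-{i}. cut (\<tau> n) j x) *\<^sub>R - cut' (\<tau> n) i x *\<^sub>R axis i (1::real))" for x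
    have "set_integrable lborel \<Xi> (\<lambda>x. V x \<bullet> (\<phi> x *\<^sub>R Q x))"
    proof -
      have c: "continuous_on UNIV (\<lambda>x. \<phi> x *\<^sub>R Q x)"
        unfolding Q_def by (intro continuous_intros c\<phi> C1_on_continuous[OF C1_on_cut])
          (use \<tau>[of n] in \<open>auto simp: cut'_def[abs_def] intro!: continuous_intros continuous_on_compose2[OF continuous_step'[of UNIV]]\<close>)
      have "compact ((\<lambda>x. \<phi> x *\<^sub>R Q x) ` closure \<Xi>)"
        using bounded_dom by (intro compact_continuous_image continuous_on_subset[OF c]) auto
      then obtain M where M: "\<And>x. x \<in> closure \<Xi> \<Longrightarrow> norm (\<phi> x *\<^sub>R Q x) \<le> M"
        using compact_imp_bounded bounded_iff by (metis (no_types, lifting) imageI)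
      show ?thesis
      proof (rule set_integrable_bounded_continuous[OF _ open_dom bounded_dom])
        show "continuous_on \<Xi> (\<lambda>x. V x \<bullet> (\<phi> x *\<^sub>R Q x))"
          using continuous_V continuous_on_subset[OF c] by (intro continuous_on_inner) auto
        fix x assume x: "x \<in> \<Xi>"
        show "norm (V x \<bullet> (\<phi> x *\<^sub>R Q x)) \<le> B * M"
          unfolding real_norm_def using V_bound[OF x] M[of x] x closure_subset[of \<Xi>] B_nonneg
          by (intro order_trans[OF Cauchy_Schwarz_ineq2] mult_mono) auto
      qed
    qed
    then show ?thesis by (simp add: G_def[abs_def] Q_def inner_axis mult_ac)
  qed
  have Keq: "(LINT x:\<Xi>|lborel. K n x * (V x \<bullet> D\<phi> x)) = (\<Sum>i\<in>UNIV. LINT x:\<Xi>|lborel. G n i x)" for n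
  proof -
    have "V x \<bullet> (K n x *\<^sub>R D\<phi> x + \<phi> x *\<^sub>R DK n x) = K n x * (V x \<bullet> D\<phi> x) - (\<Sum>i\<in>UNIV. G n i x)" for x
      by (simp add: DK_def G_def inner_add_right inner_diff_right inner_sum_right inner_axis sum_distrib_left sum_negf mult_ac)
    moreover have "set_integrable lborel \<Xi> (\<lambda>x. \<Sum>i\<in>UNIV. G n i x)"
      using iG[of n] unfolding set_integrable_def scaleR_sum_right
      by (intro Bochner_Integration.integrable_sum)
    note iS = this
    ultimately have "0 = (LINT x:\<Xi>|lborel. K n x * (V x \<bullet> D\<phi> x) - (\<Sum>i\<in>UNIV. G n i x))"
      using zero[of n] by simp
    also have "\<dots> = (LINT x:\<Xi>|lborel. K n x * (V x \<bullet> D\<phi> x)) - (LINT x:\<Xi>|lborel. (\<Sum>i\<in>UNIV. G n i x))"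
      by (intro set_integral_diff iK iS)
    also have "(LINT x:\<Xi>|lborel. (\<Sum>i\<in>UNIV. G n i x)) = (\<Sum>i\<in>UNIV. LINT x:\<Xi>|lborel. G n i x)"
      using iG unfolding set_lebesgue_integral_def set_integrable_def
      by (subst Bochner_Integration.integral_sum[symmetric]) (auto simp: sum_distrib_left)
    finally show ?thesis by simp
  qed
  have "(\<lambda>n. \<Sum>i\<in>UNIV. LINT x:\<Xi>|lborel. G n i x) \<longlonglongrightarrow> (\<Sum>i\<in>UNIV. \<v> i * (LINT z:ball 0 (h i)|lborel. \<phi> (insert_coord i l0 z)))"
    unfolding G_def \<tau>_def by (intro tendsto_sum face_limit c\<phi>)
  moreover have "(\<lambda>n. LINT x:\<Xi>|lborel. K n x * (V x \<bullet> D\<phi> x)) \<longlonglongrightarrow> (LINT x:\<Xi>|lborel. V x \<bullet> D\<phi> x)"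
    unfolding set_lebesgue_integral_def
  proof (rule integral_dominated_convergence[where w = "\<lambda>x. norm (indicator \<Xi> x *\<^sub>R (V x \<bullet> D\<phi> x))"])
    show "integrable lborel (\<lambda>x. norm (indicator \<Xi> x *\<^sub>R (V x \<bullet> D\<phi> x)))"
      using iV by (simp add: set_integrable_def)
    show "(\<lambda>x. indicator \<Xi> x *\<^sub>R (V x \<bullet> D\<phi> x)) \<in> borel_measurable lborel"
      using iV by (auto simp: set_integrable_def)
    show "(\<lambda>x. indicator \<Xi> x *\<^sub>R (K n x * (V x \<bullet> D\<phi> x))) \<in> borel_measurable lborel" for n
      using iK[of n] by (auto simp: set_integrable_def)
    show "AE x in lborel. norm (indicator \<Xi> x *\<^sub>R (K n x * (V x \<bullet> D\<phi> x))) \<le> norm (indicator \<Xi> x *\<^sub>R (V x \<bullet> D\<phi> x))" for n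
      using K01 by (intro AE_I2) (auto simp: abs_mult indicator_def intro!: mult_left_le_one_le)
    show "AE x in lborel. (\<lambda>n. indicator \<Xi> x *\<^sub>R (K n x * (V x \<bullet> D\<phi> x))) \<longlonglongrightarrow> indicator \<Xi> x *\<^sub>R (V x \<bullet> D\<phi> x)"
    proof (rule AE_I2)
      fix x
      show "(\<lambda>n. indicator \<Xi> x *\<^sub>R (K n x * (V x \<bullet> D\<phi> x))) \<longlonglongrightarrow> indicator \<Xi> x *\<^sub>R (V x \<bullet> D\<phi> x)"
      proof (cases "x \<in> \<Xi>")
        case True
        have "\<forall>\<^sub>F n in sequentially. cut (\<tau> n) j x = 1" for j
        proof -
          have pos: "0 < (l0 - x $ j) / 2" using below[OF True] by simp
          have "\<forall>\<^sub>F n in sequentially. \<tau> n < (l0 - x $ j) / 2"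
            using order_tendstoD(2)[OF \<tau>0 pos] .
          then show ?thesis
          proof eventually_elim
            case (elim n)
            then have "(l0 - x $ j) / \<tau> n - 1 \<ge> 1" using \<tau>[of n] by (simp add: field_simps)
            then show ?case unfolding cut_def by (rule step_eq(2))
          qed
        qed
        then have "\<forall>\<^sub>F n in sequentially. \<forall>j\<in>UNIV. cut (\<tau> n) j x = 1"
          by (intro eventually_ball_finite) auto
        then have "\<forall>\<^sub>F n in sequentially. indicator \<Xi> x *\<^sub>R (K n x * (V x \<bullet> D\<phi> x)) = indicator \<Xi> x *\<^sub>R (V x \<bullet> D\<phi> x)"
          by eventually_elim (simp add: K_def)
        then show ?thesis by (rule tendsto_eventually)
      qed simp
    qed
  qed
  ultimately show ?thesis unfolding Keq by (rule LIMSEQ_unique[rotated])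
qed

end

section \<open>Geometry of the junction\<close>

lemma gderiv_grad:
  assumes "f differentiable (at x)"
  shows "GDERIV f x :> grad f x"
proof -
  have D: "(f has_derivative frechet_derivative f (at x)) (at x)"
    using assms by (simp add: frechet_derivative_works)
  have lin: "linear (frechet_derivative f (at x))" by (rule has_derivative_linear[OF D])
  have "frechet_derivative f (at x) v = v \<bullet> grad f x" for v
  proof -
    have "frechet_derivative f (at x) v = frechet_derivative f (at x) (\<Sum>i\<in>UNIV. v $ i *\<^sub>R axis i 1)"
      by (simp add: basis_expansion scalar_mult_eq_scaleR[symmetric])
    also have "\<dots> = (\<Sum>i\<in>UNIV. v $ i *\<^sub>R frechet_derivative f (at x) (axis i 1))"
      using lin by (simp add: linear_sum linear_scale)
    also have "\<dots> = v \<bullet> grad f x"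
      by (simp add: inner_vec_def grad_def partial_def)
    finally show ?thesis .
  qed
  then have "frechet_derivative f (at x) = (\<lambda>v. v \<bullet> grad f x)" by (rule ext)
  then show ?thesis using D by (simp add: gderiv_def)
qed

lemma grad_eqI: "GDERIV f x :> D \<Longrightarrow> grad f x = D"
  using gderiv_grad gderiv_unique by (metis differentiable_def gderiv_def)

lemma C1_on_grad:
  assumes "\<And>x. x \<in> S \<Longrightarrow> f differentiable (at x)" "\<And>i. continuous_on S (partial i f)"
  shows "C1_on S f (grad f)"
  using assms gderiv_grad unfolding C1_on_def
  by (auto simp: grad_def[abs_def] intro!: continuous_on_vec_lambda)

lemma C_on_SucD:
  assumes "C_on (Suc k) S f"
  shows "x \<in> S \<Longrightarrow> f differentiable (at x)" "C_on k S (partial i f)"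
proof -
  have "axis i (1::real) \<in> Basis" by (auto simp: Basis_vec_def)
  then show "C_on k S (partial i f)" using assms by (auto simp: partial_def[abs_def])
  show "x \<in> S \<Longrightarrow> f differentiable (at x)" using assms by simp
qed

lemma C_on_continuous: "C_on k S f \<Longrightarrow> continuous_on S f"
  by (cases k) (auto intro!: differentiable_imp_continuous_on differentiable_at_imp_differentiable_on)

lemma C_on_C1_on: "C_on (Suc k) S f \<Longrightarrow> C1_on S f (grad f)"
  by (rule C1_on_grad) (use C_on_SucD C_on_continuous in blast)+

lemma smooth_on_C1_on: "smooth_on S f \<Longrightarrow> C1_on S f (grad f)"
  unfolding smooth_on_def using C_on_C1_on[of 0] by blast

lemma C_on_cong:
  assumes "open S" "C_on k S f" "\<And>x. x \<in> S \<Longrightarrow> f x = g x"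
  shows "C_on k S g"
  using assms(2,3)
proof (induction k arbitrary: f g)
  case 0
  then show ?case by (simp cong: continuous_on_cong)
next
  case (Suc k)
  have fd: "g differentiable (at x) \<and> frechet_derivative g (at x) = frechet_derivative f (at x)" if x: "x \<in> S" for x
  proof -
    have "(f has_derivative frechet_derivative f (at x)) (at x)"
      using Suc.prems x by (simp add: frechet_derivative_works)
    then have "(g has_derivative frechet_derivative f (at x)) (at x)"
      by (rule has_derivative_transform_within_open[OF _ assms(1) x]) (use Suc.prems in auto)
    then show ?thesis by (metis differentiable_def frechet_derivative_at)
  qed
  show ?case
    unfolding C_on.simps
  proof (intro conjI ballI)
    fix b :: 'a assume "b \<in> Basis"
    then have "C_on k S (\<lambda>x. frechet_derivative f (at x) b)" using Suc.prems by simp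
    then show "C_on k S (\<lambda>x. frechet_derivative g (at x) b)"
      by (rule Suc.IH) (use fd in auto)
  qed (use fd in auto)
qed

text \<open>The factor \<open>a\<close> serves the induction: each differentiation multiplies the
  composed function by another \<open>c\<close>.\<close>

lemma C_on_scale:
  fixes f :: "'a::euclidean_space \<Rightarrow> real"
  assumes T: "open T" and S: "\<And>x. x \<in> T \<Longrightarrow> c *\<^sub>R x \<in> S"
  shows "C_on k S f \<Longrightarrow> C_on k T (\<lambda>x. a * f (c *\<^sub>R x))"
proof (induction k arbitrary: f a)
  case 0
  then show ?case using S by (auto intro!: continuous_intros continuous_on_compose2[of S f])
next
  case (Suc k)
  have d: "((\<lambda>x. a * f (c *\<^sub>R x)) has_derivative (\<lambda>h. a * (c * frechet_derivative f (at (c *\<^sub>R x)) h))) (at x)"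
    if x: "x \<in> T" for x
  proof -
    have D: "(f has_derivative frechet_derivative f (at (c *\<^sub>R x))) (at (c *\<^sub>R x))"
      using Suc.prems S[OF x] by (simp add: frechet_derivative_works)
    have "((\<lambda>x. f (c *\<^sub>R x)) has_derivative (\<lambda>h. frechet_derivative f (at (c *\<^sub>R x)) (c *\<^sub>R h))) (at x)"
      by (rule has_derivative_compose[of "\<lambda>x. c *\<^sub>R x" "\<lambda>h. c *\<^sub>R h" x UNIV f])
        (use D in \<open>auto intro!: derivative_eq_intros\<close>)
    then have "((\<lambda>x. a * f (c *\<^sub>R x)) has_derivative (\<lambda>h. a * frechet_derivative f (at (c *\<^sub>R x)) (c *\<^sub>R h))) (at x)"
      by (rule has_derivative_mult_right)
    moreover have "frechet_derivative f (at (c *\<^sub>R x)) (c *\<^sub>R h) = c * frechet_derivative f (at (c *\<^sub>R x)) h" for h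
      using linear_scale[OF has_derivative_linear[OF D]] by simp
    ultimately show ?thesis by simp
  qed
  show ?case
    unfolding C_on.simps
  proof (intro conjI ballI)
    show "(\<lambda>x. a * f (c *\<^sub>R x)) differentiable at x" if "x \<in> T" for x
      using d[OF that] by (auto simp: differentiable_def)
    fix b :: 'a assume b: "b \<in> Basis"
    have "C_on k T (\<lambda>x. (a * c) * frechet_derivative f (at (c *\<^sub>R x)) b)"
      by (rule Suc.IH) (use Suc.prems b in auto)
    then show "C_on k T (\<lambda>x. frechet_derivative (\<lambda>x. a * f (c *\<^sub>R x)) (at x) b)"
      by (rule C_on_cong[OF T]) (simp add: frechet_derivative_at[OF d, symmetric])
  qed
qed

lemma closure_disc:
  assumes "0 < \<epsilon> * h i"
  shows "closure (disc h \<epsilon> i y) = {x. x $ i = y \<and> norm (bar i x) \<le> \<epsilon> * h i}"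
proof
  show "closure (disc h \<epsilon> i y) \<subseteq> {x. x $ i = y \<and> norm (bar i x) \<le> \<epsilon> * h i}"
    by (rule closure_minimal) (auto simp: disc_def intro!: closed_Collect_conj closed_Collect_eq closed_Collect_le continuous_intros)
  have "insert_coord i y ` closure (ball 0 (\<epsilon> * h i)) \<subseteq> closure (disc h \<epsilon> i y)"
    by (rule image_closure_subset) (auto simp: disc_def intro!: continuous_intros subsetD[OF closure_subset])
  then have "insert_coord i y ` cball 0 (\<epsilon> * h i) \<subseteq> closure (disc h \<epsilon> i y)"
    using assms by simp
  moreover have "x = insert_coord i y (bar i x)" if "x $ i = y" for x
    using that insert_coord_bar[of i x] by metis
  ultimately show "{x. x $ i = y \<and> norm (bar i x) \<le> \<epsilon> * h i} \<subseteq> closure (disc h \<epsilon> i y)"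
    by (force simp: image_subset_iff)
qed

lemma closure_cyl_subset:
  "closure (cyl l0 l h \<epsilon> i) \<subseteq> {x. \<epsilon> * l0 \<le> x $ i \<and> x $ i \<le> l i \<and> norm (bar i x) \<le> \<epsilon> * h i}"
  by (rule closure_minimal) (auto simp: cyl_def intro!: closed_Collect_conj closed_Collect_le continuous_intros)

lemma closure_cyl_superset:
  assumes "0 < \<epsilon> * h i" "\<epsilon> * l0 < x $ i" "x $ i < l i" "norm (bar i x) \<le> \<epsilon> * h i"
  shows "x \<in> closure (cyl l0 l h \<epsilon> i)"
proof -
  have "disc h \<epsilon> i (x $ i) \<subseteq> cyl l0 l h \<epsilon> i" using assms by (auto simp: disc_def cyl_def)
  then have "closure (disc h \<epsilon> i (x $ i)) \<subseteq> closure (cyl l0 l h \<epsilon> i)" by (rule closure_mono)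
  then show ?thesis using closure_disc[of \<epsilon> h i, OF assms(1)] assms by auto
qed

lemma open_cyl: "open (cyl l0 l h \<epsilon> i)"
  unfolding cyl_eq_cylinder by (rule open_cylinder)

lemma bar_axis [simp]: "bar i (axis i a) = 0"
  using exhaust_3[of i] by (auto simp: bar_def axis_def vec2_eq_iff)

section \<open>The unscaled node\<close>

locale thin_junction =
  fixes \<epsilon>0 l0 :: real and l h :: "3 \<Rightarrow> real" and \<Xi> :: "(real^3) set"
  assumes geometry: "junction_geometry \<epsilon>0 l0 l h \<Xi>"
begin

lemma \<epsilon>0: "0 < \<epsilon>0" and l0: "0 < l0" and l: "1 \<le> l i" and h: "0 < h i" and \<epsilon>0_l: "\<epsilon>0 * l0 \<le> l i"
  and open_\<Xi>: "open \<Xi>" and connected_\<Xi>: "connected \<Xi>" and bounded_\<Xi>: "bounded \<Xi>" and nonempty_\<Xi>: "\<Xi> \<noteq> {}"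
  and below: "x \<in> \<Xi> \<Longrightarrow> x $ i < l0"
  using geometry by (auto simp: junction_geometry_def)

lemma face_iff: "x \<in> closure \<Xi> \<and> x $ i = l0 \<longleftrightarrow> x $ i = l0 \<and> norm (bar i x) \<le> h i"
proof -
  have "node_face l0 \<Xi> i = closure (disc h 1 i l0)"
    using geometry by (auto simp: junction_geometry_def)
  then show ?thesis
    using closure_disc[of 1 h i l0] h[of i] by (auto simp: node_face_def)
qed

lemma closure_below: "x \<in> closure \<Xi> \<Longrightarrow> x $ i \<le> l0"
proof -
  have "closure \<Xi> \<subseteq> {x. x $ i \<le> l0}"
  proof (rule closure_minimal)
    show "\<Xi> \<subseteq> {x. x $ i \<le> l0}" using below[of _ i] by (auto intro: less_imp_le)
    show "closed {x::real^3. x $ i \<le> l0}" by (intro closed_Collect_le continuous_intros)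
  qed
  then show "x \<in> closure \<Xi> \<Longrightarrow> x $ i \<le> l0" by auto
qed

text \<open>The rim of the i-th disc contains a point whose j-th coordinate is \<open>h i\<close>,
  for some other index j. This point belongs to the closed node, all of whose coordinates are at
  most \<open>l0\<close>.\<close>

lemma h_le_l0: "h i \<le> l0"
proof -
  obtain j :: 3 where j: "j \<noteq> i" using exhaust_3[of i] by (metis zero_neq_one)
  define x where "x = l0 *\<^sub>R axis i 1 + h i *\<^sub>R (axis j 1 :: real^3)"
  have xi: "x $ i = l0" "x $ j = h i" using j by (auto simp: x_def axis_def)
  have "norm (bar i x) = h i"
  proof (rule power2_eq_imp_eq)
    have "(norm x)\<^sup>2 = l0\<^sup>2 + (h i)\<^sup>2"
      unfolding power2_norm_eq_inner
      using j by (simp add: x_def inner_add_left inner_add_right inner_axis_axis power2_eq_square)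
    then show "(norm (bar i x))\<^sup>2 = (h i)\<^sup>2" using norm_sq_bar[of x i] xi by simp
  qed (use h[of i] in auto)
  then have "x \<in> closure \<Xi>" using face_iff[of x i] xi by simp
  then show ?thesis using closure_below[of x j] xi by simp
qed

end

section \<open>The junction for a fixed parameter\<close>

locale scaled_junction = thin_junction +
  fixes \<epsilon> :: real
  assumes \<epsilon>: "0 < \<epsilon>" "\<epsilon> < \<epsilon>0"
begin

abbreviation "J \<equiv> junction l0 l h \<Xi> \<epsilon>"

lemma \<epsilon>h: "0 < \<epsilon> * h i" using \<epsilon> h by simp

lemma \<epsilon>l0: "\<epsilon> * l0 < l i"
  using \<epsilon> l0 \<epsilon>0_l[of i] by (meson mult_strict_right_mono order_less_le_trans)

lemma open_J: "open J" by (simp add: junction_def)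

lemma in_node: "\<epsilon> *\<^sub>R \<xi> \<in> node \<Xi> \<epsilon> \<longleftrightarrow> \<xi> \<in> \<Xi>"
  using \<epsilon> by (auto simp: node_def)

lemma in_closure_node: "\<epsilon> *\<^sub>R \<xi> \<in> closure (node \<Xi> \<epsilon>) \<longleftrightarrow> \<xi> \<in> closure \<Xi>"
  using \<epsilon> by (auto simp: node_def closure_scaleR[symmetric])

lemma node_nth: "x \<in> closure (node \<Xi> \<epsilon>) \<Longrightarrow> x $ i \<le> \<epsilon> * l0"
  using in_closure_node[of "(1 / \<epsilon>) *\<^sub>R x"] closure_below[of "(1 / \<epsilon>) *\<^sub>R x" i] \<epsilon> by (simp add: field_simps)

lemma open_node: "open (node \<Xi> \<epsilon>)"
  unfolding node_def using \<epsilon> open_\<Xi> by (intro open_scaling) auto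

lemma node_subset_J: "node \<Xi> \<epsilon> \<subseteq> J"
  unfolding junction_def by (rule interior_maximal[OF _ open_node]) (use closure_subset in blast)

lemma cyl_subset_J: "cyl l0 l h \<epsilon> i \<subseteq> J"
  unfolding junction_def by (rule interior_maximal[OF _ open_cyl]) (use closure_subset in blast)

lemma frontier_node: "\<epsilon> *\<^sub>R \<xi> \<in> frontier (node \<Xi> \<epsilon>) \<longleftrightarrow> \<xi> \<in> frontier \<Xi>"
  using open_node open_\<Xi> by (simp add: frontier_def interior_open in_node in_closure_node)

lemma frontier_\<Xi>: "\<xi> \<in> frontier \<Xi> \<longleftrightarrow> \<xi> \<in> closure \<Xi> \<and> \<xi> \<notin> \<Xi>"
  using open_\<Xi> by (simp add: frontier_def interior_open)

lemma side_frontier_J: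
  assumes "\<xi> \<in> frontier \<Xi>" "\<And>i. \<xi> $ i < l0"
  shows "\<epsilon> *\<^sub>R \<xi> \<in> frontier J"
proof -
  have "\<epsilon> *\<^sub>R \<xi> \<in> node_lateral l0 h \<Xi> \<epsilon>"
    using assms \<epsilon> closure_disc[of \<epsilon> h, OF \<epsilon>h] by (auto simp: node_lateral_def frontier_node)
  then show ?thesis using geometry \<epsilon> by (auto simp: junction_geometry_def)
qed

text \<open>Below all face planes a point of the junction lies in no closed cylinder, hence in the
  closed node. If it were on the frontier of the node, it would be on that of the junction, because
  the geometry forbids slits. So node and junction coincide there.\<close>

lemma J_below:
  assumes "\<epsilon> *\<^sub>R \<xi> \<in> J" "\<And>i. \<xi> $ i < l0"
  shows "\<xi> \<in> \<Xi>"
proof (rule ccontr)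
  assume n: "\<xi> \<notin> \<Xi>"
  have "\<epsilon> *\<^sub>R \<xi> \<notin> closure (cyl l0 l h \<epsilon> i)" for i
    using closure_cyl_subset[of l0 l h \<epsilon> i] assms(2)[of i] \<epsilon> by auto
  then have "\<epsilon> *\<^sub>R \<xi> \<in> closure (node \<Xi> \<epsilon>)"
    using assms(1) interior_subset unfolding junction_def by blast
  then have "\<epsilon> *\<^sub>R \<xi> \<in> frontier J"
    using n assms(2) by (intro side_frontier_J) (auto simp: frontier_\<Xi> in_closure_node)
  then show False using assms(1) open_J by (simp add: frontier_def interior_open)
qed

lemma \<Xi>_in_J: "\<xi> \<in> \<Xi> \<Longrightarrow> \<epsilon> *\<^sub>R \<xi> \<in> J"
  using node_subset_J in_node by blast

lemma closure_\<Xi>_in_J: "\<xi> \<in> closure \<Xi> \<Longrightarrow> \<epsilon> *\<^sub>R \<xi> \<in> closure J"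
  using closure_mono[OF node_subset_J] in_closure_node by blast

text \<open>Arbitrarily close to the given point there are points above the node, outside the closed
  i-th cylinder, and outside the other closed cylinders, whose radii are at most \<epsilon> l0.
  Admitting positive \<open>s\<close> covers the line on the cylinder wall that starts at the
  edge.\<close>

lemma edge_notin_J:
  assumes \<xi>: "\<xi> $ i = l0" "norm (bar i \<xi>) = h i" and s: "0 \<le> s"
  shows "\<epsilon> *\<^sub>R \<xi> + s *\<^sub>R axis i 1 \<notin> J"
proof
  let ?x = "\<epsilon> *\<^sub>R \<xi> + s *\<^sub>R axis i 1"
  assume "?x \<in> J"
  then obtain d where d: "d > 0" "ball ?x d \<subseteq> closure (node \<Xi> \<epsilon>) \<union> (\<Union>i. closure (cyl l0 l h \<epsilon> i))"
    unfolding junction_def mem_interior by blast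
  \<comment> \<open>This direction increases the axial coordinate and the distance from the axis at
    once; the length \<open>t\<close> keeps the displacement below the radius
    \<open>d\<close>.\<close>
  define v where "v = \<epsilon> *\<^sub>R \<xi> + axis i (1::real)"
  define t where "t = d / (2 * (norm v + 1))"
  have t: "t > 0" using d by (simp add: t_def add_nonneg_pos)
  define y where "y = ?x + t *\<^sub>R v"
  have "norm (t *\<^sub>R v) < d"
  proof -
    have "norm (t *\<^sub>R v) = d * (norm v / (2 * (norm v + 1)))" using d(1) by (simp add: t_def)
    also have "\<dots> < d * 1"
      using d(1) norm_ge_zero[of v] by (intro mult_strict_left_mono) (auto simp: divide_less_eq add_nonneg_pos)
    finally show ?thesis by simp
  qed
  then have "y \<in> ball ?x d" by (simp add: y_def dist_norm)
  then have mem: "y \<in> closure (node \<Xi> \<epsilon>) \<union> (\<Union>i. closure (cyl l0 l h \<epsilon> i))" using d by blast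
  have yi: "y $ i > \<epsilon> * l0" using t s \<xi> \<epsilon> l0 by (simp add: y_def v_def add_nonneg_pos add_pos_pos)
  have "bar i y = ((1 + t) * \<epsilon>) *\<^sub>R bar i \<xi>"
    by (simp add: y_def v_def bar_add bar_scaleR algebra_simps)
  then have "norm (bar i y) = (1 + t) * (\<epsilon> * h i)" using t \<epsilon> \<xi> by (simp add: abs_mult)
  then have bary: "norm (bar i y) > \<epsilon> * h i" using t \<epsilon>h[of i] by (simp add: distrib_right)
  have "y \<notin> closure (node \<Xi> \<epsilon>)" using node_nth[of y i] yi by auto
  moreover have "y \<notin> closure (cyl l0 l h \<epsilon> j)" for j
  proof
    assume "y \<in> closure (cyl l0 l h \<epsilon> j)"
    then have c: "norm (bar j y) \<le> \<epsilon> * h j" using closure_cyl_subset by blast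
    show False
    proof (cases "j = i")
      case False
      then have "\<bar>y $ i\<bar> \<le> norm (bar j y)" by (intro abs_nth_le_norm_bar) auto
      also have "\<dots> \<le> \<epsilon> * l0" using c h_le_l0[of j] \<epsilon> by (meson mult_left_mono less_imp_le order_trans)
      finally show False using yi by simp
    qed (use c bary in auto)
  qed
  ultimately show False using mem by blast
qed

lemma edge_frontier_J:
  assumes \<xi>: "\<xi> \<in> closure \<Xi>" "\<xi> $ i = l0" "norm (bar i \<xi>) = h i"
  shows "\<epsilon> *\<^sub>R \<xi> \<in> frontier J"
  using edge_notin_J[OF \<xi>(2,3), of 0] closure_\<Xi>_in_J[OF \<xi>(1)] open_J
  by (simp add: frontier_def interior_open)

text \<open>Smoothness is assumed away from the outer ends only. The scaled closed node stays away
  from these, as its i-th coordinate is at most \<epsilon> l0 < l i.\<close>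

lemma smooth_boundary:
  assumes "\<xi> \<in> closure \<Xi>" "\<epsilon> *\<^sub>R \<xi> \<in> frontier J"
  shows "\<exists>U \<rho>. local_defining_function J (\<epsilon> *\<^sub>R \<xi>) U \<rho>"
proof -
  have "\<epsilon> *\<^sub>R \<xi> \<notin> closure (disc h \<epsilon> i (l i))" for i
  proof -
    have "\<epsilon> * \<xi> $ i \<le> \<epsilon> * l0" using closure_below[OF assms(1), of i] \<epsilon> by simp
    then show ?thesis using closure_disc[of \<epsilon> h, OF \<epsilon>h] \<epsilon>l0[of i] by auto
  qed
  then have "smooth_boundary_at J (\<epsilon> *\<^sub>R \<xi>)"
    using assms(2) geometry \<epsilon> unfolding junction_geometry_def by (auto simp del: closure_disc)
  then show ?thesis by (auto simp: smooth_boundary_at_def)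
qed

text \<open>By continuity: a positive value at a point of the closure would force positive values at
  nearby points of the junction.\<close>

lemma defining_function_frontier:
  assumes d: "local_defining_function J x0 U \<rho>" and x: "x \<in> U"
  shows "x \<in> closure J \<Longrightarrow> \<rho> x \<le> 0" "x \<notin> J \<Longrightarrow> 0 \<le> \<rho> x"
proof -
  have U: "open U" "J \<inter> U = {y \<in> U. \<rho> y < 0}" and c: "continuous_on U \<rho>"
    using d C1_on_continuous[OF smooth_on_C1_on] by (auto simp: local_defining_function_def)
  show "x \<notin> J \<Longrightarrow> 0 \<le> \<rho> x" using U x by force
  assume xc: "x \<in> closure J"
  show "\<rho> x \<le> 0"
  proof (rule ccontr)
    assume "\<not> \<rho> x \<le> 0"
    then have "x \<in> U \<inter> \<rho> -` {0<..}" using x by simp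
    moreover have "open (U \<inter> \<rho> -` {0<..})" using c U(1) by (intro continuous_open_preimage) auto
    ultimately have "J \<inter> (U \<inter> \<rho> -` {0<..}) \<noteq> {}"
      using xc by (meson closure_iff_nhds_not_empty order_refl)
    then show False using U(2) by force
  qed
qed

text \<open>One-sided, because the sign of a defining function is known only along rays leaving the
  boundary point.\<close>

lemma ray_deriv:
  assumes "GDERIV f x :> D"
  shows "((\<lambda>s. (f (x + s *\<^sub>R v) - f x) / s) \<longlongrightarrow> v \<bullet> D) (at_right 0)"
proof -
  have "((\<lambda>s. f (x + s *\<^sub>R v)) has_derivative (\<lambda>s. (s *\<^sub>R v) \<bullet> D)) (at 0)"
    by (rule has_derivative_compose[of "\<lambda>s. x + s *\<^sub>R v" "\<lambda>s. s *\<^sub>R v" 0 UNIV f])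
      (use assms in \<open>auto simp: gderiv_def intro!: derivative_eq_intros\<close>)
  moreover have "(\<lambda>s. (s *\<^sub>R v) \<bullet> D) = (*) (v \<bullet> D)" by (simp add: fun_eq_iff)
  ultimately have "DERIV (\<lambda>s. f (x + s *\<^sub>R v)) 0 :> v \<bullet> D" by (simp add: has_field_derivative_def)
  then show ?thesis
    unfolding DERIV_def by (simp add: filterlim_at_split)
qed

lemma eventually_ray_in_open:
  fixes x v :: "real^3"
  assumes "open U" "x \<in> U"
  shows "\<forall>\<^sub>F s in at_right (0::real). x + s *\<^sub>R v \<in> U"
proof -
  have "((\<lambda>s. x + s *\<^sub>R v) \<longlongrightarrow> x + 0 *\<^sub>R v) (at_right (0::real))" by (intro tendsto_intros)
  then show ?thesis using assms by (intro topological_tendstoD) auto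
qed

text \<open>The ray from the edge in the axial direction runs along the wall of the cylinder: it
  lies in the closure of the junction but not in the junction. So the defining function vanishes
  along it, and its gradient is orthogonal to the axis.\<close>

lemma edge_tangent:
  assumes \<xi>: "\<xi> \<in> closure \<Xi>" "\<xi> $ i = l0" "norm (bar i \<xi>) = h i"
    and d: "local_defining_function J (\<epsilon> *\<^sub>R \<xi>) U \<rho>"
  shows "grad \<rho> (\<epsilon> *\<^sub>R \<xi>) $ i = 0"
proof -
  let ?x = "\<epsilon> *\<^sub>R \<xi>"
  have U: "open U" "?x \<in> U" and C: "C1_on U \<rho> (grad \<rho>)"
    using d smooth_on_C1_on by (auto simp: local_defining_function_def)
  have zero: "\<rho> (?x + s *\<^sub>R axis i 1) = 0" if s: "0 \<le> s" "s < l i - \<epsilon> * l0" "?x + s *\<^sub>R axis i 1 \<in> U" for s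
  proof -
    have "?x + s *\<^sub>R axis i 1 \<in> closure J"
    proof (cases "s = 0")
      case False
      have "?x + s *\<^sub>R axis i 1 \<in> closure (cyl l0 l h \<epsilon> i)"
        using s False \<xi> \<epsilon> h by (intro closure_cyl_superset) (auto simp: bar_add bar_scaleR)
      then show ?thesis using closure_mono[OF cyl_subset_J] by blast
    qed (use closure_\<Xi>_in_J[OF \<xi>(1)] in simp)
    then show ?thesis
      using defining_function_frontier[OF d s(3)] edge_notin_J[OF \<xi>(2,3) s(1)] by auto
  qed
  have "\<forall>\<^sub>F s in at_right 0. s < l i - \<epsilon> * l0"
    using \<epsilon>l0[of i] by (intro eventually_at_right_less[THEN eventually_mono] order_tendstoD(2)[of "\<lambda>s. s"] tendsto_ident_at) auto
  moreover have "\<forall>\<^sub>F s in at_right (0::real). 0 < s" by (rule eventually_at_right_less)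
  ultimately have "\<forall>\<^sub>F s in at_right 0. (\<rho> (?x + s *\<^sub>R axis i 1) - \<rho> ?x) / s = 0"
    using eventually_ray_in_open[OF U, of "axis i 1"]
  proof eventually_elim
    case (elim s)
    then show ?case using zero[of s] zero[of 0] U \<epsilon>l0[of i] by simp
  qed
  then have "((\<lambda>s. (\<rho> (?x + s *\<^sub>R axis i 1) - \<rho> ?x) / s) \<longlongrightarrow> 0) (at_right 0)"
    by (rule tendsto_eventually)
  moreover have "((\<lambda>s. (\<rho> (?x + s *\<^sub>R axis i 1) - \<rho> ?x) / s) \<longlongrightarrow> axis i 1 \<bullet> grad \<rho> ?x) (at_right 0)"
    using C1_onD(1)[OF C U(2)] by (rule ray_deriv)
  ultimately have "axis i 1 \<bullet> grad \<rho> ?x = 0"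
    using tendsto_unique[OF trivial_limit_at_right_real] by blast
  then show ?thesis by (simp add: inner_axis')
qed

end

section \<open>Boundary charts of the unscaled node\<close>

context scaled_junction
begin

text \<open>The chart in the variables of the unscaled node, restricted to points below all face
  planes, where node and junction agree after scaling.\<close>

definition chart_dom :: "(real^3) set \<Rightarrow> (real^3) set" where
  "chart_dom U = {y. \<epsilon> *\<^sub>R y \<in> U \<and> (\<forall>j. y $ j < l0)}"

lemma chart_scaled:
  assumes d: "local_defining_function J x0 U \<rho>"
  shows "open {y. \<epsilon> *\<^sub>R y \<in> U}"
    and "C1_on {y. \<epsilon> *\<^sub>R y \<in> U} (\<lambda>y. \<rho> (\<epsilon> *\<^sub>R y)) (\<lambda>y. \<epsilon> *\<^sub>R grad \<rho> (\<epsilon> *\<^sub>R y))"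
proof -
  have U: "open U" and C: "C1_on U \<rho> (grad \<rho>)"
    using d smooth_on_C1_on by (auto simp: local_defining_function_def)
  have "{y. \<epsilon> *\<^sub>R y \<in> U} = (\<lambda>y. \<epsilon> *\<^sub>R y) -` U" by auto
  then show o: "open {y. \<epsilon> *\<^sub>R y \<in> U}"
    using U by (simp add: open_vimage continuous_intros)
  show "C1_on {y. \<epsilon> *\<^sub>R y \<in> U} (\<lambda>y. \<rho> (\<epsilon> *\<^sub>R y)) (\<lambda>y. \<epsilon> *\<^sub>R grad \<rho> (\<epsilon> *\<^sub>R y))"
    unfolding C1_on_def
  proof (intro conjI ballI)
    fix y assume "y \<in> {y. \<epsilon> *\<^sub>R y \<in> U}"
    then have "GDERIV \<rho> (\<epsilon> *\<^sub>R y) :> grad \<rho> (\<epsilon> *\<^sub>R y)" using C1_onD(1)[OF C] by blast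
    then have "((\<lambda>y. \<rho> (\<epsilon> *\<^sub>R y)) has_derivative (\<lambda>h. (\<epsilon> *\<^sub>R h) \<bullet> grad \<rho> (\<epsilon> *\<^sub>R y))) (at y)"
      unfolding gderiv_def
      by (intro has_derivative_compose[of "\<lambda>y. \<epsilon> *\<^sub>R y" "\<lambda>h. \<epsilon> *\<^sub>R h" y UNIV \<rho>]) (auto intro!: derivative_eq_intros)
    then show "GDERIV (\<lambda>y. \<rho> (\<epsilon> *\<^sub>R y)) y :> \<epsilon> *\<^sub>R grad \<rho> (\<epsilon> *\<^sub>R y)"
      by (simp add: gderiv_def)
  next
    show "continuous_on {y. \<epsilon> *\<^sub>R y \<in> U} (\<lambda>y. \<epsilon> *\<^sub>R grad \<rho> (\<epsilon> *\<^sub>R y))"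
      by (intro continuous_intros continuous_on_compose2[OF C1_onD(2)[OF C]]) auto
  qed
qed

lemma open_chart_dom:
  assumes d: "local_defining_function J x0 U \<rho>"
  shows "open (chart_dom U)"
proof -
  have "chart_dom U = {y. \<epsilon> *\<^sub>R y \<in> U} \<inter> (\<Inter>j. {y. y $ j < l0})"
    by (auto simp: chart_dom_def)
  moreover have "open (\<Inter>j. {y::real^3. y $ j < l0})"
    by (intro open_INT) (auto intro!: open_Collect_less continuous_intros)
  ultimately show ?thesis using chart_scaled(1)[OF d] by (simp add: open_Int)
qed

lemma chart_dom_\<Xi>:
  assumes d: "local_defining_function J x0 U \<rho>"
  shows "\<Xi> \<inter> chart_dom U = {y \<in> chart_dom U. \<rho> (\<epsilon> *\<^sub>R y) < 0}"
proof -
  have "J \<inter> U = {y \<in> U. \<rho> y < 0}" using d by (simp add: local_defining_function_def)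
  then show ?thesis using \<Xi>_in_J J_below by (fastforce simp: chart_dom_def)
qed

text \<open>The Neumann condition speaks of normals of \<open>\<Xi>\<close>, whereas smoothness is
  known for the boundary of the junction. Below the face planes a defining function of the junction
  yields one of the node, and the scaling cancels in the normalized gradient.\<close>

lemma side_normal:
  assumes d: "local_defining_function J x0 U \<rho>" and y: "y \<in> frontier \<Xi>" "y \<in> chart_dom U"
  shows "outward_unit_normal \<Xi> y ((1 / norm (grad \<rho> (\<epsilon> *\<^sub>R y))) *\<^sub>R grad \<rho> (\<epsilon> *\<^sub>R y))"
proof -
  \<comment> \<open>The factor 1 gives the function the form required by
    \<open>C_on_scale\<close>.\<close>
  let ?\<rho> = "\<lambda>y. 1 * \<rho> (\<epsilon> *\<^sub>R y)"
  have g: "grad ?\<rho> y = \<epsilon> *\<^sub>R grad \<rho> (\<epsilon> *\<^sub>R y)" if "y \<in> chart_dom U" for y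
    using that C1_onD(1)[OF chart_scaled(2)[OF d]] by (intro grad_eqI) (simp add: chart_dom_def)
  have "smooth_on (chart_dom U) ?\<rho>"
    unfolding smooth_on_def
  proof
    fix k
    have "C_on k U \<rho>" using d by (simp add: local_defining_function_def smooth_on_def)
    then show "C_on k (chart_dom U) ?\<rho>"
      by (rule C_on_scale[OF open_chart_dom[OF d], rotated]) (auto simp: chart_dom_def)
  qed
  moreover have "grad ?\<rho> y \<noteq> 0" if "y \<in> chart_dom U" for y
    using that g[OF that] d \<epsilon> by (auto simp: local_defining_function_def chart_dom_def)
  ultimately have "local_defining_function \<Xi> y (chart_dom U) ?\<rho>"
    using open_chart_dom[OF d] y(2) chart_dom_\<Xi>[OF d] by (simp add: local_defining_function_def)
  moreover have "(1 / norm (grad \<rho> (\<epsilon> *\<^sub>R y))) *\<^sub>R grad \<rho> (\<epsilon> *\<^sub>R y) = (1 / norm (grad ?\<rho> y)) *\<^sub>R grad ?\<rho> y"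
    using g[OF y(2)] \<epsilon> by simp
  ultimately show ?thesis using y(1) unfolding outward_unit_normal_def by blast
qed

lemma side_not_face: "(\<And>j. y $ j < l0) \<Longrightarrow> y \<notin> (\<Union>i. node_face l0 \<Xi> i)"
  by (auto simp: node_face_def)

end

section \<open>Interfaces, walls and edges under the Neumann condition\<close>

lemma filterlim_at_within_seq:
  assumes "Z \<longlonglongrightarrow> x" "\<And>n. Z n \<in> S" "x \<notin> S"
  shows "filterlim Z (at x within S) sequentially"
  unfolding at_within_def filterlim_inf filterlim_principal
  using assms by (auto intro!: always_eventually)

context scaled_junction
begin

text \<open>A point of an open interface disc that is not interior to the junction would be a smooth
  boundary point touched from below by the wall of the node, with normal direction \<open>x\<^sub>i\<close>; the
  Neumann conditions on the wall and on the disc would then force \<open>\<v>\<^sub>i = 0\<close>.\<close>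

lemma disc_in_J:
  assumes neu: "neumann_potential l0 \<Xi> \<v> p" and v: "\<v> i \<noteq> 0"
    and B: "\<And>x. x \<in> \<Xi> \<Longrightarrow> norm (grad p x) \<le> B"
    and \<xi>: "\<xi> $ i = l0" "norm (bar i \<xi>) < h i"
  shows "\<epsilon> *\<^sub>R \<xi> \<in> J"
proof (rule ccontr)
  assume nJ: "\<epsilon> *\<^sub>R \<xi> \<notin> J"
  let ?x = "\<epsilon> *\<^sub>R \<xi>"
  have \<xi>c: "\<xi> \<in> closure \<Xi>" using face_iff[of \<xi> i] \<xi> by auto
  have "?x \<in> frontier J" using closure_\<Xi>_in_J[OF \<xi>c] nJ open_J by (simp add: frontier_def interior_open)
  then obtain U \<rho> where d: "local_defining_function J ?x U \<rho>" using smooth_boundary[OF \<xi>c] by blast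
  have U: "open U" "?x \<in> U" and C: "C1_on U \<rho> (grad \<rho>)" and g0: "\<And>y. y \<in> U \<Longrightarrow> grad \<rho> y \<noteq> 0"
    and JU: "J \<inter> U = {y \<in> U. \<rho> y < 0}"
    using d smooth_on_C1_on by (auto simp: local_defining_function_def)
  let ?g = "grad \<rho> ?x"
  have \<rho>0: "\<rho> ?x = 0"
    using defining_function_frontier[OF d U(2)] closure_\<Xi>_in_J[OF \<xi>c] nJ by auto
  have cyl_near: "\<forall>\<^sub>F s in at_right 0. ?x + s *\<^sub>R v \<in> cyl l0 l h \<epsilon> i" if "v $ i > 0" for v
  proof -
    define O' where "O' = {x::real^3. x $ i < l i \<and> norm (bar i x) < \<epsilon> * h i}"
    have "open O'" unfolding O'_def by (intro open_Collect_conj open_Collect_less continuous_intros)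
    moreover have "?x \<in> O'" using \<xi> \<epsilon> \<epsilon>l0[of i] by (simp add: O'_def bar_scaleR)
    ultimately have "\<forall>\<^sub>F s in at_right 0. ?x + s *\<^sub>R v \<in> O'" by (rule eventually_ray_in_open)
    moreover have "\<forall>\<^sub>F s in at_right (0::real). 0 < s" by (rule eventually_at_right_less)
    ultimately show ?thesis
    proof eventually_elim
      case (elim s)
      have "\<epsilon> * l0 < (?x + s *\<^sub>R v) $ i" using elim that \<xi> by simp
      then show ?case using elim unfolding O'_def cyl_def by blast
    qed
  qed
  \<comment> \<open>Directions into the cylinder lead into the junction, where \<open>\<rho>\<close>
    is negative. As these directions form an open half space, only a negative multiple of
    \<open>axis i 1\<close> is left for the gradient.\<close>
  have neg: "v \<bullet> ?g \<le> 0" if "v $ i > 0" for v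
  proof -
    have "\<forall>\<^sub>F s in at_right (0::real). 0 < s" by (rule eventually_at_right_less)
    with cyl_near[OF that] eventually_ray_in_open[OF U, of v]
    have "\<forall>\<^sub>F s in at_right 0. (\<rho> (?x + s *\<^sub>R v) - \<rho> ?x) / s \<le> 0"
    proof eventually_elim
      case (elim s)
      then have "?x + s *\<^sub>R v \<in> J \<inter> U" using cyl_subset_J by blast
      then have "\<rho> (?x + s *\<^sub>R v) < 0" using JU by blast
      then show ?case using elim \<rho>0 by (simp add: divide_le_0_iff)
    qed
    then show ?thesis
      using tendsto_upperbound[OF ray_deriv[OF C1_onD(1)[OF C U(2)], of v]] by simp
  qed
  have gj: "?g $ j = 0" if j: "j \<noteq> i" for j
  proof (rule ccontr)
    assume n: "?g $ j \<noteq> 0"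
    \<comment> \<open>The first coefficient makes the inner product with the gradient equal to |g_i|
      + 1 + g_i, which is positive.\<close>
    define v where "v = ((\<bar>?g $ i\<bar> + 1) / ?g $ j) *\<^sub>R axis j 1 + axis i (1::real)"
    have "v $ i > 0" using j by (simp add: v_def axis_def)
    then have "v \<bullet> ?g \<le> 0" by (rule neg)
    moreover have "v \<bullet> ?g = \<bar>?g $ i\<bar> + 1 + ?g $ i" using n by (simp add: v_def inner_add_left inner_axis')
    ultimately show False by linarith
  qed
  have gi: "?g = (?g $ i) *\<^sub>R axis i 1"
    using gj by (auto simp: vec_eq_iff axis_def)
  have gineg: "?g $ i < 0"
  proof -
    have "?g $ i \<noteq> 0" using gi g0[OF U(2)] by auto
    moreover have "?g $ i \<le> 0" using neg[of "axis i 1"] by (simp add: inner_axis')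
    ultimately show ?thesis by simp
  qed
  define N where "N y = (1 / norm (grad \<rho> (\<epsilon> *\<^sub>R y))) *\<^sub>R grad \<rho> (\<epsilon> *\<^sub>R y)" for y
  have N\<xi>: "N \<xi> = - axis i 1"
  proof -
    have "norm ?g = - (?g $ i)" using gineg by (subst gi) simp
    then have "N \<xi> = (1 / - (?g $ i)) *\<^sub>R ((?g $ i) *\<^sub>R axis i 1)" unfolding N_def using gi by metis
    then show ?thesis using gineg by simp
  qed
  have cN: "continuous_on {y. \<epsilon> *\<^sub>R y \<in> U} N"
    unfolding N_def using g0
    by (intro continuous_intros continuous_on_compose2[OF C1_onD(2)[OF C]]) auto
  define A where "A = {y. \<epsilon> *\<^sub>R y \<in> U} \<inter> (\<Inter>j\<in>-{i}. {y::real^3. y $ j < l0})"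
  have oA: "open A"
    unfolding A_def by (intro open_Int chart_scaled(1)[OF d] open_INT) (auto intro!: open_Collect_less continuous_intros)
  have \<xi>A: "\<xi> \<in> A"
  proof -
    have "\<xi> $ j < l0" if "j \<noteq> i" for j
      using abs_nth_le_norm_bar[OF that, of \<xi>] \<xi> h_le_l0[of i] by linarith
    then show ?thesis using U by (auto simp: A_def)
  qed
  \<comment> \<open>Wall points of the node accumulate at \<xi> from below: a half ball under the
    disc is connected and meets the node, so unless it is contained in the node it meets the
    frontier of the node.\<close>
  have step: "\<exists>y. y \<in> frontier \<Xi> \<and> y \<in> chart_dom U \<and> dist y \<xi> < \<delta>" if \<delta>: "\<delta> > 0" for \<delta>
  proof -
    define O' where "O' = {y::real^3. \<epsilon> * y $ i < l i \<and> norm (bar i y) < h i}"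
    have "open O'" unfolding O'_def by (intro open_Collect_conj open_Collect_less continuous_intros)
    moreover have "\<xi> \<in> O'" using \<xi> \<epsilon>l0[of i] by (simp add: O'_def)
    ultimately have "open (A \<inter> O' \<inter> ball \<xi> \<delta>)" "\<xi> \<in> A \<inter> O' \<inter> ball \<xi> \<delta>" using oA \<xi>A \<delta> by auto
    then obtain r where r: "r > 0" "ball \<xi> r \<subseteq> A \<inter> O' \<inter> ball \<xi> \<delta>" by (meson openE)
    define H where "H = ball \<xi> r \<inter> {y. y $ i < l0}"
    have "convex H"
    proof -
      have "{y::real^3. y $ i < l0} = {y. axis i 1 \<bullet> y < l0}" by (simp add: inner_axis')
      then show ?thesis unfolding H_def by (metis convex_Int convex_ball convex_halfspace_lt)
    qed
    then have conn: "connected H" by (rule convex_connected)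
    obtain z where z: "z \<in> \<Xi>" "dist z \<xi> < r" using \<xi>c r(1) closure_approachable by blast
    have "z \<in> H \<inter> \<Xi>" using z below by (auto simp: H_def dist_commute)
    then have ne1: "H \<inter> \<Xi> \<noteq> {}" by blast
    \<comment> \<open>If the node filled the half ball, then node, face and cylinder together would
      fill a full ball, and the point would be interior to the junction.\<close>
    have ne2: "H - \<Xi> \<noteq> {}"
    proof
      assume "H - \<Xi> = {}"
      then have sub: "H \<subseteq> \<Xi>" by blast
      have "\<epsilon> *\<^sub>R y \<in> closure (node \<Xi> \<epsilon>) \<union> (\<Union>i. closure (cyl l0 l h \<epsilon> i))" if y: "y \<in> ball \<xi> r" for y
      proof (cases "y $ i < l0")
        case True
        then have "y \<in> \<Xi>" using sub y by (auto simp: H_def)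
        then show ?thesis using in_closure_node closure_subset by blast
      next
        case False
        have yO: "y \<in> O'" using y r by blast
        show ?thesis
        proof (cases "y $ i = l0")
          case True
          then have "y \<in> closure \<Xi>" using face_iff[of y i] yO by (auto simp: O'_def)
          then show ?thesis using in_closure_node by blast
        next
          case ne: False
          then have "\<epsilon> * l0 < \<epsilon> * y $ i" using False \<epsilon> by simp
          then have "\<epsilon> *\<^sub>R y \<in> cyl l0 l h \<epsilon> i" using yO \<epsilon> by (auto simp: cyl_def O'_def bar_scaleR)
          then show ?thesis using closure_subset by blast
        qed
      qed
      then have "(\<lambda>y. \<epsilon> *\<^sub>R y) ` ball \<xi> r \<subseteq> closure (node \<Xi> \<epsilon>) \<union> (\<Union>i. closure (cyl l0 l h \<epsilon> i))" by blast
      moreover have "open ((\<lambda>y. \<epsilon> *\<^sub>R y) ` ball \<xi> r)" using \<epsilon> by (intro open_scaling) auto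
      ultimately have "(\<lambda>y. \<epsilon> *\<^sub>R y) ` ball \<xi> r \<subseteq> J" unfolding junction_def by (rule interior_maximal)
      moreover have "\<xi> \<in> ball \<xi> r" using r(1) by simp
      ultimately show False using nJ by blast
    qed
    obtain y where y: "y \<in> H" "y \<in> frontier \<Xi>"
      using connected_Int_frontier[OF conn ne1 ne2] by blast
    have "y \<in> A" "y $ i < l0" "dist y \<xi> < \<delta>" using y(1) r by (auto simp: H_def dist_commute)
    then have "y \<in> chart_dom U" by (auto simp: A_def chart_dom_def)
    then show ?thesis using y(2) \<open>dist y \<xi> < \<delta>\<close> by blast
  qed
  \<comment> \<open>At wall points tending to \<xi> the Neumann condition is a limit from inside; it
    is replaced by small flux at nearby points of the node.\<close>
  have "\<exists>y z. y \<in> chart_dom U \<and> dist y \<xi> < 1 / real (Suc n) \<and> z \<in> \<Xi> \<and> dist z y < 1 / real (Suc n)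
      \<and> \<bar>grad p z \<bullet> N y\<bar> < 1 / real (Suc n)" for n
  proof -
    have pos: "0 < 1 / real (Suc n)" by simp
    obtain y where y: "y \<in> frontier \<Xi>" "y \<in> chart_dom U" "dist y \<xi> < 1 / real (Suc n)"
      using step[OF pos] by blast
    have "y \<notin> (\<Union>i. node_face l0 \<Xi> i)" using y(2) by (intro side_not_face) (auto simp: chart_dom_def)
    then have "((\<lambda>z. grad p z \<bullet> N y) \<longlongrightarrow> 0) (at y within \<Xi>)"
      using neu y(1) side_normal[OF d y(1,2)] unfolding neumann_potential_def N_def by blast
    then have "\<forall>\<^sub>F z in at y within \<Xi>. dist (grad p z \<bullet> N y) 0 < 1 / real (Suc n)"
      using pos by (rule tendstoD)
    then obtain \<delta> where \<delta>: "\<delta> > 0" "\<And>z. z \<in> \<Xi> \<Longrightarrow> z \<noteq> y \<Longrightarrow> dist z y < \<delta> \<Longrightarrow> \<bar>grad p z \<bullet> N y\<bar> < 1 / real (Suc n)"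
      unfolding eventually_at by (auto simp: dist_real_def)
    have "y \<in> closure \<Xi>" "y \<notin> \<Xi>" using y(1) by (auto simp: frontier_\<Xi>)
    then obtain z where "z \<in> \<Xi>" "dist z y < min \<delta> (1 / real (Suc n))"
      using \<delta>(1) pos closure_approachable[of y \<Xi>] by (metis min_less_iff_conj)
    then show ?thesis using y \<delta>(2)[of z] \<open>y \<notin> \<Xi>\<close> by (intro exI[of _ y] exI[of _ z]) auto
  qed
  then obtain Y Z where YZ: "\<And>n. Y n \<in> chart_dom U" "\<And>n. dist (Y n) \<xi> < 1 / real (Suc n)"
    "\<And>n. Z n \<in> \<Xi>" "\<And>n. dist (Z n) (Y n) < 1 / real (Suc n)" "\<And>n. \<bar>grad p (Z n) \<bullet> N (Y n)\<bar> < 1 / real (Suc n)"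
    by metis
  have to0: "(\<lambda>n. 1 / real (Suc n)) \<longlonglongrightarrow> 0" by (rule LIMSEQ_Suc[OF lim_1_over_n])
  have Yl: "Y \<longlonglongrightarrow> \<xi>"
    unfolding tendsto_dist_iff[of Y] by (rule tendsto_sandwich[OF _ _ tendsto_const to0]) (auto intro!: always_eventually less_imp_le[OF YZ(2)] simp del: of_nat_Suc)
  have Zl: "Z \<longlonglongrightarrow> \<xi>"
  proof -
    have "(\<lambda>n. dist (Z n) \<xi>) \<longlonglongrightarrow> 0"
    proof (rule tendsto_sandwich[OF _ _ tendsto_const])
      show "(\<lambda>n. 1 / real (Suc n) + 1 / real (Suc n)) \<longlonglongrightarrow> 0" using tendsto_add[OF to0 to0] by simp
      show "\<forall>\<^sub>F n in sequentially. dist (Z n) \<xi> \<le> 1 / real (Suc n) + 1 / real (Suc n)"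
      proof (intro always_eventually allI)
        show "dist (Z n) \<xi> \<le> 1 / real (Suc n) + 1 / real (Suc n)" for n
          using YZ(2,4)[of n] dist_triangle[of "Z n" \<xi> "Y n"] by linarith
      qed
    qed auto
    then show ?thesis by (rule tendsto_dist_iff[THEN iffD2])
  qed
  have \<xi>n: "\<xi> \<notin> \<Xi>" using below[of \<xi> i] \<xi> by auto
  have "(partial i p \<longlongrightarrow> \<v> i) (at \<xi> within \<Xi>)"
    using neu \<xi>c \<xi>(1) unfolding neumann_potential_def node_face_def by blast
  then have pl: "(\<lambda>n. partial i p (Z n)) \<longlonglongrightarrow> \<v> i"
    by (rule filterlim_compose[OF _ filterlim_at_within_seq[OF Zl YZ(3) \<xi>n]])
  have nl: "(\<lambda>n. grad p (Z n) \<bullet> N (Y n)) \<longlonglongrightarrow> 0"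
    by (rule tendsto_rabs_zero_cancel, rule tendsto_sandwich[OF _ _ tendsto_const to0])
      (auto intro!: always_eventually less_imp_le[OF YZ(5)] simp del: of_nat_Suc)
  have Nl: "(\<lambda>n. N (Y n)) \<longlonglongrightarrow> - axis i 1"
    using continuous_on_tendsto_compose[OF cN Yl] U YZ(1) unfolding N\<xi>[symmetric]
    by (auto simp: chart_dom_def)
  \<comment> \<open>The wall normals tend to the negative axis vector and the gradient of
    \<open>p\<close> is bounded, so exchanging one for the other costs nothing in the limit.\<close>
  have "(\<lambda>n. B * norm (N (Y n) + axis i 1)) \<longlonglongrightarrow> B * norm (- axis i 1 + axis i (1::real) :: real^3)"
    by (intro tendsto_intros Nl)
  then have Bl: "(\<lambda>n. B * norm (N (Y n) + axis i 1)) \<longlonglongrightarrow> 0" by simp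
  have "(\<lambda>n. grad p (Z n) \<bullet> (N (Y n) + axis i 1)) \<longlonglongrightarrow> 0"
  proof (rule tendsto_rabs_zero_cancel, rule tendsto_sandwich[OF _ _ tendsto_const Bl])
    show "\<forall>\<^sub>F n in sequentially. \<bar>grad p (Z n) \<bullet> (N (Y n) + axis i 1)\<bar> \<le> B * norm (N (Y n) + axis i 1)"
      using B[OF YZ(3)] by (intro always_eventually allI order_trans[OF Cauchy_Schwarz_ineq2] mult_right_mono) auto
  qed auto
  moreover have "(\<lambda>n. grad p (Z n) \<bullet> N (Y n) + partial i p (Z n)) \<longlonglongrightarrow> 0 + \<v> i"
    by (intro tendsto_add nl pl)
  ultimately have "\<v> i = 0"
    by (simp add: inner_add_right inner_axis grad_def LIMSEQ_unique)
  then show False using v by simp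
qed

text \<open>By \<open>disc_in_J\<close> the scaled point has a neighbourhood in the open set J; the
  part of it below the face planes belongs to the node by \<open>J_below\<close>.\<close>

lemma disc_half_ball:
  assumes neu: "neumann_potential l0 \<Xi> \<v> p" and v: "\<v> i \<noteq> 0"
    and B: "\<And>x. x \<in> \<Xi> \<Longrightarrow> norm (grad p x) \<le> B"
    and \<xi>: "\<xi> $ i = l0" "norm (bar i \<xi>) < h i"
  shows "\<exists>d>0. \<forall>y. dist y \<xi> < d \<longrightarrow> y $ i < l0 \<longrightarrow> y \<in> \<Xi>"
proof -
  define A where "A = (\<lambda>y. \<epsilon> *\<^sub>R y) -` J \<inter> (\<Inter>j\<in>-{i}. {y::real^3. y $ j < l0})"
  have oA: "open A"
    unfolding A_def by (intro open_Int open_INT open_vimage open_J) (auto intro!: open_Collect_less continuous_intros)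
  have "\<xi> $ j < l0" if "j \<noteq> i" for j
    using abs_nth_le_norm_bar[OF that, of \<xi>] \<xi> h_le_l0[of i] by linarith
  then have "\<xi> \<in> A" using disc_in_J[OF assms] by (auto simp: A_def)
  then obtain d where d: "d > 0" "ball \<xi> d \<subseteq> A" using oA by (meson openE)
  have "y \<in> \<Xi>" if "dist y \<xi> < d" "y $ i < l0" for y
  proof -
    have "y \<in> A" using that d by (auto simp: dist_commute)
    then show ?thesis using that(2) by (intro J_below) (auto simp: A_def)
  qed
  then show ?thesis using d by blast
qed

text \<open>At a wall point \<open>no_flux_boundary\<close> applies with the negative gradient of
  the chart as transversal direction. The Neumann condition is only pointwise on the wall; its
  uniformity in a thin layer follows from compactness, continuity of the chart gradient and
  boundedness of the field.\<close>

lemma no_flux_at_side: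
  assumes sol: "solenoidal \<Xi> (grad p) DV B" and neu: "neumann_potential l0 \<Xi> \<v> p"
    and x: "x \<in> closure \<Xi>" "\<And>i. x $ i < l0"
  shows "solenoidal.no_flux_at \<Xi> (grad p) x"
proof (cases "x \<in> \<Xi>")
  case True
  then show ?thesis by (rule solenoidal.no_flux_interior[OF sol])
next
  case False
  have B: "\<And>y. y \<in> \<Xi> \<Longrightarrow> norm (grad p y) \<le> B" using sol by (simp add: solenoidal_def)
  have xf: "x \<in> frontier \<Xi>" using x False by (simp add: frontier_\<Xi>)
  then obtain U \<rho> where d: "local_defining_function J (\<epsilon> *\<^sub>R x) U \<rho>"
    using smooth_boundary[OF x(1) side_frontier_J] x(2) by blast
  define \<rho>' where "\<rho>' y = \<rho> (\<epsilon> *\<^sub>R y)" for y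
  define G where "G y = \<epsilon> *\<^sub>R grad \<rho> (\<epsilon> *\<^sub>R y)" for y
  let ?U = "chart_dom U"
  have oU: "open ?U" by (rule open_chart_dom[OF d])
  have xU: "x \<in> ?U" using d x by (auto simp: local_defining_function_def chart_dom_def)
  have C: "C1_on ?U \<rho>' G"
    unfolding \<rho>'_def[abs_def] G_def[abs_def]
    by (rule C1_on_subset[OF chart_scaled(2)[OF d]]) (auto simp: chart_dom_def)
  have dom: "\<Xi> \<inter> ?U = {y \<in> ?U. \<rho>' y < 0}" unfolding \<rho>'_def by (rule chart_dom_\<Xi>[OF d])
  have Gn: "G y \<noteq> 0" if "y \<in> ?U" for y
    using that d \<epsilon> by (auto simp: local_defining_function_def chart_dom_def G_def)
  \<comment> \<open>At \<open>x\<close> itself the inner product is minus the full square; half of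
    it remains in a neighbourhood.\<close>
  define c where "c = (norm (G x))\<^sup>2 / 2"
  have c: "0 < c" using Gn[OF xU] by (simp add: c_def)
  define A where "A = ?U \<inter> (\<lambda>y. G y \<bullet> - G x) -` {..<- c}"
  have "open A"
    unfolding A_def by (intro continuous_open_preimage oU) (auto intro!: continuous_intros C1_onD(2)[OF C])
  moreover have "x \<in> A" using xU c by (simp add: A_def c_def flip: power2_norm_eq_inner)
  ultimately obtain r where r: "r > 0" "cball x r \<subseteq> A" using open_contains_cball by blast
  show ?thesis
  proof (rule solenoidal.no_flux_boundary[OF sol r(1) _ oU C dom c, where e = "- G x"])
    show sub: "cball x r \<subseteq> ?U" using r by (auto simp: A_def)
    show "G y \<bullet> - G x \<le> - c" if "y \<in> cball x r" for y using r that by (auto simp: A_def)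
    fix \<eta> :: real assume \<eta>: "\<eta> > 0"
    show "\<exists>d>0. \<forall>y\<in>cball x r \<inter> \<Xi>. \<rho>' y > - d \<longrightarrow> \<bar>grad p y \<bullet> G y\<bar> \<le> \<eta>"
    \<comment> \<open>Otherwise points of the node approaching the wall, with flux above \<eta>,
      accumulate at a point of the closed ball. It is a wall point, and the Neumann condition there
      gives flux zero in the limit.\<close>
    proof (rule ccontr)
      assume neg: "\<not> ?thesis"
      have "\<exists>y. y \<in> cball x r \<and> y \<in> \<Xi> \<and> \<rho>' y > - (1 / real (Suc n)) \<and> \<bar>grad p y \<bullet> G y\<bar> > \<eta>" for n
      proof -
        have "0 < 1 / real (Suc n)" by simp
        then show ?thesis using neg by (meson IntE not_le)
      qed
      then obtain Y where Y: "\<And>n. Y n \<in> cball x r" "\<And>n. Y n \<in> \<Xi>" "\<And>n. \<rho>' (Y n) > - (1 / real (Suc n))"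
        "\<And>n. \<bar>grad p (Y n) \<bullet> G (Y n)\<bar> > \<eta>" by metis
      obtain y k where y: "y \<in> cball x r" "strict_mono k" "(Y \<circ> k) \<longlonglongrightarrow> y"
        using compact_cball[of x r] Y(1) unfolding compact_def by meson
      have yU: "y \<in> ?U" using y(1) sub by blast
      define Z where "Z n = Y (k n)" for n
      have Zl: "Z \<longlonglongrightarrow> y" using y(3) by (simp add: Z_def[abs_def] o_def)
      have ZU: "Z n \<in> ?U" for n using Y(1) sub by (auto simp: Z_def)
      have lim0: "(\<lambda>n. - (1 / real (Suc (k n)))) \<longlonglongrightarrow> - 0"
        by (intro tendsto_minus LIMSEQ_subseq_LIMSEQ[OF LIMSEQ_Suc[OF lim_1_over_n] y(2), unfolded o_def])
      have "(\<lambda>n. \<rho>' (Z n)) \<longlonglongrightarrow> \<rho>' y"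
        by (rule continuous_on_tendsto_compose[OF C1_on_continuous[OF C] Zl yU]) (use ZU in auto)
      then have "- 0 \<le> \<rho>' y"
        by (rule LIMSEQ_le[OF lim0]) (use Y(3) in \<open>auto simp: Z_def intro: less_imp_le simp del: of_nat_Suc\<close>)
      then have yn: "y \<notin> \<Xi>" using dom yU by force
      have "y \<in> closure \<Xi>"
        by (rule closed_sequentially[OF closed_closure _ Zl]) (use Y(2) closure_subset in \<open>auto simp: Z_def\<close>)
      then have yf: "y \<in> frontier \<Xi>" using yn by (simp add: frontier_\<Xi>)
      have "y \<notin> (\<Union>i. node_face l0 \<Xi> i)" using yU by (intro side_not_face) (auto simp: chart_dom_def)
      then have "((\<lambda>z. grad p z \<bullet> ((1 / norm (grad \<rho> (\<epsilon> *\<^sub>R y))) *\<^sub>R grad \<rho> (\<epsilon> *\<^sub>R y))) \<longlongrightarrow> 0) (at y within \<Xi>)"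
        using neu yf side_normal[OF d yf yU] unfolding neumann_potential_def by blast
      then have "(\<lambda>n. grad p (Z n) \<bullet> ((1 / norm (grad \<rho> (\<epsilon> *\<^sub>R y))) *\<^sub>R grad \<rho> (\<epsilon> *\<^sub>R y))) \<longlonglongrightarrow> 0"
        by (rule filterlim_compose[OF _ filterlim_at_within_seq[OF Zl _ yn]]) (use Y(2) in \<open>simp add: Z_def\<close>)
      \<comment> \<open>Multiplication by the length of the scaled gradient turns the unit normal
        into \<open>G y\<close>.\<close>
      then have "(\<lambda>n. (\<epsilon> * norm (grad \<rho> (\<epsilon> *\<^sub>R y))) * (grad p (Z n) \<bullet> ((1 / norm (grad \<rho> (\<epsilon> *\<^sub>R y))) *\<^sub>R grad \<rho> (\<epsilon> *\<^sub>R y))))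
        \<longlonglongrightarrow> (\<epsilon> * norm (grad \<rho> (\<epsilon> *\<^sub>R y))) * 0" by (intro tendsto_mult tendsto_const)
      moreover have "(\<epsilon> * norm (grad \<rho> (\<epsilon> *\<^sub>R y))) * (grad p (Z n) \<bullet> ((1 / norm (grad \<rho> (\<epsilon> *\<^sub>R y))) *\<^sub>R grad \<rho> (\<epsilon> *\<^sub>R y)))
        = grad p (Z n) \<bullet> G y" for n
        using Gn[OF yU] by (simp add: G_def)
      ultimately have 1: "(\<lambda>n. grad p (Z n) \<bullet> G y) \<longlonglongrightarrow> 0" by simp
      have "(\<lambda>n. G (Z n)) \<longlonglongrightarrow> G y"
        by (rule continuous_on_tendsto_compose[OF C1_onD(2)[OF C] Zl yU]) (use ZU in auto)
      then have "(\<lambda>n. B * norm (G (Z n) - G y)) \<longlonglongrightarrow> B * norm (G y - G y)" by (intro tendsto_intros)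
      then have Bl: "(\<lambda>n. B * norm (G (Z n) - G y)) \<longlonglongrightarrow> 0" by simp
      have 2: "(\<lambda>n. grad p (Z n) \<bullet> (G (Z n) - G y)) \<longlonglongrightarrow> 0"
      proof (rule tendsto_rabs_zero_cancel, rule tendsto_sandwich[OF _ _ tendsto_const Bl])
        show "\<forall>\<^sub>F n in sequentially. \<bar>grad p (Z n) \<bullet> (G (Z n) - G y)\<bar> \<le> B * norm (G (Z n) - G y)"
          using B[OF Y(2)] by (intro always_eventually allI order_trans[OF Cauchy_Schwarz_ineq2] mult_right_mono) (auto simp: Z_def)
      qed auto
      have "(\<lambda>n. \<bar>grad p (Z n) \<bullet> G (Z n)\<bar>) \<longlonglongrightarrow> \<bar>0\<bar>"
        using tendsto_rabs[OF tendsto_add[OF 1 2]] by (simp add: inner_diff_right)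
      then have "\<eta> \<le> \<bar>0\<bar>"
        by (rule LIMSEQ_le_const) (use Y(4) in \<open>auto simp: Z_def intro: less_imp_le\<close>)
      then show False using \<eta> by simp
    qed
  qed
qed

text \<open>Points of an open disc are moved along the negative axis. At a wall or edge point the
  translation has to preserve two conditions: a negative defining function of the junction, and
  coordinates below all face planes. By \<open>edge_tangent\<close> the gradient has no component
  along the axes of the planes through the point, so both conditions can be met by one vector. This
  replaces regularity of the node at the edges.\<close>

lemma translation_inwards:
  assumes neu: "neumann_potential l0 \<Xi> \<v> p" and v: "\<And>i. \<v> i \<noteq> 0"
    and B: "\<And>x. x \<in> \<Xi> \<Longrightarrow> norm (grad p x) \<le> B"
    and x: "x \<in> closure \<Xi>"
  shows "\<exists>r>0. \<exists>e. x + e \<in> \<Xi> \<and> (\<forall>y\<in>ball x r \<inter> \<Xi>. \<forall>s\<in>{0..1}. y + s *\<^sub>R e \<in> \<Xi>)"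
proof (cases "x \<in> \<Xi>")
  case True
  then show ?thesis by (intro exI[of _ 1] conjI exI[of _ 0]) auto
next
  case x\<Xi>: False
  show ?thesis
  proof (cases "\<exists>i. x $ i = l0 \<and> norm (bar i x) < h i")
    case True
    then obtain i where i: "x $ i = l0" "norm (bar i x) < h i" by blast
    obtain d where d: "d > 0" "\<And>y. dist y x < d \<Longrightarrow> y $ i < l0 \<Longrightarrow> y \<in> \<Xi>"
      using disc_half_ball[OF neu v B i] by blast
    \<comment> \<open>Half of the radius \<open>d\<close> is spent on the translation and half on
      the neighbourhood of the point.\<close>
    define e where "e = (- (d / 2)) *\<^sub>R axis i (1::real)"
    have e: "norm e = d / 2" "e $ i = - (d / 2)" using d by (auto simp: e_def)
    show ?thesis
    proof (intro exI[of _ "d / 2"] conjI exI[of _ e] ballI)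
      show "x + e \<in> \<Xi>" by (rule d(2)) (use d(1) e i in \<open>auto simp: dist_norm\<close>)
      fix y s assume y: "y \<in> ball x (d / 2) \<inter> \<Xi>" and s: "s \<in> {0..1::real}"
      show "y + s *\<^sub>R e \<in> \<Xi>"
      proof (rule d(2))
        have "norm (y + s *\<^sub>R e - x) \<le> norm (y - x) + norm (s *\<^sub>R e)"
          using norm_triangle_ineq[of "y - x" "s *\<^sub>R e"] by (simp add: algebra_simps)
        also have "norm (s *\<^sub>R e) \<le> d / 2"
          using s e(1) mult_left_le_one_le[of "norm e" s] by simp
        also have "norm (y - x) < d / 2" using y by (simp add: dist_norm norm_minus_commute)
        finally show "dist (y + s *\<^sub>R e) x < d" by (simp add: dist_norm)
        have "s * (d / 2) \<ge> 0" using s d by simp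
        then show "(y + s *\<^sub>R e) $ i < l0" using e below[of y i] y by simp
      qed
    qed (use d in auto)
  next
    case noface: False
    have edge: "norm (bar i x) = h i" if "x $ i = l0" for i
      using noface that face_iff[of x i] x by force
    have "\<epsilon> *\<^sub>R x \<in> frontier J"
    proof (cases "\<exists>i. x $ i = l0")
      case True
      then show ?thesis using edge_frontier_J[OF x] edge by blast
    next
      case False
      then have "x $ i < l0" for i using closure_below[OF x, of i] by (simp add: less_le)
      then show ?thesis using side_frontier_J x x\<Xi> by (simp add: frontier_\<Xi>)
    qed
    then obtain U \<rho> where d: "local_defining_function J (\<epsilon> *\<^sub>R x) U \<rho>" using smooth_boundary[OF x] by blast
    let ?U = "{y. \<epsilon> *\<^sub>R y \<in> U}"
    define \<rho>' where "\<rho>' y = \<rho> (\<epsilon> *\<^sub>R y)" for y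
    define G where "G y = \<epsilon> *\<^sub>R grad \<rho> (\<epsilon> *\<^sub>R y)" for y
    have oU: "open ?U" and C: "C1_on ?U \<rho>' G"
      unfolding \<rho>'_def[abs_def] G_def[abs_def] by (rule chart_scaled[OF d])+
    have xU: "x \<in> ?U" and JU: "\<And>y. y \<in> ?U \<Longrightarrow> \<epsilon> *\<^sub>R y \<in> J \<longleftrightarrow> \<rho>' y < 0"
      using d by (auto simp: local_defining_function_def \<rho>'_def)
    have Gx: "G x \<noteq> 0" using d \<epsilon> by (auto simp: local_defining_function_def G_def)
    have Gi: "G x $ i = 0" if "x $ i = l0" for i
      using edge_tangent[OF x that edge[OF that] d] by (simp add: G_def)
    define I where "I = {i. x $ i = l0}"
    \<comment> \<open>The gradient term moves into the junction, the axis vectors move below the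
      planes through the point; the two are orthogonal, so neither spoils the other.\<close>
    define e where "e = - G x - (\<Sum>i\<in>I. axis i 1)"
    have ei: "e $ i = - 1" if "i \<in> I" for i
      using that Gi[of i] by (simp add: e_def I_def axis_def)
    have Ge: "G x \<bullet> e = - (norm (G x))\<^sup>2"
      using Gi by (simp add: e_def I_def inner_diff_right inner_sum_right inner_axis power2_norm_eq_inner)
    define A where "A = (?U \<inter> (\<lambda>y. G y \<bullet> e) -` {..<0}) \<inter> (\<Inter>i\<in>-I. {y::real^3. y $ i < l0})"
    have "open A"
      unfolding A_def by (intro open_Int continuous_open_preimage oU open_INT)
        (auto intro!: continuous_intros C1_onD(2)[OF C] open_Collect_less)
    moreover have "x \<in> A"
      using xU Ge Gx closure_below[OF x] by (auto simp: A_def I_def less_le)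
    ultimately obtain R where R: "R > 0" "ball x R \<subseteq> A" by (meson openE)
    \<comment> \<open>Makes the translation shorter than \<open>R / 2\<close>, strictly because of
      the summand 1.\<close>
    define t where "t = R / (2 * (norm e + 1))"
    have t: "t > 0" using R by (simp add: t_def add_nonneg_pos)
    have te: "norm (t *\<^sub>R e) < R / 2"
    proof -
      have "norm (t *\<^sub>R e) = (R / 2) * (norm e / (norm e + 1))" using R by (simp add: t_def)
      also have "\<dots> < (R / 2) * 1"
        using R norm_ge_zero[of e] by (intro mult_strict_left_mono) (auto simp: divide_less_eq add_nonneg_pos)
      finally show ?thesis by simp
    qed
    have inball: "y + s *\<^sub>R t *\<^sub>R e \<in> ball x R" if "y \<in> ball x (R / 2)" "s \<in> {0..1}" for y s
    proof -
      have "norm (y + s *\<^sub>R t *\<^sub>R e - x) \<le> norm (y - x) + norm (s *\<^sub>R t *\<^sub>R e)"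
        using norm_triangle_ineq[of "y - x" "s *\<^sub>R t *\<^sub>R e"] by (simp add: algebra_simps)
      also have "norm (s *\<^sub>R t *\<^sub>R e) = \<bar>s\<bar> * norm (t *\<^sub>R e)" by (rule norm_scaleR)
      also have "\<dots> \<le> norm (t *\<^sub>R e)" using that by (intro mult_left_le_one_le) auto
      also have "norm (y - x) < R / 2" using that by (simp add: dist_norm norm_minus_commute)
      finally show ?thesis using te by (simp add: dist_norm norm_minus_commute)
    qed
    \<comment> \<open>By the mean value theorem \<open>\<rho>'\<close> drops strictly along the
      segment, whose points stay in the set where the derivative in direction \<open>e\<close> is
      negative. The premises are weak inequalities in order to include the point \<open>x\<close>
      itself.\<close>
    have key: "y + s *\<^sub>R t *\<^sub>R e \<in> \<Xi>"
      if y: "y \<in> ball x (R / 2)" "\<rho>' y \<le> 0" "\<And>i. i \<in> I \<Longrightarrow> y $ i \<le> l0" and s: "0 < s" "s \<le> 1" for y s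
    proof (rule J_below)
      let ?z = "\<lambda>u. y + u *\<^sub>R t *\<^sub>R e"
      have zA: "?z u \<in> A" if "0 \<le> u" "u \<le> 1" for u using inball[OF y(1)] that R by auto
      have D: "((\<lambda>u. \<rho>' (?z u)) has_derivative (\<lambda>h. (h *\<^sub>R t *\<^sub>R e) \<bullet> G (?z u))) (at u)" if "0 \<le> u" "u \<le> 1" for u
        by (rule has_derivative_compose[of ?z "\<lambda>h. h *\<^sub>R t *\<^sub>R e" u UNIV \<rho>'])
          (use C1_onD(1)[OF C, of "?z u"] zA[OF that] in \<open>auto simp: gderiv_def A_def intro!: derivative_eq_intros\<close>)
      have "\<exists>u\<in>{0<..<s}. \<rho>' (?z s) - \<rho>' (?z 0) = ((s - 0) *\<^sub>R t *\<^sub>R e) \<bullet> G (?z u)"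
      proof (rule mvt_simple[OF s(1)])
        fix u assume u: "0 \<le> u" "u \<le> s"
        have "0 \<le> u" "u \<le> 1" using u s by auto
        from has_derivative_at_withinI[OF D[OF this]]
        show "((\<lambda>u. \<rho>' (?z u)) has_derivative (\<lambda>h. (h *\<^sub>R t *\<^sub>R e) \<bullet> G (?z u))) (at u within {0..s})" .
      qed
      then obtain u where u0: "u \<in> {0<..<s}" "\<rho>' (?z s) - \<rho>' (?z 0) = ((s - 0) *\<^sub>R t *\<^sub>R e) \<bullet> G (?z u)"
        by (rule bexE)
      then have u: "0 < u" "u < s" and u3: "\<rho>' (?z s) - \<rho>' y = s * (t * (e \<bullet> G (?z u)))" by simp_all
      have "G (?z u) \<bullet> e < 0" using zA[of u] u s by (auto simp: A_def)
      then have "s * (t * (e \<bullet> G (?z u))) < 0" using s t by (simp add: mult_pos_neg inner_commute)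
      then have "\<rho>' (?z s) < 0" using u3 y(2) by linarith
      then show "\<epsilon> *\<^sub>R ?z s \<in> J" using JU[of "?z s"] zA[of s] s by (auto simp: A_def)
      fix i
      show "?z s $ i < l0"
      proof (cases "i \<in> I")
        case True
        have "0 < s * t" using s t by simp
        then show ?thesis using y(3)[OF True] ei[OF True] by simp
      next
        case False
        then show ?thesis using zA[of s] s by (auto simp: A_def)
      qed
    qed
    show ?thesis
    proof (intro exI[of _ "R / 2"] conjI exI[of _ "t *\<^sub>R e"] ballI)
      have "\<rho>' x \<le> 0"
        using defining_function_frontier(1)[OF d _ closure_\<Xi>_in_J[OF x]] xU by (simp add: \<rho>'_def)
      then show "x + t *\<^sub>R e \<in> \<Xi>" using key[of x 1] R closure_below[OF x] by auto
      fix y s assume y: "y \<in> ball x (R / 2) \<inter> \<Xi>" and s: "s \<in> {0..1::real}"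
      have "y \<in> ball x R" using R y by auto
      then have "y \<in> ?U" using R(2) unfolding A_def by blast
      then have "\<rho>' y < 0" using JU \<Xi>_in_J y by blast
      then show "y + s *\<^sub>R t *\<^sub>R e \<in> \<Xi>"
        using key[of y s] y s below by (cases "s = 0") (auto intro: less_imp_le)
    qed (use R in auto)
  qed
qed

end

section \<open>The Poincare inequality\<close>

lemma set_integrable_bounded_open:
  fixes f :: "'a::euclidean_space \<Rightarrow> real"
  assumes f: "continuous_on UNIV f" and A: "open A" "bounded A"
  shows "set_integrable lborel A f"
proof -
  have "compact (f ` closure A)"
    using A by (intro compact_continuous_image continuous_on_subset[OF f]) auto
  then obtain M where M: "\<And>x. x \<in> closure A \<Longrightarrow> norm (f x) \<le> M"
    using compact_imp_bounded bounded_iff by (metis imageI)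
  show ?thesis
    by (rule set_integrable_bounded_continuous[OF continuous_on_subset[OF f] A M])
      (use closure_subset in auto)
qed

lemma LINT_nonneg: "(\<And>x. x \<in> A \<Longrightarrow> 0 \<le> f x) \<Longrightarrow> 0 \<le> (LINT x:A|M. f x :: real)"
  unfolding set_lebesgue_integral_def by (intro integral_nonneg_AE) (auto simp: indicator_def)

text \<open>The value at \<open>y\<close> is compared with that at \<open>y + e\<close> by
  integrating the gradient along the segment. After exchanging the integrals, each intermediate
  translate of \<open>A\<close> lies in \<open>\<Xi>\<close>, so its share is at most the whole
  Dirichlet integral.\<close>

lemma translation_L2:
  fixes u :: "'a::euclidean_space \<Rightarrow> real"
  assumes u: "C1_on UNIV u Du" and A: "open A" "bounded A" and A': "open A'" "bounded A'"
    and \<Xi>: "open \<Xi>" "bounded \<Xi>"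
    and e: "\<And>y. y \<in> A \<Longrightarrow> y + e \<in> A'" and seg: "\<And>y s. y \<in> A \<Longrightarrow> 0 < s \<Longrightarrow> s < 1 \<Longrightarrow> y + s *\<^sub>R e \<in> \<Xi>"
  shows "(LINT x:A|lborel. (u x)\<^sup>2) \<le> 2 * (LINT x:A'|lborel. (u x)\<^sup>2) + 2 * (norm e)\<^sup>2 * (LINT x:\<Xi>|lborel. (norm (Du x))\<^sup>2)"
proof -
  have cu [continuous_intros]: "continuous_on S f \<Longrightarrow> continuous_on S (\<lambda>x. u (f x))" for S :: "'b::t2_space set" and f
    by (rule continuous_on_compose2[OF C1_on_continuous[OF u]]) auto
  have cDu [continuous_intros]: "continuous_on S f \<Longrightarrow> continuous_on S (\<lambda>x. Du (f x))" for S :: "'b::t2_space set" and f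
    by (rule continuous_on_compose2[OF C1_onD(2)[OF u]]) auto
  have shift: "(LINT y:A|lborel. g (y + s *\<^sub>R e)) \<le> (LINT x:S|lborel. g x)"
    if g: "continuous_on UNIV g" "\<And>x. 0 \<le> g x" and S: "open S" "bounded S" "\<And>y. y \<in> A \<Longrightarrow> y + s *\<^sub>R e \<in> S"
    for g :: "'a \<Rightarrow> real" and S s
  proof -
    let ?h = "\<lambda>x. indicator S x *\<^sub>R g x"
    have i: "integrable lborel ?h"
      using set_integrable_bounded_open[OF g(1) S(1,2)] by (simp add: set_integrable_def)
    have m: "?h \<in> borel_measurable borel" using i by auto
    have tr: "(\<lambda>y. s *\<^sub>R e + y) \<in> lborel \<rightarrow>\<^sub>M borel" by simp
    have i2: "integrable lborel (\<lambda>y. ?h (s *\<^sub>R e + y))"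
      using integrable_distr_eq[OF tr m] i by (simp add: lborel_distr_plus)
    have "(LINT y:A|lborel. g (y + s *\<^sub>R e)) \<le> (\<integral>y. ?h (s *\<^sub>R e + y) \<partial>lborel)"
      unfolding set_lebesgue_integral_def
    proof (rule integral_mono[OF _ i2])
      have "set_integrable lborel A (\<lambda>y. g (y + s *\<^sub>R e))"
        by (rule set_integrable_bounded_open[OF _ A]) (intro continuous_on_compose2[OF g(1)] continuous_intros, auto)
      then show "integrable lborel (\<lambda>y. indicator A y *\<^sub>R g (y + s *\<^sub>R e))" by (simp add: set_integrable_def)
      show "indicator A y *\<^sub>R g (y + s *\<^sub>R e) \<le> ?h (s *\<^sub>R e + y)" for y
        using S(3)[of y] g(2) by (auto simp: indicator_def add.commute)
    qed
    also have "\<dots> = (\<integral>x. ?h x \<partial>distr lborel borel (\<lambda>y. s *\<^sub>R e + y))"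
      by (rule integral_distr[OF tr m, symmetric])
    also have "\<dots> = (LINT x:S|lborel. g x)" by (simp add: lborel_distr_plus set_lebesgue_integral_def)
    finally show ?thesis .
  qed
  define g where "g x = (norm (Du x))\<^sup>2" for x
  have cg [continuous_intros]: "continuous_on S f \<Longrightarrow> continuous_on S (\<lambda>x. g (f x))" for S :: "'b::t2_space set" and f
    unfolding g_def by (intro continuous_intros)
  have ptw: "(u y)\<^sup>2 \<le> 2 * (u (y + e))\<^sup>2 + 2 * (norm e)\<^sup>2 * (LINT s:{0<..<1}|lborel. g (y + s *\<^sub>R e))" for y
  proof -
    have D: "DERIV (\<lambda>s. u (y + s *\<^sub>R e)) s :> e \<bullet> Du (y + s *\<^sub>R e)" for s
    proof -
      have "((\<lambda>s. u (y + s *\<^sub>R e)) has_derivative (\<lambda>h. (h *\<^sub>R e) \<bullet> Du (y + s *\<^sub>R e))) (at s)"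
        by (rule has_derivative_compose[of "\<lambda>s. y + s *\<^sub>R e" "\<lambda>h. h *\<^sub>R e" s UNIV u])
          (use C1_onD(1)[OF u, of "y + s *\<^sub>R e"] in \<open>auto simp: gderiv_def intro!: derivative_eq_intros\<close>)
      moreover have "(\<lambda>h. (h *\<^sub>R e) \<bullet> Du (y + s *\<^sub>R e)) = (*) (e \<bullet> Du (y + s *\<^sub>R e))"
        by (simp add: fun_eq_iff)
      ultimately show ?thesis by (simp add: has_field_derivative_def)
    qed
    have "(u (y + 1 *\<^sub>R e) - u (y + 0 *\<^sub>R e))\<^sup>2 \<le> (1 - 0) * (LINT s:{0<..<1}|lborel. (e \<bullet> Du (y + s *\<^sub>R e))\<^sup>2)"
      by (rule increment_sq_le[OF D]) (intro continuous_intros | simp)+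
    also have "\<dots> \<le> (1 - 0) * (LINT s:{0<..<1}|lborel. (norm e)\<^sup>2 * g (y + s *\<^sub>R e))"
    proof (intro mult_left_mono LINT_mono_Ioo)
      fix s
      have "\<bar>e \<bullet> Du (y + s *\<^sub>R e)\<bar>\<^sup>2 \<le> (norm e * norm (Du (y + s *\<^sub>R e)))\<^sup>2"
        by (intro power_mono Cauchy_Schwarz_ineq2) auto
      then show "(e \<bullet> Du (y + s *\<^sub>R e))\<^sup>2 \<le> (norm e)\<^sup>2 * g (y + s *\<^sub>R e)"
        by (simp add: g_def power_mult_distrib)
    qed (intro continuous_intros | simp)+
    finally have "(u (y + e) - u y)\<^sup>2 \<le> (norm e)\<^sup>2 * (LINT s:{0<..<1}|lborel. g (y + s *\<^sub>R e))" by simp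
    moreover have "(u y)\<^sup>2 \<le> 2 * (u (y + e))\<^sup>2 + 2 * (u (y + e) - u y)\<^sup>2"
      using zero_le_power2[of "u y - 2 * u (y + e)"] by (simp add: power2_eq_square algebra_simps)
    ultimately show ?thesis by linarith
  qed
  have "set_integrable lborel ({0<..<1} \<times> A) (\<lambda>p. g (snd p + fst p *\<^sub>R e))"
    using A by (intro set_integrable_bounded_open continuous_intros open_Times bounded_Times) auto
  then have ip: "integrable (lborel \<Otimes>\<^sub>M lborel) (\<lambda>(s, y). indicator {0<..<1} s * (indicator A y * g (y + s *\<^sub>R e)))"
    unfolding set_integrable_def lborel_prod
    by (rule Bochner_Integration.integrable_cong[THEN iffD1, rotated -1]) (auto simp: indicator_def)
  have inner: "(\<integral>s. indicator {0<..<1} s * (indicator A y * g (y + s *\<^sub>R e)) \<partial>lborel)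
    = indicator A y *\<^sub>R (LINT s:{0<..<1}|lborel. g (y + s *\<^sub>R e))" for y
    by (simp add: set_lebesgue_integral_def mult_ac flip: integral_mult_right_zero)
  have iI: "set_integrable lborel A (\<lambda>y. LINT s:{0<..<1}|lborel. g (y + s *\<^sub>R e))"
    using lborel_pair.integrable_snd[OF ip] unfolding inner set_integrable_def .
  have swap: "(LINT y:A|lborel. (LINT s:{0<..<1}|lborel. g (y + s *\<^sub>R e))) = (LINT s:{0<..<1}|lborel. (LINT y:A|lborel. g (y + s *\<^sub>R e)))"
    and iI2: "set_integrable lborel {0<..<1} (\<lambda>s. LINT y:A|lborel. g (y + s *\<^sub>R e))"
  proof -
    have inner': "(\<integral>y. indicator {0<..<1} s * (indicator A y * g (y + s *\<^sub>R e)) \<partial>lborel)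
      = indicator {0<..<1} s *\<^sub>R (LINT y:A|lborel. g (y + s *\<^sub>R e))" for s
      by (simp add: set_lebesgue_integral_def)
    show "(LINT y:A|lborel. (LINT s:{0<..<1}|lborel. g (y + s *\<^sub>R e))) = (LINT s:{0<..<1}|lborel. (LINT y:A|lborel. g (y + s *\<^sub>R e)))"
      using lborel_pair.Fubini_integral[OF ip] unfolding inner inner'
      by (simp add: set_lebesgue_integral_def)
    show "set_integrable lborel {0<..<1} (\<lambda>s. LINT y:A|lborel. g (y + s *\<^sub>R e))"
      using lborel_pair.integrable_fst[OF ip] unfolding inner' set_integrable_def .
  qed
  have g\<Xi>: "(LINT s:{0<..<1}|lborel. (LINT y:A|lborel. g (y + s *\<^sub>R e))) \<le> (LINT x:\<Xi>|lborel. g x)"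
  proof -
    have "(LINT s:{0<..<1}|lborel. (LINT y:A|lborel. g (y + s *\<^sub>R e))) \<le> (LINT s:{0<..<1::real}|lborel. (LINT x:\<Xi>|lborel. g x))"
    proof (rule set_integral_mono[OF iI2])
      show "set_integrable lborel {0<..<1::real} (\<lambda>s. LINT x:\<Xi>|lborel. g x)" by (intro set_integrable_Ioo continuous_intros)
      show "(LINT y:A|lborel. g (y + s *\<^sub>R e)) \<le> (LINT x:\<Xi>|lborel. g x)" if "s \<in> {0<..<1}" for s
        by (rule shift) (use that seg \<Xi> in \<open>auto intro!: continuous_intros simp: g_def\<close>)
    qed
    then show ?thesis by (simp add: set_lebesgue_integral_def)
  qed
  have iu: "set_integrable lborel A (\<lambda>y. (u (y + e))\<^sup>2)" "set_integrable lborel A (\<lambda>y. (u y)\<^sup>2)"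
    by (intro set_integrable_bounded_open A continuous_intros)+
  have "(LINT x:A|lborel. (u x)\<^sup>2) \<le> (LINT y:A|lborel. 2 * (u (y + e))\<^sup>2 + 2 * (norm e)\<^sup>2 * (LINT s:{0<..<1}|lborel. g (y + s *\<^sub>R e)))"
    by (intro set_integral_mono iu set_integral_add set_integrable_mult_right iI ptw)
  also have "\<dots> = 2 * (LINT y:A|lborel. (u (y + e))\<^sup>2) + 2 * (norm e)\<^sup>2 * (LINT y:A|lborel. (LINT s:{0<..<1}|lborel. g (y + s *\<^sub>R e)))"
    by (subst set_integral_add, (intro set_integrable_mult_right iu iI)+, simp)
  also have "\<dots> \<le> 2 * (LINT x:A'|lborel. (u x)\<^sup>2) + 2 * (norm e)\<^sup>2 * (LINT x:\<Xi>|lborel. g x)"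
  proof -
    have "continuous_on UNIV (\<lambda>x. (u x)\<^sup>2)" by (intro continuous_intros)
    from shift[OF this _ A', of 1] e have "(LINT y:A|lborel. (u (y + e))\<^sup>2) \<le> (LINT x:A'|lborel. (u x)\<^sup>2)"
      by simp
    then show ?thesis using g\<Xi> unfolding swap by (intro add_mono mult_left_mono) auto
  qed
  finally show ?thesis by (simp add: g_def)
qed

text \<open>A Poincare constant for \<open>A\<close> that is uniform over all functions of class
  C^1. The energy is a parameter, since besides the Dirichlet integral it will contain a face
  term.\<close>

definition controlled_by :: "(('a::euclidean_space \<Rightarrow> real) \<Rightarrow> ('a \<Rightarrow> 'a) \<Rightarrow> real) \<Rightarrow> 'a set \<Rightarrow> bool" where
  "controlled_by E A \<longleftrightarrow> (\<exists>C\<ge>0. \<forall>u Du. C1_on UNIV u Du \<longrightarrow> (LINT x:A|lborel. (u x)\<^sup>2) \<le> C * E u Du)"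

text \<open>Mass is moved between balls by translations along segments inside the
  domain, and connectedness and compactness spread the control from one ball to the whole domain.\<close>

context
  fixes \<Xi> :: "'a::euclidean_space set" and E :: "('a \<Rightarrow> real) \<Rightarrow> ('a \<Rightarrow> 'a) \<Rightarrow> real"
  assumes \<Xi>: "open \<Xi>" "bounded \<Xi>" "connected \<Xi>"
    and E: "\<And>u Du. C1_on UNIV u Du \<Longrightarrow> (LINT x:\<Xi>|lborel. (norm (Du x))\<^sup>2) \<le> E u Du"
begin

private abbreviation "controlled \<equiv> controlled_by E"

private lemma E_nonneg: "C1_on UNIV u Du \<Longrightarrow> 0 \<le> E u Du"
  using E LINT_nonneg[of \<Xi> "\<lambda>x. (norm (Du x))\<^sup>2" lborel] by force

private lemma iu:
  assumes "C1_on UNIV u Du" "open A" "bounded A"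
  shows "set_integrable lborel A (\<lambda>x. (u x)\<^sup>2)"
  using C1_on_continuous[OF assms(1)] assms(2,3) by (intro set_integrable_bounded_open continuous_intros)

lemma controlled_subset:
  assumes "controlled A" "B \<subseteq> A" "open A" "bounded A" "open B"
  shows "controlled B"
proof -
  obtain C where C: "C \<ge> 0" "\<And>u Du. C1_on UNIV u Du \<Longrightarrow> (LINT x:A|lborel. (u x)\<^sup>2) \<le> C * E u Du"
    using assms(1) unfolding controlled_by_def by blast
  have "(LINT x:B|lborel. (u x)\<^sup>2) \<le> C * E u Du" if u: "C1_on UNIV u Du" for u Du
    using set_integral_mono_set[OF iu[OF u assms(5) bounded_subset[OF assms(4,2)]] iu[OF u assms(3,4)] assms(2)] C(2)[OF u]
    by simp
  then show ?thesis unfolding controlled_by_def using C(1) by blast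
qed

lemma controlled_translate:
  assumes "controlled A'" "open A" "bounded A" "open A'" "bounded A'"
    and "\<And>y. y \<in> A \<Longrightarrow> y + e \<in> A'" "\<And>y s. y \<in> A \<Longrightarrow> 0 < s \<Longrightarrow> s < 1 \<Longrightarrow> y + s *\<^sub>R e \<in> \<Xi>"
  shows "controlled A"
proof -
  obtain C where C: "C \<ge> 0" "\<And>u Du. C1_on UNIV u Du \<Longrightarrow> (LINT x:A'|lborel. (u x)\<^sup>2) \<le> C * E u Du"
    using assms(1) unfolding controlled_by_def by blast
  have "(LINT x:A|lborel. (u x)\<^sup>2) \<le> (2 * C + 2 * (norm e)\<^sup>2) * E u Du" if u: "C1_on UNIV u Du" for u Du
  proof -
    have "(LINT x:A|lborel. (u x)\<^sup>2) \<le> 2 * (LINT x:A'|lborel. (u x)\<^sup>2) + 2 * (norm e)\<^sup>2 * (LINT x:\<Xi>|lborel. (norm (Du x))\<^sup>2)"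
      by (rule translation_L2[OF u assms(2-5) \<Xi>(1,2) assms(6,7)])
    also have "\<dots> \<le> 2 * (C * E u Du) + 2 * (norm e)\<^sup>2 * E u Du"
      using C(2)[OF u] E[OF u] by (intro add_mono mult_left_mono) auto
    finally show ?thesis by (simp add: distrib_right)
  qed
  then show ?thesis unfolding controlled_by_def using C(1) by (intro exI[of _ "2 * C + 2 * (norm e)\<^sup>2"]) auto
qed

lemma controlled_Un:
  assumes "controlled A" "controlled B" "open A" "bounded A" "open B" "bounded B"
  shows "controlled (A \<union> B)"
proof -
  obtain C where C: "C \<ge> 0" "\<And>u Du. C1_on UNIV u Du \<Longrightarrow> (LINT x:A|lborel. (u x)\<^sup>2) \<le> C * E u Du"
    using assms(1) unfolding controlled_by_def by blast
  obtain D where D: "D \<ge> 0" "\<And>u Du. C1_on UNIV u Du \<Longrightarrow> (LINT x:B|lborel. (u x)\<^sup>2) \<le> D * E u Du"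
    using assms(2) unfolding controlled_by_def by blast
  have "(LINT x:A\<union>B|lborel. (u x)\<^sup>2) \<le> (C + D) * E u Du" if u: "C1_on UNIV u Du" for u Du
  proof -
    have "(LINT x:A\<union>B|lborel. (u x)\<^sup>2) \<le> (LINT x:A|lborel. (u x)\<^sup>2) + (LINT x:B|lborel. (u x)\<^sup>2)"
      using iu[OF u assms(3,4)] iu[OF u assms(5,6)] iu[OF u open_Un[OF assms(3,5)] bounded_Un[THEN iffD2, OF conjI[OF assms(4,6)]]]
      unfolding set_lebesgue_integral_def set_integrable_def
      unfolding Bochner_Integration.integral_add[OF iu[OF u assms(3,4), unfolded set_integrable_def]
          iu[OF u assms(5,6), unfolded set_integrable_def], symmetric]
      by (intro integral_mono Bochner_Integration.integrable_add) (auto simp: indicator_def)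
    then show ?thesis using C(2)[OF u] D(2)[OF u] by (simp add: distrib_right)
  qed
  then show ?thesis unfolding controlled_by_def using C(1) D(1) by (intro exI[of _ "C + D"]) auto
qed

lemma controlled_Union:
  assumes "finite I" "\<And>i. i \<in> I \<Longrightarrow> controlled (A i) \<and> open (A i) \<and> bounded (A i)"
  shows "controlled (\<Union>i\<in>I. A i)"
  using assms
proof (induction I rule: finite_induct)
  case empty
  have "controlled {}"
    unfolding controlled_by_def using E_nonneg by (auto intro!: exI[of _ 0] simp: set_lebesgue_integral_def)
  then show ?case by simp
next
  case (insert i I)
  then show ?case by (auto intro!: controlled_Un)
qed

theorem poincare:
  assumes A0: "controlled A0" "open A0" "A0 \<subseteq> \<Xi>" "A0 \<noteq> {}"
    and inw: "\<And>x. x \<in> closure \<Xi> \<Longrightarrow> \<exists>r>0. \<exists>e. x + e \<in> \<Xi> \<and> (\<forall>y\<in>ball x r \<inter> \<Xi>. \<forall>s\<in>{0..1}. y + s *\<^sub>R e \<in> \<Xi>)"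
  shows "controlled \<Xi>"
proof -
  \<comment> \<open>Centres of controlled balls. This set and its complement in the domain are both
    open, the latter because a ball around a nearby centre can be translated.\<close>
  define G where "G = {x \<in> \<Xi>. \<exists>r>0. ball x r \<subseteq> \<Xi> \<and> controlled (ball x r)}"
  have shrink: "controlled (ball y r)" if "controlled (ball x R)" "ball y r \<subseteq> ball x R" for x R y r
    by (rule controlled_subset[OF that]) auto
  have oG: "open G"
    unfolding open_contains_ball
  proof
    fix x assume "x \<in> G"
    then obtain r where r: "r > 0" "ball x r \<subseteq> \<Xi>" "controlled (ball x r)" by (auto simp: G_def)
    have "y \<in> G" if y: "y \<in> ball x r" for y
    proof -
      obtain s where s: "s > 0" "ball y s \<subseteq> ball x r" using y by (meson open_ball openE)
      then have "ball y s \<subseteq> \<Xi>" "controlled (ball y s)" "y \<in> \<Xi>" using r shrink y by auto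
      then show ?thesis using s(1) by (auto simp: G_def)
    qed
    then show "\<exists>r>0. ball x r \<subseteq> G" using r by blast
  qed
  have oC: "open (\<Xi> - G)"
    unfolding open_contains_ball
  proof
    fix x assume x: "x \<in> \<Xi> - G"
    then obtain R where R: "R > 0" "ball x R \<subseteq> \<Xi>" using \<Xi>(1) by (meson DiffD1 openE)
    have "z \<notin> G" if z: "z \<in> ball x R" for z
    proof
      assume "z \<in> G"
      then obtain r where r: "r > 0" "ball z r \<subseteq> \<Xi>" "controlled (ball z r)" by (auto simp: G_def)
      \<comment> \<open>The second bound keeps all segments towards the controlled ball inside the
        large ball around \<open>x\<close>.\<close>
      define r' where "r' = min r (R - norm (z - x))"
      have nz: "norm (z - x) < R" using z by (simp add: dist_norm norm_minus_commute)
      have r': "r' > 0" using r nz by (simp add: r'_def)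
      have "controlled (ball x r')"
      proof (rule controlled_translate[OF r(3), where e = "z - x"])
        fix y assume y: "y \<in> ball x r'"
        have "dist z (y + (z - x)) = dist x y" by (simp add: dist_norm)
        then show "y + (z - x) \<in> ball z r" using y by (simp add: r'_def)
        fix s :: real assume s: "0 < s" "s < 1"
        have "norm (y + s *\<^sub>R (z - x) - x) \<le> norm (y - x) + norm (s *\<^sub>R (z - x))"
          using norm_triangle_ineq[of "y - x" "s *\<^sub>R (z - x)"] by (simp add: algebra_simps)
        also have "norm (s *\<^sub>R (z - x)) \<le> norm (z - x)" using s by (simp add: mult_left_le_one_le)
        also have "norm (y - x) < R - norm (z - x)" using y by (simp add: r'_def dist_norm norm_minus_commute)
        finally show "y + s *\<^sub>R (z - x) \<in> \<Xi>" using R by (auto simp: dist_norm norm_minus_commute)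
      qed auto
      moreover have "r' \<le> R" using norm_ge_zero[of "z - x"] unfolding r'_def by linarith
      then have "ball x r' \<subseteq> \<Xi>" using R(2) subset_ball[of r' R x] by blast
      ultimately have "x \<in> G" using r' x by (auto simp: G_def)
      then show False using x by blast
    qed
    then show "\<exists>r>0. ball x r \<subseteq> \<Xi> - G" using R by blast
  qed
  have "G \<noteq> {}"
  proof -
    obtain x where x: "x \<in> A0" using A0(4) by blast
    then obtain r where r: "r > 0" "ball x r \<subseteq> A0" using A0(2) by (meson openE)
    then have "controlled (ball x r)" using controlled_subset[OF A0(1) r(2) A0(2) bounded_subset[OF \<Xi>(2) A0(3)]] by simp
    then show ?thesis using r A0(3) x by (auto simp: G_def)
  qed
  moreover have "G \<inter> (\<Xi> - G) \<inter> \<Xi> = {}" "\<Xi> \<subseteq> G \<union> (\<Xi> - G)" "G \<subseteq> \<Xi>" by (auto simp: G_def)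
  ultimately have "\<Xi> - G = {}"
    using \<Xi>(3) oG oC unfolding connected_def by blast
  then have all: "\<exists>r>0. ball x r \<subseteq> \<Xi> \<and> controlled (ball x r)" if "x \<in> \<Xi>" for x
    using that by (auto simp: G_def)
  \<comment> \<open>Near a point of the closure the inward vector carries the part of the domain in
    a small ball into a controlled ball around \<open>x + e\<close>. The smaller radius guarantees
    both the segments and the landing.\<close>
  have "\<exists>r>0. controlled (ball x r \<inter> \<Xi>)" if xc: "x \<in> closure \<Xi>" for x
  proof -
    obtain r e where r: "r > 0" "x + e \<in> \<Xi>" "\<And>y s. y \<in> ball x r \<inter> \<Xi> \<Longrightarrow> s \<in> {0..1} \<Longrightarrow> y + s *\<^sub>R e \<in> \<Xi>"
      using inw[OF xc] by blast
    obtain R where R: "R > 0" "controlled (ball (x + e) R)" using all[OF r(2)] by blast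
    have "controlled (ball x (min r R) \<inter> \<Xi>)"
    proof (rule controlled_translate[OF R(2), where e = e])
      show "open (ball x (min r R) \<inter> \<Xi>)" using \<Xi> by auto
      show "y + e \<in> ball (x + e) R" if "y \<in> ball x (min r R) \<inter> \<Xi>" for y
        using that by (auto simp: dist_norm)
      show "y + s *\<^sub>R e \<in> \<Xi>" if "y \<in> ball x (min r R) \<inter> \<Xi>" "0 < s" "s < 1" for y s
        using that by (intro r(3)) auto
    qed (use bounded_Int in auto)
    then show ?thesis using r R by (intro exI[of _ "min r R"]) auto
  qed
  then obtain r where r: "\<And>x. x \<in> closure \<Xi> \<Longrightarrow> r x > 0 \<and> controlled (ball x (r x) \<inter> \<Xi>)" by metis
  have "compact (closure \<Xi>)" using \<Xi> by simp
  then obtain D where D: "finite D" "D \<subseteq> closure \<Xi>" "closure \<Xi> \<subseteq> (\<Union>x\<in>D. ball x (r x))"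
    by (rule compactE_image[of _ "closure \<Xi>" "\<lambda>x. ball x (r x)"]) (use r in \<open>force intro!: exI\<close>)+
  have "controlled (\<Union>x\<in>D. ball x (r x) \<inter> \<Xi>)"
    using r D \<Xi> by (intro controlled_Union) (auto intro: bounded_Int)
  moreover have "(\<Union>x\<in>D. ball x (r x) \<inter> \<Xi>) = \<Xi>" using D closure_subset by blast
  ultimately show ?thesis by simp
qed

end

context scaled_junction
begin

text \<open>A small cylinder below the centre of the i-th disc starts the spreading: there
  Friedrichs' inequality bounds the mass by the face term and the axial derivative.\<close>

lemma poincare_node:
  assumes neu: "neumann_potential l0 \<Xi> \<v> p" and v: "\<And>i. \<v> i \<noteq> 0"
    and B: "\<And>x. x \<in> \<Xi> \<Longrightarrow> norm (grad p x) \<le> B"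
  shows "\<exists>C\<ge>0. \<forall>u Du. C1_on UNIV u Du \<longrightarrow> (LINT x:\<Xi>|lborel. (u x)\<^sup>2) \<le>
    C * ((LINT x:\<Xi>|lborel. (norm (Du x))\<^sup>2) + (LINT z:ball 0 (h i)|lborel. (u (insert_coord i l0 z))\<^sup>2))"
proof -
  define E where "E u Du = (LINT x:\<Xi>|lborel. (norm (Du x))\<^sup>2) + (LINT z:ball 0 (h i)|lborel. (u (insert_coord i l0 z))\<^sup>2)"
    for u :: "real^3 \<Rightarrow> real" and Du :: "real^3 \<Rightarrow> real^3"
  have E: "(LINT x:\<Xi>|lborel. (norm (Du x))\<^sup>2) \<le> E u Du" if "C1_on UNIV u Du" for u Du
    unfolding E_def by (simp add: LINT_nonneg)
  let ?\<xi> = "insert_coord i l0 0"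
  obtain d where d: "d > 0" "\<And>y. dist y ?\<xi> < d \<Longrightarrow> y $ i < l0 \<Longrightarrow> y \<in> \<Xi>"
    using disc_half_ball[OF neu v B, of ?\<xi> i] h[of i] by auto
  \<comment> \<open>The bound \<open>d / 2\<close> puts the cylinder into the ball of radius
    \<open>d\<close>, as 2 (d/2)^2 \<le> d^2; the bound \<open>h i\<close> keeps its top inside the
    disc.\<close>
  define \<sigma> where "\<sigma> = min (d / 2) (h i)"
  have \<sigma>: "0 < \<sigma>" "\<sigma> \<le> d / 2" "\<sigma> \<le> h i" using d h[of i] by (auto simp: \<sigma>_def)
  let ?A = "cylinder i (l0 - \<sigma>) l0 \<sigma>"
  have A\<Xi>: "?A \<subseteq> \<Xi>"
  proof
    fix y assume y: "y \<in> ?A"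
    have "(norm (y - ?\<xi>))\<^sup>2 = (y $ i - l0)\<^sup>2 + (norm (bar i y))\<^sup>2"
      using norm_sq_bar[of "y - ?\<xi>" i] by (simp add: bar_diff)
    also have "\<dots> < \<sigma>\<^sup>2 + \<sigma>\<^sup>2"
    proof (rule add_strict_mono)
      have "\<bar>y $ i - l0\<bar>\<^sup>2 < \<sigma>\<^sup>2" using y by (intro power_strict_mono) (auto simp: cylinder_def)
      then show "(y $ i - l0)\<^sup>2 < \<sigma>\<^sup>2" by simp
      show "(norm (bar i y))\<^sup>2 < \<sigma>\<^sup>2" using y by (intro power_strict_mono) (auto simp: cylinder_def)
    qed
    also have "\<dots> \<le> d\<^sup>2"
    proof -
      have "\<sigma>\<^sup>2 \<le> (d / 2)\<^sup>2" using \<sigma> by (intro power_mono) auto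
      moreover have "(d / 2)\<^sup>2 = d\<^sup>2 / 4" by (simp add: power_divide)
      ultimately show ?thesis using zero_le_power2[of d] by linarith
    qed
    finally have "norm (y - ?\<xi>) < d" using d(1) by (intro power2_less_imp_less[of _ d]) auto
    then show "y \<in> \<Xi>" using y by (intro d(2)) (auto simp: dist_norm cylinder_def)
  qed
  have "controlled_by E ?A"
    unfolding controlled_by_def
  proof (intro exI[of _ "3 * \<sigma> + (3/4) * \<sigma>\<^sup>2"] conjI allI impI)
    show "0 \<le> 3 * \<sigma> + (3/4) * \<sigma>\<^sup>2" using \<sigma> by simp
    fix u :: "real^3 \<Rightarrow> real" and Du assume u: "C1_on UNIV u Du"
    have cu: "continuous_on UNIV u" by (rule C1_on_continuous[OF u])
    have cDu: "continuous_on UNIV Du" using u by (rule C1_onD)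
    let ?e = "\<lambda>R. LINT z:ball 0 R|lborel. (u (insert_coord i l0 z))\<^sup>2"
    have "(LINT x:?A|lborel. (u x)\<^sup>2) \<le> 3 * \<sigma> * ?e \<sigma> + (3/4) * \<sigma>\<^sup>2 * (LINT x:?A|lborel. (Du x $ i)\<^sup>2)"
      using cylinder_friedrichs[OF u, of "l0 - \<sigma>" l0 i \<sigma>] \<sigma> by simp
    moreover have "?e \<sigma> \<le> ?e (h i)"
      using \<sigma> by (intro set_integral_mono_set set_integrable_ball continuous_intros continuous_on_compose2[OF cu]) auto
    moreover have "(LINT x:?A|lborel. (Du x $ i)\<^sup>2) \<le> (LINT x:\<Xi>|lborel. (norm (Du x))\<^sup>2)"
    proof -
      have "(LINT x:?A|lborel. (Du x $ i)\<^sup>2) \<le> (LINT x:?A|lborel. (norm (Du x))\<^sup>2)"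
        by (intro set_integral_mono set_integrable_cylinder continuous_intros cDu) (simp add: norm_sq_bar[of _ i])
      also have "\<dots> \<le> (LINT x:\<Xi>|lborel. (norm (Du x))\<^sup>2)"
        by (intro set_integral_mono_set A\<Xi> set_integrable_cylinder set_integrable_bounded_open open_\<Xi> bounded_\<Xi> continuous_intros cDu) auto
      finally show ?thesis .
    qed
    moreover have "0 \<le> ?e (h i)" "0 \<le> (LINT x:\<Xi>|lborel. (norm (Du x))\<^sup>2)" by (simp_all add: LINT_nonneg)
    moreover have "3 * s * e + (3/4) * s\<^sup>2 * D \<le> (3 * s + (3/4) * s\<^sup>2) * (D' + e')"
      if "0 \<le> s" "e \<le> e'" "D \<le> D'" "0 \<le> e'" "0 \<le> D'" for s e D e' D' :: real
    proof -
      have "3 * s * e + (3/4) * s\<^sup>2 * D \<le> 3 * s * e' + (3/4) * s\<^sup>2 * D'"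
        using that by (intro add_mono mult_left_mono) auto
      moreover have "0 \<le> 3 * s * D'" "0 \<le> (3/4) * s\<^sup>2 * e'" using that by auto
      moreover have "(3 * s + (3/4) * s\<^sup>2) * (D' + e') = 3 * s * e' + (3/4) * s\<^sup>2 * D' + 3 * s * D' + (3/4) * s\<^sup>2 * e'"
        by (simp add: field_simps)
      ultimately show ?thesis by linarith
    qed
    ultimately show "(LINT x:?A|lborel. (u x)\<^sup>2) \<le> (3 * \<sigma> + (3/4) * \<sigma>\<^sup>2) * E u Du"
      unfolding E_def using \<sigma>(1) by (meson less_imp_le order_trans)
  qed
  moreover have "?A \<noteq> {}"
  proof -
    have "insert_coord i (l0 - \<sigma> / 2) 0 \<in> ?A" using \<sigma> by (simp add: cylinder_def)
    then show ?thesis by blast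
  qed
  ultimately have "controlled_by E \<Xi>"
    using poincare[of \<Xi> E ?A] open_\<Xi> bounded_\<Xi> connected_\<Xi> E open_cylinder A\<Xi> translation_inwards[OF neu v B]
    by blast
  then show ?thesis unfolding controlled_by_def E_def .
qed

end

section \<open>Square-integrable functions\<close>

lemma L2_real: "L2 M (f::_ \<Rightarrow> real) \<longleftrightarrow> f \<in> borel_measurable M \<and> integrable M (\<lambda>x. (f x)\<^sup>2)"
  by (simp add: L2_def)

lemma L2_integrable_mult:
  fixes f g :: "'a \<Rightarrow> real"
  assumes "L2 M f" "L2 M g"
  shows "integrable M (\<lambda>x. f x * g x)"
proof (rule Bochner_Integration.integrable_bound)
  show "integrable M (\<lambda>x. (f x)\<^sup>2 + (g x)\<^sup>2)" using assms by (simp add: L2_real)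
  show "(\<lambda>x. f x * g x) \<in> borel_measurable M" using assms by (auto simp: L2_real)
  show "AE x in M. norm (f x * g x) \<le> norm ((f x)\<^sup>2 + (g x)\<^sup>2)"
  proof (rule AE_I2)
    fix x
    have "2 * (\<bar>f x\<bar> * \<bar>g x\<bar>) \<le> (f x)\<^sup>2 + (g x)\<^sup>2" using sum_squares_bound[of "\<bar>f x\<bar>" "\<bar>g x\<bar>"] by simp
    moreover have "0 \<le> \<bar>f x\<bar> * \<bar>g x\<bar>" by (intro mult_nonneg_nonneg) auto
    ultimately have "\<bar>f x\<bar> * \<bar>g x\<bar> \<le> (f x)\<^sup>2 + (g x)\<^sup>2" by linarith
    then show "norm (f x * g x) \<le> norm ((f x)\<^sup>2 + (g x)\<^sup>2)" by (simp add: abs_mult)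
  qed
qed

lemma L2_diff: "L2 M f \<Longrightarrow> L2 M g \<Longrightarrow> L2 M (\<lambda>x. f x - g x :: real)"
  using L2_integrable_mult[of M f g] by (auto simp: L2_real power2_diff mult.assoc)

text \<open>The integral of (t |f| - |g|)^2 is a nonnegative quadratic in t. With the absolute value
  inside the integral the bound also serves products with a bounded coefficient.\<close>

lemma L2_cauchy_schwarz:
  fixes f g :: "'a \<Rightarrow> real"
  assumes f: "L2 M f" and g: "L2 M g"
  shows "(\<integral>x. \<bar>f x * g x\<bar> \<partial>M) \<le> L2_norm_on M f * L2_norm_on M g"
proof -
  define a where "a = (\<integral>x. (f x)\<^sup>2 \<partial>M)"
  define b where "b = (\<integral>x. (g x)\<^sup>2 \<partial>M)"
  define c where "c = (\<integral>x. \<bar>f x * g x\<bar> \<partial>M)"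
  have a: "0 \<le> a" and b: "0 \<le> b" and c: "0 \<le> c" by (simp_all add: a_def b_def c_def)
  have q: "0 \<le> t\<^sup>2 * a - 2 * t * c + b" for t
  proof -
    have "0 \<le> (\<integral>x. (t * \<bar>f x\<bar> - \<bar>g x\<bar>)\<^sup>2 \<partial>M)" by simp
    also have "\<dots> = (\<integral>x. t\<^sup>2 * (f x)\<^sup>2 - (2 * t) * \<bar>f x * g x\<bar> + (g x)\<^sup>2 \<partial>M)"
      by (intro Bochner_Integration.integral_cong) (auto simp: power2_diff power_mult_distrib abs_mult)
    also have "\<dots> = t\<^sup>2 * a - (2 * t) * c + b"
      using f g L2_integrable_mult[OF f g] by (simp add: a_def b_def c_def L2_real)
    finally show ?thesis by simp
  qed
  have "c\<^sup>2 \<le> a * b"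
  proof (cases "a = 0")
    case True
    have "c = 0"
    proof (rule ccontr)
      assume "c \<noteq> 0"
      then have "c > 0" using c by simp
      \<comment> \<open>For a = 0 the quadratic is linear in t, and this value of t makes it
        negative.\<close>
      then show False using q[of "(b + 1) / c"] True b by simp
    qed
    then show ?thesis using True by simp
  next
    case False
    then have "a > 0" using a by simp
    then show ?thesis using q[of "c / a"] by (simp add: power2_eq_square field_simps)
  qed
  then have "sqrt (c\<^sup>2) \<le> sqrt (a * b)" by (rule real_sqrt_le_mono)
  then show ?thesis using c by (simp add: a_def b_def c_def L2_norm_on_def real_sqrt_mult)
qed

lemma L2_cauchy_schwarz':
  fixes f g :: "'a \<Rightarrow> real"
  assumes f: "L2 M f" and g: "L2 M g"
  shows "\<bar>\<integral>x. f x * g x \<partial>M\<bar> \<le> L2_norm_on M f * L2_norm_on M g"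
  using integral_abs_bound[of M "\<lambda>x. f x * g x"] L2_cauchy_schwarz[OF assms] by (rule order_trans)

lemma L2_norm_on_nonneg: "0 \<le> L2_norm_on M f"
  by (simp add: L2_norm_on_def)

definition L2conv :: "'a measure \<Rightarrow> (nat \<Rightarrow> 'a \<Rightarrow> real) \<Rightarrow> ('a \<Rightarrow> real) \<Rightarrow> bool" where
  "L2conv M f F \<longleftrightarrow> (\<forall>n. L2 M (f n)) \<and> L2 M F \<and> (\<lambda>n. L2_norm_on M (\<lambda>x. f n x - F x)) \<longlonglongrightarrow> 0"

text \<open>The difference splits into three products, each with a factor tending to zero. The
  bounded coefficient is later a velocity component, a matrix entry or the indicator of a
  piece.\<close>

lemma L2conv_mult:
  assumes f: "L2conv M f F" and g: "L2conv M g G" and b: "b \<in> borel_measurable M" "\<And>x. \<bar>b x\<bar> \<le> K"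
  shows "(\<lambda>n. \<integral>x. b x * (f n x * g n x) \<partial>M) \<longlonglongrightarrow> (\<integral>x. b x * (F x * G x) \<partial>M)"
    and "integrable M (\<lambda>x. b x * (F x * G x))"
proof -
  have L: "L2 M (f n)" "L2 M F" "L2 M (g n)" "L2 M G" for n using f g by (auto simp: L2conv_def)
  have d: "L2 M (\<lambda>x. f n x - F x)" "L2 M (\<lambda>x. g n x - G x)" for n by (intro L2_diff L)+
  have K: "0 \<le> K" using b(2) by (meson abs_ge_zero order_trans)
  have ib: "integrable M (\<lambda>x. b x * (p x * q x))" if "L2 M p" "L2 M q" for p q
  proof (rule Bochner_Integration.integrable_bound)
    show "integrable M (\<lambda>x. K * (p x * q x))" using L2_integrable_mult[OF that] by simp
    show "(\<lambda>x. b x * (p x * q x)) \<in> borel_measurable M" using b that by (auto simp: L2_real)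
    show "AE x in M. norm (b x * (p x * q x)) \<le> norm (K * (p x * q x))"
      using b(2) K by (intro AE_I2) (auto simp: abs_mult intro!: mult_right_mono)
  qed
  show "integrable M (\<lambda>x. b x * (F x * G x))" by (rule ib[OF L(2,4)])
  let ?N = "L2_norm_on M"
  have bnd: "\<bar>(\<integral>x. b x * (f n x * g n x) \<partial>M) - (\<integral>x. b x * (F x * G x) \<partial>M)\<bar>
    \<le> K * (?N (\<lambda>x. f n x - F x) * ?N (\<lambda>x. g n x - G x) + ?N F * ?N (\<lambda>x. g n x - G x) + ?N (\<lambda>x. f n x - F x) * ?N G)" for n
  proof -
    let ?p = "\<lambda>x. f n x - F x" and ?q = "\<lambda>x. g n x - G x"
    have cs: "\<bar>\<integral>x. b x * (p x * q x) \<partial>M\<bar> \<le> K * (?N p * ?N q)" if "L2 M p" "L2 M q" for p q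
    proof -
      have "\<bar>\<integral>x. b x * (p x * q x) \<partial>M\<bar> \<le> (\<integral>x. \<bar>b x * (p x * q x)\<bar> \<partial>M)" by (rule integral_abs_bound)
      also have "\<dots> \<le> (\<integral>x. K * \<bar>p x * q x\<bar> \<partial>M)"
      proof (rule integral_mono)
        show "integrable M (\<lambda>x. \<bar>b x * (p x * q x)\<bar>)" by (rule integrable_abs[OF ib[OF that]])
        show "integrable M (\<lambda>x. K * \<bar>p x * q x\<bar>)" using integrable_abs[OF L2_integrable_mult[OF that]] by simp
        show "\<bar>b x * (p x * q x)\<bar> \<le> K * \<bar>p x * q x\<bar>" for x
          unfolding abs_mult[of "b x"] using b(2) by (intro mult_right_mono) auto
      qed
      also have "\<dots> \<le> K * (?N p * ?N q)" using L2_cauchy_schwarz[OF that] K by (simp add: mult_left_mono)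
      finally show ?thesis .
    qed
    have "(\<integral>x. b x * (f n x * g n x) \<partial>M) - (\<integral>x. b x * (F x * G x) \<partial>M)
      = (\<integral>x. b x * (?p x * ?q x) + b x * (F x * ?q x) + b x * (?p x * G x) \<partial>M)"
      using ib[OF L(1,3)] ib[OF L(2,4)]
      by (subst Bochner_Integration.integral_diff[symmetric]) (auto simp: algebra_simps)
    also have "\<dots> = (\<integral>x. b x * (?p x * ?q x) \<partial>M) + (\<integral>x. b x * (F x * ?q x) \<partial>M) + (\<integral>x. b x * (?p x * G x) \<partial>M)"
      using ib[OF d] ib[OF L(2) d(2)] ib[OF d(1) L(4)] by simp
    finally show ?thesis
      using cs[OF d, of n n] cs[OF L(2) d(2), of n] cs[OF d(1) L(4), of n] K by (simp add: distrib_left)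
  qed
  have "(\<lambda>n. K * (?N (\<lambda>x. f n x - F x) * ?N (\<lambda>x. g n x - G x) + ?N F * ?N (\<lambda>x. g n x - G x) + ?N (\<lambda>x. f n x - F x) * ?N G))
    \<longlonglongrightarrow> K * (0 * 0 + ?N F * 0 + 0 * ?N G)"
    using f g by (intro tendsto_intros) (auto simp: L2conv_def)
  then have "(\<lambda>n. K * (?N (\<lambda>x. f n x - F x) * ?N (\<lambda>x. g n x - G x) + ?N F * ?N (\<lambda>x. g n x - G x) + ?N (\<lambda>x. f n x - F x) * ?N G)) \<longlonglongrightarrow> 0"
    by simp
  then have "(\<lambda>n. (\<integral>x. b x * (f n x * g n x) \<partial>M) - (\<integral>x. b x * (F x * G x) \<partial>M)) \<longlonglongrightarrow> 0"
    by (rule Lim_null_comparison[rotated]) (use bnd in \<open>auto intro!: always_eventually\<close>)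
  then show "(\<lambda>n. \<integral>x. b x * (f n x * g n x) \<partial>M) \<longlonglongrightarrow> (\<integral>x. b x * (F x * G x) \<partial>M)"
    by (simp add: LIM_zero_iff)
qed

lemma L2conv_sq:
  assumes "L2conv M f F"
  shows "(\<lambda>n. \<integral>x. (f n x)\<^sup>2 \<partial>M) \<longlonglongrightarrow> (\<integral>x. (F x)\<^sup>2 \<partial>M)"
  using L2conv_mult(1)[OF assms assms, of "\<lambda>_. 1" 1] by (simp add: power2_eq_square)

text \<open>This supplies the limits of restrictions to the lateral surfaces. On a finite measure
  space the sequence is Cauchy in L^1, so a subsequence converges almost everywhere, and Fatou's
  lemma carries the bound over to the limit. The Cauchy condition is a sum because the restrictions
  are compared through their distances to a common Sobolev function.\<close>

lemma L2_complete:
  fixes f :: "nat \<Rightarrow> 'a \<Rightarrow> real"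
  assumes M: "finite_measure M" and f: "\<And>n. L2 M (f n)" and a: "a \<longlonglongrightarrow> 0"
    and cauchy: "\<And>i j. (\<integral>x. (f i x - f j x)\<^sup>2 \<partial>M) \<le> a i + a j"
  shows "\<exists>t. L2conv M f t"
proof -
  interpret finite_measure M by (rule M)
  have fm: "f n \<in> borel_measurable M" for n using f by (simp add: L2_real)
  have L1: "L2 M (\<lambda>_. 1::real)" by (simp add: L2_real)
  have if1: "integrable M (f n)" for n using L2_integrable_mult[OF f L1] by simp
  have d: "L2 M (\<lambda>x. f i x - f j x)" for i j by (intro L2_diff f)
  define m where "m = L2_norm_on M (\<lambda>_. 1::real)"
  have m: "0 \<le> m" by (simp add: m_def L2_norm_on_nonneg)
  have ann: "0 \<le> a i" for i using cauchy[of i i] by simp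
  have L1c: "(\<integral>x. norm (f i x - f j x) \<partial>M) \<le> sqrt (a i + a j) * m" for i j
  proof -
    have "(\<integral>x. \<bar>(f i x - f j x) * 1\<bar> \<partial>M) \<le> L2_norm_on M (\<lambda>x. f i x - f j x) * m"
      unfolding m_def by (rule L2_cauchy_schwarz[OF d L1])
    also have "\<dots> \<le> sqrt (a i + a j) * m"
      using m cauchy[of i j] by (intro mult_right_mono) (auto simp: L2_norm_on_def)
    finally show ?thesis by simp
  qed
  obtain r where r: "strict_mono r" "AE x in M. Cauchy (\<lambda>i. f (r i) x)"
  proof (rule cauchy_L1_AE_cauchy_subseq[of M f])
    fix e :: real assume e: "e > 0"
    \<comment> \<open>Two terms below \<eta> add up to less than the square of e / (m + 1), and m /
      (m + 1) < 1 gives the strict bound.\<close>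
    define \<eta> where "\<eta> = (e / (m + 1))\<^sup>2 / 2"
    have \<eta>: "\<eta> > 0" using e m by (simp add: \<eta>_def)
    obtain N where N: "\<And>n. n \<ge> N \<Longrightarrow> a n < \<eta>"
      using order_tendstoD(2)[OF a \<eta>] by (auto simp: eventually_sequentially)
    have "(\<integral>x. norm (f i x - f j x) \<partial>M) < e" if ij: "i \<ge> N" "j \<ge> N" for i j
    proof -
      have "a i + a j < (e / (m + 1))\<^sup>2" using N[OF ij(1)] N[OF ij(2)] by (simp add: \<eta>_def)
      then have "sqrt (a i + a j) < e / (m + 1)"
        using e m by (intro real_less_lsqrt) auto
      then have "sqrt (a i + a j) * m \<le> e / (m + 1) * m" using m by (intro mult_right_mono) auto
      also have "\<dots> < e" using e m by (simp add: field_simps)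
      finally show ?thesis using L1c[of i j] by simp
    qed
    then show "\<exists>N. \<forall>i\<ge>N. \<forall>j\<ge>N. (\<integral>x. norm (f i x - f j x) \<partial>M) < e" by blast
  qed (use if1 in auto)
  define t where "t x = lim (\<lambda>i. f (r i) x)" for x
  have tm: "t \<in> borel_measurable M"
    unfolding t_def using fm by (intro borel_measurable_lim_metric) auto
  have tl: "AE x in M. (\<lambda>i. f (r i) x) \<longlonglongrightarrow> t x"
    using r(2) by eventually_elim (auto simp: t_def Cauchy_convergent_iff convergent_LIMSEQ_iff)
  have le: "(\<integral>\<^sup>+x. ennreal ((f n x - t x)\<^sup>2) \<partial>M) \<le> ennreal (a n)" for n
  proof -
    have "(\<integral>\<^sup>+x. ennreal ((f n x - t x)\<^sup>2) \<partial>M) = (\<integral>\<^sup>+x. liminf (\<lambda>i. ennreal ((f n x - f (r i) x)\<^sup>2)) \<partial>M)"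
    proof (rule nn_integral_cong_AE)
      show "AE x in M. ennreal ((f n x - t x)\<^sup>2) = liminf (\<lambda>i. ennreal ((f n x - f (r i) x)\<^sup>2))"
        using tl
      proof eventually_elim
        case (elim x)
        have "(\<lambda>i. ennreal ((f n x - f (r i) x)\<^sup>2)) \<longlonglongrightarrow> ennreal ((f n x - t x)\<^sup>2)"
          by (intro tendsto_ennrealI tendsto_intros elim)
        then show ?case by (intro lim_imp_Liminf[OF trivial_limit_sequentially, symmetric])
      qed
    qed
    also have "\<dots> \<le> liminf (\<lambda>i. \<integral>\<^sup>+x. ennreal ((f n x - f (r i) x)\<^sup>2) \<partial>M)"
      using fm by (intro nn_integral_liminf) auto
    also have "\<dots> \<le> liminf (\<lambda>i. ennreal (a n + a (r i)))"
    proof (rule Liminf_mono, intro always_eventually allI)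
      fix i
      have "(\<integral>\<^sup>+x. ennreal ((f n x - f (r i) x)\<^sup>2) \<partial>M) = ennreal (\<integral>x. (f n x - f (r i) x)\<^sup>2 \<partial>M)"
        using d[of n "r i"] by (intro nn_integral_eq_integral) (auto simp: L2_real)
      also have "\<dots> \<le> ennreal (a n + a (r i))" using cauchy by (intro ennreal_leI)
      finally show "(\<integral>\<^sup>+x. ennreal ((f n x - f (r i) x)\<^sup>2) \<partial>M) \<le> ennreal (a n + a (r i))" .
    qed
    also have "(\<lambda>i. ennreal (a n + a (r i))) \<longlonglongrightarrow> ennreal (a n + 0)"
      using LIMSEQ_subseq_LIMSEQ[OF a r(1)] by (intro tendsto_ennrealI tendsto_intros) (simp add: o_def)
    then have "liminf (\<lambda>i. ennreal (a n + a (r i))) = ennreal (a n)"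
      using lim_imp_Liminf[OF trivial_limit_sequentially] by fastforce
    finally show ?thesis .
  qed
  have dt: "L2 M (\<lambda>x. f n x - t x)" for n
    unfolding L2_real using fm tm le[of n]
    by (auto intro!: integrableI_bounded simp: le_less_trans[OF _ ennreal_less_top])
  \<comment> \<open>Square integrability of the limit is obtained by writing it as a difference of
    two square-integrable functions.\<close>
  have "L2 M (\<lambda>x. f 0 x - (f 0 x - t x))" by (rule L2_diff[OF f dt])
  then have Lt: "L2 M t" by simp
  have "(\<integral>x. (f n x - t x)\<^sup>2 \<partial>M) \<le> a n" for n
  proof -
    have "ennreal (\<integral>x. (f n x - t x)\<^sup>2 \<partial>M) = (\<integral>\<^sup>+x. ennreal ((f n x - t x)\<^sup>2) \<partial>M)"
      using dt[of n] by (intro nn_integral_eq_integral[symmetric]) (auto simp: L2_real)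
    then have "ennreal (\<integral>x. (f n x - t x)\<^sup>2 \<partial>M) \<le> ennreal (a n)" using le[of n] by (simp only:)
    then show ?thesis using ennreal_le_iff[OF ann[of n]] by blast
  qed
  then have b: "L2_norm_on M (\<lambda>x. f n x - t x) \<le> sqrt (a n)" for n by (simp add: L2_norm_on_def)
  have "(\<lambda>n. sqrt (a n)) \<longlonglongrightarrow> sqrt 0" by (intro tendsto_intros a)
  then have s0: "(\<lambda>n. sqrt (a n)) \<longlonglongrightarrow> 0" by simp
  have "(\<lambda>n. L2_norm_on M (\<lambda>x. f n x - t x)) \<longlonglongrightarrow> 0"
    by (rule tendsto_sandwich[OF _ _ tendsto_const s0]) (auto intro!: always_eventually b L2_norm_on_nonneg)
  then show ?thesis using f Lt unfolding L2conv_def by blast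
qed

lemma LINT_scale:
  fixes f :: "'a::euclidean_space \<Rightarrow> real"
  assumes c: "0 < c" and f: "(\<lambda>x. indicator ((\<lambda>x. c *\<^sub>R x) ` S) x * f x) \<in> borel_measurable borel"
  shows "(LINT x:(\<lambda>x. c *\<^sub>R x) ` S|lborel. f x) = c ^ DIM('a) * (LINT x:S|lborel. f (c *\<^sub>R x))"
proof -
  let ?g = "\<lambda>x. indicator ((\<lambda>x. c *\<^sub>R x) ` S) x * f x"
  have m: "(\<lambda>x::'a. 0 + c *\<^sub>R x) \<in> lborel \<rightarrow>\<^sub>M borel" by simp
  have "(\<integral>x. ?g x \<partial>lborel) = (\<integral>x. ?g x \<partial>density (distr lborel borel (\<lambda>x. 0 + c *\<^sub>R x)) (\<lambda>_. ennreal (\<bar>c\<bar> ^ DIM('a))))"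
    using lborel_affine[of c "0::'a"] c by simp
  also have "\<dots> = (\<integral>x. \<bar>c\<bar> ^ DIM('a) *\<^sub>R ?g x \<partial>distr lborel borel (\<lambda>x. 0 + c *\<^sub>R x))"
    using f by (intro integral_density) auto
  also have "\<dots> = (\<integral>x. \<bar>c\<bar> ^ DIM('a) *\<^sub>R ?g (0 + c *\<^sub>R x) \<partial>lborel)"
    using f by (intro integral_distr[OF m]) simp
  also have "\<dots> = c ^ DIM('a) * (LINT x:S|lborel. f (c *\<^sub>R x))"
  proof -
    have "c *\<^sub>R x \<in> (\<lambda>x. c *\<^sub>R x) ` S \<longleftrightarrow> x \<in> S" for x using c by auto
    then have "indicator ((\<lambda>x. c *\<^sub>R x) ` S) (c *\<^sub>R x) = (indicator S x :: real)" for x by (simp add: indicator_def)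
    then show ?thesis using c by (simp add: set_lebesgue_integral_def)
  qed
  finally show ?thesis by (simp add: set_lebesgue_integral_def)
qed

lemma ball_scale: "0 < c \<Longrightarrow> (\<lambda>x. c *\<^sub>R x) ` ball 0 r = ball (0::'a::euclidean_space) (c * r)"
  using ball_scale[of c 0 r] by simp

section \<open>Convection\<close>

locale problem = thin_junction +
  fixes \<v> :: "3 \<Rightarrow> real" and v0 :: "real^3 \<Rightarrow> real^3" and w :: "3 \<Rightarrow> real \<Rightarrow> real"
    and vt :: "3 \<Rightarrow> 3 \<Rightarrow> real \<times> (real^2) \<Rightarrow> real"
    and a0 :: "real^3 \<Rightarrow> real^3^3" and a :: "3 \<Rightarrow> real^2 \<Rightarrow> real^3^3"
    and \<kappa>0n \<kappa>1n :: real and \<kappa>0 \<kappa>1 :: "3 \<Rightarrow> real" and p :: "real^3 \<Rightarrow> real"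
  assumes velocity: "velocity_field \<epsilon>0 l0 l h \<Xi> \<v> v0 w vt"
    and diffusion: "diffusion_matrix h \<Xi> a0 a \<kappa>0n \<kappa>1n \<kappa>0 \<kappa>1"
    and w_mono: "\<And>i t. t \<in> {0<..<l i} \<Longrightarrow> deriv (w i) t \<ge> 0"
    and small: "\<And>\<epsilon> i. \<epsilon> \<in> {0<..<\<epsilon>0} \<Longrightarrow> \<kappa>0 i - transversal_sup l0 l h vt \<epsilon> i * l i > 0"
    and neumann: "neumann_potential l0 \<Xi> \<v> p"
    and potential: "\<And>\<epsilon> x. \<epsilon> \<in> {0<..<\<epsilon>0} \<Longrightarrow> x \<in> node \<Xi> \<epsilon> \<Longrightarrow> V_node v0 \<epsilon> x = grad p ((1/\<epsilon>) *\<^sub>R x)"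
begin

lemma scaled: "\<epsilon> \<in> {0<..<\<epsilon>0} \<Longrightarrow> scaled_junction \<epsilon>0 l0 l h \<Xi> \<epsilon>"
  using geometry by unfold_locales auto

lemma \<epsilon>_half: "\<epsilon>0 / 2 \<in> {0<..<\<epsilon>0}" using \<epsilon>0 by simp

lemma v0_eq: "\<xi> \<in> \<Xi> \<Longrightarrow> v0 \<xi> = grad p \<xi>"
  using potential[OF \<epsilon>_half, of "(\<epsilon>0 / 2) *\<^sub>R \<xi>"] \<epsilon>0 by (simp add: V_node_def node_def)

lemma grad_p_bounded: "\<exists>B\<ge>0. \<forall>x\<in>\<Xi>. norm (grad p x) \<le> B"
proof -
  have "\<exists>b. \<forall>x\<in>\<Xi>. \<bar>v0 x $ j\<bar> \<le> b" for j
    using velocity by (auto simp: velocity_field_def smooth_bounded_on_def bounded_iff)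
  then obtain b where b: "\<And>j x. x \<in> \<Xi> \<Longrightarrow> \<bar>v0 x $ j\<bar> \<le> b j" by metis
  have "norm (grad p x) \<le> \<bar>\<Sum>j\<in>UNIV. b j\<bar>" if "x \<in> \<Xi>" for x
  proof -
    have "norm (grad p x) \<le> (\<Sum>j\<in>UNIV. \<bar>grad p x $ j\<bar>)" by (rule norm_le_l1_cart)
    also have "\<dots> \<le> (\<Sum>j\<in>UNIV. b j)" using b[OF that] v0_eq[OF that] by (intro sum_mono) simp
    finally show ?thesis by linarith
  qed
  then show ?thesis by (intro exI[of _ "\<bar>\<Sum>j\<in>UNIV. b j\<bar>"]) auto
qed

text \<open>Near zero the axial profile equals \<open>\<v> i\<close>, and it has a strict sign on
  the whole interval. This is what excludes walls in the interfaces.\<close>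

lemma v_nonzero: "\<v> i \<noteq> 0"
proof -
  obtain \<delta> where \<delta>: "\<delta> > 0" "\<And>t. t \<in> {0<..<l i} \<Longrightarrow> t < \<delta> \<Longrightarrow> w i t = \<v> i"
    using velocity unfolding velocity_field_def by meson
  define t where "t = min \<delta> (l i) / 2"
  have t: "t \<in> {0<..<l i}" "t < \<delta>" using \<delta>(1) l[of i] by (auto simp: t_def min_def)
  have "\<forall>t\<in>{0<..<l 1}. w 1 t < 0" "\<forall>t\<in>{0<..<l 2}. w 2 t > 0" "\<forall>t\<in>{0<..<l 3}. w 3 t > 0"
    using velocity unfolding velocity_field_def by blast+
  then have "w i t \<noteq> 0" using t exhaust_3[of i] by fastforce
  then show ?thesis using \<delta>(2)[OF t] by simp
qed

lemma solenoidal_p: "\<exists>B\<ge>0. solenoidal \<Xi> (grad p) (\<lambda>i. grad (partial i p)) B \<and> (\<forall>x\<in>\<Xi>. norm (grad p x) \<le> B)"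
proof -
  obtain B where B: "B \<ge> 0" "\<And>x. x \<in> \<Xi> \<Longrightarrow> norm (grad p x) \<le> B" using grad_p_bounded by blast
  have C2: "C_on (Suc (Suc 0)) \<Xi> p" and harm: "\<And>\<xi>. \<xi> \<in> \<Xi> \<Longrightarrow> laplacian p \<xi> = 0"
    using neumann by (auto simp: neumann_potential_def numeral_2_eq_2 simp del: C_on.simps)
  have "solenoidal \<Xi> (grad p) (\<lambda>i. grad (partial i p)) B"
  proof
    show "C1_on \<Xi> (\<lambda>x. grad p x $ i) (grad (partial i p))" for i
      using C_on_C1_on[OF C_on_SucD(2)[OF C2]] by (simp add: grad_def[of p])
    show "(\<Sum>i\<in>UNIV. grad (partial i p) x $ i) = 0" if "x \<in> \<Xi>" for x
      using harm[OF that] by (simp add: laplacian_def grad_def)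
  qed (use B open_\<Xi> bounded_\<Xi> in auto)
  then show ?thesis using B by blast
qed

text \<open>The statement concerns the unscaled node, but boundary charts come from the scaled
  junctions; the single parameter \<open>\<epsilon>0 / 2\<close> suffices to obtain them.\<close>

lemma flux_node:
  assumes "C1_on UNIV \<phi> D\<phi>"
  shows "(LINT x:\<Xi>|lborel. grad p x \<bullet> D\<phi> x) = (\<Sum>i\<in>UNIV. \<v> i * (LINT z:ball 0 (h i)|lborel. \<phi> (insert_coord i l0 z)))"
proof -
  interpret scaled_junction \<epsilon>0 l0 l h \<Xi> "\<epsilon>0 / 2" by (rule scaled[OF \<epsilon>_half])
  obtain B where B: "B \<ge> 0" "solenoidal \<Xi> (grad p) (\<lambda>i. grad (partial i p)) B"
    "\<And>x. x \<in> \<Xi> \<Longrightarrow> norm (grad p x) \<le> B" using solenoidal_p by blast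
  have "node_flux \<Xi> (grad p) (\<lambda>i. grad (partial i p)) B l0 h \<v>"
    unfolding node_flux_def node_flux_axioms_def
  proof (intro conjI B(2) allI impI)
    show "0 < l0" by (rule l0)
    show "0 < h i" "h i \<le> l0" for i by (rule h h_le_l0)+
    show "x $ i < l0" if "x \<in> \<Xi>" for x i using that by (rule below)
    show "norm (bar i x) \<le> h i" if "x \<in> closure \<Xi>" "x $ i = l0" for x i
      using face_iff that by blast
    show "\<exists>d>0. \<forall>y. dist y x < d \<longrightarrow> y $ i < l0 \<longrightarrow> y \<in> \<Xi>"
      if "x $ i = l0" "norm (bar i x) < h i" for x i
      by (rule disc_half_ball[OF neumann v_nonzero B(3) that])
    show "((\<lambda>y. grad p y $ i) \<longlongrightarrow> \<v> i) (at x within \<Xi>)"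
      if x: "x $ i = l0" "norm (bar i x) < h i" for x i
    proof -
      have "x \<in> node_face l0 \<Xi> i" using face_iff[of x i] x by (auto simp: node_face_def)
      then show ?thesis using neumann by (simp add: neumann_potential_def grad_def)
    qed
    show "solenoidal.no_flux_at \<Xi> (grad p) x" if "x \<in> closure \<Xi>" "\<forall>i. x $ i < l0" for x
      using no_flux_at_side[OF B(2) neumann] that by blast
  qed
  then show ?thesis by (rule node_flux.flux_through_faces[OF _ assms])
qed

lemma C1_on_scaled:
  fixes U :: "real^3 \<Rightarrow> real"
  assumes "C1_on UNIV U DU"
  shows "C1_on UNIV (\<lambda>x. U (c *\<^sub>R x)) (\<lambda>x. c *\<^sub>R DU (c *\<^sub>R x))"
  unfolding C1_on_def
proof (intro conjI ballI)
  fix y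
  have "GDERIV U (c *\<^sub>R y) :> DU (c *\<^sub>R y)" using C1_onD(1)[OF assms] by blast
  then have "((\<lambda>y. U (c *\<^sub>R y)) has_derivative (\<lambda>h. (c *\<^sub>R h) \<bullet> DU (c *\<^sub>R y))) (at y)"
    unfolding gderiv_def
    by (intro has_derivative_compose[of "\<lambda>y. c *\<^sub>R y" "\<lambda>h. c *\<^sub>R h" y UNIV U]) (auto intro!: derivative_eq_intros)
  then show "GDERIV (\<lambda>y. U (c *\<^sub>R y)) y :> c *\<^sub>R DU (c *\<^sub>R y)" by (simp add: gderiv_def)
  show "continuous_on UNIV (\<lambda>y. c *\<^sub>R DU (c *\<^sub>R y))"
    by (intro continuous_intros continuous_on_compose2[OF C1_onD(2)[OF assms]]) auto
qed

lemma C1_on_sq: "C1_on S U DU \<Longrightarrow> C1_on S (\<lambda>x. (U x)\<^sup>2) (\<lambda>x. (2 * U x) *\<^sub>R DU x)"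
  using C1_on_mult[of S U DU U DU] by (simp add: power2_eq_square scaleR_2 flip: scaleR_add_left mult_2)

lemma borel_indicator_continuous:
  fixes f :: "'a::euclidean_space \<Rightarrow> real"
  assumes "open S" "continuous_on S f"
  shows "(\<lambda>x. indicator S x * f x) \<in> borel_measurable borel"
  using borel_measurable_continuous_on_indicator[OF _ assms(2)] assms(1) by simp

lemma face_scale:
  fixes f :: "real^3 \<Rightarrow> real"
  assumes \<epsilon>: "0 < \<epsilon>" and f: "continuous_on UNIV f"
  shows "(LINT z:ball 0 (\<epsilon> * h i)|lborel. f (insert_coord i (\<epsilon> * t) z)) = \<epsilon>\<^sup>2 * (LINT z:ball 0 (h i)|lborel. f (\<epsilon> *\<^sub>R insert_coord i t z))"
proof -
  have c: "continuous_on S (\<lambda>z. f (insert_coord i (\<epsilon> * t) z))" for S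
    by (intro continuous_intros continuous_on_compose2[OF f]) auto
  have "(LINT z:(\<lambda>z. \<epsilon> *\<^sub>R z) ` ball 0 (h i)|lborel. f (insert_coord i (\<epsilon> * t) z))
    = \<epsilon> ^ DIM(real^2) * (LINT z:ball 0 (h i)|lborel. f (insert_coord i (\<epsilon> * t) (\<epsilon> *\<^sub>R z)))"
    by (rule LINT_scale[OF \<epsilon>], rule borel_indicator_continuous)
      (use \<epsilon> c in \<open>auto intro: open_scaling\<close>)
  then show ?thesis using \<epsilon> by (simp add: ball_scale insert_coord_scaleR)
qed

lemma node_scale:
  fixes f :: "real^3 \<Rightarrow> real"
  assumes \<epsilon>: "0 < \<epsilon>" and f: "continuous_on (node \<Xi> \<epsilon>) f"
  shows "(LINT x:node \<Xi> \<epsilon>|lborel. f x) = \<epsilon> ^ 3 * (LINT x:\<Xi>|lborel. f (\<epsilon> *\<^sub>R x))"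
proof -
  have "open (node \<Xi> \<epsilon>)" unfolding node_def using \<epsilon> open_\<Xi> by (intro open_scaling) auto
  from LINT_scale[OF \<epsilon> borel_indicator_continuous[OF this f, unfolded node_def]]
  show ?thesis by (simp add: node_def)
qed

text \<open>2 U DU is the gradient of U^2, to which \<open>flux_node\<close> applies after scaling.
  The volume contributes \<epsilon>^3 and the derivative 1/\<epsilon>; the product \<epsilon>^2 is
  the area factor of the faces.\<close>

lemma node_convection:
  assumes \<epsilon>: "\<epsilon> \<in> {0<..<\<epsilon>0}" and U: "C1_on UNIV U DU"
  shows "(LINT x:node \<Xi> \<epsilon>|lborel. 2 * U x * (V_node v0 \<epsilon> x \<bullet> DU x))
    = (\<Sum>i\<in>UNIV. \<v> i * (LINT z:ball 0 (\<epsilon> * h i)|lborel. (U (insert_coord i (\<epsilon> * l0) z))\<^sup>2))"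
    and "set_integrable lborel (node \<Xi> \<epsilon>) (\<lambda>x. 2 * U x * (V_node v0 \<epsilon> x \<bullet> DU x))"
proof -
  interpret SJ: scaled_junction \<epsilon>0 l0 l h \<Xi> \<epsilon> by (rule scaled[OF \<epsilon>])
  have e: "0 < \<epsilon>" using \<epsilon> by simp
  obtain B where B: "B \<ge> 0" "solenoidal \<Xi> (grad p) (\<lambda>i. grad (partial i p)) B"
    "\<And>x. x \<in> \<Xi> \<Longrightarrow> norm (grad p x) \<le> B" using solenoidal_p by blast
  note cp = solenoidal.continuous_V[OF B(2)]
  have cU: "continuous_on S U" and cDU: "continuous_on S DU" for S
    using C1_on_continuous[OF U] C1_onD(2)[OF U] continuous_on_subset by blast+
  have V: "V_node v0 \<epsilon> x = grad p ((1/\<epsilon>) *\<^sub>R x)" if "x \<in> node \<Xi> \<epsilon>" for x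
    using potential[OF \<epsilon> that] .
  have "continuous_on (node \<Xi> \<epsilon>) (\<lambda>x. grad p ((1/\<epsilon>) *\<^sub>R x))"
    using e by (intro continuous_on_compose2[OF cp] continuous_intros) (auto simp: node_def)
  then have "continuous_on (node \<Xi> \<epsilon>) (\<lambda>x. 2 * U x * (grad p ((1/\<epsilon>) *\<^sub>R x) \<bullet> DU x))"
    by (intro continuous_intros cU cDU)
  then have cf: "continuous_on (node \<Xi> \<epsilon>) (\<lambda>x. 2 * U x * (V_node v0 \<epsilon> x \<bullet> DU x))"
    by (rule continuous_on_cong[THEN iffD1, rotated -1]) (auto simp: V)
  have bn: "bounded (node \<Xi> \<epsilon>)" unfolding node_def using bounded_\<Xi> by (intro bounded_scaling)
  have "compact ((\<lambda>x. (2 * U x) *\<^sub>R DU x) ` closure (node \<Xi> \<epsilon>))"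
    using bn by (intro compact_continuous_image continuous_intros cU cDU) auto
  then obtain M where M: "\<And>x. x \<in> closure (node \<Xi> \<epsilon>) \<Longrightarrow> norm ((2 * U x) *\<^sub>R DU x) \<le> M"
    using compact_imp_bounded bounded_iff by (metis (no_types, lifting) image_eqI)
  show "set_integrable lborel (node \<Xi> \<epsilon>) (\<lambda>x. 2 * U x * (V_node v0 \<epsilon> x \<bullet> DU x))"
  proof (rule set_integrable_bounded_continuous[OF cf SJ.open_node bn])
    fix x assume x: "x \<in> node \<Xi> \<epsilon>"
    have "norm (2 * U x * (V_node v0 \<epsilon> x \<bullet> DU x)) = \<bar>V_node v0 \<epsilon> x \<bullet> ((2 * U x) *\<^sub>R DU x)\<bar>"
      by (simp add: abs_mult)
    also have "\<dots> \<le> norm (V_node v0 \<epsilon> x) * norm ((2 * U x) *\<^sub>R DU x)" by (rule Cauchy_Schwarz_ineq2)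
    also have "\<dots> \<le> B * M"
    proof (rule mult_mono)
      show "norm (V_node v0 \<epsilon> x) \<le> B" using x e by (subst V) (auto simp: node_def intro: B(3))
      show "norm ((2 * U x) *\<^sub>R DU x) \<le> M" using M x closure_subset by blast
    qed (use B in auto)
    finally show "norm (2 * U x * (V_node v0 \<epsilon> x \<bullet> DU x)) \<le> B * M" .
  qed
  let ?\<phi> = "\<lambda>\<xi>. (U (\<epsilon> *\<^sub>R \<xi>))\<^sup>2"
  have C\<phi>: "C1_on UNIV ?\<phi> (\<lambda>\<xi>. (2 * U (\<epsilon> *\<^sub>R \<xi>)) *\<^sub>R \<epsilon> *\<^sub>R DU (\<epsilon> *\<^sub>R \<xi>))"
    by (rule C1_on_sq[OF C1_on_scaled[OF U]])
  have "(LINT x:node \<Xi> \<epsilon>|lborel. 2 * U x * (V_node v0 \<epsilon> x \<bullet> DU x)) = \<epsilon> ^ 3 * (LINT \<xi>:\<Xi>|lborel. 2 * U (\<epsilon> *\<^sub>R \<xi>) * (V_node v0 \<epsilon> (\<epsilon> *\<^sub>R \<xi>) \<bullet> DU (\<epsilon> *\<^sub>R \<xi>)))"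
    by (rule node_scale[OF e cf])
  also have "(LINT \<xi>:\<Xi>|lborel. 2 * U (\<epsilon> *\<^sub>R \<xi>) * (V_node v0 \<epsilon> (\<epsilon> *\<^sub>R \<xi>) \<bullet> DU (\<epsilon> *\<^sub>R \<xi>)))
    = (LINT \<xi>:\<Xi>|lborel. (1 / \<epsilon>) * (grad p \<xi> \<bullet> ((2 * U (\<epsilon> *\<^sub>R \<xi>)) *\<^sub>R \<epsilon> *\<^sub>R DU (\<epsilon> *\<^sub>R \<xi>))))"
    using e open_\<Xi> by (intro set_lebesgue_integral_cong) (auto simp: V_node_def v0_eq)
  also have "\<dots> = (1 / \<epsilon>) * (\<Sum>i\<in>UNIV. \<v> i * (LINT z:ball 0 (h i)|lborel. ?\<phi> (insert_coord i l0 z)))"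
    by (simp only: set_integral_mult_right flux_node[OF C\<phi>])
  also have "\<epsilon> ^ 3 * ((1 / \<epsilon>) * (\<Sum>i\<in>UNIV. \<v> i * (LINT z:ball 0 (h i)|lborel. ?\<phi> (insert_coord i l0 z))))
    = (\<Sum>i\<in>UNIV. \<v> i * (\<epsilon>\<^sup>2 * (LINT z:ball 0 (h i)|lborel. ?\<phi> (insert_coord i l0 z))))"
    using e by (simp add: sum_distrib_left power2_eq_square power3_eq_cube mult_ac)
  also have "\<dots> = (\<Sum>i\<in>UNIV. \<v> i * (LINT z:ball 0 (\<epsilon> * h i)|lborel. (U (insert_coord i (\<epsilon> * l0) z))\<^sup>2))"
    using face_scale[OF e, of "\<lambda>x. (U x)\<^sup>2"] by (simp add: continuous_intros cU)
  finally show "(LINT x:node \<Xi> \<epsilon>|lborel. 2 * U x * (V_node v0 \<epsilon> x \<bullet> DU x))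
    = (\<Sum>i\<in>UNIV. \<v> i * (LINT z:ball 0 (\<epsilon> * h i)|lborel. (U (insert_coord i (\<epsilon> * l0) z))\<^sup>2))" .
qed

text \<open>Scaling the inequality on the fixed node yields the factor \<epsilon>^2 for the gradient
  and \<epsilon> for the face term. Both are bounded by powers of \<open>\<epsilon>0\<close>, so the
  constant is uniform.\<close>

lemma node_poincare:
  "\<exists>C\<ge>0. \<forall>\<epsilon>\<in>{0<..<\<epsilon>0}. \<forall>U DU. C1_on UNIV U DU \<longrightarrow> (LINT x:node \<Xi> \<epsilon>|lborel. (U x)\<^sup>2) \<le>
    C * ((LINT x:node \<Xi> \<epsilon>|lborel. (norm (DU x))\<^sup>2) + (LINT z:ball 0 (\<epsilon> * h 1)|lborel. (U (insert_coord 1 (\<epsilon> * l0) z))\<^sup>2))"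
proof -
  interpret S: scaled_junction \<epsilon>0 l0 l h \<Xi> "\<epsilon>0 / 2" by (rule scaled[OF \<epsilon>_half])
  obtain B where B: "\<And>x. x \<in> \<Xi> \<Longrightarrow> norm (grad p x) \<le> B" using grad_p_bounded by blast
  obtain C where C: "C \<ge> 0" "\<And>u Du. C1_on UNIV u Du \<Longrightarrow> (LINT x:\<Xi>|lborel. (u x)\<^sup>2) \<le>
    C * ((LINT x:\<Xi>|lborel. (norm (Du x))\<^sup>2) + (LINT z:ball 0 (h 1)|lborel. (u (insert_coord 1 l0 z))\<^sup>2))"
    using S.poincare_node[OF neumann v_nonzero B, of 1] by blast
  define K where "K = C * (\<epsilon>0\<^sup>2 + \<epsilon>0)"
  have "(LINT x:node \<Xi> \<epsilon>|lborel. (U x)\<^sup>2) \<le>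
    K * ((LINT x:node \<Xi> \<epsilon>|lborel. (norm (DU x))\<^sup>2) + (LINT z:ball 0 (\<epsilon> * h 1)|lborel. (U (insert_coord 1 (\<epsilon> * l0) z))\<^sup>2))"
    if \<epsilon>: "\<epsilon> \<in> {0<..<\<epsilon>0}" and U: "C1_on UNIV U DU" for \<epsilon> U DU
  proof -
    have e: "0 < \<epsilon>" "\<epsilon> < \<epsilon>0" using \<epsilon> by auto
    have cU: "continuous_on S U" and cDU: "continuous_on S DU" for S
      using C1_on_continuous[OF U] C1_onD(2)[OF U] continuous_on_subset by blast+
    define N where "N = (LINT x:node \<Xi> \<epsilon>|lborel. (norm (DU x))\<^sup>2)"
    define F where "F = (LINT z:ball 0 (\<epsilon> * h 1)|lborel. (U (insert_coord 1 (\<epsilon> * l0) z))\<^sup>2)"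
    have N0: "0 \<le> N" "0 \<le> F" by (simp_all add: N_def F_def LINT_nonneg)
    have N: "N = \<epsilon> ^ 3 * (LINT x:\<Xi>|lborel. (norm (DU (\<epsilon> *\<^sub>R x)))\<^sup>2)"
      unfolding N_def by (rule node_scale[OF e(1)]) (intro continuous_intros cDU)
    have F: "F = \<epsilon>\<^sup>2 * (LINT z:ball 0 (h 1)|lborel. (U (\<epsilon> *\<^sub>R insert_coord 1 l0 z))\<^sup>2)"
      unfolding F_def by (rule face_scale[OF e(1)]) (intro continuous_intros cU)
    have "(LINT x:node \<Xi> \<epsilon>|lborel. (U x)\<^sup>2) = \<epsilon> ^ 3 * (LINT x:\<Xi>|lborel. (U (\<epsilon> *\<^sub>R x))\<^sup>2)"
      by (rule node_scale[OF e(1)]) (intro continuous_intros cU)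
    also have "\<dots> \<le> \<epsilon> ^ 3 * (C * ((LINT x:\<Xi>|lborel. (norm (\<epsilon> *\<^sub>R DU (\<epsilon> *\<^sub>R x)))\<^sup>2) + (LINT z:ball 0 (h 1)|lborel. (U (\<epsilon> *\<^sub>R insert_coord 1 l0 z))\<^sup>2)))"
      using C(2)[OF C1_on_scaled[OF U, of \<epsilon>]] e by (intro mult_left_mono) auto
    also have "\<dots> = C * (\<epsilon>\<^sup>2 * N + \<epsilon> * F)"
      unfolding N F using e by (simp add: power_mult_distrib power2_eq_square power3_eq_cube algebra_simps)
    also have "\<dots> \<le> C * (\<epsilon>0\<^sup>2 * N + \<epsilon>0 * F)"
      using C(1) e N0 by (intro mult_left_mono add_mono mult_right_mono power_mono) auto
    also have "\<dots> \<le> K * (N + F)"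
    proof -
      have "0 \<le> C * (\<epsilon>0\<^sup>2 * F)" "0 \<le> C * (\<epsilon>0 * N)" using C(1) N0 \<epsilon>0 by auto
      then show ?thesis unfolding K_def by (simp add: algebra_simps)
    qed
    finally show ?thesis by (simp add: N_def F_def)
  qed
  moreover have "0 \<le> K" using C(1) \<epsilon>0 by (simp add: K_def)
  ultimately show ?thesis by blast
qed

end

lemma inner_bar: "x \<bullet> y = x $ i * y $ i + bar i x \<bullet> bar i y" for x y :: "real^3"
  using exhaust_3[of i] by (auto simp: inner_vec_def sum_2 sum_3 bar_def)

lemma norm_bar_le_sum: "norm (bar i y) \<le> (\<Sum>j\<in>UNIV-{i}. \<bar>y $ j\<bar>)"
proof -
  have U: "UNIV - {1} = {2, 3::3}" "UNIV - {2} = {1, 3::3}" "UNIV - {3} = {1, 2::3}"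
    unfolding UNIV_3 by auto
  have "norm (bar i y) \<le> (\<Sum>k\<in>UNIV. \<bar>bar i y $ k\<bar>)" by (rule norm_le_l1_cart)
  also have "\<dots> = (\<Sum>j\<in>UNIV-{i}. \<bar>y $ j\<bar>)"
    using exhaust_3[of i] by (elim disjE) (simp_all add: sum_2 bar_def U)
  finally show ?thesis .
qed

text \<open>Convexity is used to see that the frontier of a cylinder is a null set.\<close>

lemma convex_cyl: "convex (cyl l0 l h \<epsilon> i)"
proof -
  have "cyl l0 l h \<epsilon> i = {x. axis i 1 \<bullet> x > \<epsilon> * l0} \<inter> {x. axis i 1 \<bullet> x < l i} \<inter> bar i -` ball 0 (\<epsilon> * h i)"
    by (auto simp: cyl_def inner_axis')
  moreover have "convex (bar i -` ball 0 (\<epsilon> * h i))"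
    by (rule convex_linear_vimage[OF linear_bar convex_ball])
  ultimately show ?thesis
    by (simp add: convex_Int convex_halfspace_gt convex_halfspace_lt)
qed

lemma lebesgue_on_eq_lborel:
  fixes g :: "'a::euclidean_space \<Rightarrow> real"
  assumes "S \<in> sets borel" "(\<lambda>x. indicator S x * g x) \<in> borel_measurable borel"
  shows "(\<integral>x. g x \<partial>lebesgue_on S) = (LINT x:S|lborel. g x)"
    and "integrable (lebesgue_on S) g \<longleftrightarrow> set_integrable lborel S g"
  using assms by (simp_all add: integral_restrict_space integrable_restrict_space set_lebesgue_integral_def
      set_integrable_def integral_completion integrable_completion)

section \<open>Splitting the junction into node and cylinders\<close>

context scaled_junction
begin

text \<open>A point of the j-th cylinder has i-th coordinate below the radius of that cylinder,
  hence below \<epsilon> l0, where the i-th cylinder has not yet begun. The node lies below all face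
  planes.\<close>

lemma disjoint_pieces:
  "node \<Xi> \<epsilon> \<inter> cyl l0 l h \<epsilon> i = {}" "i \<noteq> j \<Longrightarrow> cyl l0 l h \<epsilon> i \<inter> cyl l0 l h \<epsilon> j = {}"
proof -
  show "node \<Xi> \<epsilon> \<inter> cyl l0 l h \<epsilon> i = {}"
    using node_nth[of _ i] closure_subset[of "node \<Xi> \<epsilon>"] by (force simp: cyl_def)
  assume ij: "i \<noteq> j"
  have "x \<notin> cyl l0 l h \<epsilon> j" if "x \<in> cyl l0 l h \<epsilon> i" for x
  proof
    assume "x \<in> cyl l0 l h \<epsilon> j"
    then have "\<bar>x $ i\<bar> < \<epsilon> * h j" using abs_nth_le_norm_bar[OF ij, of x] by (simp add: cyl_def)
    also have "\<dots> \<le> \<epsilon> * l0" using h_le_l0[of j] \<epsilon> by (intro mult_left_mono) auto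
    finally show False using that abs_ge_self[of "x $ i"] by (simp add: cyl_def)
  qed
  then show "cyl l0 l h \<epsilon> i \<inter> cyl l0 l h \<epsilon> j = {}" by blast
qed

lemma bounded_node: "bounded (node \<Xi> \<epsilon>)"
  unfolding node_def using bounded_\<Xi> by (intro bounded_scaling)

lemma bounded_cyl: "bounded (cyl l0 l h \<epsilon> i)"
  unfolding cyl_eq_cylinder by (rule bounded_cylinder)

lemma bounded_J: "bounded J"
proof -
  have "bounded (closure (node \<Xi> \<epsilon>) \<union> (\<Union>i. closure (cyl l0 l h \<epsilon> i)))"
    using bounded_node bounded_cyl by (intro bounded_Un[THEN iffD2] conjI bounded_UN) auto
  then show ?thesis unfolding junction_def by (rule bounded_subset) (rule interior_subset)
qed

definition pieces :: "(real^3) set" where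
  "pieces = node \<Xi> \<epsilon> \<union> (\<Union>i. cyl l0 l h \<epsilon> i)"

lemma pieces_subset: "pieces \<subseteq> J"
  unfolding pieces_def using node_subset_J cyl_subset_J by blast

text \<open>Points left over lie on the frontier of a convex cylinder or on that of the node. In the
  second case they cannot be lateral, since the lateral part belongs to the frontier of the
  junction, so they lie in a face plane. The frontier of the node as a whole never has to be
  measured.\<close>

lemma negligible_interfaces: "negligible (J - pieces)"
proof (rule negligible_subset)
  have hyp: "negligible {x::real^3. x $ i = \<epsilon> * l0}" for i
    using negligible_hyperplane[of "axis i (1::real)" "\<epsilon> * l0"] by (simp add: inner_axis' axis_eq_0_iff)
  show "negligible ((\<Union>i. {x::real^3. x $ i = \<epsilon> * l0}) \<union> (\<Union>i. frontier (cyl l0 l h \<epsilon> i)))"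
    by (intro negligible_Un negligible_Union finite_imageI finite)
      (auto intro: hyp negligible_convex_frontier convex_cyl)
  show "J - pieces \<subseteq> (\<Union>i. {x::real^3. x $ i = \<epsilon> * l0}) \<union> (\<Union>i. frontier (cyl l0 l h \<epsilon> i))"
  proof
    fix x assume x: "x \<in> J - pieces"
    have "J \<subseteq> closure (node \<Xi> \<epsilon>) \<union> (\<Union>i. closure (cyl l0 l h \<epsilon> i))"
      unfolding junction_def by (rule interior_subset)
    then have "x \<in> closure (node \<Xi> \<epsilon>) \<or> (\<exists>i. x \<in> closure (cyl l0 l h \<epsilon> i))"
      using x by blast
    moreover have "x \<in> (\<Union>i. {x::real^3. x $ i = \<epsilon> * l0}) \<union> (\<Union>i. frontier (cyl l0 l h \<epsilon> i))" if "x \<in> closure (cyl l0 l h \<epsilon> i)" for i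
    proof -
      have "x \<in> frontier (cyl l0 l h \<epsilon> i)"
        using that x by (simp add: frontier_def interior_open[OF open_cyl] pieces_def)
      then show ?thesis by (intro UnI2 UN_I) auto
    qed
    moreover have "x \<in> (\<Union>i. {x::real^3. x $ i = \<epsilon> * l0}) \<union> (\<Union>i. frontier (cyl l0 l h \<epsilon> i))" if "x \<in> closure (node \<Xi> \<epsilon>)"
    proof -
      have xf: "x \<in> frontier (node \<Xi> \<epsilon>)"
        using that x by (simp add: frontier_def interior_open[OF open_node] pieces_def)
      have "x \<notin> frontier J" using x open_J by (simp add: frontier_def interior_open)
      then have "x \<notin> node_lateral l0 h \<Xi> \<epsilon>" using geometry \<epsilon> by (auto simp: junction_geometry_def)
      then obtain i where "x \<in> closure (disc h \<epsilon> i (\<epsilon> * l0))" using xf by (auto simp: node_lateral_def)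
      then show ?thesis using closure_disc[of \<epsilon> h i, OF \<epsilon>h] by auto
    qed
    ultimately show "x \<in> (\<Union>i. {x::real^3. x $ i = \<epsilon> * l0}) \<union> (\<Union>i. frontier (cyl l0 l h \<epsilon> i))" by blast
  qed
qed

lemma set_integral_pieces:
  fixes f :: "real^3 \<Rightarrow> real"
  assumes f0: "set_integrable lborel (node \<Xi> \<epsilon>) f" and f: "\<And>i. set_integrable lborel (cyl l0 l h \<epsilon> i) f"
  shows "set_integrable lborel pieces f"
    and "(LINT x:pieces|lborel. f x) = (LINT x:node \<Xi> \<epsilon>|lborel. f x) + (\<Sum>i\<in>UNIV. LINT x:cyl l0 l h \<epsilon> i|lborel. f x)"
proof -
  have eq: "indicator pieces x *\<^sub>R f x = indicator (node \<Xi> \<epsilon>) x *\<^sub>R f x + (\<Sum>i\<in>UNIV. indicator (cyl l0 l h \<epsilon> i) x *\<^sub>R f x)" for x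
  proof (cases "x \<in> node \<Xi> \<epsilon>")
    case True
    then have "x \<notin> cyl l0 l h \<epsilon> i" for i using disjoint_pieces(1)[of i] by blast
    then show ?thesis using True by (simp add: pieces_def)
  next
    case n: False
    show ?thesis
    proof (cases "\<exists>i. x \<in> cyl l0 l h \<epsilon> i")
      case True
      then obtain i where i: "x \<in> cyl l0 l h \<epsilon> i" by blast
      then have "x \<notin> cyl l0 l h \<epsilon> j" if "j \<noteq> i" for j using disjoint_pieces(2)[OF that] by blast
      then have "(\<Sum>j\<in>UNIV. indicator (cyl l0 l h \<epsilon> j) x *\<^sub>R f x) = (\<Sum>j\<in>UNIV. if j = i then f x else 0)"
        using i by (intro sum.cong) auto
      moreover have "x \<in> pieces" using i by (auto simp: pieces_def)
      ultimately show ?thesis using n by simp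
    qed (use n in \<open>auto simp: pieces_def\<close>)
  qed
  show "set_integrable lborel pieces f"
    unfolding set_integrable_def eq using f0 f
    by (intro Bochner_Integration.integrable_add Bochner_Integration.integrable_sum) (auto simp: set_integrable_def)
  show "(LINT x:pieces|lborel. f x) = (LINT x:node \<Xi> \<epsilon>|lborel. f x) + (\<Sum>i\<in>UNIV. LINT x:cyl l0 l h \<epsilon> i|lborel. f x)"
  proof -
    have 0: "integrable lborel (\<lambda>x. indicator (node \<Xi> \<epsilon>) x *\<^sub>R f x)"
      and i: "\<And>i. integrable lborel (\<lambda>x. indicator (cyl l0 l h \<epsilon> i) x *\<^sub>R f x)"
      using f0 f by (simp_all add: set_integrable_def)
    show ?thesis
      unfolding set_lebesgue_integral_def eq
        Bochner_Integration.integral_add[OF 0 Bochner_Integration.integrable_sum[OF i]]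
        Bochner_Integration.integral_sum[OF i] ..
  qed
qed

text \<open>Moves an integral over the junction to the pieces, across the null set of interfaces,
  and from the completed to the Borel measure, where Fubini's theorem was applied.\<close>

lemma integral_J_pieces:
  fixes f :: "real^3 \<Rightarrow> real"
  assumes f0: "set_integrable lborel (node \<Xi> \<epsilon>) f" and f: "\<And>i. set_integrable lborel (cyl l0 l h \<epsilon> i) f"
  shows "integrable (lebesgue_on J) f"
    and "(\<integral>x. f x \<partial>lebesgue_on J) = (LINT x:node \<Xi> \<epsilon>|lborel. f x) + (\<Sum>i\<in>UNIV. LINT x:cyl l0 l h \<epsilon> i|lborel. f x)"
proof -
  note P = set_integral_pieces[OF f0 f]
  have m: "(\<lambda>x. indicator pieces x * f x) \<in> borel_measurable borel"
    using P(1) by (auto simp: set_integrable_def)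
  have Jb: "J \<inter> space lebesgue \<in> sets lebesgue" using open_J by (simp add: borel_open sets_completionI_sets)
  have i1: "f absolutely_integrable_on pieces"
    using P(1) m by (simp add: set_integrable_def integrable_completion)
  have e: "{x \<in> pieces - J. f x \<noteq> 0} = {}" using pieces_subset by blast
  have n1: "negligible {x \<in> J - pieces. f x \<noteq> 0}" "negligible {x \<in> pieces - J. f x \<noteq> 0}"
    unfolding e by (auto intro: negligible_subset[OF negligible_interfaces])
  from absolutely_integrable_spike_set[OF i1 n1(2) n1(1)] have i2: "f absolutely_integrable_on J" .
  then show "integrable (lebesgue_on J) f"
    using integrable_restrict_space[OF Jb, of f] by (simp add: set_integrable_def)
  have "(\<integral>x. f x \<partial>lebesgue_on J) = (LINT x:J|lebesgue. f x)"
    using integral_restrict_space[OF Jb, of f] by (simp add: set_lebesgue_integral_def)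
  also have "\<dots> = integral J f" by (rule set_lebesgue_integral_eq_integral(2)[OF i2])
  also have "\<dots> = integral pieces f" using n1 by (intro integral_spike_set)
  also have "\<dots> = (LINT x:pieces|lebesgue. f x)" by (rule set_lebesgue_integral_eq_integral(2)[OF i1, symmetric])
  also have "\<dots> = (LINT x:pieces|lborel. f x)"
    using m by (simp add: set_lebesgue_integral_def integral_completion)
  finally show "(\<integral>x. f x \<partial>lebesgue_on J) = (LINT x:node \<Xi> \<epsilon>|lborel. f x) + (\<Sum>i\<in>UNIV. LINT x:cyl l0 l h \<epsilon> i|lborel. f x)"
    using P(2) by simp
qed

lemma integral_J_continuous:
  fixes f :: "real^3 \<Rightarrow> real"
  assumes "continuous_on UNIV f"
  shows "(\<integral>x. f x \<partial>lebesgue_on J) = (LINT x:J|lborel. f x)" "integrable (lebesgue_on J) f"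
    "(\<integral>x. f x \<partial>lebesgue_on J) = (LINT x:node \<Xi> \<epsilon>|lborel. f x) + (\<Sum>i\<in>UNIV. LINT x:cyl l0 l h \<epsilon> i|lborel. f x)"
    "A \<in> {node \<Xi> \<epsilon>, cyl l0 l h \<epsilon> i} \<Longrightarrow> (\<integral>x. indicator A x * f x \<partial>lebesgue_on J) = (LINT x:A|lborel. f x)"
proof -
  have m: "(\<lambda>x. indicator S x * f x) \<in> borel_measurable borel" if "open S" for S
    using borel_measurable_continuous_on_indicator[of S f] continuous_on_subset[OF assms] that by simp
  show "(\<integral>x. f x \<partial>lebesgue_on J) = (LINT x:J|lborel. f x)" "integrable (lebesgue_on J) f"
    using lebesgue_on_eq_lborel[OF _ m[OF open_J]] set_integrable_bounded_open[OF assms open_J bounded_J] open_J by auto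
  show "(\<integral>x. f x \<partial>lebesgue_on J) = (LINT x:node \<Xi> \<epsilon>|lborel. f x) + (\<Sum>i\<in>UNIV. LINT x:cyl l0 l h \<epsilon> i|lborel. f x)"
    by (intro integral_J_pieces set_integrable_bounded_open assms open_node bounded_node open_cyl bounded_cyl)
  assume A: "A \<in> {node \<Xi> \<epsilon>, cyl l0 l h \<epsilon> i}"
  then have oA: "open A" "A \<subseteq> J" using open_node open_cyl node_subset_J cyl_subset_J by blast+
  have e: "indicator J x * (indicator A x * f x) = indicator A x * f x" for x
    using oA(2) by (auto simp: indicator_def)
  have "(\<integral>x. indicator A x * f x \<partial>lebesgue_on J) = (LINT x:J|lborel. indicator A x * f x)"
    using open_J m[OF oA(1)] by (intro lebesgue_on_eq_lborel) (auto simp: e)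
  then show "(\<integral>x. indicator A x * f x \<partial>lebesgue_on J) = (LINT x:A|lborel. f x)"
    by (simp add: set_lebesgue_integral_def e)
qed

end

section \<open>Convection in the cylinders\<close>

context problem
begin

lemma w_props:
  "\<exists>M\<ge>0. \<forall>i. \<forall>t\<in>{0<..<l i}. \<bar>w i t\<bar> \<le> M"
  "t \<in> {0<..<l i} \<Longrightarrow> DERIV (w i) t :> deriv (w i) t"
  "continuous_on {0<..<l i} (deriv (w i))"
proof -
  have sb: "smooth_bounded_on {0<..<l i} (w i)" for i
    using velocity by (simp add: velocity_field_def)
  then have "\<exists>b. \<forall>t\<in>{0<..<l i}. \<bar>w i t\<bar> \<le> b" for i
    by (auto simp: smooth_bounded_on_def bounded_iff)
  then obtain b where b: "\<And>i t. t \<in> {0<..<l i} \<Longrightarrow> \<bar>w i t\<bar> \<le> b i" by metis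
  have "\<bar>w i t\<bar> \<le> (\<Sum>i\<in>UNIV. \<bar>b i\<bar>)" if "t \<in> {0<..<l i}" for i t
    using b[OF that] member_le_sum[of i UNIV "\<lambda>i. \<bar>b i\<bar>"] by simp
  then show "\<exists>M\<ge>0. \<forall>i. \<forall>t\<in>{0<..<l i}. \<bar>w i t\<bar> \<le> M"
    by (intro exI[of _ "\<Sum>i\<in>UNIV. \<bar>b i\<bar>"]) (auto intro: sum_nonneg)
  have C: "C_on (Suc 0) {0<..<l i} (w i)" for i using sb[of i] by (simp add: smooth_bounded_on_def smooth_on_def)
  have D: "DERIV (w i) t :> frechet_derivative (w i) (at t) 1" if "t \<in> {0<..<l i}" for i t
  proof -
    have d: "(w i has_derivative frechet_derivative (w i) (at t)) (at t)"
      using C[of i] that by (simp add: frechet_derivative_works)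
    have "frechet_derivative (w i) (at t) x = frechet_derivative (w i) (at t) 1 * x" for x
      using linear_scale[OF has_derivative_linear[OF d], of x 1] by simp
    then have "frechet_derivative (w i) (at t) = (*) (frechet_derivative (w i) (at t) 1)" by (rule ext)
    then show ?thesis using d by (simp add: has_field_derivative_def)
  qed
  then have e: "deriv (w i) t = frechet_derivative (w i) (at t) 1" if "t \<in> {0<..<l i}" for i t
    using that DERIV_imp_deriv by blast
  show "t \<in> {0<..<l i} \<Longrightarrow> DERIV (w i) t :> deriv (w i) t" using D e by metis
  have "continuous_on {0<..<l i} (\<lambda>t. frechet_derivative (w i) (at t) 1)"
    using C[of i] by simp
  then show "continuous_on {0<..<l i} (deriv (w i))"
    by (rule continuous_on_cong[THEN iffD1, rotated -1]) (auto simp: e)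
qed

text \<open>The matching condition is read off at the centre of the interface disc.\<close>

lemma w_interface:
  assumes "\<epsilon> \<in> {0<..<\<epsilon>0}"
  shows "w i (\<epsilon> * l0) = \<v> i"
proof -
  let ?x = "insert_coord i (\<epsilon> * l0) 0"
  have "?x \<in> disc h \<epsilon> i (\<epsilon> * l0)" using assms h[of i] by (simp add: disc_def)
  then have "V_cyl w vt \<epsilon> i ?x = \<v> i *\<^sub>R axis i 1"
    using velocity assms unfolding velocity_field_def by blast
  then have "V_cyl w vt \<epsilon> i ?x $ i = \<v> i" by simp
  then show ?thesis by (simp add: V_cyl_def)
qed

definition vperp :: "3 \<Rightarrow> real \<times> (real^2) \<Rightarrow> real^2" where
  "vperp i q = bar i (\<chi> j. vt i j q)"

lemma vperp_props:
  "continuous_on ({0<..<l i} \<times> ball 0 (h i)) (vperp i)"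
  "\<exists>K. \<forall>q\<in>{0<..<l i} \<times> ball 0 (h i). norm (vperp i q) \<le> K"
proof -
  have sb: "smooth_bounded_on ({0<..<l i} \<times> ball 0 (h i)) (vt i j)" if "j \<noteq> i" for j
    using velocity that by (simp add: velocity_field_def)
  have c: "continuous_on ({0<..<l i} \<times> ball 0 (h i)) (vt i j)" if "j \<noteq> i" for j
    using sb[OF that] C_on.simps(1) by (metis smooth_bounded_on_def smooth_on_def)
  \<comment> \<open>Regularity is available for the profiles with j different from i; the i-th
    entry, which \<open>bar\<close> discards, is replaced by zero.\<close>
  define g where "g q = (\<chi> j. if j = i then 0 else vt i j q)" for q
  have "bar i (g q) = vperp i q" for q
    using exhaust_3[of i] by (auto simp: vperp_def g_def bar_def)
  then have e: "vperp i = (\<lambda>q. bar i (g q))" by auto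
  have "continuous_on ({0<..<l i} \<times> ball 0 (h i)) g"
    unfolding g_def
  proof (intro continuous_on_vec_lambda)
    fix j
    show "continuous_on ({0<..<l i} \<times> ball 0 (h i)) (\<lambda>q. if j = i then 0 else vt i j q)"
      using c[of j] by (cases "j = i") auto
  qed
  then show "continuous_on ({0<..<l i} \<times> ball 0 (h i)) (vperp i)"
    unfolding e by (rule continuous_on_bar)
  have "\<exists>b. j \<noteq> i \<longrightarrow> (\<forall>q\<in>{0<..<l i} \<times> ball 0 (h i). \<bar>vt i j q\<bar> \<le> b)" for j
    using sb[of j] by (cases "j = i") (auto simp: smooth_bounded_on_def bounded_iff)
  then obtain b where b: "\<And>j q. j \<noteq> i \<Longrightarrow> q \<in> {0<..<l i} \<times> ball 0 (h i) \<Longrightarrow> \<bar>vt i j q\<bar> \<le> b j" by metis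
  have "norm (vperp i q) \<le> (\<Sum>j\<in>UNIV-{i}. b j)" if "q \<in> {0<..<l i} \<times> ball 0 (h i)" for q
    unfolding vperp_def using b that by (intro order_trans[OF norm_bar_le_sum] sum_mono) auto
  then show "\<exists>K. \<forall>q\<in>{0<..<l i} \<times> ball 0 (h i). norm (vperp i q) \<le> K" by blast
qed

lemma cyl_coords:
  assumes "0 < \<epsilon>" "x \<in> cyl l0 l h \<epsilon> i"
  shows "(x $ i, (1/\<epsilon>) *\<^sub>R bar i x) \<in> {0<..<l i} \<times> ball 0 (h i)"
proof -
  have "0 < \<epsilon> * l0" using assms l0 by simp
  moreover have "norm (bar i x) / \<epsilon> < h i" using assms by (simp add: cyl_def field_simps)
  ultimately show ?thesis using assms by (auto simp: cyl_def)
qed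

text \<open>Letting \<open>\<epsilon>\<close> tend to zero in the smallness condition gives a pointwise bound on the whole
  cylinder. The strictness is lost, but the constant in the Friedrichs inequality is less than one.\<close>

lemma vperp_bound:
  assumes t: "t \<in> {0<..<l i}" and \<xi>: "\<xi> \<in> ball 0 (h i)"
  shows "norm (vperp i (t, \<xi>)) * l i \<le> \<kappa>0 i"
proof -
  \<comment> \<open>Small enough for the cross-section at \<open>t\<close> to belong to the
    cylinder, since then \<epsilon> l0 is at most t / 2.\<close>
  define \<epsilon> where "\<epsilon> = min \<epsilon>0 (t / l0) / 2"
  have \<epsilon>: "\<epsilon> \<in> {0<..<\<epsilon>0}" using \<epsilon>0 t l0 by (auto simp: \<epsilon>_def min_def)
  have "\<epsilon> \<le> t / l0 / 2" by (simp add: \<epsilon>_def)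
  then have "\<epsilon> * l0 \<le> t / 2" using l0 by (simp add: field_simps)
  then have lt: "\<epsilon> * l0 < t" using t by simp
  let ?f = "\<lambda>x. norm (bar i (\<chi> j. vt i j (x $ i, (1/\<epsilon>) *\<^sub>R bar i x)))"
  let ?x = "insert_coord i t (\<epsilon> *\<^sub>R \<xi>)"
  have x: "?x \<in> cyl l0 l h \<epsilon> i" using \<epsilon> \<xi> t lt by (simp add: cyl_def)
  obtain K where K: "\<forall>q\<in>{0<..<l i} \<times> ball 0 (h i). norm (vperp i q) \<le> K" using vperp_props(2) by blast
  have "bdd_above (?f ` cyl l0 l h \<epsilon> i)"
    using K cyl_coords[of \<epsilon> _ i] \<epsilon> by (intro bdd_aboveI[of _ K]) (auto simp: vperp_def)
  then have "?f ?x \<le> transversal_sup l0 l h vt \<epsilon> i"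
    unfolding transversal_sup_def by (intro cSUP_upper x)
  then have "norm (vperp i (t, \<xi>)) \<le> transversal_sup l0 l h vt \<epsilon> i"
    using \<epsilon> by (simp add: vperp_def)
  then have "norm (vperp i (t, \<xi>)) * l i \<le> transversal_sup l0 l h vt \<epsilon> i * l i"
    using l[of i] by (intro mult_right_mono) auto
  then show ?thesis using small[OF \<epsilon>, of i] by linarith
qed

lemma \<kappa>_pos: "0 < \<kappa>0n" "0 < \<kappa>0 i"
  using diffusion by (auto simp: diffusion_matrix_def elliptic_matrix_on_def)

text \<open>The field is split into its axial and transversal parts. The first is handled by
  \<open>cylinder_convection\<close> and gives the flux term at the interface. The second is at most
  \<epsilon> \<open>\<kappa>0 i\<close> times the integral of U^2 / l^2 + |DU|^2; Friedrichs'
  inequality bounds this by 7/4 of the Dirichlet integral plus an end term. As the left side is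
  twice the convective term, 7/4 < 2 is the room needed.\<close>

lemma cyl_convection:
  assumes \<epsilon>: "\<epsilon> \<in> {0<..<\<epsilon>0}" and U: "C1_on UNIV U DU"
    and M: "0 \<le> M" "\<And>t. t \<in> {0<..<l i} \<Longrightarrow> \<bar>w i t\<bar> \<le> M"
  shows "set_integrable lborel (cyl l0 l h \<epsilon> i) (\<lambda>x. 2 * U x * (V_cyl w vt \<epsilon> i x \<bullet> DU x))"
    and "(LINT x:cyl l0 l h \<epsilon> i|lborel. 2 * U x * (V_cyl w vt \<epsilon> i x \<bullet> DU x))
    \<le> (7/4) * (\<epsilon> * \<kappa>0 i) * (LINT x:cyl l0 l h \<epsilon> i|lborel. (norm (DU x))\<^sup>2)
      + (M + 3 * (\<epsilon> * \<kappa>0 i)) * (LINT z:ball 0 (\<epsilon> * h i)|lborel. (U (insert_coord i (l i) z))\<^sup>2)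
      - \<v> i * (LINT z:ball 0 (\<epsilon> * h i)|lborel. (U (insert_coord i (\<epsilon> * l0) z))\<^sup>2)"
proof -
  let ?Z = "cyl l0 l h \<epsilon> i"
  interpret SJ: scaled_junction \<epsilon>0 l0 l h \<Xi> \<epsilon> by (rule scaled[OF \<epsilon>])
  have e: "0 < \<epsilon>" using \<epsilon> by simp
  have el: "0 < \<epsilon> * l0" using e l0 by simp
  have ab: "\<epsilon> * l0 < l i" by (rule SJ.\<epsilon>l0)
  have cU: "continuous_on S U" and cDU: "continuous_on S DU" for S
    using C1_on_continuous[OF U] C1_onD(2)[OF U] continuous_on_subset by blast+
  define q where "q x = (x $ i, (1/\<epsilon>) *\<^sub>R bar i x)" for x :: "real^3"
  have q: "q x \<in> {0<..<l i} \<times> ball 0 (h i)" if "x \<in> ?Z" for x unfolding q_def by (rule cyl_coords[OF e that])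
  have Vdec: "2 * U x * (V_cyl w vt \<epsilon> i x \<bullet> DU x) = w i (x $ i) * (2 * U x * DU x $ i) + 2 * \<epsilon> * (U x * (vperp i (q x) \<bullet> bar i (DU x)))" for x
  proof -
    have "bar i (V_cyl w vt \<epsilon> i x) = \<epsilon> *\<^sub>R vperp i (q x)"
      using exhaust_3[of i] by (auto simp: V_cyl_def bar_def vperp_def q_def vec2_eq_iff)
    moreover have "V_cyl w vt \<epsilon> i x $ i = w i (x $ i)" by (simp add: V_cyl_def)
    ultimately show ?thesis by (simp add: inner_bar[of _ _ i] algebra_simps)
  qed
  have conv: "set_integrable lborel ?Z (\<lambda>x. w i (x $ i) * (2 * U x * DU x $ i))"
    "(LINT x:?Z|lborel. w i (x $ i) * (2 * U x * DU x $ i))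
      \<le> M * (LINT z:ball 0 (\<epsilon> * h i)|lborel. (U (insert_coord i (l i) z))\<^sup>2)
        - \<v> i * (LINT z:ball 0 (\<epsilon> * h i)|lborel. (U (insert_coord i (\<epsilon> * l0) z))\<^sup>2)"
  proof -
    have D: "DERIV (w i) t :> deriv (w i) t" if "\<epsilon> * l0 \<le> t" "t < l i" for t
      using that el by (intro w_props(2)) auto
    have c: "continuous_on {\<epsilon> * l0..<l i} (deriv (w i))"
      by (rule continuous_on_subset[OF w_props(3)]) (use el in auto)
    have nn: "0 \<le> deriv (w i) t" if "\<epsilon> * l0 \<le> t" "t < l i" for t
      using that el by (intro w_mono) auto
    have Mb: "\<bar>w i t\<bar> \<le> M" if "\<epsilon> * l0 \<le> t" "t < l i" for t
      using that el by (intro M) auto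
    show "set_integrable lborel ?Z (\<lambda>x. w i (x $ i) * (2 * U x * DU x $ i))"
      unfolding cyl_eq_cylinder by (rule cylinder_convection(1)[OF U ab D c nn Mb])
    show "(LINT x:?Z|lborel. w i (x $ i) * (2 * U x * DU x $ i))
      \<le> M * (LINT z:ball 0 (\<epsilon> * h i)|lborel. (U (insert_coord i (l i) z))\<^sup>2)
        - \<v> i * (LINT z:ball 0 (\<epsilon> * h i)|lborel. (U (insert_coord i (\<epsilon> * l0) z))\<^sup>2)"
      unfolding cyl_eq_cylinder w_interface[OF \<epsilon>, symmetric] by (rule cylinder_convection(2)[OF U ab D c nn Mb])
  qed
  \<comment> \<open>The weight 1 / l^2 comes from Young's inequality with the bound
    \<open>\<kappa>0 i / l i\<close> on the transversal profile, and cancels the squared length in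
    Friedrichs' inequality.\<close>
  define P where "P x = (1 / (l i)\<^sup>2) * (U x)\<^sup>2 + (norm (DU x))\<^sup>2" for x
  have cP: "continuous_on S P" for S unfolding P_def by (intro continuous_intros cU cDU)
  have iP: "set_integrable lborel ?Z P"
    by (rule set_integrable_bounded_open[OF cP open_cyl SJ.bounded_cyl])
  have pt: "\<bar>2 * (U x * (vperp i (q x) \<bullet> bar i (DU x)))\<bar> \<le> \<kappa>0 i * P x" if xZ: "x \<in> ?Z" for x
  proof -
    obtain t \<xi> where t\<xi>: "q x = (t, \<xi>)" "t \<in> {0<..<l i}" "\<xi> \<in> ball 0 (h i)" using q[OF xZ] by auto
    have li: "0 < l i" using l[of i] by simp
    have "norm (vperp i (q x)) \<le> \<kappa>0 i / l i"
      using vperp_bound[OF t\<xi>(2,3)] li by (simp add: t\<xi>(1) pos_le_divide_eq)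
    then have "\<bar>vperp i (q x) \<bullet> bar i (DU x)\<bar> \<le> (\<kappa>0 i / l i) * norm (DU x)"
      using norm_bar_le[of i "DU x"] \<kappa>_pos(2)[of i] li
      by (intro order_trans[OF Cauchy_Schwarz_ineq2] mult_mono) auto
    then have "\<bar>U x\<bar> * \<bar>vperp i (q x) \<bullet> bar i (DU x)\<bar> \<le> \<bar>U x\<bar> * ((\<kappa>0 i / l i) * norm (DU x))"
      by (intro mult_left_mono) auto
    then have "2 * (\<bar>U x\<bar> * \<bar>vperp i (q x) \<bullet> bar i (DU x)\<bar>) \<le> 2 * (\<bar>U x\<bar> * ((\<kappa>0 i / l i) * norm (DU x)))"
      by (rule mult_left_mono) simp
    then have "\<bar>2 * (U x * (vperp i (q x) \<bullet> bar i (DU x)))\<bar> \<le> \<kappa>0 i * (2 * (\<bar>U x\<bar> / l i) * norm (DU x))"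
      by (simp add: abs_mult mult_ac)
    also have "\<dots> \<le> \<kappa>0 i * ((\<bar>U x\<bar> / l i)\<^sup>2 + (norm (DU x))\<^sup>2)"
      using \<kappa>_pos(2)[of i] sum_squares_bound[of "\<bar>U x\<bar> / l i" "norm (DU x)"] by (intro mult_left_mono) auto
    finally show ?thesis by (simp add: P_def power_divide)
  qed
  have iT: "set_integrable lborel ?Z (\<lambda>x. 2 * \<epsilon> * (U x * (vperp i (q x) \<bullet> bar i (DU x))))"
    unfolding set_integrable_def
  proof (rule Bochner_Integration.integrable_bound)
    show "integrable lborel (\<lambda>x. (\<epsilon> * \<kappa>0 i) * (indicator ?Z x *\<^sub>R P x))"
      using iP by (simp add: set_integrable_def)
    have cq: "continuous_on ?Z (\<lambda>x. vperp i (q x))"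
      by (rule continuous_on_compose2[OF vperp_props(1)]) (use q in \<open>auto simp: q_def intro!: continuous_intros\<close>)
    show "(\<lambda>x. indicator ?Z x *\<^sub>R (2 * \<epsilon> * (U x * (vperp i (q x) \<bullet> bar i (DU x))))) \<in> borel_measurable lborel"
      unfolding measurable_lborel2
      by (rule borel_measurable_continuous_on_indicator) (auto intro!: continuous_intros cU cDU cq open_cyl borel_open)
    show "AE x in lborel. norm (indicator ?Z x *\<^sub>R (2 * \<epsilon> * (U x * (vperp i (q x) \<bullet> bar i (DU x)))))
      \<le> norm ((\<epsilon> * \<kappa>0 i) * (indicator ?Z x *\<^sub>R P x))"
    proof (rule AE_I2)
      fix x
      show "norm (indicator ?Z x *\<^sub>R (2 * \<epsilon> * (U x * (vperp i (q x) \<bullet> bar i (DU x)))))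
        \<le> norm ((\<epsilon> * \<kappa>0 i) * (indicator ?Z x *\<^sub>R P x))"
      proof (cases "x \<in> ?Z")
        case True
        have "\<epsilon> * \<bar>2 * (U x * (vperp i (q x) \<bullet> bar i (DU x)))\<bar> \<le> \<epsilon> * (\<kappa>0 i * P x)"
          using pt[OF True] e by (intro mult_left_mono) auto
        then have "\<bar>2 * \<epsilon> * (U x * (vperp i (q x) \<bullet> bar i (DU x)))\<bar> \<le> \<epsilon> * \<kappa>0 i * P x"
          using e by (simp add: abs_mult mult_ac)
        also have "\<dots> \<le> \<bar>\<epsilon> * \<kappa>0 i * P x\<bar>" by simp
        finally show ?thesis using True by simp
      qed simp
    qed
  qed
  show "set_integrable lborel ?Z (\<lambda>x. 2 * U x * (V_cyl w vt \<epsilon> i x \<bullet> DU x))"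
    unfolding Vdec by (rule set_integral_add(1)[OF conv(1) iT])
  have T: "(LINT x:?Z|lborel. 2 * \<epsilon> * (U x * (vperp i (q x) \<bullet> bar i (DU x)))) \<le> (\<epsilon> * \<kappa>0 i) * (LINT x:?Z|lborel. P x)"
  proof -
    have "(LINT x:?Z|lborel. 2 * \<epsilon> * (U x * (vperp i (q x) \<bullet> bar i (DU x)))) \<le> (LINT x:?Z|lborel. (\<epsilon> * \<kappa>0 i) * P x)"
    proof (rule set_integral_mono[OF iT])
      show "set_integrable lborel ?Z (\<lambda>x. (\<epsilon> * \<kappa>0 i) * P x)" using iP by (intro set_integrable_mult_right)
      fix x assume x: "x \<in> ?Z"
      have "\<epsilon> * (2 * (U x * (vperp i (q x) \<bullet> bar i (DU x)))) \<le> \<epsilon> * (\<kappa>0 i * P x)"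
        using pt[OF x] e by (intro mult_left_mono) auto
      then show "2 * \<epsilon> * (U x * (vperp i (q x) \<bullet> bar i (DU x))) \<le> (\<epsilon> * \<kappa>0 i) * P x"
        by (simp add: mult_ac)
    qed
    then show ?thesis by simp
  qed
  define G where "G = (LINT x:?Z|lborel. (norm (DU x))\<^sup>2)"
  define E where "E = (LINT z:ball 0 (\<epsilon> * h i)|lborel. (U (insert_coord i (l i) z))\<^sup>2)"
  define F where "F = (LINT z:ball 0 (\<epsilon> * h i)|lborel. (U (insert_coord i (\<epsilon> * l0) z))\<^sup>2)"
  have E0: "0 \<le> E" "0 \<le> G" by (simp_all add: E_def G_def LINT_nonneg)
  have PG: "(LINT x:?Z|lborel. P x) \<le> 3 * E + (7/4) * G"
  proof -
    have Gi: "(LINT x:?Z|lborel. (DU x $ i)\<^sup>2) \<le> G"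
      unfolding G_def by (intro set_integral_mono set_integrable_bounded_open open_cyl SJ.bounded_cyl continuous_intros cDU)
        (simp add: norm_sq_bar[of _ i])
    have "(LINT x:?Z|lborel. (U x)\<^sup>2) \<le> 3 * (l i - \<epsilon> * l0) * E + (3/4) * (l i - \<epsilon> * l0)\<^sup>2 * (LINT x:?Z|lborel. (DU x $ i)\<^sup>2)"
      unfolding E_def cyl_eq_cylinder by (rule cylinder_friedrichs[OF U ab])
    also have "\<dots> \<le> 3 * (l i)\<^sup>2 * E + (3/4) * (l i)\<^sup>2 * G"
    proof (intro add_mono mult_mono)
      \<comment> \<open>Length at least 1 makes the length at most its square, so both terms of
        Friedrichs' inequality carry the factor l^2.\<close>
      have "l i * 1 \<le> l i * l i" using l[of i] by (intro mult_left_mono) auto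
      then show "l i - \<epsilon> * l0 \<le> (l i)\<^sup>2" using el by (simp add: power2_eq_square)
      show "(l i - \<epsilon> * l0)\<^sup>2 \<le> (l i)\<^sup>2" using el ab by (intro power_mono) auto
      show "0 \<le> (LINT x:?Z|lborel. (DU x $ i)\<^sup>2)" by (rule LINT_nonneg) simp
    qed (use E0 Gi ab in auto)
    finally have "(1 / (l i)\<^sup>2) * (LINT x:?Z|lborel. (U x)\<^sup>2) \<le> (1 / (l i)\<^sup>2) * (3 * (l i)\<^sup>2 * E + (3/4) * (l i)\<^sup>2 * G)"
      by (intro mult_left_mono) auto
    also have "\<dots> = 3 * E + (3/4) * G" using l[of i] by (simp add: field_simps)
    finally have 1: "(1 / (l i)\<^sup>2) * (LINT x:?Z|lborel. (U x)\<^sup>2) \<le> 3 * E + (3/4) * G" .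
    have "(LINT x:?Z|lborel. P x) = (LINT x:?Z|lborel. (1 / (l i)\<^sup>2) * (U x)\<^sup>2) + G"
      unfolding P_def G_def
      by (intro set_integral_add set_integrable_bounded_open open_cyl SJ.bounded_cyl continuous_intros cDU cU)
    also have "(LINT x:?Z|lborel. (1 / (l i)\<^sup>2) * (U x)\<^sup>2) = (1 / (l i)\<^sup>2) * (LINT x:?Z|lborel. (U x)\<^sup>2)"
      by (rule set_integral_mult_right)
    finally show ?thesis using 1 by simp
  qed
  have ek: "0 \<le> \<epsilon> * \<kappa>0 i" using e \<kappa>_pos(2)[of i] by simp
  have "(LINT x:?Z|lborel. 2 * U x * (V_cyl w vt \<epsilon> i x \<bullet> DU x))
    = (LINT x:?Z|lborel. w i (x $ i) * (2 * U x * DU x $ i)) + (LINT x:?Z|lborel. 2 * \<epsilon> * (U x * (vperp i (q x) \<bullet> bar i (DU x))))"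
    unfolding Vdec by (rule set_integral_add(2)[OF conv(1) iT])
  also have "\<dots> \<le> (M * E - \<v> i * F) + (\<epsilon> * \<kappa>0 i) * (3 * E + (7/4) * G)"
    using conv(2) T mult_left_mono[OF PG ek] unfolding E_def F_def by linarith
  also have "\<dots> = (7/4) * (\<epsilon> * \<kappa>0 i) * G + (M + 3 * (\<epsilon> * \<kappa>0 i)) * E - \<v> i * F"
    by (simp add: algebra_simps)
  finally show "(LINT x:?Z|lborel. 2 * U x * (V_cyl w vt \<epsilon> i x \<bullet> DU x))
    \<le> (7/4) * (\<epsilon> * \<kappa>0 i) * (LINT x:?Z|lborel. (norm (DU x))\<^sup>2)
      + (M + 3 * (\<epsilon> * \<kappa>0 i)) * (LINT z:ball 0 (\<epsilon> * h i)|lborel. (U (insert_coord i (l i) z))\<^sup>2)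
      - \<v> i * (LINT z:ball 0 (\<epsilon> * h i)|lborel. (U (insert_coord i (\<epsilon> * l0) z))\<^sup>2)"
    unfolding G_def E_def F_def .
qed

end

section \<open>Surface integrals\<close>

lemma pushforward_integral:
  fixes g :: "'a::euclidean_space \<Rightarrow> 'b::euclidean_space" and f :: "'b \<Rightarrow> real"
  assumes S: "S \<in> sets borel" and g: "continuous_on UNIV g" "g ` S \<subseteq> L" and f: "f \<in> borel_measurable borel"
  shows "(\<integral>x. f x \<partial>distr (restrict_space lborel S) (restrict_space borel L) g) = (LINT x:S|lborel. f (g x))"
    and "integrable (distr (restrict_space lborel S) (restrict_space borel L) g) f \<longleftrightarrow> set_integrable lborel S (\<lambda>x. f (g x))"
proof -
  have gm: "g \<in> restrict_space lborel S \<rightarrow>\<^sub>M restrict_space borel L"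
    using g by (intro measurable_restrict_space2 measurable_restrict_space1)
      (auto simp: space_restrict_space borel_measurable_continuous_onI)
  have fm: "f \<in> borel_measurable (restrict_space borel L)" using f by (rule measurable_restrict_space1)
  have S': "S \<inter> space lborel \<in> sets lborel" using S by simp
  show "(\<integral>x. f x \<partial>distr (restrict_space lborel S) (restrict_space borel L) g) = (LINT x:S|lborel. f (g x))"
    unfolding integral_distr[OF gm fm] integral_restrict_space[OF S'] set_lebesgue_integral_def ..
  show "integrable (distr (restrict_space lborel S) (restrict_space borel L) g) f \<longleftrightarrow> set_integrable lborel S (\<lambda>x. f (g x))"
    unfolding integrable_distr_eq[OF gm fm] integrable_restrict_space[OF S'] set_integrable_def ..
qed

lemma scale_measure_eq_density: "scale_measure r M = density M (\<lambda>_. r)"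
  by (rule measure_eqI) (simp_all add: emeasure_density_const)

context scaled_junction
begin

text \<open>The squared norm on an outer end, written over the cross-section, the form that slicing
  produces; \<open>end_sq_eq\<close> relates it to the measure occurring in traces.\<close>

definition end_sq :: "3 \<Rightarrow> (real^3 \<Rightarrow> real) \<Rightarrow> real" where
  "end_sq i u = (LINT z:ball 0 (\<epsilon> * h i)|lborel. (u (insert_coord i (l i) z))\<^sup>2)"

lemma end_sq_nonneg: "0 \<le> end_sq i u"
  unfolding end_sq_def by (rule LINT_nonneg) simp

lemma disc_integral:
  fixes f :: "real^3 \<Rightarrow> real"
  assumes "continuous_on UNIV f"
  shows "(\<integral>x. f x \<partial>disc_measure h \<epsilon> i y) = (LINT z:ball 0 (\<epsilon> * h i)|lborel. f (insert_coord i y z))"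
  unfolding disc_measure_def
  by (intro pushforward_integral continuous_intros borel_measurable_continuous_onI assms) (auto simp: disc_def)

lemma end_sq_eq: "continuous_on UNIV u \<Longrightarrow> end_sq i u = (L2_norm_on (disc_measure h \<epsilon> i (l i)) u)\<^sup>2"
  using disc_integral[of "\<lambda>x. (u x)\<^sup>2" i "l i"]
  by (simp add: end_sq_def L2_norm_on_def LINT_nonneg continuous_on_power)

abbreviation "side_param i p \<equiv> insert_coord i (fst p) ((\<epsilon> * h i) *\<^sub>R vector [cos (snd p), sin (snd p)])"
abbreviation "side_dom i \<equiv> {\<epsilon> * l0<..<l i} \<times> {0..<2 * pi}"

lemma norm_circle: "norm (r *\<^sub>R vector [cos t, sin t] :: real^2) = \<bar>r\<bar>"
proof -
  have "norm (vector [cos t, sin t] :: real^2) = 1"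
    by (simp add: norm_eq_sqrt_inner inner_vec_def sum_2 power2_eq_square[symmetric])
  then show ?thesis by simp
qed

lemma continuous_side_param: "continuous_on UNIV (side_param i)"
  by (intro continuous_intros)

lemma side_param_lateral: "side_param i ` side_dom i \<subseteq> lateral l0 l h \<epsilon> i"
proof (intro image_subsetI)
  fix p assume p: "p \<in> side_dom i"
  have n: "norm (bar i (side_param i p)) = \<epsilon> * h i" using \<epsilon>h[of i] by (simp add: norm_circle del: norm_scaleR)
  have "side_param i p \<in> closure (cyl l0 l h \<epsilon> i)"
    by (rule closure_cyl_superset[OF \<epsilon>h]) (use p n in auto)
  moreover have "side_param i p \<notin> cyl l0 l h \<epsilon> i" using n by (simp add: cyl_def)
  ultimately show "side_param i p \<in> lateral l0 l h \<epsilon> i"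
    using p by (auto simp: lateral_def frontier_def interior_open[OF open_cyl])
qed

lemma lateral_measure_eq:
  "lateral_measure l0 l h \<epsilon> i = density (distr (restrict_space lborel (side_dom i))
     (restrict_space borel (lateral l0 l h \<epsilon> i)) (side_param i)) (\<lambda>_. ennreal (\<epsilon> * h i))"
  by (simp add: lateral_measure_def scale_measure_eq_density split_def)

lemma lateral_integral:
  assumes f: "continuous_on UNIV f"
  shows "(\<integral>x. f x \<partial>lateral_measure l0 l h \<epsilon> i) = (\<epsilon> * h i) * (LINT p:side_dom i|lborel. f (side_param i p))"
    and "integrable (lateral_measure l0 l h \<epsilon> i) f \<longleftrightarrow> set_integrable lborel (side_dom i) (\<lambda>p. f (side_param i p))"
    and "f \<in> borel_measurable (lateral_measure l0 l h \<epsilon> i)"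
proof -
  have S: "side_dom i \<in> sets borel" by (intro borel_Times) auto
  have fb: "f \<in> borel_measurable borel" using f by (rule borel_measurable_continuous_onI)
  let ?D = "distr (restrict_space lborel (side_dom i)) (restrict_space borel (lateral l0 l h \<epsilon> i)) (side_param i)"
  have fm: "f \<in> borel_measurable ?D" using measurable_restrict_space1[OF fb] by simp
  note P = pushforward_integral[OF S continuous_side_param side_param_lateral fb]
  have e: "0 \<le> \<epsilon> * h i" "\<epsilon> * h i \<noteq> 0" using \<epsilon>h[of i] by auto
  show "(\<integral>x. f x \<partial>lateral_measure l0 l h \<epsilon> i) = (\<epsilon> * h i) * (LINT p:side_dom i|lborel. f (side_param i p))"
    unfolding lateral_measure_eq P(1)[symmetric] using integral_density[OF fm, of "\<lambda>_. \<epsilon> * h i"] e by simp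
  show "integrable (lateral_measure l0 l h \<epsilon> i) f \<longleftrightarrow> set_integrable lborel (side_dom i) (\<lambda>p. f (side_param i p))"
    unfolding lateral_measure_eq P(2)[symmetric] using integrable_density[OF fm, of "\<lambda>_. \<epsilon> * h i"] e by simp
  show "f \<in> borel_measurable (lateral_measure l0 l h \<epsilon> i)" unfolding lateral_measure_eq using fm by simp
qed

lemma finite_lateral_measure: "finite_measure (lateral_measure l0 l h \<epsilon> i)"
proof -
  have S: "side_dom i \<in> sets borel" by (intro borel_Times) auto
  have "bounded (side_dom i)" by (intro bounded_Times) (auto intro: bounded_subset[OF bounded_closed_interval])
  then have "set_integrable lborel (side_dom i) (\<lambda>_. 1::real)"
    unfolding set_integrable_def using S emeasure_bounded_finite[of "side_dom i"]
    by (auto intro!: integrable_real_indicator simp del: lborel_prod)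
  then have "integrable (lateral_measure l0 l h \<epsilon> i) (\<lambda>_. 1::real)"
    using lateral_integral(2)[of "\<lambda>_. 1"] by simp
  then show ?thesis by (intro finite_measureI) (simp add: integrable_iff_bounded)
qed

lemma piece_le:
  fixes f :: "real^3 \<Rightarrow> real"
  assumes f: "continuous_on UNIV f" "\<And>x. 0 \<le> f x"
  shows "(LINT x:node \<Xi> \<epsilon>|lborel. f x) \<le> (\<integral>x. f x \<partial>lebesgue_on J)"
    and "(LINT x:cyl l0 l h \<epsilon> i|lborel. f x) \<le> (\<integral>x. f x \<partial>lebesgue_on J)"
proof -
  have n: "0 \<le> (LINT x:A|lborel. f x)" for A by (intro LINT_nonneg f)
  show "(LINT x:node \<Xi> \<epsilon>|lborel. f x) \<le> (\<integral>x. f x \<partial>lebesgue_on J)"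
    unfolding integral_J_continuous(3)[OF f(1)] using sum_nonneg[of UNIV "\<lambda>i. LINT x:cyl l0 l h \<epsilon> i|lborel. f x"] n by simp
  show "(LINT x:cyl l0 l h \<epsilon> i|lborel. f x) \<le> (\<integral>x. f x \<partial>lebesgue_on J)"
    unfolding integral_J_continuous(3)[OF f(1)]
    by (intro add_increasing[OF n] member_le_sum n) auto
qed

context
  fixes U :: "real^3 \<Rightarrow> real" and DU :: "real^3 \<Rightarrow> real^3"
  assumes U: "C1_on UNIV U DU"
begin

lemma continuous_sq: "continuous_on UNIV (\<lambda>x. (U x)\<^sup>2)" "continuous_on UNIV (\<lambda>x. (norm (DU x))\<^sup>2)"
  "continuous_on UNIV (\<lambda>x. (DU x $ i)\<^sup>2)"
  using C1_on_continuous[OF U] C1_onD(2)[OF U] by (intro continuous_intros; simp)+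

lemma partial_le: "(LINT x:cyl l0 l h \<epsilon> i|lborel. (DU x $ j)\<^sup>2) \<le> (\<integral>x. (norm (DU x))\<^sup>2 \<partial>lebesgue_on J)"
proof -
  have "(LINT x:cyl l0 l h \<epsilon> i|lborel. (DU x $ j)\<^sup>2) \<le> (LINT x:cyl l0 l h \<epsilon> i|lborel. (norm (DU x))\<^sup>2)"
    by (intro set_integral_mono set_integrable_bounded_open continuous_sq open_cyl bounded_cyl)
      (metis component_le_norm_cart power2_abs power_mono abs_ge_zero)
  also have "\<dots> \<le> (\<integral>x. (norm (DU x))\<^sup>2 \<partial>lebesgue_on J)" by (intro piece_le continuous_sq) simp
  finally show ?thesis .
qed

text \<open>End values are continuous in the Sobolev norm; this transfers their decay from one
  approximating sequence to another. Here the constant may depend on \<epsilon>.\<close>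

lemma end_sq_le:
  "end_sq i U \<le> (2 / (l i - \<epsilon> * l0) + 2 * (l i - \<epsilon> * l0)) * ((\<integral>x. (U x)\<^sup>2 \<partial>lebesgue_on J) + (\<integral>x. (norm (DU x))\<^sup>2 \<partial>lebesgue_on J))"
proof -
  let ?d = "l i - \<epsilon> * l0"
  have d: "0 < ?d" using \<epsilon>l0[of i] by simp
  have "end_sq i U \<le> 2 / ?d * (LINT x:cyl l0 l h \<epsilon> i|lborel. (U x)\<^sup>2) + 2 * ?d * (LINT x:cyl l0 l h \<epsilon> i|lborel. (DU x $ i)\<^sup>2)"
    unfolding end_sq_def cyl_eq_cylinder by (rule cylinder_trace_right[OF U]) (use d in simp)
  also have "\<dots> \<le> 2 / ?d * (\<integral>x. (U x)\<^sup>2 \<partial>lebesgue_on J) + 2 * ?d * (\<integral>x. (norm (DU x))\<^sup>2 \<partial>lebesgue_on J)"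
    using d by (intro add_mono mult_left_mono partial_le piece_le continuous_sq) auto
  also have "\<dots> \<le> (2 / ?d + 2 * ?d) * (\<integral>x. (U x)\<^sup>2 \<partial>lebesgue_on J) + (2 / ?d + 2 * ?d) * (\<integral>x. (norm (DU x))\<^sup>2 \<partial>lebesgue_on J)"
    using d by (intro add_mono mult_right_mono) auto
  finally show ?thesis by (simp only: distrib_left)
qed

text \<open>For radius R = \<epsilon> h the trace inequality has the constants 3/R and R; taking out
  1/\<epsilon> leaves 3/h and \<epsilon>^2 h. The rate 1/\<epsilon> is what turns the factor
  \<epsilon> of the boundary integral into its square root in the final estimate.\<close>

lemma lateral_le:
  "integrable (lateral_measure l0 l h \<epsilon> i) (\<lambda>x. (U x)\<^sup>2)"
  "(\<integral>x. (U x)\<^sup>2 \<partial>lateral_measure l0 l h \<epsilon> i) \<le> (1 / \<epsilon>) * ((3 / h i + \<epsilon>0\<^sup>2 * h i) *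
     ((\<integral>x. (U x)\<^sup>2 \<partial>lebesgue_on J) + (\<integral>x. (norm (DU x))\<^sup>2 \<partial>lebesgue_on J)))"
proof -
  let ?R = "\<epsilon> * h i"
  let ?u = "\<integral>x. (U x)\<^sup>2 \<partial>lebesgue_on J" and ?g = "\<integral>x. (norm (DU x))\<^sup>2 \<partial>lebesgue_on J"
  note T = lateral_trace[OF U \<epsilon>h[of i]]
  show "integrable (lateral_measure l0 l h \<epsilon> i) (\<lambda>x. (U x)\<^sup>2)"
    unfolding lateral_integral(2)[OF continuous_sq(1)] by (rule T(1))
  have "(\<integral>x. (U x)\<^sup>2 \<partial>lateral_measure l0 l h \<epsilon> i) \<le> (1 / ?R) * (LINT x:cyl l0 l h \<epsilon> i|lborel. 3 * (U x)\<^sup>2 + ?R\<^sup>2 * (norm (DU x))\<^sup>2)"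
    unfolding lateral_integral(1)[OF continuous_sq(1)] cyl_eq_cylinder by (rule T(2))
  also have "\<dots> = (1 / ?R) * (3 * (LINT x:cyl l0 l h \<epsilon> i|lborel. (U x)\<^sup>2) + ?R\<^sup>2 * (LINT x:cyl l0 l h \<epsilon> i|lborel. (norm (DU x))\<^sup>2))"
    by (subst set_integral_add, (intro set_integrable_mult_right set_integrable_bounded_open continuous_sq open_cyl bounded_cyl)+, simp)
  also have "\<dots> \<le> (1 / ?R) * (3 * ?u + ?R\<^sup>2 * ?g)"
    using \<epsilon>h[of i] by (intro add_mono mult_left_mono piece_le continuous_sq) auto
  also have "\<dots> = (1 / \<epsilon>) * ((3 / h i) * ?u + \<epsilon>\<^sup>2 * h i * ?g)"
    using \<epsilon> h[of i] by (simp add: field_simps power2_eq_square)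
  also have "\<dots> \<le> (1 / \<epsilon>) * ((3 / h i + \<epsilon>0\<^sup>2 * h i) * ?u + (3 / h i + \<epsilon>0\<^sup>2 * h i) * ?g)"
  proof -
    have "\<epsilon>\<^sup>2 * h i \<le> \<epsilon>0\<^sup>2 * h i" using \<epsilon> h[of i] by (intro mult_right_mono power_mono) auto
    then have "\<epsilon>\<^sup>2 * h i \<le> 3 / h i + \<epsilon>0\<^sup>2 * h i" using h[of i] by (simp add: add_increasing)
    then show ?thesis using \<epsilon> h[of i] by (intro mult_left_mono add_mono mult_right_mono) auto
  qed
  finally show "(\<integral>x. (U x)\<^sup>2 \<partial>lateral_measure l0 l h \<epsilon> i) \<le> (1 / \<epsilon>) * ((3 / h i + \<epsilon>0\<^sup>2 * h i) * (?u + ?g))"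
    by (simp only: distrib_left)
qed

end

lemma piecewise_eq:
  "x \<in> node \<Xi> \<epsilon> \<Longrightarrow> piecewise l0 l h \<Xi> \<epsilon> f0 f x = f0 x"
  "x \<in> cyl l0 l h \<epsilon> i \<Longrightarrow> piecewise l0 l h \<Xi> \<epsilon> f0 f x = f i x"
  "x \<notin> pieces \<Longrightarrow> piecewise l0 l h \<Xi> \<epsilon> f0 f x = 0"
proof -
  show "x \<in> node \<Xi> \<epsilon> \<Longrightarrow> piecewise l0 l h \<Xi> \<epsilon> f0 f x = f0 x" by (simp add: piecewise_def)
  show "x \<notin> pieces \<Longrightarrow> piecewise l0 l h \<Xi> \<epsilon> f0 f x = 0" by (simp add: piecewise_def pieces_def)
  assume x: "x \<in> cyl l0 l h \<epsilon> i"
  have "x \<notin> node \<Xi> \<epsilon>" using disjoint_pieces(1)[of i] x by blast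
  moreover have "x \<notin> cyl l0 l h \<epsilon> j" if "j \<noteq> i" for j using disjoint_pieces(2)[OF that] x by blast
  ultimately show "piecewise l0 l h \<Xi> \<epsilon> f0 f x = f i x"
    using x exhaust_3[of i] by (auto simp: piecewise_def)
qed

end

section \<open>Estimates on the whole junction for functions of class C^1\<close>

context problem
begin

text \<open>The cylinders are controlled from their outer ends by Friedrichs' inequality. The node
  needs only one face: the values on the interface of the first cylinder are reached from the outer
  end of that cylinder. The bound \<open>L\<close> on all lengths makes the constant
  uniform.\<close>

lemma smooth_poincare:
  "\<exists>C\<ge>0. \<forall>\<epsilon>\<in>{0<..<\<epsilon>0}. \<forall>U DU. C1_on UNIV U DU \<longrightarrow>
     (\<integral>x. (U x)\<^sup>2 \<partial>lebesgue_on (junction l0 l h \<Xi> \<epsilon>)) \<le>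
     C * ((\<integral>x. (norm (DU x))\<^sup>2 \<partial>lebesgue_on (junction l0 l h \<Xi> \<epsilon>)) + (\<Sum>i\<in>UNIV. scaled_junction.end_sq l h \<epsilon> i U))"
proof -
  obtain C0 where C0: "C0 \<ge> 0" "\<And>\<epsilon> U DU. \<epsilon> \<in> {0<..<\<epsilon>0} \<Longrightarrow> C1_on UNIV U DU \<Longrightarrow> (LINT x:node \<Xi> \<epsilon>|lborel. (U x)\<^sup>2) \<le>
    C0 * ((LINT x:node \<Xi> \<epsilon>|lborel. (norm (DU x))\<^sup>2) + (LINT z:ball 0 (\<epsilon> * h 1)|lborel. (U (insert_coord 1 (\<epsilon> * l0) z))\<^sup>2))"
    using node_poincare by blast
  define L where "L = (\<Sum>i\<in>UNIV. l i)"
  have lL: "l i \<le> L" for i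
    unfolding L_def using l by (intro member_le_sum) (auto intro: order_trans[OF zero_le_one])
  have L: "1 \<le> L" using l[of 1] lL[of 1] by simp
  define C where "C = C0 * (2 + 2 * L) + 3 * L + 3 * L\<^sup>2"
  have "(\<integral>x. (U x)\<^sup>2 \<partial>lebesgue_on (junction l0 l h \<Xi> \<epsilon>)) \<le>
     C * ((\<integral>x. (norm (DU x))\<^sup>2 \<partial>lebesgue_on (junction l0 l h \<Xi> \<epsilon>)) + (\<Sum>i\<in>UNIV. scaled_junction.end_sq l h \<epsilon> i U))"
    if \<epsilon>: "\<epsilon> \<in> {0<..<\<epsilon>0}" and U: "C1_on UNIV U DU" for \<epsilon> U DU
  proof -
    interpret SJ: scaled_junction \<epsilon>0 l0 l h \<Xi> \<epsilon> by (rule scaled[OF \<epsilon>])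
    let ?g = "\<integral>x. (norm (DU x))\<^sup>2 \<partial>lebesgue_on SJ.J" and ?S = "\<Sum>i\<in>UNIV. SJ.end_sq i U"
    have g: "0 \<le> ?g" by simp
    have S: "0 \<le> ?S" by (intro sum_nonneg SJ.end_sq_nonneg)
    have eS: "SJ.end_sq i U \<le> ?S" for i by (intro member_le_sum) (auto intro: SJ.end_sq_nonneg)
    have d: "0 < l i - \<epsilon> * l0" "l i - \<epsilon> * l0 \<le> L" for i
    proof -
      show "0 < l i - \<epsilon> * l0" using SJ.\<epsilon>l0[of i] by simp
      have "0 < \<epsilon> * l0" using \<epsilon> l0 by simp
      then show "l i - \<epsilon> * l0 \<le> L" using lL[of i] by simp
    qed
    have pl: "(LINT x:cyl l0 l h \<epsilon> i|lborel. (DU x $ i)\<^sup>2) \<le> ?g" for i by (rule SJ.partial_le[OF U])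
    have "(LINT z:ball 0 (\<epsilon> * h 1)|lborel. (U (insert_coord 1 (\<epsilon> * l0) z))\<^sup>2) \<le> 2 * SJ.end_sq 1 U
      + 2 * (l 1 - \<epsilon> * l0) * (LINT x:cyl l0 l h \<epsilon> 1|lborel. (DU x $ 1)\<^sup>2)"
      unfolding SJ.end_sq_def cyl_eq_cylinder by (rule cylinder_trace_left[OF U]) (use d[of 1] in simp)
    also have "\<dots> \<le> 2 * ?S + 2 * L * ?g"
      using d[of 1] L g SJ.end_sq_nonneg[of 1 U] by (intro add_mono mult_mono eS pl LINT_nonneg) auto
    finally have face: "(LINT z:ball 0 (\<epsilon> * h 1)|lborel. (U (insert_coord 1 (\<epsilon> * l0) z))\<^sup>2) \<le> 2 * ?S + 2 * L * ?g" .
    have "(LINT x:node \<Xi> \<epsilon>|lborel. (U x)\<^sup>2) \<le> C0 * (?g + (2 * ?S + 2 * L * ?g))"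
      by (rule order_trans[OF C0(2)[OF \<epsilon> U]])
        (intro mult_left_mono add_mono face SJ.piece_le SJ.continuous_sq[OF U] C0(1), simp)
    also have "\<dots> = C0 * (1 + 2 * L) * ?g + C0 * 2 * ?S" by (simp add: algebra_simps)
    also have "\<dots> \<le> C0 * (2 + 2 * L) * ?g + C0 * (2 + 2 * L) * ?S"
      using C0(1) L g S by (intro add_mono mult_right_mono mult_left_mono) auto
    finally have node: "(LINT x:node \<Xi> \<epsilon>|lborel. (U x)\<^sup>2) \<le> C0 * (2 + 2 * L) * ?g + C0 * (2 + 2 * L) * ?S" .
    have cyl: "(LINT x:cyl l0 l h \<epsilon> i|lborel. (U x)\<^sup>2) \<le> 3 * L * SJ.end_sq i U + L\<^sup>2 * ?g" for i
    proof -
      have "(LINT x:cyl l0 l h \<epsilon> i|lborel. (U x)\<^sup>2) \<le> 3 * (l i - \<epsilon> * l0) * SJ.end_sq i U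
        + (3/4) * (l i - \<epsilon> * l0)\<^sup>2 * (LINT x:cyl l0 l h \<epsilon> i|lborel. (DU x $ i)\<^sup>2)"
        unfolding SJ.end_sq_def cyl_eq_cylinder by (rule cylinder_friedrichs[OF U]) (use d[of i] in simp)
      also have "\<dots> \<le> 3 * L * SJ.end_sq i U + (3/4) * L\<^sup>2 * ?g"
        using d[of i] order_trans[OF zero_le_one L] g SJ.end_sq_nonneg[of i U]
        by (intro add_mono mult_mono pl LINT_nonneg power_mono) auto
      also have "\<dots> \<le> 3 * L * SJ.end_sq i U + 1 * L\<^sup>2 * ?g" using g by (intro add_left_mono mult_right_mono) auto
      finally show ?thesis by simp
    qed
    have "(\<integral>x. (U x)\<^sup>2 \<partial>lebesgue_on SJ.J) \<le> (C0 * (2 + 2 * L) * ?g + C0 * (2 + 2 * L) * ?S) + (\<Sum>i\<in>UNIV. 3 * L * SJ.end_sq i U + L\<^sup>2 * ?g)"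
      unfolding SJ.integral_J_continuous(3)[OF SJ.continuous_sq(1)[OF U]]
      by (intro add_mono sum_mono node cyl)
    also have "\<dots> = (C0 * (2 + 2 * L) + 3 * L\<^sup>2) * ?g + (C0 * (2 + 2 * L) + 3 * L) * ?S"
      by (simp add: sum.distrib sum_distrib_left[symmetric] algebra_simps)
    also have "\<dots> \<le> C * ?g + C * ?S"
      using L g S self_le_power[of L 2] unfolding C_def by (intro add_mono mult_right_mono) auto
    finally show ?thesis by (simp only: distrib_left)
  qed
  moreover have "0 \<le> C" unfolding C_def using C0(1) L by (intro add_nonneg_nonneg mult_nonneg_nonneg) auto
  ultimately show ?thesis by blast
qed

abbreviation "V \<epsilon> \<equiv> piecewise l0 l h \<Xi> \<epsilon> (V_node v0 \<epsilon>) (V_cyl w vt \<epsilon>)"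

text \<open>In the sum over node and cylinders the interface fluxes cancel, and halving turns 7/4
  into 7/8. The coefficients \<open>K\<close> may depend on \<epsilon>, since they multiply end
  terms that vanish in the limit.\<close>

lemma smooth_convection:
  assumes \<epsilon>: "\<epsilon> \<in> {0<..<\<epsilon>0}"
  shows "\<exists>K. \<forall>U DU. C1_on UNIV U DU \<longrightarrow>
     (\<integral>x. U x * (V \<epsilon> x \<bullet> DU x) \<partial>lebesgue_on (junction l0 l h \<Xi> \<epsilon>)) \<le>
     (\<Sum>i\<in>UNIV. (7/8) * (\<epsilon> * \<kappa>0 i) * (\<integral>x. indicator (cyl l0 l h \<epsilon> i) x * (norm (DU x))\<^sup>2 \<partial>lebesgue_on (junction l0 l h \<Xi> \<epsilon>)))
     + (\<Sum>i\<in>UNIV. K i * scaled_junction.end_sq l h \<epsilon> i U)"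
proof -
  interpret SJ: scaled_junction \<epsilon>0 l0 l h \<Xi> \<epsilon> by (rule scaled[OF \<epsilon>])
  obtain M where M: "0 \<le> M" "\<And>i t. t \<in> {0<..<l i} \<Longrightarrow> \<bar>w i t\<bar> \<le> M" using w_props(1) by blast
  have "(\<integral>x. U x * (V \<epsilon> x \<bullet> DU x) \<partial>lebesgue_on SJ.J) \<le>
     (\<Sum>i\<in>UNIV. (7/8) * (\<epsilon> * \<kappa>0 i) * (\<integral>x. indicator (cyl l0 l h \<epsilon> i) x * (norm (DU x))\<^sup>2 \<partial>lebesgue_on SJ.J))
     + (\<Sum>i\<in>UNIV. (M + 3 * (\<epsilon> * \<kappa>0 i)) / 2 * SJ.end_sq i U)" (is "?l \<le> ?r")
    if U: "C1_on UNIV U DU" for U DU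
  proof -
    note N = node_convection[OF \<epsilon> U] and Z = cyl_convection[OF \<epsilon> U M]
    let ?f = "\<lambda>x. 2 * U x * (V \<epsilon> x \<bullet> DU x)"
    have n0: "set_integrable lborel (node \<Xi> \<epsilon>) ?f"
      using N(2) by (rule set_integrable_cong[THEN iffD1, rotated -1]) (auto simp: SJ.piecewise_eq)
    have z0: "set_integrable lborel (cyl l0 l h \<epsilon> i) ?f" for i
      using Z(1)[of i] by (rule set_integrable_cong[THEN iffD1, rotated -1]) (auto simp: SJ.piecewise_eq)
    have n1: "(LINT x:node \<Xi> \<epsilon>|lborel. ?f x) = (LINT x:node \<Xi> \<epsilon>|lborel. 2 * U x * (V_node v0 \<epsilon> x \<bullet> DU x))"
      by (intro set_lebesgue_integral_cong) (auto simp: SJ.piecewise_eq SJ.open_node)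
    have z1: "(LINT x:cyl l0 l h \<epsilon> i|lborel. ?f x) = (LINT x:cyl l0 l h \<epsilon> i|lborel. 2 * U x * (V_cyl w vt \<epsilon> i x \<bullet> DU x))" for i
      by (intro set_lebesgue_integral_cong) (auto simp: SJ.piecewise_eq open_cyl)
    have G: "(\<integral>x. indicator (cyl l0 l h \<epsilon> i) x * (norm (DU x))\<^sup>2 \<partial>lebesgue_on SJ.J) = (LINT x:cyl l0 l h \<epsilon> i|lborel. (norm (DU x))\<^sup>2)" for i
      by (rule SJ.integral_J_continuous(4)[OF SJ.continuous_sq(2)[OF U], where i = i]) simp
    have "2 * ?l = (\<integral>x. ?f x \<partial>lebesgue_on SJ.J)" by (simp add: mult.assoc)
    also have "\<dots> = (LINT x:node \<Xi> \<epsilon>|lborel. ?f x) + (\<Sum>i\<in>UNIV. LINT x:cyl l0 l h \<epsilon> i|lborel. ?f x)"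
      by (rule SJ.integral_J_pieces(2)[OF n0 z0])
    also have "\<dots> \<le> (\<Sum>i\<in>UNIV. \<v> i * (LINT z:ball 0 (\<epsilon> * h i)|lborel. (U (insert_coord i (\<epsilon> * l0) z))\<^sup>2))
      + (\<Sum>i\<in>UNIV. (7/4) * (\<epsilon> * \<kappa>0 i) * (LINT x:cyl l0 l h \<epsilon> i|lborel. (norm (DU x))\<^sup>2)
      + (M + 3 * (\<epsilon> * \<kappa>0 i)) * SJ.end_sq i U
      - \<v> i * (LINT z:ball 0 (\<epsilon> * h i)|lborel. (U (insert_coord i (\<epsilon> * l0) z))\<^sup>2))"
      unfolding n1 z1 N(1) SJ.end_sq_def by (intro add_left_mono sum_mono Z(2))
    also have "\<dots> = 2 * ?r"
      unfolding G by (simp add: sum.distrib sum_subtractf sum_distrib_left mult.assoc)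
    finally show ?thesis by simp
  qed
  then show ?thesis by (intro exI[of _ "\<lambda>i. (M + 3 * (\<epsilon> * \<kappa>0 i)) / 2"]) blast
qed

end

section \<open>Passage to Sobolev functions\<close>

lemma norm_sq_sum: "(norm x)\<^sup>2 = (\<Sum>j\<in>UNIV. x $ j * x $ j)" for x :: "real^'n"
  unfolding power2_norm_eq_inner by (simp add: inner_vec_def)

text \<open>The parallelogram identity with the square of the sum dropped.\<close>

lemma norm_diff_sq_le: "(norm (a - b))\<^sup>2 \<le> 2 * (norm a)\<^sup>2 + 2 * (norm b)\<^sup>2" for a b :: "'a::real_inner"
proof -
  have "(norm (a - b))\<^sup>2 + (norm (a + b))\<^sup>2 = 2 * (norm a)\<^sup>2 + 2 * (norm b)\<^sup>2"
    by (simp add: power2_norm_eq_inner inner_simps inner_commute)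
  then show ?thesis using zero_le_power2[of "norm (a + b)"] by linarith
qed

lemma square_diff_le: "(a - b)\<^sup>2 \<le> 2 * a\<^sup>2 + 2 * b\<^sup>2" for a b :: real
  using norm_diff_sq_le[of a b] by simp

lemma L2_norm_on_sq: "(L2_norm_on M f)\<^sup>2 = (\<integral>x. (norm (f x))\<^sup>2 \<partial>M)"
  by (simp add: L2_norm_on_def)

lemma H1_norm_sq: "(H1_norm \<Omega> u Du)\<^sup>2 = (\<integral>x. (u x)\<^sup>2 \<partial>lebesgue_on \<Omega>) + (\<integral>x. (norm (Du x))\<^sup>2 \<partial>lebesgue_on \<Omega>)"
  by (simp add: H1_norm_def L2_norm_on_sq)

lemma H1_norm_nonneg: "0 \<le> H1_norm \<Omega> u Du"
  by (simp add: H1_norm_def)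

lemma L2_nth:
  fixes f :: "'a \<Rightarrow> real^'n"
  assumes f: "L2 M f"
  shows "L2 M (\<lambda>x. f x $ j)"
proof -
  have m: "(\<lambda>x. f x $ j) \<in> borel_measurable M"
    using f by (intro borel_measurable_continuous_on[of "\<lambda>y. y $ j" f]) (auto simp: L2_def intro!: continuous_intros)
  have "integrable M (\<lambda>x. (f x $ j)\<^sup>2)"
  proof (rule Bochner_Integration.integrable_bound)
    show "integrable M (\<lambda>x. (norm (f x))\<^sup>2)" using f by (simp add: L2_def)
    show "(\<lambda>x. (f x $ j)\<^sup>2) \<in> borel_measurable M" using m by simp
    have "(f x $ j)\<^sup>2 \<le> (norm (f x))\<^sup>2" for x
      using component_le_norm_cart[of "f x" j] by (metis power2_abs power_mono abs_ge_zero)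
    then show "AE x in M. norm ((f x $ j)\<^sup>2) \<le> norm ((norm (f x))\<^sup>2)" by simp
  qed
  then show ?thesis using m by (simp add: L2_real)
qed

lemma L2conv_iff:
  "L2conv M f F \<longleftrightarrow> (\<forall>n. L2 M (f n)) \<and> L2 M F \<and> (\<lambda>n. \<integral>x. (f n x - F x)\<^sup>2 \<partial>M) \<longlonglongrightarrow> 0"
proof -
  have "(\<lambda>n. \<integral>x. (f n x - F x)\<^sup>2 \<partial>M) = (\<lambda>n. (L2_norm_on M (\<lambda>x. f n x - F x))\<^sup>2)"
    by (simp add: L2_norm_on_sq)
  then show ?thesis unfolding L2conv_def by (simp only: power_tendsto_0_iff pos2)
qed

lemma L2conv_const: "L2 M f \<Longrightarrow> L2conv M (\<lambda>_. f) f"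
  by (simp add: L2conv_iff)

lemma L2conv_diff:
  assumes "L2conv M f F" "L2conv M g G"
  shows "L2conv M (\<lambda>n x. f n x - g n x) (\<lambda>x. F x - G x)"
proof -
  have L: "L2 M (f n)" "L2 M F" "L2 M (g n)" "L2 M G" for n using assms by (auto simp: L2conv_def)
  have i: "integrable M (\<lambda>x. (p x - q x)\<^sup>2)" if "L2 M p" "L2 M q" for p q :: "_ \<Rightarrow> real"
    using L2_diff[OF that] by (simp add: L2_real)
  have "(\<lambda>n. \<integral>x. (f n x - g n x - (F x - G x))\<^sup>2 \<partial>M) \<longlonglongrightarrow> 0"
  proof (rule tendsto_sandwich[OF _ _ tendsto_const])
    show "\<forall>\<^sub>F n in sequentially. 0 \<le> (\<integral>x. (f n x - g n x - (F x - G x))\<^sup>2 \<partial>M)" by simp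
    have "(\<integral>x. (f n x - g n x - (F x - G x))\<^sup>2 \<partial>M) \<le> (\<integral>x. 2 * (f n x - F x)\<^sup>2 + 2 * (g n x - G x)\<^sup>2 \<partial>M)" for n
    proof (rule integral_mono)
      show "integrable M (\<lambda>x. (f n x - g n x - (F x - G x))\<^sup>2)" by (intro i L2_diff L)
      show "integrable M (\<lambda>x. 2 * (f n x - F x)\<^sup>2 + 2 * (g n x - G x)\<^sup>2)" using i L by simp
      show "(f n x - g n x - (F x - G x))\<^sup>2 \<le> 2 * (f n x - F x)\<^sup>2 + 2 * (g n x - G x)\<^sup>2" for x
        using square_diff_le[of "f n x - F x" "g n x - G x"] by (simp add: algebra_simps)
    qed
    also have "(\<integral>x. 2 * (f n x - F x)\<^sup>2 + 2 * (g n x - G x)\<^sup>2 \<partial>M) = 2 * (\<integral>x. (f n x - F x)\<^sup>2 \<partial>M) + 2 * (\<integral>x. (g n x - G x)\<^sup>2 \<partial>M)" for n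
      using i L by simp
    finally show "\<forall>\<^sub>F n in sequentially. (\<integral>x. (f n x - g n x - (F x - G x))\<^sup>2 \<partial>M)
      \<le> 2 * (\<integral>x. (f n x - F x)\<^sup>2 \<partial>M) + 2 * (\<integral>x. (g n x - G x)\<^sup>2 \<partial>M)" by simp
    show "(\<lambda>n. 2 * (\<integral>x. (f n x - F x)\<^sup>2 \<partial>M) + 2 * (\<integral>x. (g n x - G x)\<^sup>2 \<partial>M)) \<longlonglongrightarrow> 0"
      using assms by (auto simp: L2conv_iff intro!: tendsto_eq_intros)
  qed
  then show ?thesis using L by (simp add: L2conv_iff L2_diff)
qed

lemma smooth_bounded_on_compose:
  assumes f: "smooth_bounded_on S f" and g: "continuous_on A g" "g ` A \<subseteq> S"
  shows "continuous_on A (\<lambda>x. f (g x))" "bounded ((\<lambda>x. f (g x)) ` A)"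
proof -
  have "continuous_on S f" using f C_on.simps(1)[of S f] by (simp add: smooth_bounded_on_def smooth_on_def del: C_on.simps)
  then show "continuous_on A (\<lambda>x. f (g x))" by (rule continuous_on_compose2[OF _ g])
  have "bounded (f ` S)" using f by (simp add: smooth_bounded_on_def)
  then show "bounded ((\<lambda>x. f (g x)) ` A)" by (rule bounded_subset) (use g(2) in auto)
qed

context scaled_junction
begin

abbreviation "M \<equiv> lebesgue_on J"

lemma piecewise_bounded_measurable:
  fixes f0 :: "real^3 \<Rightarrow> real"
  assumes f0: "continuous_on (node \<Xi> \<epsilon>) f0" "bounded (f0 ` node \<Xi> \<epsilon>)"
    and f: "\<And>i. continuous_on (cyl l0 l h \<epsilon> i) (f i)" "\<And>i. bounded (f i ` cyl l0 l h \<epsilon> i)"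
  shows "piecewise l0 l h \<Xi> \<epsilon> f0 f \<in> borel_measurable M" "\<exists>K. \<forall>x. \<bar>piecewise l0 l h \<Xi> \<epsilon> f0 f x\<bar> \<le> K"
proof -
  have eq: "piecewise l0 l h \<Xi> \<epsilon> f0 f x = indicator (node \<Xi> \<epsilon>) x *\<^sub>R f0 x + (\<Sum>i\<in>UNIV. indicator (cyl l0 l h \<epsilon> i) x *\<^sub>R f i x)" for x
  proof -
    have n: "x \<notin> cyl l0 l h \<epsilon> i" if "x \<in> node \<Xi> \<epsilon>" for i using that disjoint_pieces(1)[of i] by blast
    have c: "x \<notin> cyl l0 l h \<epsilon> j" if "x \<in> cyl l0 l h \<epsilon> i" "i \<noteq> j" for i j using that disjoint_pieces(2)[of i j] by blast
    show ?thesis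
      using n c[of 1 2] c[of 1 3] c[of 2 3] unfolding piecewise_def sum_3 by (auto simp: indicator_def)
  qed
  have b: "(\<lambda>x. indicator A x *\<^sub>R g x) \<in> borel_measurable borel" if "open A" "continuous_on A g" for A and g :: "real^3 \<Rightarrow> real"
    using that by (intro borel_measurable_continuous_on_indicator) auto
  have "piecewise l0 l h \<Xi> \<epsilon> f0 f \<in> borel_measurable borel"
    unfolding eq[abs_def] by (intro borel_measurable_add borel_measurable_sum b open_node open_cyl f0 f)
  then show "piecewise l0 l h \<Xi> \<epsilon> f0 f \<in> borel_measurable M"
    by (intro measurable_restrict_space1 measurable_completion) simp
  have "bounded (f0 ` node \<Xi> \<epsilon> \<union> (\<Union>i. f i ` cyl l0 l h \<epsilon> i) \<union> {0})"
    using f0 f by (intro bounded_Un[THEN iffD2] conjI bounded_UN) auto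
  then obtain K where K: "\<And>y. y \<in> f0 ` node \<Xi> \<epsilon> \<union> (\<Union>i. f i ` cyl l0 l h \<epsilon> i) \<union> {0} \<Longrightarrow> \<bar>y\<bar> \<le> K"
    unfolding bounded_iff real_norm_def by blast
  have "piecewise l0 l h \<Xi> \<epsilon> f0 f x \<in> f0 ` node \<Xi> \<epsilon> \<union> (\<Union>i. f i ` cyl l0 l h \<epsilon> i) \<union> {0}" for x
  proof (cases "x \<in> pieces")
    case True
    then consider "x \<in> node \<Xi> \<epsilon>" | i where "x \<in> cyl l0 l h \<epsilon> i" unfolding pieces_def by blast
    then show ?thesis by cases (auto simp: piecewise_eq)
  qed (simp add: piecewise_eq)
  then show "\<exists>K. \<forall>x. \<bar>piecewise l0 l h \<Xi> \<epsilon> f0 f x\<bar> \<le> K" using K by blast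
qed

lemma indicator_measurable_M:
  assumes "A = node \<Xi> \<epsilon> \<or> A = cyl l0 l h \<epsilon> i"
  shows "(indicator A :: real^3 \<Rightarrow> real) \<in> borel_measurable M"
proof -
  have "open A" using assms open_node open_cyl by auto
  then have "(indicator A :: real^3 \<Rightarrow> real) \<in> borel_measurable borel" by simp
  then show ?thesis by (intro measurable_restrict_space1 measurable_completion) simp
qed

lemma continuous_L2:
  assumes f: "continuous_on UNIV f"
  shows "L2 M (f :: _ \<Rightarrow> real)"
proof -
  have "f \<in> borel_measurable borel" using f by (rule borel_measurable_continuous_onI)
  then have "f \<in> borel_measurable M" by (intro measurable_restrict_space1 measurable_completion) simp
  then show ?thesis using integral_J_continuous(2)[OF continuous_on_power[OF f, of 2]] by (simp add: L2_real)
qed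

text \<open>Convergence of the gradients is recorded by components, so that every passage to the
  limit reduces to products of scalar functions in \<open>L2conv_mult\<close>.\<close>

definition approximates :: "(nat \<Rightarrow> real^3 \<Rightarrow> real) \<Rightarrow> (real^3 \<Rightarrow> real) \<Rightarrow> (real^3 \<Rightarrow> real^3) \<Rightarrow> bool" where
  "approximates U u Du \<longleftrightarrow> (\<forall>n. C1_on UNIV (U n) (grad (U n))) \<and> L2conv M U u \<and>
     (\<forall>j. L2conv M (\<lambda>n x. grad (U n) x $ j) (\<lambda>x. Du x $ j))"

lemma approximatesI:
  assumes u: "L2 M u" "L2 M Du" and U: "\<And>n. smooth_on UNIV (U n)"
    and lim: "(\<lambda>n. H1_norm J (\<lambda>x. U n x - u x) (\<lambda>x. grad (U n) x - Du x)) \<longlonglongrightarrow> 0"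
  shows "approximates U u Du"
    and "integrable M (\<lambda>x. (norm (grad (U n) x - Du x))\<^sup>2)"
proof -
  have C1: "C1_on UNIV (U n) (grad (U n))" for n by (rule smooth_on_C1_on[OF U])
  have Lg: "L2 M (\<lambda>x. grad (U n) x $ j)" for n j
    using C1_onD(2)[OF C1] by (intro continuous_L2 continuous_intros)
  have LU: "L2 M (U n)" for n by (intro continuous_L2 C1_on_continuous[OF C1])
  have id: "integrable M (\<lambda>x. (grad (U n) x $ j - Du x $ j)\<^sup>2)" for n j
    using L2_diff[OF Lg L2_nth[OF u(2)]] by (simp add: L2_real)
  have ig: "integrable M (\<lambda>x. (norm (grad (U n) x - Du x))\<^sup>2)" for n
    unfolding norm_sq_sum using id by (simp add: power2_eq_square)
  then show "integrable M (\<lambda>x. (norm (grad (U n) x - Du x))\<^sup>2)" .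
  let ?d = "\<lambda>n. (H1_norm J (\<lambda>x. U n x - u x) (\<lambda>x. grad (U n) x - Du x))\<^sup>2"
  have d: "?d \<longlonglongrightarrow> 0" using lim by simp
  have "(\<lambda>n. \<integral>x. (U n x - u x)\<^sup>2 \<partial>M) \<longlonglongrightarrow> 0"
    by (rule tendsto_sandwich[OF _ _ tendsto_const d]) (simp_all add: H1_norm_sq)
  then have 1: "L2conv M U u" using LU u by (simp add: L2conv_iff)
  have "(\<lambda>n. \<integral>x. (grad (U n) x $ j - Du x $ j)\<^sup>2 \<partial>M) \<longlonglongrightarrow> 0" for j
  proof (rule tendsto_sandwich[OF _ _ tendsto_const d])
    have "(\<integral>x. (grad (U n) x $ j - Du x $ j)\<^sup>2 \<partial>M) \<le> (\<integral>x. (norm (grad (U n) x - Du x))\<^sup>2 \<partial>M)" for n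
    proof (rule integral_mono[OF id ig])
      show "(grad (U n) x $ j - Du x $ j)\<^sup>2 \<le> (norm (grad (U n) x - Du x))\<^sup>2" for x
        using component_le_norm_cart[of "grad (U n) x - Du x" j]
        by (metis power2_abs power_mono abs_ge_zero vector_minus_component)
    qed
    then show "\<forall>\<^sub>F n in sequentially. (\<integral>x. (grad (U n) x $ j - Du x $ j)\<^sup>2 \<partial>M) \<le> ?d n"
      by (simp add: H1_norm_sq add_increasing)
  qed simp
  then have "L2conv M (\<lambda>n x. grad (U n) x $ j) (\<lambda>x. Du x $ j)" for j
    using Lg L2_nth[OF u(2)] by (simp add: L2conv_iff)
  then show "approximates U u Du" using 1 C1 by (simp add: approximates_def)
qed

context
  fixes U u Du
  assumes A: "approximates U u Du"
begin

lemma approx_gradient: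
  assumes b: "b \<in> borel_measurable M" "\<And>x. \<bar>b x\<bar> \<le> K"
  shows "(\<lambda>n. \<integral>x. b x * (norm (grad (U n) x))\<^sup>2 \<partial>M) \<longlonglongrightarrow> (\<integral>x. b x * (norm (Du x))\<^sup>2 \<partial>M)"
    and "integrable M (\<lambda>x. b x * (norm (Du x))\<^sup>2)"
proof -
  have c: "L2conv M (\<lambda>n x. grad (U n) x $ j) (\<lambda>x. Du x $ j)" for j using A by (simp add: approximates_def)
  have i: "integrable M (\<lambda>x. b x * (f x * g x))" if "L2 M f" "L2 M g" for f g
    by (rule L2conv_mult(2)[OF L2conv_const[OF that(1)] L2conv_const[OF that(2)] b])
  have L: "L2 M (\<lambda>x. grad (U n) x $ j)" "L2 M (\<lambda>x. Du x $ j)" for n j using c[of j] by (auto simp: L2conv_def)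
  have "(\<lambda>n. \<Sum>j\<in>UNIV. \<integral>x. b x * (grad (U n) x $ j * grad (U n) x $ j) \<partial>M)
    \<longlonglongrightarrow> (\<Sum>j\<in>UNIV. \<integral>x. b x * (Du x $ j * Du x $ j) \<partial>M)"
    by (intro tendsto_sum L2conv_mult(1)[OF c c b])
  then show "(\<lambda>n. \<integral>x. b x * (norm (grad (U n) x))\<^sup>2 \<partial>M) \<longlonglongrightarrow> (\<integral>x. b x * (norm (Du x))\<^sup>2 \<partial>M)"
    unfolding norm_sq_sum sum_distrib_left by (simp add: i L)
  show "integrable M (\<lambda>x. b x * (norm (Du x))\<^sup>2)"
    unfolding norm_sq_sum sum_distrib_left by (simp add: i L)
qed

lemma approx_convection:
  assumes W: "\<And>j. (\<lambda>x. W x $ j) \<in> borel_measurable M" "\<And>x j. \<bar>W x $ j\<bar> \<le> K"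
  shows "(\<lambda>n. \<integral>x. U n x * (W x \<bullet> grad (U n) x) \<partial>M) \<longlonglongrightarrow> (\<integral>x. u x * (W x \<bullet> Du x) \<partial>M)"
proof -
  have c: "L2conv M (\<lambda>n x. grad (U n) x $ j) (\<lambda>x. Du x $ j)" for j using A by (simp add: approximates_def)
  have cu: "L2conv M U u" using A by (simp add: approximates_def)
  have i: "integrable M (\<lambda>x. W x $ j * (f x * g x))" if "L2 M f" "L2 M g" for f g j
    by (rule L2conv_mult(2)[OF L2conv_const[OF that(1)] L2conv_const[OF that(2)] W])
  have L: "L2 M (\<lambda>x. grad (U n) x $ j)" "L2 M (\<lambda>x. Du x $ j)" "L2 M (U n)" "L2 M u" for n j
    using c[of j] cu by (auto simp: L2conv_def)
  have e: "p * (W x \<bullet> q) = (\<Sum>j\<in>UNIV. W x $ j * (p * q $ j))" for p x q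
    by (simp add: inner_vec_def sum_distrib_left mult.left_commute)
  have "(\<lambda>n. \<Sum>j\<in>UNIV. \<integral>x. W x $ j * (U n x * grad (U n) x $ j) \<partial>M)
    \<longlonglongrightarrow> (\<Sum>j\<in>UNIV. \<integral>x. W x $ j * (u x * Du x $ j) \<partial>M)"
    by (intro tendsto_sum L2conv_mult(1)[OF cu c W])
  then show ?thesis unfolding e by (simp add: i L)
qed

lemma approx_sq: "(\<lambda>n. \<integral>x. (U n x)\<^sup>2 \<partial>M) \<longlonglongrightarrow> (\<integral>x. (u x)\<^sup>2 \<partial>M)"
  using A by (intro L2conv_sq) (simp add: approximates_def)

lemma approx_gradient_sq: "(\<lambda>n. \<integral>x. (norm (grad (U n) x))\<^sup>2 \<partial>M) \<longlonglongrightarrow> (\<integral>x. (norm (Du x))\<^sup>2 \<partial>M)"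
  using approx_gradient(1)[of "\<lambda>_. 1" 1] by simp

end

text \<open>The vanishing trace on each end comes with its own approximating sequence, which need
  not be \<open>U\<close>. The difference of the two sequences tends to zero in the Sobolev norm,
  hence on the end by \<open>end_sq_le\<close>. Thus a single sequence can be used for all
  ends.\<close>

lemma end_sq_tendsto_0:
  assumes v: "H1_vanishing l0 l h \<Xi> \<epsilon> u Du" and A: "approximates U u Du"
  shows "(\<lambda>n. end_sq i (U n)) \<longlonglongrightarrow> 0"
proof -
  have u: "L2 M u" "L2 M Du" using v by (simp_all add: H1_vanishing_def H1_def)
  obtain W where W: "\<And>n. smooth_on UNIV (W n)"
    "(\<lambda>n. H1_norm J (\<lambda>x. W n x - u x) (\<lambda>x. grad (W n) x - Du x)) \<longlonglongrightarrow> 0"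
    "(\<lambda>n. L2_norm_on (disc_measure h \<epsilon> i (l i)) (W n)) \<longlonglongrightarrow> 0"
    using v unfolding H1_vanishing_def has_trace_def by (auto dest!: spec[of _ i])
  have B: "approximates W u Du" by (rule approximatesI[OF u W(1,2)])
  have C1: "C1_on UNIV (U n) (grad (U n))" "C1_on UNIV (W n) (grad (W n))" for n
    using A B by (auto simp: approximates_def)
  have D: "C1_on UNIV (\<lambda>x. U n x - W n x) (\<lambda>x. grad (U n) x - grad (W n) x)" for n by (intro C1_on_diff C1)
  have ci: "continuous_on UNIV (U n)" "continuous_on UNIV (W n)" for n using C1 C1_on_continuous by blast+
  have 0: "(\<lambda>n. \<integral>x. (U n x - W n x)\<^sup>2 \<partial>M) \<longlonglongrightarrow> 0"
    using L2conv_sq[OF L2conv_diff[of M U u W u]] A B by (simp add: approximates_def)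
  have 1: "(\<lambda>n. \<integral>x. (norm (grad (U n) x - grad (W n) x))\<^sup>2 \<partial>M) \<longlonglongrightarrow> 0"
  proof -
    have "(\<lambda>n. \<integral>x. (grad (U n) x $ j - grad (W n) x $ j)\<^sup>2 \<partial>M) \<longlonglongrightarrow> 0" for j
      using L2conv_sq[OF L2conv_diff[of M "\<lambda>n x. grad (U n) x $ j" "\<lambda>x. Du x $ j" "\<lambda>n x. grad (W n) x $ j" "\<lambda>x. Du x $ j"]] A B
      by (simp add: approximates_def)
    then have "(\<lambda>n. \<Sum>j\<in>UNIV. \<integral>x. (grad (U n) x $ j - grad (W n) x $ j)\<^sup>2 \<partial>M) \<longlonglongrightarrow> (\<Sum>j\<in>(UNIV :: 3 set). 0)"
      by (intro tendsto_sum)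
    moreover have "(\<Sum>j\<in>UNIV. \<integral>x. (grad (U n) x $ j - grad (W n) x $ j)\<^sup>2 \<partial>M) = (\<integral>x. (norm (grad (U n) x - grad (W n) x))\<^sup>2 \<partial>M)" for n
    proof -
      have "integrable M (\<lambda>x. (grad (U n) x $ j - grad (W n) x $ j)\<^sup>2)" for j
        using C1_onD(2)[OF D] by (intro integral_J_continuous continuous_intros) (simp add: continuous_on_diff C1_onD(2)[OF C1(1)] C1_onD(2)[OF C1(2)])+
      then show ?thesis unfolding norm_sq_sum by (simp add: power2_eq_square)
    qed
    ultimately show ?thesis by simp
  qed
  let ?K = "2 / (l i - \<epsilon> * l0) + 2 * (l i - \<epsilon> * l0)"
  show ?thesis
  proof (rule tendsto_sandwich[OF _ _ tendsto_const])
    show "\<forall>\<^sub>F n in sequentially. 0 \<le> end_sq i (U n)" by (simp add: end_sq_nonneg)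
    have "end_sq i (U n) \<le> 2 * end_sq i (\<lambda>x. U n x - W n x) + 2 * end_sq i (W n)" for n
    proof -
      have cc: "continuous_on UNIV (\<lambda>z. U n (insert_coord i (l i) z))" "continuous_on UNIV (\<lambda>z. W n (insert_coord i (l i) z))"
        by (rule continuous_on_compose2[OF ci(1)] continuous_on_compose2[OF ci(2)], auto intro!: continuous_intros)+
      have "end_sq i (U n) \<le> (LINT z:ball 0 (\<epsilon> * h i)|lborel. 2 * (U n (insert_coord i (l i) z) - W n (insert_coord i (l i) z))\<^sup>2
        + 2 * (W n (insert_coord i (l i) z))\<^sup>2)"
        unfolding end_sq_def
        by (intro set_integral_mono set_integrable_bounded_open continuous_intros cc)
          (auto intro: order_trans[OF _ square_diff_le[of "U n _ - W n _" "- W n _", simplified]])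
      also have "\<dots> = 2 * end_sq i (\<lambda>x. U n x - W n x) + 2 * end_sq i (W n)"
        unfolding end_sq_def
        by (subst set_integral_add, (intro set_integrable_mult_right set_integrable_bounded_open continuous_intros cc open_ball bounded_ball)+, simp)
      finally show ?thesis .
    qed
    also have "2 * end_sq i (\<lambda>x. U n x - W n x) + 2 * end_sq i (W n) \<le>
       2 * (?K * ((\<integral>x. (U n x - W n x)\<^sup>2 \<partial>M) + (\<integral>x. (norm (grad (U n) x - grad (W n) x))\<^sup>2 \<partial>M)))
       + 2 * (L2_norm_on (disc_measure h \<epsilon> i (l i)) (W n))\<^sup>2" for n
      using end_sq_le[OF D, of i n] end_sq_eq[OF ci(2), of i n] by simp
    finally show "\<forall>\<^sub>F n in sequentially. end_sq i (U n) \<le>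
       2 * (?K * ((\<integral>x. (U n x - W n x)\<^sup>2 \<partial>M) + (\<integral>x. (norm (grad (U n) x - grad (W n) x))\<^sup>2 \<partial>M)))
       + 2 * (L2_norm_on (disc_measure h \<epsilon> i (l i)) (W n))\<^sup>2" by simp
    show "(\<lambda>n. 2 * (?K * ((\<integral>x. (U n x - W n x)\<^sup>2 \<partial>M) + (\<integral>x. (norm (grad (U n) x - grad (W n) x))\<^sup>2 \<partial>M)))
       + 2 * (L2_norm_on (disc_measure h \<epsilon> i (l i)) (W n))\<^sup>2) \<longlonglongrightarrow> 0"
      by (rule tendsto_eq_intros 0 1 W(3) refl | simp)+
  qed
qed

text \<open>Test functions come equipped with lateral traces, so the solution itself can be inserted
  only after its traces are constructed. The restrictions of the approximations are Cauchy by
  \<open>lateral_le\<close>, and their limit inherits the bound.\<close>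

lemma lateral_trace_exists:
  assumes u: "L2 M u" "L2 M Du" and U: "\<And>n. smooth_on UNIV (U n)"
    and lim: "(\<lambda>n. H1_norm J (\<lambda>x. U n x - u x) (\<lambda>x. grad (U n) x - Du x)) \<longlonglongrightarrow> 0"
  shows "\<exists>t. has_trace J (lateral_measure l0 l h \<epsilon> i) u Du t \<and>
    (L2_norm_on (lateral_measure l0 l h \<epsilon> i) t)\<^sup>2 \<le> (1 / \<epsilon>) * ((3 / h i + \<epsilon>0\<^sup>2 * h i) * (H1_norm J u Du)\<^sup>2)"
proof -
  let ?N = "lateral_measure l0 l h \<epsilon> i"
  let ?d = "\<lambda>n. (H1_norm J (\<lambda>x. U n x - u x) (\<lambda>x. grad (U n) x - Du x))\<^sup>2"
  define K where "K = (1 / \<epsilon>) * (3 / h i + \<epsilon>0\<^sup>2 * h i)"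
  have K: "0 \<le> K" using \<epsilon> h[of i] by (auto simp: K_def intro!: mult_nonneg_nonneg add_nonneg_nonneg)
  note A = approximatesI(1)[OF u U lim]
  note ig = approximatesI(2)[OF u U lim]
  have C1: "C1_on UNIV (U n) (grad (U n))" for n using A by (simp add: approximates_def)
  have D: "C1_on UNIV (\<lambda>x. U m x - U n x) (\<lambda>x. grad (U m) x - grad (U n) x)" for m n by (intro C1_on_diff C1)
  have LU: "L2 M (U n)" for n using A by (simp add: approximates_def L2conv_def)
  have L: "L2 ?N (U n)" for n
    using lateral_le(1)[OF C1] lateral_integral(3)[OF C1_on_continuous[OF C1]] by (simp add: L2_real)
  \<comment> \<open>Both approximations are compared with \<open>u\<close>, which gives the additive
    form required by \<open>L2_complete\<close>; the factor 2 stems from the square of a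
    difference.\<close>
  have cauchy: "(\<integral>x. (U m x - U n x)\<^sup>2 \<partial>?N) \<le> 2 * K * ?d m + 2 * K * ?d n" for m n
  proof -
    have iu: "integrable M (\<lambda>x. (U n x - u x)\<^sup>2)" for n using L2_diff[OF LU u(1)] by (simp add: L2_real)
    have "(\<integral>x. (U m x - U n x)\<^sup>2 \<partial>M) \<le> (\<integral>x. 2 * (U m x - u x)\<^sup>2 + 2 * (U n x - u x)\<^sup>2 \<partial>M)"
    proof (rule integral_mono)
      show "integrable M (\<lambda>x. (U m x - U n x)\<^sup>2)" using L2_diff[OF LU LU] by (simp add: L2_real)
      show "integrable M (\<lambda>x. 2 * (U m x - u x)\<^sup>2 + 2 * (U n x - u x)\<^sup>2)" using iu by simp
      show "(U m x - U n x)\<^sup>2 \<le> 2 * (U m x - u x)\<^sup>2 + 2 * (U n x - u x)\<^sup>2" for x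
        using square_diff_le[of "U m x - u x" "U n x - u x"] by simp
    qed
    then have 1: "(\<integral>x. (U m x - U n x)\<^sup>2 \<partial>M) \<le> 2 * (\<integral>x. (U m x - u x)\<^sup>2 \<partial>M) + 2 * (\<integral>x. (U n x - u x)\<^sup>2 \<partial>M)"
      using iu by simp
    have "(\<integral>x. (norm (grad (U m) x - grad (U n) x))\<^sup>2 \<partial>M) \<le> (\<integral>x. 2 * (norm (grad (U m) x - Du x))\<^sup>2 + 2 * (norm (grad (U n) x - Du x))\<^sup>2 \<partial>M)"
    proof (rule integral_mono)
      show "integrable M (\<lambda>x. (norm (grad (U m) x - grad (U n) x))\<^sup>2)" by (rule integral_J_continuous(2)[OF continuous_sq(2)[OF D]])
      show "integrable M (\<lambda>x. 2 * (norm (grad (U m) x - Du x))\<^sup>2 + 2 * (norm (grad (U n) x - Du x))\<^sup>2)" using ig by simp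
      show "(norm (grad (U m) x - grad (U n) x))\<^sup>2 \<le> 2 * (norm (grad (U m) x - Du x))\<^sup>2 + 2 * (norm (grad (U n) x - Du x))\<^sup>2" for x
        using norm_diff_sq_le[of "grad (U m) x - Du x" "grad (U n) x - Du x"] by simp
    qed
    then have 2: "(\<integral>x. (norm (grad (U m) x - grad (U n) x))\<^sup>2 \<partial>M) \<le> 2 * (\<integral>x. (norm (grad (U m) x - Du x))\<^sup>2 \<partial>M) + 2 * (\<integral>x. (norm (grad (U n) x - Du x))\<^sup>2 \<partial>M)"
      using ig by simp
    have "(\<integral>x. (U m x - U n x)\<^sup>2 \<partial>?N) \<le> K * ((\<integral>x. (U m x - U n x)\<^sup>2 \<partial>M) + (\<integral>x. (norm (grad (U m) x - grad (U n) x))\<^sup>2 \<partial>M))"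
      using lateral_le(2)[OF D] by (simp add: K_def mult.assoc)
    also have "\<dots> \<le> K * (2 * ?d m + 2 * ?d n)"
      using 1 2 K unfolding H1_norm_sq by (intro mult_left_mono) auto
    finally show ?thesis by (simp add: algebra_simps)
  qed
  have "(\<lambda>n. 2 * K * ?d n) \<longlonglongrightarrow> 0" by (rule tendsto_eq_intros lim refl | simp)+
  from L2_complete[where f = U, OF finite_lateral_measure L this cauchy]
  obtain t where t: "L2conv ?N U t" by blast
  have "has_trace J ?N u Du t"
    unfolding has_trace_def using t U lim by (auto simp: L2conv_def)
  moreover have "(\<integral>x. (t x)\<^sup>2 \<partial>?N) \<le> K * ((\<integral>x. (u x)\<^sup>2 \<partial>M) + (\<integral>x. (norm (Du x))\<^sup>2 \<partial>M))"
  proof (rule LIMSEQ_le[OF L2conv_sq[OF t]])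
    show "(\<lambda>n. K * ((\<integral>x. (U n x)\<^sup>2 \<partial>M) + (\<integral>x. (norm (grad (U n) x))\<^sup>2 \<partial>M))) \<longlonglongrightarrow> K * ((\<integral>x. (u x)\<^sup>2 \<partial>M) + (\<integral>x. (norm (Du x))\<^sup>2 \<partial>M))"
      by (intro tendsto_intros approx_sq[OF A] approx_gradient_sq[OF A])
    show "\<exists>N. \<forall>n\<ge>N. (\<integral>x. (U n x)\<^sup>2 \<partial>?N) \<le> K * ((\<integral>x. (U n x)\<^sup>2 \<partial>M) + (\<integral>x. (norm (grad (U n) x))\<^sup>2 \<partial>M))"
      using lateral_le(2)[OF C1] by (simp add: K_def mult.assoc)
  qed
  ultimately show ?thesis
    by (intro exI[of _ t]) (simp add: H1_norm_sq L2_norm_on_sq K_def mult.assoc)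
qed

end

section \<open>The energy estimate\<close>

lemma quadratic_form: "y \<bullet> (A *v y) = (\<Sum>m\<in>UNIV. \<Sum>n\<in>UNIV. A $ m $ n * y $ m * y $ n)" for y :: "real^'n"
  by (simp add: inner_vec_def matrix_vector_mult_def sum_distrib_left mult_ac)

context scaled_junction
begin

lemma AE_pieces: "AE x in M. x \<in> pieces"
proof -
  have "negligible (J - pieces)" by (rule negligible_interfaces)
  then have "AE x in lebesgue. x \<notin> J - pieces"
    by (intro AE_not_in) (simp add: negligible_iff_null_sets)
  then show ?thesis
    using open_J by (subst AE_restrict_space_iff) (auto simp: sets_completionI_sets borel_open)
qed

lemma indicator_pieces:
  "x \<in> pieces \<Longrightarrow> indicator (node \<Xi> \<epsilon>) x + (\<Sum>i\<in>UNIV. indicator (cyl l0 l h \<epsilon> i) x) = (1 :: real)"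
proof -
  assume x: "x \<in> pieces"
  consider "x \<in> node \<Xi> \<epsilon>" | i where "x \<in> cyl l0 l h \<epsilon> i" using x unfolding pieces_def by blast
  then show ?thesis
  proof cases
    case 1
    then have "x \<notin> cyl l0 l h \<epsilon> i" for i using disjoint_pieces(1)[of i] by blast
    then show ?thesis using 1 by simp
  next
    case (2 i)
    have "x \<in> cyl l0 l h \<epsilon> j \<longleftrightarrow> j = i" for j
      using 2 disjoint_pieces(2)[of i j] by blast
    then have "indicator (cyl l0 l h \<epsilon> j) x = (if j = i then 1 else 0 :: real)" for j
      by (simp add: indicator_def)
    moreover have "x \<notin> node \<Xi> \<epsilon>" using 2 disjoint_pieces(1)[of i] by blast
    ultimately show ?thesis by simp
  qed
qed

lemma L2_cyl:
  assumes "L2 M (u :: _ \<Rightarrow> real)"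
  shows "L2 (lebesgue_on (cyl l0 l h \<epsilon> i)) u"
    and "L2_norm_on (lebesgue_on (cyl l0 l h \<epsilon> i)) u \<le> L2_norm_on M u"
proof -
  let ?Z = "cyl l0 l h \<epsilon> i"
  have e: "lebesgue_on ?Z = restrict_space M ?Z"
    using cyl_subset_J[of i] by (simp add: restrict_restrict_space open_J open_cyl sets_completionI_sets Int_absorb1)
  have Zs: "?Z \<in> sets M"
    using open_J open_cyl[of l0 l h \<epsilon> i] cyl_subset_J[of i]
    by (simp add: sets_restrict_space_iff sets_completionI_sets borel_open)
  then have Z: "?Z \<inter> space M \<in> sets M" by (rule sets.Int) simp
  have u: "u \<in> borel_measurable M" "integrable M (\<lambda>x. (u x)\<^sup>2)" using assms by (simp_all add: L2_real)
  have i: "integrable M (\<lambda>x. indicator ?Z x *\<^sub>R (u x)\<^sup>2)"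
    by (rule integrable_mult_indicator[OF Zs u(2)])
  show "L2 (lebesgue_on ?Z) u"
    unfolding e using i u by (simp add: L2_real integrable_restrict_space[OF Z] measurable_restrict_space1)
  have "(\<integral>x. (u x)\<^sup>2 \<partial>lebesgue_on ?Z) = (\<integral>x. indicator ?Z x *\<^sub>R (u x)\<^sup>2 \<partial>M)"
    unfolding e by (rule integral_restrict_space[OF Z])
  also have "\<dots> \<le> (\<integral>x. (u x)\<^sup>2 \<partial>M)" by (rule integral_mono[OF i u(2)]) (simp add: indicator_def)
  finally show "L2_norm_on (lebesgue_on ?Z) u \<le> L2_norm_on M u" by (simp add: L2_norm_on_def)
qed

end

context problem
begin

text \<open>The limit in the convective term needs coefficients that are measurable and bounded at
  all points, also at the interfaces, where the default value 0 is taken.\<close>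

lemma V_regular:
  assumes \<epsilon>: "\<epsilon> \<in> {0<..<\<epsilon>0}"
  shows "(\<lambda>x. V \<epsilon> x $ j) \<in> borel_measurable (lebesgue_on (junction l0 l h \<Xi> \<epsilon>))"
    and "\<exists>K. \<forall>x j. \<bar>V \<epsilon> x $ j\<bar> \<le> K"
proof -
  interpret SJ: scaled_junction \<epsilon>0 l0 l h \<Xi> \<epsilon> by (rule scaled[OF \<epsilon>])
  have eq: "V \<epsilon> x $ j = piecewise l0 l h \<Xi> \<epsilon> (\<lambda>x. V_node v0 \<epsilon> x $ j) (\<lambda>i x. V_cyl w vt \<epsilon> i x $ j) x" for x j
    by (simp add: piecewise_def)
  have sb0: "smooth_bounded_on \<Xi> (\<lambda>\<xi>. v0 \<xi> $ j)" for j using velocity by (simp add: velocity_field_def)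
  have sbw: "smooth_bounded_on {0<..<l i} (w i)" for i using velocity by (simp add: velocity_field_def)
  have sbv: "smooth_bounded_on ({0<..<l i} \<times> ball 0 (h i)) (vt i j)" if "j \<noteq> i" for i j
    using velocity that by (simp add: velocity_field_def)
  have node: "(\<lambda>x. (1/\<epsilon>) *\<^sub>R x) ` node \<Xi> \<epsilon> \<subseteq> \<Xi>" using \<epsilon> by (auto simp: node_def)
  have c0: "continuous_on (node \<Xi> \<epsilon>) (\<lambda>x. V_node v0 \<epsilon> x $ j)" "bounded ((\<lambda>x. V_node v0 \<epsilon> x $ j) ` node \<Xi> \<epsilon>)" for j
    unfolding V_node_def by (rule smooth_bounded_on_compose[OF sb0 _ node], intro continuous_intros)+
  have cyl: "(\<lambda>x. (x $ i, (1/\<epsilon>) *\<^sub>R bar i x)) ` cyl l0 l h \<epsilon> i \<subseteq> {0<..<l i} \<times> ball 0 (h i)"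
    "(\<lambda>x. x $ i) ` cyl l0 l h \<epsilon> i \<subseteq> {0<..<l i}" for i
    using cyl_coords[of \<epsilon> _ i] \<epsilon> by fastforce+
  have c: "continuous_on (cyl l0 l h \<epsilon> i) (\<lambda>x. V_cyl w vt \<epsilon> i x $ j) \<and> bounded ((\<lambda>x. V_cyl w vt \<epsilon> i x $ j) ` cyl l0 l h \<epsilon> i)" for i j
  proof (cases "j = i")
    case True
    then have e: "(\<lambda>x. V_cyl w vt \<epsilon> i x $ j) = (\<lambda>x. w i (x $ i))" by (simp add: V_cyl_def)
    have cc: "continuous_on (cyl l0 l h \<epsilon> i) (\<lambda>x. x $ i)" by (intro continuous_intros)
    show ?thesis unfolding e using smooth_bounded_on_compose[OF sbw cc cyl(2)] by blast
  next
    case False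
    let ?g = "\<lambda>x. vt i j (x $ i, (1/\<epsilon>) *\<^sub>R bar i x)"
    have e: "(\<lambda>x. V_cyl w vt \<epsilon> i x $ j) = (\<lambda>x. \<epsilon> * ?g x)" using False by (simp add: V_cyl_def)
    have cc: "continuous_on (cyl l0 l h \<epsilon> i) (\<lambda>x. (x $ i, (1/\<epsilon>) *\<^sub>R bar i x))" by (intro continuous_intros)
    note g = smooth_bounded_on_compose[OF sbv[OF False] cc cyl(1)]
    have "bounded ((\<lambda>y. \<epsilon> *\<^sub>R y) ` (?g ` cyl l0 l h \<epsilon> i))" by (intro bounded_scaling g(2))
    then show ?thesis unfolding e using g(1) by (simp add: image_image continuous_on_mult_left)
  qed
  note P = SJ.piecewise_bounded_measurable[OF c0 conjunct1[OF c] conjunct2[OF c]]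
  show "(\<lambda>x. V \<epsilon> x $ j) \<in> borel_measurable (lebesgue_on (junction l0 l h \<Xi> \<epsilon>))"
    unfolding eq by (rule P(1))
  have "\<exists>K. \<forall>x. \<bar>V \<epsilon> x $ j\<bar> \<le> K" for j unfolding eq by (rule P(2))
  then obtain K where K: "\<And>j x. \<bar>V \<epsilon> x $ j\<bar> \<le> K j" by metis
  have "\<bar>V \<epsilon> x $ j\<bar> \<le> Max (range K)" for x j
    by (rule order_trans[OF K[of x j] Max_ge]) auto
  then show "\<exists>K. \<forall>x j. \<bar>V \<epsilon> x $ j\<bar> \<le> K"
    by blast
qed

abbreviation "D \<epsilon> \<equiv> piecewise l0 l h \<Xi> \<epsilon> (D_node a0 \<epsilon>) (D_cyl a \<epsilon>)"

text \<open>The ellipticity bound holds at every point and not only almost everywhere: off the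
  pieces the matrix takes the default value zero, and so does the lower bound.\<close>

lemma D_regular:
  assumes \<epsilon>: "\<epsilon> \<in> {0<..<\<epsilon>0}"
  shows "(\<lambda>x. D \<epsilon> x $ m $ n) \<in> borel_measurable (lebesgue_on (junction l0 l h \<Xi> \<epsilon>))"
    and "\<exists>K. \<forall>x. \<bar>D \<epsilon> x $ m $ n\<bar> \<le> K"
    and "\<kappa>0n * (indicator (node \<Xi> \<epsilon>) x * (norm y)\<^sup>2) + (\<Sum>i\<in>UNIV. \<kappa>0 i * (indicator (cyl l0 l h \<epsilon> i) x * (norm y)\<^sup>2))
      \<le> y \<bullet> (D \<epsilon> x *v y)"
proof -
  interpret SJ: scaled_junction \<epsilon>0 l0 l h \<Xi> \<epsilon> by (rule scaled[OF \<epsilon>])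
  have eq: "D \<epsilon> x $ m $ n = piecewise l0 l h \<Xi> \<epsilon> (\<lambda>x. D_node a0 \<epsilon> x $ m $ n) (\<lambda>i x. D_cyl a \<epsilon> i x $ m $ n) x" for x
    by (simp add: piecewise_def)
  have ell: "elliptic_matrix_on \<Xi> a0 \<kappa>0n \<kappa>1n" "elliptic_matrix_on (ball 0 (h i)) (a i) (\<kappa>0 i) (\<kappa>1 i)" for i
    using diffusion by (simp_all add: diffusion_matrix_def)
  have sb: "smooth_bounded_on \<Xi> (\<lambda>\<xi>. a0 \<xi> $ m $ n)" "smooth_bounded_on (ball 0 (h i)) (\<lambda>\<xi>. a i \<xi> $ m $ n)" for i
    using ell by (simp_all add: elliptic_matrix_on_def)
  have node: "(\<lambda>x. (1/\<epsilon>) *\<^sub>R x) ` node \<Xi> \<epsilon> \<subseteq> \<Xi>" using \<epsilon> by (auto simp: node_def)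
  have cyl: "(\<lambda>x. (1/\<epsilon>) *\<^sub>R bar i x) ` cyl l0 l h \<epsilon> i \<subseteq> ball 0 (h i)" for i
    using cyl_coords[of \<epsilon> _ i] \<epsilon> by fastforce
  have c0: "continuous_on (node \<Xi> \<epsilon>) (\<lambda>x. D_node a0 \<epsilon> x $ m $ n)" "bounded ((\<lambda>x. D_node a0 \<epsilon> x $ m $ n) ` node \<Xi> \<epsilon>)"
    unfolding D_node_def by (rule smooth_bounded_on_compose[OF sb(1) _ node], intro continuous_intros)+
  have c: "continuous_on (cyl l0 l h \<epsilon> i) (\<lambda>x. D_cyl a \<epsilon> i x $ m $ n)" "bounded ((\<lambda>x. D_cyl a \<epsilon> i x $ m $ n) ` cyl l0 l h \<epsilon> i)" for i
    unfolding D_cyl_def by (rule smooth_bounded_on_compose[OF sb(2) _ cyl], intro continuous_intros)+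
  note P = SJ.piecewise_bounded_measurable[OF c0 c]
  show "(\<lambda>x. D \<epsilon> x $ m $ n) \<in> borel_measurable (lebesgue_on (junction l0 l h \<Xi> \<epsilon>))"
    "\<exists>K. \<forall>x. \<bar>D \<epsilon> x $ m $ n\<bar> \<le> K" unfolding eq by (rule P)+
  have n: "x \<notin> cyl l0 l h \<epsilon> i" if "x \<in> node \<Xi> \<epsilon>" for i using that SJ.disjoint_pieces(1)[of i] by blast
  show "\<kappa>0n * (indicator (node \<Xi> \<epsilon>) x * (norm y)\<^sup>2) + (\<Sum>i\<in>UNIV. \<kappa>0 i * (indicator (cyl l0 l h \<epsilon> i) x * (norm y)\<^sup>2))
      \<le> y \<bullet> (D \<epsilon> x *v y)"
  proof (cases "x \<in> SJ.pieces")
    case False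
    then show ?thesis by (simp add: SJ.piecewise_eq SJ.pieces_def)
  next
    case True
    then consider "x \<in> node \<Xi> \<epsilon>" | i where "x \<in> cyl l0 l h \<epsilon> i" unfolding SJ.pieces_def by blast
    then show ?thesis
    proof cases
      case 1
      have "(1/\<epsilon>) *\<^sub>R x \<in> \<Xi>" using node 1 by blast
      then show ?thesis using 1 n ell(1) by (simp add: SJ.piecewise_eq D_node_def elliptic_matrix_on_def quadratic_form)
    next
      case (2 i)
      have "x \<in> cyl l0 l h \<epsilon> j \<longleftrightarrow> j = i" for j
        using 2 SJ.disjoint_pieces(2)[of i j] by blast
      then have o: "indicator (cyl l0 l h \<epsilon> j) x = (if j = i then 1 else 0 :: real)" for j
        by (simp add: indicator_def)
      have "x \<notin> node \<Xi> \<epsilon>" using 2 n by blast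
      moreover have "(1/\<epsilon>) *\<^sub>R bar i x \<in> ball 0 (h i)" using cyl 2 by blast
      ultimately show ?thesis
        using ell(2)[of i] 2 unfolding o
        by (simp add: SJ.piecewise_eq D_cyl_def elliptic_matrix_on_def quadratic_form if_distrib if_distribR cong: if_cong)
    qed
  qed
qed

text \<open>The constants are parameters, so that the final one visibly does not depend on
  \<epsilon>: \<open>C2\<close> is the Poincare constant, \<open>C3\<close> belongs to the lateral
  traces, and \<open>\<kappa>\<close> is the coercivity left when convection has taken seven eighths
  of the diffusion in the cylinders and nothing in the node.\<close>

lemma energy_estimate:
  assumes \<epsilon>: "\<epsilon> \<in> {0<..<\<epsilon>0}"
    and C2: "0 \<le> C2" "\<And>U DU. C1_on UNIV U DU \<Longrightarrow>
      (\<integral>x. (U x)\<^sup>2 \<partial>lebesgue_on (junction l0 l h \<Xi> \<epsilon>)) \<le>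
      C2 * ((\<integral>x. (norm (DU x))\<^sup>2 \<partial>lebesgue_on (junction l0 l h \<Xi> \<epsilon>)) + (\<Sum>i\<in>UNIV. scaled_junction.end_sq l h \<epsilon> i U))"
    and \<kappa>: "0 < \<kappa>" "\<kappa> \<le> \<kappa>0n" "\<And>i. \<kappa> \<le> \<kappa>0 i / 8"
    and C3: "\<And>i. 3 / h i + \<epsilon>0\<^sup>2 * h i \<le> C3\<^sup>2" "1 \<le> C3"
    and F: "\<And>i. L2 (lebesgue_on (cyl l0 l h \<epsilon> i)) (F i)"
    and \<Phi>: "\<And>i. L2 (lateral_measure l0 l h \<epsilon> i) (\<Phi> i)"
    and weak: "weak_solution l0 l h \<Xi> \<epsilon> (V \<epsilon>) (D \<epsilon>) F \<Phi> \<psi> D\<psi>"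
  shows "H1_norm (junction l0 l h \<Xi> \<epsilon>) \<psi> D\<psi> \<le> ((1 + C2) * C3 / \<kappa>) * (1/\<epsilon>) *
    (\<Sum>i\<in>UNIV. L2_norm_on (lebesgue_on (cyl l0 l h \<epsilon> i)) (F i)
       + sqrt \<epsilon> * L2_norm_on (lateral_measure l0 l h \<epsilon> i) (\<Phi> i))"
proof -
  interpret SJ: scaled_junction \<epsilon>0 l0 l h \<Xi> \<epsilon> by (rule scaled[OF \<epsilon>])
  have e: "0 < \<epsilon>" using \<epsilon> by simp
  have van: "H1_vanishing l0 l h \<Xi> \<epsilon> \<psi> D\<psi>" using weak by (simp add: weak_solution_def)
  have \<psi>: "L2 SJ.M \<psi>" "L2 SJ.M D\<psi>" using van by (simp_all add: H1_vanishing_def H1_def)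
  obtain U where U: "\<And>n. smooth_on UNIV (U n)"
    "(\<lambda>n. H1_norm SJ.J (\<lambda>x. U n x - \<psi> x) (\<lambda>x. grad (U n) x - D\<psi> x)) \<longlonglongrightarrow> 0"
    using van unfolding H1_vanishing_def has_trace_def by blast
  note A = SJ.approximatesI(1)[OF \<psi> U]
  have C1: "C1_on UNIV (U n) (grad (U n))" for n using A by (simp add: SJ.approximates_def)
  note E = SJ.end_sq_tendsto_0[OF van A]
  let ?H = "H1_norm SJ.J \<psi> D\<psi>"
  define G where "G = (\<integral>x. (norm (D\<psi> x))\<^sup>2 \<partial>SJ.M)"
  define g0 where "g0 = (\<integral>x. indicator (node \<Xi> \<epsilon>) x * (norm (D\<psi> x))\<^sup>2 \<partial>SJ.M)"
  define g where "g i = (\<integral>x. indicator (cyl l0 l h \<epsilon> i) x * (norm (D\<psi> x))\<^sup>2 \<partial>SJ.M)" for i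
  have ind: "\<bar>indicator S x :: real\<bar> \<le> 1" for S and x :: "real^3" by (simp add: indicator_def)
  note g0l = SJ.approx_gradient[OF A SJ.indicator_measurable_M ind, of "node \<Xi> \<epsilon>", simplified]
  note gl = SJ.approx_gradient[OF A SJ.indicator_measurable_M ind, of "cyl l0 l h \<epsilon> i" i for i, simplified]
  have g_nonneg: "0 \<le> g0" "0 \<le> g i" for i by (simp_all add: g0_def g_def)
  have G_eq: "G = g0 + (\<Sum>i\<in>UNIV. g i)"
  proof -
    have "G = (\<integral>x. indicator (node \<Xi> \<epsilon>) x * (norm (D\<psi> x))\<^sup>2 + (\<Sum>i\<in>UNIV. indicator (cyl l0 l h \<epsilon> i) x * (norm (D\<psi> x))\<^sup>2) \<partial>SJ.M)"
      unfolding G_def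
    proof (rule integral_cong_AE)
      show "(\<lambda>x. (norm (D\<psi> x))\<^sup>2) \<in> borel_measurable SJ.M" using \<psi>(2) by (auto simp: L2_def)
      show "(\<lambda>x. indicator (node \<Xi> \<epsilon>) x * (norm (D\<psi> x))\<^sup>2 + (\<Sum>i\<in>UNIV. indicator (cyl l0 l h \<epsilon> i) x * (norm (D\<psi> x))\<^sup>2)) \<in> borel_measurable SJ.M"
        using g0l(2) gl(2) by (intro borel_measurable_add borel_measurable_sum borel_measurable_integrable) auto
      show "AE x in SJ.M. (norm (D\<psi> x))\<^sup>2 = indicator (node \<Xi> \<epsilon>) x * (norm (D\<psi> x))\<^sup>2 + (\<Sum>i\<in>UNIV. indicator (cyl l0 l h \<epsilon> i) x * (norm (D\<psi> x))\<^sup>2)"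
        using SJ.AE_pieces
      proof eventually_elim
        case (elim x)
        show ?case using SJ.indicator_pieces[OF elim]
          by (simp add: sum_distrib_right[symmetric] distrib_right[symmetric])
      qed
    qed
    also have "\<dots> = g0 + (\<Sum>i\<in>UNIV. g i)"
      unfolding g0_def g_def Bochner_Integration.integral_add[OF g0l(2) Bochner_Integration.integrable_sum[OF gl(2)]]
        Bochner_Integration.integral_sum[OF gl(2)] ..
    finally show ?thesis .
  qed

  \<comment> \<open>The end terms disappear along the sequence; the sum of zeros keeps the shape of
    the limit.\<close>
  have poincare: "(\<integral>x. (\<psi> x)\<^sup>2 \<partial>SJ.M) \<le> C2 * (G + (\<Sum>i\<in>(UNIV :: 3 set). 0))"
    unfolding G_def
  proof (rule LIMSEQ_le[OF SJ.approx_sq[OF A]])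
    show "(\<lambda>n. C2 * ((\<integral>x. (norm (grad (U n) x))\<^sup>2 \<partial>SJ.M) + (\<Sum>i\<in>UNIV. SJ.end_sq i (U n))))
      \<longlonglongrightarrow> C2 * ((\<integral>x. (norm (D\<psi> x))\<^sup>2 \<partial>SJ.M) + (\<Sum>i\<in>(UNIV :: 3 set). 0))"
      by (intro tendsto_intros SJ.approx_gradient_sq[OF A] E)
    show "\<exists>N. \<forall>n\<ge>N. (\<integral>x. (U n x)\<^sup>2 \<partial>SJ.M) \<le> C2 * ((\<integral>x. (norm (grad (U n) x))\<^sup>2 \<partial>SJ.M) + (\<Sum>i\<in>UNIV. SJ.end_sq i (U n)))"
      using C2(2)[OF C1] by blast
  qed
  then have H2: "?H\<^sup>2 \<le> (1 + C2) * G" by (simp add: H1_norm_sq G_def algebra_simps)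

  obtain K where K: "\<And>U DU. C1_on UNIV U DU \<Longrightarrow> (\<integral>x. U x * (V \<epsilon> x \<bullet> DU x) \<partial>SJ.M) \<le>
     (\<Sum>i\<in>UNIV. (7/8) * (\<epsilon> * \<kappa>0 i) * (\<integral>x. indicator (cyl l0 l h \<epsilon> i) x * (norm (DU x))\<^sup>2 \<partial>SJ.M))
     + (\<Sum>i\<in>UNIV. K i * SJ.end_sq i U)" using smooth_convection[OF \<epsilon>] by blast
  obtain B where B: "\<And>x j. \<bar>V \<epsilon> x $ j\<bar> \<le> B" using V_regular(2)[OF \<epsilon>] by blast
  have convection: "(\<integral>x. \<psi> x * (V \<epsilon> x \<bullet> D\<psi> x) \<partial>SJ.M) \<le> (\<Sum>i\<in>UNIV. (7/8) * (\<epsilon> * \<kappa>0 i) * g i) + (\<Sum>i\<in>UNIV. K i * 0)"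
    unfolding g_def
  proof (rule LIMSEQ_le[OF SJ.approx_convection[OF A V_regular(1)[OF \<epsilon>] B]])
    show "(\<lambda>n. (\<Sum>i\<in>UNIV. (7/8) * (\<epsilon> * \<kappa>0 i) * (\<integral>x. indicator (cyl l0 l h \<epsilon> i) x * (norm (grad (U n) x))\<^sup>2 \<partial>SJ.M))
      + (\<Sum>i\<in>UNIV. K i * SJ.end_sq i (U n))) \<longlonglongrightarrow>
      (\<Sum>i\<in>UNIV. (7/8) * (\<epsilon> * \<kappa>0 i) * (\<integral>x. indicator (cyl l0 l h \<epsilon> i) x * (norm (D\<psi> x))\<^sup>2 \<partial>SJ.M)) + (\<Sum>i\<in>UNIV. K i * 0)"
      by (intro tendsto_intros gl(1) E)
    show "\<exists>N. \<forall>n\<ge>N. (\<integral>x. U n x * (V \<epsilon> x \<bullet> grad (U n) x) \<partial>SJ.M) \<le>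
      (\<Sum>i\<in>UNIV. (7/8) * (\<epsilon> * \<kappa>0 i) * (\<integral>x. indicator (cyl l0 l h \<epsilon> i) x * (norm (grad (U n) x))\<^sup>2 \<partial>SJ.M))
      + (\<Sum>i\<in>UNIV. K i * SJ.end_sq i (U n))" using K[OF C1] by blast
  qed

  have diffusion: "\<kappa>0n * g0 + (\<Sum>i\<in>UNIV. \<kappa>0 i * g i) \<le> (\<integral>x. D\<psi> x \<bullet> (D \<epsilon> x *v D\<psi> x) \<partial>SJ.M)"
  proof -
    have L: "L2 SJ.M (\<lambda>x. D\<psi> x $ j)" for j by (rule L2_nth[OF \<psi>(2)])
    have "integrable SJ.M (\<lambda>x. D \<epsilon> x $ m $ n * (D\<psi> x $ m * D\<psi> x $ n))" for m n
    proof -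
      obtain B where "\<And>x. \<bar>D \<epsilon> x $ m $ n\<bar> \<le> B" using D_regular(2)[OF \<epsilon>] by blast
      then show ?thesis by (rule L2conv_mult(2)[OF L2conv_const[OF L] L2conv_const[OF L] D_regular(1)[OF \<epsilon>]])
    qed
    then have i: "integrable SJ.M (\<lambda>x. D\<psi> x \<bullet> (D \<epsilon> x *v D\<psi> x))"
      unfolding quadratic_form by (simp add: mult.assoc)
    have "(\<integral>x. \<kappa>0n * (indicator (node \<Xi> \<epsilon>) x * (norm (D\<psi> x))\<^sup>2) + (\<Sum>i\<in>UNIV. \<kappa>0 i * (indicator (cyl l0 l h \<epsilon> i) x * (norm (D\<psi> x))\<^sup>2)) \<partial>SJ.M)
      \<le> (\<integral>x. D\<psi> x \<bullet> (D \<epsilon> x *v D\<psi> x) \<partial>SJ.M)"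
      by (rule integral_mono[OF _ i D_regular(3)[OF \<epsilon>]]) (use g0l(2) gl(2) in simp)
    then show ?thesis unfolding g0_def g_def using g0l(2) gl(2) by simp
  qed

  have "\<exists>t. has_trace SJ.J (lateral_measure l0 l h \<epsilon> i) \<psi> D\<psi> t \<and>
    (L2_norm_on (lateral_measure l0 l h \<epsilon> i) t)\<^sup>2 \<le> (1 / \<epsilon>) * ((3 / h i + \<epsilon>0\<^sup>2 * h i) * ?H\<^sup>2)" for i
    by (rule SJ.lateral_trace_exists[OF \<psi> U])
  then obtain t where t: "\<And>i. has_trace SJ.J (lateral_measure l0 l h \<epsilon> i) \<psi> D\<psi> (t i)"
    "\<And>i. (L2_norm_on (lateral_measure l0 l h \<epsilon> i) (t i))\<^sup>2 \<le> (1 / \<epsilon>) * ((3 / h i + \<epsilon>0\<^sup>2 * h i) * ?H\<^sup>2)" by metis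
  have tL: "L2 (lateral_measure l0 l h \<epsilon> i) (t i)" for i using t(1) by (simp add: has_trace_def)
  have H: "0 \<le> ?H" by (rule H1_norm_nonneg)
  \<comment> \<open>The trace is bounded by the Sobolev norm times a constant over the square root
    of \<epsilon>, so the factor \<epsilon> in front of the boundary integral leaves the square
    root.\<close>
  have tn: "\<epsilon> * L2_norm_on (lateral_measure l0 l h \<epsilon> i) (t i) \<le> C3 * sqrt \<epsilon> * ?H" for i
  proof -
    have "(\<epsilon> * L2_norm_on (lateral_measure l0 l h \<epsilon> i) (t i))\<^sup>2 \<le> \<epsilon>\<^sup>2 * ((1 / \<epsilon>) * ((3 / h i + \<epsilon>0\<^sup>2 * h i) * ?H\<^sup>2))"
      unfolding power_mult_distrib by (intro mult_left_mono t(2)) simp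
    also have "\<dots> \<le> \<epsilon>\<^sup>2 * ((1 / \<epsilon>) * (C3\<^sup>2 * ?H\<^sup>2))"
      using e by (intro mult_left_mono mult_right_mono C3(1)) auto
    also have "\<dots> = (\<epsilon>\<^sup>2 * (1 / \<epsilon>)) * (C3\<^sup>2 * ?H\<^sup>2)" by (simp only: mult.assoc)
    also have "\<epsilon>\<^sup>2 * (1 / \<epsilon>) = (sqrt \<epsilon>)\<^sup>2" using e by (simp add: power2_eq_square)
    also have "(sqrt \<epsilon>)\<^sup>2 * (C3\<^sup>2 * ?H\<^sup>2) = (C3 * sqrt \<epsilon> * ?H)\<^sup>2" by (simp only: power_mult_distrib mult_ac)
    finally show ?thesis by (rule power2_le_imp_le) (use C3(2) H e in simp)
  qed
  have \<psi>n: "L2_norm_on (lebesgue_on (cyl l0 l h \<epsilon> i)) \<psi> \<le> ?H" for i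
  proof -
    have "L2_norm_on SJ.M \<psi> \<le> ?H"
      by (rule power2_le_imp_le[OF _ H]) (simp add: H1_norm_sq L2_norm_on_sq)
    then show ?thesis using SJ.L2_cyl(2)[OF \<psi>(1), of i] by simp
  qed
  let ?f = "\<lambda>i. L2_norm_on (lebesgue_on (cyl l0 l h \<epsilon> i)) (F i)"
  let ?p = "\<lambda>i. L2_norm_on (lateral_measure l0 l h \<epsilon> i) (\<Phi> i)"
  \<comment> \<open>Coercivity with the remaining eighth; the chain then passes through the weak
    formulation with the solution and its constructed traces as test data.\<close>
  have "\<epsilon> * (\<kappa> * G) \<le> \<epsilon> * (\<kappa>0n * g0 + (\<Sum>i\<in>UNIV. \<kappa>0 i / 8 * g i))"
    unfolding G_eq distrib_left[of \<kappa>] sum_distrib_left[of \<kappa>]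
    using e by (intro mult_left_mono add_mono sum_mono mult_right_mono \<kappa> g_nonneg) auto
  also have "\<dots> = \<epsilon> * (\<kappa>0n * g0 + (\<Sum>i\<in>UNIV. \<kappa>0 i * g i)) - (\<Sum>i\<in>UNIV. (7/8) * (\<epsilon> * \<kappa>0 i) * g i)"
    by (simp add: sum_3 algebra_simps)
  also have "\<dots> \<le> \<epsilon> * (\<integral>x. D\<psi> x \<bullet> (D \<epsilon> x *v D\<psi> x) \<partial>SJ.M) - (\<integral>x. \<psi> x * (V \<epsilon> x \<bullet> D\<psi> x) \<partial>SJ.M)"
    using convection diffusion e by (intro diff_mono mult_left_mono) auto
  also have "\<dots> = (\<Sum>i\<in>UNIV. \<integral>x. F i x * \<psi> x \<partial>lebesgue_on (cyl l0 l h \<epsilon> i))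
      - \<epsilon> * (\<Sum>i\<in>UNIV. \<integral>x. \<Phi> i x * t i x \<partial>lateral_measure l0 l h \<epsilon> i)"
    using weak van t(1) unfolding weak_solution_def by blast
  also have "\<dots> \<le> (\<Sum>i\<in>UNIV. ?f i * ?H) + (\<Sum>i\<in>UNIV. ?p i * (C3 * sqrt \<epsilon> * ?H))"
  proof -
    have "(\<integral>x. F i x * \<psi> x \<partial>lebesgue_on (cyl l0 l h \<epsilon> i)) \<le> ?f i * ?H" for i
    proof -
      have "(\<integral>x. F i x * \<psi> x \<partial>lebesgue_on (cyl l0 l h \<epsilon> i)) \<le> ?f i * L2_norm_on (lebesgue_on (cyl l0 l h \<epsilon> i)) \<psi>"
        using L2_cauchy_schwarz'[OF F SJ.L2_cyl(1)[OF \<psi>(1)], of i] by (rule order_trans[OF abs_ge_self])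
      also have "\<dots> \<le> ?f i * ?H" by (intro mult_left_mono \<psi>n L2_norm_on_nonneg)
      finally show ?thesis .
    qed
    moreover have "- (\<epsilon> * (\<integral>x. \<Phi> i x * t i x \<partial>lateral_measure l0 l h \<epsilon> i)) \<le> ?p i * (C3 * sqrt \<epsilon> * ?H)" for i
    proof -
      have "- (\<integral>x. \<Phi> i x * t i x \<partial>lateral_measure l0 l h \<epsilon> i) \<le> ?p i * L2_norm_on (lateral_measure l0 l h \<epsilon> i) (t i)"
        using L2_cauchy_schwarz'[OF \<Phi> tL, of i] by linarith
      then have "\<epsilon> * - (\<integral>x. \<Phi> i x * t i x \<partial>lateral_measure l0 l h \<epsilon> i) \<le> \<epsilon> * (?p i * L2_norm_on (lateral_measure l0 l h \<epsilon> i) (t i))"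
        using e by (intro mult_left_mono) auto
      also have "\<dots> = ?p i * (\<epsilon> * L2_norm_on (lateral_measure l0 l h \<epsilon> i) (t i))" by simp
      also have "\<dots> \<le> ?p i * (C3 * sqrt \<epsilon> * ?H)" by (intro mult_left_mono tn L2_norm_on_nonneg)
      finally show ?thesis by simp
    qed
    ultimately show ?thesis
      unfolding diff_conv_add_uminus sum_distrib_left sum_negf[symmetric] by (intro add_mono sum_mono)
  qed
  \<comment> \<open>Since \<open>C3\<close> is at least 1, the volume terms can share the factor of
    the boundary terms.\<close>
  also have "\<dots> \<le> (\<Sum>i\<in>UNIV. C3 * (?f i * ?H)) + (\<Sum>i\<in>UNIV. ?p i * (C3 * sqrt \<epsilon> * ?H))"
    using mult_right_mono[OF C3(2), of "?f i * ?H" for i] H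
    by (intro add_right_mono sum_mono) (simp add: L2_norm_on_nonneg)
  also have "\<dots> = C3 * (\<Sum>i\<in>UNIV. ?f i + sqrt \<epsilon> * ?p i) * ?H"
    by (simp add: sum_3 algebra_simps)
  finally have main: "\<epsilon> * (\<kappa> * G) \<le> C3 * (\<Sum>i\<in>UNIV. ?f i + sqrt \<epsilon> * ?p i) * ?H" .
  let ?S = "\<Sum>i\<in>UNIV. ?f i + sqrt \<epsilon> * ?p i"
  have S: "0 \<le> ?S" using e by (intro sum_nonneg add_nonneg_nonneg mult_nonneg_nonneg L2_norm_on_nonneg) auto
  show ?thesis
  \<comment> \<open>The estimate is quadratic in the norm on one side and linear on the other, so it
    has to be divided by the norm once.\<close>
  proof (cases "?H = 0")
    case True
    then show ?thesis using S C2(1) C3(2) \<kappa>(1) e by simp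
  next
    case False
    then have Hp: "0 < ?H" using H by simp
    have "\<epsilon> * \<kappa> * ?H\<^sup>2 \<le> \<epsilon> * \<kappa> * ((1 + C2) * G)" using e \<kappa>(1) by (intro mult_left_mono H2) auto
    also have "\<dots> = (1 + C2) * (\<epsilon> * (\<kappa> * G))" by simp
    also have "\<dots> \<le> (1 + C2) * (C3 * ?S * ?H)" using C2(1) by (intro mult_left_mono main) auto
    finally have "(\<epsilon> * \<kappa> * ?H) * ?H \<le> ((1 + C2) * (C3 * ?S)) * ?H" by (simp add: power2_eq_square mult_ac)
    then have "\<epsilon> * \<kappa> * ?H \<le> (1 + C2) * (C3 * ?S)" using Hp by (rule mult_right_le_imp_le)
    then show ?thesis using e \<kappa>(1) by (simp add: field_simps)
  qed
qed

end

theorem theorem4p1: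
  fixes \<epsilon>0 l0 :: real and l h \<v> :: "3 \<Rightarrow> real" and \<Xi> :: "(real^3) set"
    and v0 :: "real^3 \<Rightarrow> real^3" and w :: "3 \<Rightarrow> real \<Rightarrow> real"
    and vt :: "3 \<Rightarrow> 3 \<Rightarrow> real \<times> (real^2) \<Rightarrow> real"
    and a0 :: "real^3 \<Rightarrow> real^3^3" and a :: "3 \<Rightarrow> real^2 \<Rightarrow> real^3^3"
    and \<kappa>0n \<kappa>1n :: real and \<kappa>0 \<kappa>1 :: "3 \<Rightarrow> real"
    and p :: "real^3 \<Rightarrow> real"
  assumes "junction_geometry \<epsilon>0 l0 l h \<Xi>"
    and "velocity_field \<epsilon>0 l0 l h \<Xi> \<v> v0 w vt"
    and "diffusion_matrix h \<Xi> a0 a \<kappa>0n \<kappa>1n \<kappa>0 \<kappa>1"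
    and "\<And>i t. t \<in> {0<..<l i} \<Longrightarrow> deriv (w i) t \<ge> 0"
    and "\<And>\<epsilon> i. \<epsilon> \<in> {0<..<\<epsilon>0} \<Longrightarrow> \<kappa>0 i - transversal_sup l0 l h vt \<epsilon> i * l i > 0"
    and "(\<Sum>i\<in>UNIV. (h i)\<^sup>2 * \<v> i) = 0"
    and "neumann_potential l0 \<Xi> \<v> p"
    and "\<And>\<epsilon> x. \<epsilon> \<in> {0<..<\<epsilon>0} \<Longrightarrow> x \<in> node \<Xi> \<epsilon> \<Longrightarrow>
           V_node v0 \<epsilon> x = grad p ((1/\<epsilon>) *\<^sub>R x)"
  shows "\<exists>C. \<forall>\<epsilon>\<in>{0<..<\<epsilon>0}. \<forall>F \<Phi> \<psi> D\<psi>.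
           (\<forall>i. L2 (lebesgue_on (cyl l0 l h \<epsilon> i)) (F i)) \<longrightarrow>
           (\<forall>i. L2 (lateral_measure l0 l h \<epsilon> i) (\<Phi> i)) \<longrightarrow>
           weak_solution l0 l h \<Xi> \<epsilon>
             (piecewise l0 l h \<Xi> \<epsilon> (V_node v0 \<epsilon>) (V_cyl w vt \<epsilon>))
             (piecewise l0 l h \<Xi> \<epsilon> (D_node a0 \<epsilon>) (D_cyl a \<epsilon>))
             F \<Phi> \<psi> D\<psi> \<longrightarrow>
           H1_norm (junction l0 l h \<Xi> \<epsilon>) \<psi> D\<psi>
             \<le> C * (1/\<epsilon>) * (\<Sum>i\<in>UNIV. L2_norm_on (lebesgue_on (cyl l0 l h \<epsilon> i)) (F i)
                              + sqrt \<epsilon> * L2_norm_on (lateral_measure l0 l h \<epsilon> i) (\<Phi> i))"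
proof -
  interpret P: problem \<epsilon>0 l0 l h \<Xi> \<v> v0 w vt a0 a \<kappa>0n \<kappa>1n \<kappa>0 \<kappa>1 p
    using assms by unfold_locales
  obtain C2 where C2: "0 \<le> C2" "\<And>\<epsilon> U DU. \<epsilon> \<in> {0<..<\<epsilon>0} \<Longrightarrow> C1_on UNIV U DU \<Longrightarrow>
    (\<integral>x. (U x)\<^sup>2 \<partial>lebesgue_on (junction l0 l h \<Xi> \<epsilon>)) \<le>
    C2 * ((\<integral>x. (norm (DU x))\<^sup>2 \<partial>lebesgue_on (junction l0 l h \<Xi> \<epsilon>)) + (\<Sum>i\<in>UNIV. scaled_junction.end_sq l h \<epsilon> i U))"
    using P.smooth_poincare by blast
  \<comment> \<open>The node keeps its full ellipticity constant, each cylinder the eighth left over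
    by the factor 7/8.\<close>
  define \<kappa> where "\<kappa> = min \<kappa>0n (Min (range (\<lambda>i. \<kappa>0 i / 8)))"
  have \<kappa>: "0 < \<kappa>" "\<kappa> \<le> \<kappa>0n" "\<And>i. \<kappa> \<le> \<kappa>0 i / 8"
  proof -
    show "0 < \<kappa>" "\<kappa> \<le> \<kappa>0n" using P.\<kappa>_pos by (simp_all add: \<kappa>_def)
    show "\<kappa> \<le> \<kappa>0 i / 8" for i unfolding \<kappa>_def by (intro min.coboundedI2 Min_le) auto
  qed
  \<comment> \<open>The summand 1 makes \<open>C3\<close> at least 1 and hence at most its own
    square, which avoids taking a square root of the trace constants.\<close>
  define C3 where "C3 = 1 + Max (range (\<lambda>i. 3 / h i + \<epsilon>0\<^sup>2 * h i))"
  have m: "3 / h i + \<epsilon>0\<^sup>2 * h i \<le> C3 - 1" for i by (simp add: C3_def)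
  have C3_ge: "1 \<le> C3"
    using m[of 1] P.h[of 1] by (smt (verit) divide_pos_pos mult_nonneg_nonneg zero_le_power2)
  have C3: "3 / h i + \<epsilon>0\<^sup>2 * h i \<le> C3\<^sup>2" for i
    using m[of i] self_le_power[OF C3_ge, of 2] by simp
  show ?thesis
    using P.energy_estimate[OF _ C2(1) C2(2) \<kappa> C3 C3_ge] by blast
qed

end
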